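(* Let $d\ge 1$, $\sigma\in\mathbb N$, $\alpha\in\mathbb C$, and let $s>s'>\frac d2$. Let $W$ be a real-valued one-dimensional Brownian motion on a filtered probability space $(\Omega,\mathcal F,\mathbb F,\mathbb P)$ satisfying the standard conditions. Let $\phi:H^{s'}\to H^{-s-1}$ be a map such that: (a) $\phi$ maps $H^s$ into $H^s$ and $\phi:H^s\to H^s$ is bounded on balls; (b) $\phi:H^{s'}\to H^{-s-1}$ is continuous and bounded on balls; (c) for every $n\in\mathbb N$ the map $P_n\phi:H_n\to H_n$ is locally Lipschitz continuous; (d) there exists a measurable, locally bounded (i.e. bounded on bounded sets) function $\psi:\mathbb R^+\times\mathbb R^+\to\mathbb R^+$ such that $\|\phi(u)-\phi(v)\|_s\le \psi(\|u\|_s,\|v\|_s)\|u-v\|_s$ for all $u,v\in H^s$; (e) there exists $f:H^s\to\mathbb C$ such that $\phi(u)=f(u)u$ for $u\in H^s$, and there exist $p\in(0,1)$ and $B<0$ such that $$|\alpha|K\|u\|_{L^\infty}^{2\sigma}+\frac12|f(u)|^2-\frac{2-p}{2}[\Re f(u)]^2\le B\qquad\text{for all }u\in H^s.$$ For $u^0\in H^s$ let $u$ be the unique global strong solution of $$\mathrm d u(t)+\mathrm i\,[-Au(t)+\alpha F(u(t))]\,\mathrm dt=\phi(u(t))\,\mathrm dW(t),\quad t>0,\qquad u(0)=u^0.$$ Then for any $u^0\in H^s$: (i) the zero solution is exponentially stable in the $p$-mean, where $p$ is the parameter in (e), that is, there exist constants $C<\infty$, $\lambda>0$ such that $$\mathbb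 E[\|u(t)\|_s^p]\le Ce^{-\lambda t}\|u^0\|_s^p\qquad\text{for all }t\ge0;$$ (ii) the zero solution is exponentially stable with probability one, that is (with $C,\lambda$ as in (i)), for any $\bar\lambda\in(0,\lambda)$ there exists a $\mathbb P$-a.s. finite random time $\tau_0$ such that $$\|u(t)\|_s^p\le Ce^{-\bar\lambda t}\|u^0\|_s^p\qquad\text{for all }t\ge\tau_0,\quad\mathbb P\text{-a.s.};$$ (iii) $\mu=\delta_0$ is the unique invariant measure for the equation.
   Context: $\mathbb N=\{1,2,\dots\}$, $\mathbb R^+=[0,\infty)$. $\mathbb T^d=(\mathbb R/2\pi\mathbb Z)^d$; all functions are complex-valued on $\mathbb T^d$. For $k\in\mathbb Z^d$, $e_k(x)=(2\pi)^{-d/2}e^{\mathrm i k\cdot x}$, $\widehat u(k)=(2\pi)^{-d/2}\int_{\mathbb T^d}u(x)e^{-\mathrm i k\cdot x}\,dx$, $\langle k\rangle=\sqrt{1+|k|^2}$. For $r\in\mathbb R$, $H^r$ is the $L^2$-based Sobolev space with inner product $(u,v)_r=\sum_{k}\langle k\rangle^{2r}\widehat u(k)\overline{\widehat v(k)}$ and norm $\|\cdot\|_r$; $H=H^0=L^2$. $A=-\Delta$ and $F(u)=|u|^{2\sigma}u$. $H_n=\mathrm{span}\{e_k:|k|\le n\}$ and $P_nu=\sum_{|k|\le n}(u,e_k)_0e_k$, extended to negative order Sobolev spaces by duality. $K=K(s,\sigma,d)>0$ is a fixed constant such that $\|F(u)\|_s\le K\|u\|_{L^\infty}^{2\sigma}\|u\|_s$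 for all $u\in H^s\cap L^\infty$ (such a constant exists). Standard conditions: the filtration $\mathbb F=(\mathcal F_t)_{t\ge0}$ is right-continuous and all $\mathbb P$-negligible sets of $\mathcal F$ belong to $\mathcal F_0$. Under the stated hypotheses, for every $x\in H^s$ the equation has a unique global strong solution $u(\cdot;x)$ with $u(0;x)=x$ and $\mathbb P$-a.s. paths in $C([0,\infty);H^s)$: an adapted process such that for every $t\ge0$, $u(t)=x+\mathrm i\int_0^t[Au(\rho)-\alpha F(u(\rho))]\,d\rho+\int_0^t\phi(u(\rho))\,dW(\rho)$ holds $\mathbb P$-a.s. in $H^{-s-1}$. The transition semigroup is $(P_t\varphi)(x)=\mathbb E[\varphi(u(t;x))]$ for $\varphi\in\mathcal B_b(H^s)$, the bounded Borel functions $H^s\to\mathbb R$. An invariant measure is a Borel probability measure $\mu$ on $H^s$ with $\int_{H^s}\varphi\,d\mu=\int_{H^s}P_t\varphi\,d\mu$ for all $t\ge0$ and all $\varphi\in\mathcal B_b(H^s)$. *)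

theory Defs
  imports "HOL-Probability.Probability"
begin

section \<open>The Hilbert space of square-summable families\<close>

text \<open>
  Each Sobolev space below is isometric to this separable Hilbert space. The type serves
  to have the library's Bochner integral available for Sobolev-valued functions.
\<close>

typedef 'k ell2 = "{a :: 'k \<Rightarrow> complex. (\<lambda>k. (cmod (a k))\<^sup>2) summable_on UNIV}"
  morphisms ell2_coeff Abs_ell2
  by (rule exI[of _ "\<lambda>_. 0"]) simp

setup_lifting type_definition_ell2

lemma ell2_summable: "(\<lambda>k. (cmod (ell2_coeff a k))\<^sup>2) summable_on UNIV"
  using ell2_coeff[of a] by simp

lemma norm_add_sq_le: "(norm (a + b :: 'a::real_normed_vector))\<^sup>2 \<le> 2 * (norm a)\<^sup>2 + 2 * (norm b)\<^sup>2"
proof -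
  have "(norm (a + b))\<^sup>2 \<le> (norm a + norm b)\<^sup>2"
    by (simp add: norm_triangle_ineq power_mono)
  also have "\<dots> \<le> 2 * (norm a)\<^sup>2 + 2 * (norm b)\<^sup>2"
    using sum_squares_ge_zero[of "norm a - norm b" 0] by (simp add: power2_eq_square algebra_simps)
  finally show ?thesis .
qed

lemma sq_summable_add:
  fixes a b :: "'k \<Rightarrow> complex"
  assumes "(\<lambda>k. (cmod (a k))\<^sup>2) summable_on UNIV" "(\<lambda>k. (cmod (b k))\<^sup>2) summable_on UNIV"
  shows "(\<lambda>k. (cmod (a k + b k))\<^sup>2) summable_on UNIV"
  by (rule summable_on_comparison_test[where f = "\<lambda>k. 2 * (cmod (a k))\<^sup>2 + 2 * (cmod (b k))\<^sup>2"])
    (auto intro!: summable_on_add summable_on_cmult_right assms norm_add_sq_le)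

lemma sq_summable_inner:
  fixes a b :: "'k \<Rightarrow> complex"
  assumes "(\<lambda>k. (cmod (a k))\<^sup>2) summable_on UNIV" "(\<lambda>k. (cmod (b k))\<^sup>2) summable_on UNIV"
  shows "(\<lambda>k. a k \<bullet> b k) summable_on UNIV"
proof -
  have "(\<lambda>k. norm (a k \<bullet> b k)) summable_on UNIV"
  proof (rule summable_on_comparison_test[where f = "\<lambda>k. (cmod (a k))\<^sup>2 + (cmod (b k))\<^sup>2"])
    fix k
    have "norm (a k \<bullet> b k) \<le> cmod (a k) * cmod (b k)" by (simp add: Cauchy_Schwarz_ineq2)
    also have "\<dots> \<le> (cmod (a k))\<^sup>2 + (cmod (b k))\<^sup>2"
      using sum_squares_bound[of "cmod (a k)" "cmod (b k)"]
        mult_nonneg_nonneg[OF norm_ge_zero[of "a k"] norm_ge_zero[of "b k"]] by linarith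
    finally show "norm (a k \<bullet> b k) \<le> (cmod (a k))\<^sup>2 + (cmod (b k))\<^sup>2" .
  qed (auto intro!: summable_on_add assms)
  then show ?thesis by (rule abs_summable_summable)
qed

instantiation ell2 :: (type) real_inner
begin

lift_definition zero_ell2 :: "'a ell2" is "\<lambda>_. 0" by simp
lift_definition plus_ell2 :: "'a ell2 \<Rightarrow> 'a ell2 \<Rightarrow> 'a ell2" is "\<lambda>a b k. a k + b k"
  by (rule sq_summable_add)
lift_definition uminus_ell2 :: "'a ell2 \<Rightarrow> 'a ell2" is "\<lambda>a k. - a k" by simp
lift_definition minus_ell2 :: "'a ell2 \<Rightarrow> 'a ell2 \<Rightarrow> 'a ell2" is "\<lambda>a b k. a k - b k"
  using sq_summable_add[of _ "\<lambda>k. - _ k"] by simp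
lift_definition scaleR_ell2 :: "real \<Rightarrow> 'a ell2 \<Rightarrow> 'a ell2" is "\<lambda>r a k. r *\<^sub>R a k"
  by (simp add: power_mult_distrib summable_on_cmult_right)
lift_definition inner_ell2 :: "'a ell2 \<Rightarrow> 'a ell2 \<Rightarrow> real" is "\<lambda>a b. \<Sum>\<^sub>\<infinity>k. a k \<bullet> b k" .

definition norm_ell2 :: "'a ell2 \<Rightarrow> real" where "norm_ell2 a = sqrt (inner a a)"
definition sgn_ell2 :: "'a ell2 \<Rightarrow> 'a ell2" where "sgn_ell2 a = inverse (norm a) *\<^sub>R a"
definition dist_ell2 :: "'a ell2 \<Rightarrow> 'a ell2 \<Rightarrow> real" where "dist_ell2 a b = norm (a - b)"
definition uniformity_ell2 :: "('a ell2 \<times> 'a ell2) filter"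
  where "uniformity_ell2 = (INF e\<in>{0<..}. principal {(x, y). dist x y < e})"
definition open_ell2 :: "'a ell2 set \<Rightarrow> bool"
  where "open_ell2 U \<longleftrightarrow> (\<forall>x\<in>U. \<forall>\<^sub>F (x', y) in uniformity. x' = x \<longrightarrow> y \<in> U)"

instance
proof
  fix a b c :: "'a ell2" and r q :: real and U :: "'a ell2 set"
  show "a + b + c = a + (b + c)" "a + b = b + a" "0 + a = a" "- a + a = 0" "a - b = a + - b"
    "r *\<^sub>R (a + b) = r *\<^sub>R a + r *\<^sub>R b" "(r + q) *\<^sub>R a = r *\<^sub>R a + q *\<^sub>R a"
    "r *\<^sub>R q *\<^sub>R a = (r * q) *\<^sub>R a" "1 *\<^sub>R a = a"
    by (transfer; simp add: algebra_simps scaleR_add_left)+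
  show "dist a b = norm (a - b)" by (rule dist_ell2_def)
  show "sgn a = inverse (norm a) *\<^sub>R a" by (rule sgn_ell2_def)
  show "uniformity = (INF e\<in>{0<..}. principal {(x, y :: 'a ell2). dist x y < e})"
    by (rule uniformity_ell2_def)
  show "open U \<longleftrightarrow> (\<forall>x\<in>U. \<forall>\<^sub>F (x', y) in uniformity. x' = x \<longrightarrow> y \<in> U)"
    by (rule open_ell2_def)
  show "inner a b = inner b a" by transfer (simp add: inner_commute)
  show "inner (a + b) c = inner a c + inner b c"
    by transfer (simp add: inner_add_left infsum_add sq_summable_inner)
  show "inner (r *\<^sub>R a) b = r * inner a b"
    by transfer (simp add: infsum_cmult_right' del: scaleR_complex_def)
  show "0 \<le> inner a a" by transfer (simp add: infsum_nonneg)
  show "norm a = sqrt (inner a a)" by (rule norm_ell2_def)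
  show "inner a a = 0 \<longleftrightarrow> a = 0"
  proof transfer
    fix a :: "'a \<Rightarrow> complex"
    assume a: "(\<lambda>k. (cmod (a k))\<^sup>2) summable_on UNIV"
    show "(\<Sum>\<^sub>\<infinity>k. a k \<bullet> a k) = 0 \<longleftrightarrow> a = (\<lambda>_. 0)"
    proof
      assume "(\<Sum>\<^sub>\<infinity>k. a k \<bullet> a k) = 0"
      then have "a k \<bullet> a k = 0" for k
        by (intro nonneg_infsum_le_0D[where A = UNIV and f = "\<lambda>k. a k \<bullet> a k"] sq_summable_inner a) auto
      then show "a = (\<lambda>_. 0)" by auto
    qed simp
  qed
qed

end

lemma norm_ell2_sq: "(norm a)\<^sup>2 = (\<Sum>\<^sub>\<infinity>k. (cmod (ell2_coeff a k))\<^sup>2)"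
proof -
  have "(norm a)\<^sup>2 = inner a a" by (rule power2_norm_eq_inner)
  also have "\<dots> = (\<Sum>\<^sub>\<infinity>k. (cmod (ell2_coeff a k))\<^sup>2)"
    by transfer (simp add: power2_norm_eq_inner)
  finally show ?thesis .
qed

lemma ell2_coeff_simps [simp]:
  "ell2_coeff (a + b) k = ell2_coeff a k + ell2_coeff b k"
  "ell2_coeff (a - b) k = ell2_coeff a k - ell2_coeff b k"
  "ell2_coeff (r *\<^sub>R a) k = r *\<^sub>R ell2_coeff a k"
  "ell2_coeff 0 k = 0"
  by (transfer; simp)+

lemma sum_ell2_coeff_le: "finite A \<Longrightarrow> (\<Sum>k\<in>A. (cmod (ell2_coeff a k))\<^sup>2) \<le> (norm a)\<^sup>2"
  unfolding norm_ell2_sq by (rule finite_sum_le_infsum[OF ell2_summable]) auto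

lemma norm_ell2_coeff_le: "cmod (ell2_coeff a k) \<le> norm a"
  using sum_ell2_coeff_le[of "{k}" a] by (simp add: abs_le_square_iff[symmetric])

instance ell2 :: (type) banach
proof
  fix X :: "nat \<Rightarrow> 'a ell2"
  assume X: "Cauchy X"
  have "Cauchy (\<lambda>n. ell2_coeff (X n) k)" for k
  proof (rule metric_CauchyI)
    fix e :: real assume "0 < e"
    then obtain N where "\<forall>m\<ge>N. \<forall>n\<ge>N. dist (X m) (X n) < e" using X metric_CauchyD by blast
    then have "\<forall>m\<ge>N. \<forall>n\<ge>N. dist (ell2_coeff (X m) k) (ell2_coeff (X n) k) < e"
      by (metis (no_types, opaque_lifting) dist_norm ell2_coeff_simps(2) norm_ell2_coeff_le order_le_less_trans)
    then show "\<exists>N. \<forall>m\<ge>N. \<forall>n\<ge>N. dist (ell2_coeff (X m) k) (ell2_coeff (X n) k) < e" by blast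
  qed
  then have "\<exists>l. (\<lambda>n. ell2_coeff (X n) k) \<longlonglongrightarrow> l" for k
    using Cauchy_convergent convergent_def by blast
  then obtain l where l: "\<And>k. (\<lambda>n. ell2_coeff (X n) k) \<longlonglongrightarrow> l k" by metis
  have fin: "(\<Sum>k\<in>A. (cmod (ell2_coeff (X n) k - l k))\<^sup>2) \<le> e\<^sup>2"
    if "finite A" "e > 0" "\<And>m. m \<ge> N \<Longrightarrow> norm (X n - X m) \<le> e" for A e n N
  proof (rule tendsto_upperbound)
    show "(\<lambda>m. \<Sum>k\<in>A. (cmod (ell2_coeff (X n) k - ell2_coeff (X m) k))\<^sup>2)
        \<longlonglongrightarrow> (\<Sum>k\<in>A. (cmod (ell2_coeff (X n) k - l k))\<^sup>2)"
      by (intro tendsto_intros l)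
    show "\<forall>\<^sub>F m in sequentially. (\<Sum>k\<in>A. (cmod (ell2_coeff (X n) k - ell2_coeff (X m) k))\<^sup>2) \<le> e\<^sup>2"
      unfolding eventually_sequentially
    proof (intro exI[of _ N] allI impI)
      fix m assume "N \<le> m"
      have "(\<Sum>k\<in>A. (cmod (ell2_coeff (X n) k - ell2_coeff (X m) k))\<^sup>2) \<le> (norm (X n - X m))\<^sup>2"
        using sum_ell2_coeff_le[OF that(1), of "X n - X m"] by simp
      also have "\<dots> \<le> e\<^sup>2" using that(3)[OF \<open>N \<le> m\<close>] by (simp add: power_mono)
      finally show "(\<Sum>k\<in>A. (cmod (ell2_coeff (X n) k - ell2_coeff (X m) k))\<^sup>2) \<le> e\<^sup>2" .
    qed
  qed simp
  have tail: "\<exists>N. \<forall>n\<ge>N. \<forall>m\<ge>N. norm (X n - X m) \<le> e" if "e > 0" for e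
    using metric_CauchyD[OF X that] by (metis dist_norm less_imp_le)
  have sm: "(\<lambda>k. (cmod (ell2_coeff (X n) k - l k))\<^sup>2) summable_on UNIV"
    if "e > 0" "\<And>m. m \<ge> N \<Longrightarrow> norm (X n - X m) \<le> e" for e n N
    by (rule nonneg_bdd_above_summable_on) (auto intro!: bdd_aboveI2[where M = "e\<^sup>2"] fin that)
  obtain N where N: "\<forall>n\<ge>N. \<forall>m\<ge>N. norm (X n - X m) \<le> 1" using tail[of 1] by auto
  have "(\<lambda>k. (cmod (ell2_coeff (X N) k + - (ell2_coeff (X N) k - l k)))\<^sup>2) summable_on UNIV"
    using sm[of 1 N N] N by (intro sq_summable_add ell2_summable) (auto simp: norm_minus_commute)
  then have L: "ell2_coeff (Abs_ell2 l) = l" by (simp add: Abs_ell2_inverse)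
  have "X \<longlonglongrightarrow> Abs_ell2 l"
  proof (rule metric_LIMSEQ_I)
    fix e :: real assume "0 < e"
    then obtain N where N: "\<And>n m. n \<ge> N \<Longrightarrow> m \<ge> N \<Longrightarrow> norm (X n - X m) \<le> e / 2"
      using tail[of "e / 2"] by auto
    have "dist (X n) (Abs_ell2 l) < e" if "n \<ge> N" for n
    proof -
      have "(norm (X n - Abs_ell2 l))\<^sup>2 \<le> (e / 2)\<^sup>2"
        unfolding norm_ell2_sq using \<open>0 < e\<close> N[OF that] sm[of "e / 2" N n] fin[of _ "e / 2" N n]
        by (auto simp: L intro!: infsum_le_finite_sums)
      then show ?thesis using \<open>0 < e\<close> by (simp add: dist_norm abs_le_square_iff[symmetric])
    qed
    then show "\<exists>N. \<forall>n\<ge>N. dist (X n) (Abs_ell2 l) < e" by blast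
  qed
  then show "convergent X" by (auto simp: convergent_def)
qed

lemma ell2_dense:
  fixes a :: "'k ell2"
  assumes "e > 0"
  obtains l :: "('k \<times> rat \<times> rat) list"
  where "dist a (Abs_ell2 (\<lambda>k. case map_of l k of None \<Rightarrow> 0 | Some (x, y) \<Rightarrow> Complex (of_rat x) (of_rat y))) < e"
proof -
  obtain A where A: "finite A"
    "dist (\<Sum>k\<in>A. (cmod (ell2_coeff a k))\<^sup>2) (\<Sum>\<^sub>\<infinity>k. (cmod (ell2_coeff a k))\<^sup>2) \<le> (e / 2)\<^sup>2"
    using infsum_finite_approximation[OF ell2_summable, of "(e/2)\<^sup>2" a] assms by auto
  define c where "c = e / (4 * (real (card A) + 1))"
  have c: "c > 0" using assms by (simp add: c_def)
  have "\<exists>x y. cmod (z - Complex (of_rat x) (of_rat y)) < 2 * c" for z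
  proof -
    obtain x where x: "Re z < of_rat x" "of_rat x < Re z + c"
      using of_rat_dense[of "Re z" "Re z + c"] c by auto
    obtain y where y: "Im z < of_rat y" "of_rat y < Im z + c"
      using of_rat_dense[of "Im z" "Im z + c"] c by auto
    have "cmod (z - Complex (of_rat x) (of_rat y)) \<le> \<bar>Re z - of_rat x\<bar> + \<bar>Im z - of_rat y\<bar>"
      using cmod_le[of "z - Complex (of_rat x) (of_rat y)"] by simp
    then show ?thesis using x y by (intro exI[of _ x] exI[of _ y]) linarith
  qed
  then obtain x y where xy: "\<And>z. cmod (z - Complex (of_rat (x z)) (of_rat (y z))) < 2 * c" by metis
  obtain ks where ks: "set ks = A" "distinct ks" using finite_distinct_list[OF A(1)] by blast
  define l where "l = map (\<lambda>k. (k, x (ell2_coeff a k), y (ell2_coeff a k))) ks"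
  define q where "q = (\<lambda>k. case map_of l k of None \<Rightarrow> 0 | Some (x, y) \<Rightarrow> Complex (of_rat x) (of_rat y))"
  have q: "q k = (if k \<in> A then Complex (of_rat (x (ell2_coeff a k))) (of_rat (y (ell2_coeff a k))) else 0)" for k
    unfolding q_def l_def using ks by (auto simp: map_of_map_restrict restrict_map_def)
  have qs: "(\<lambda>k. (cmod (q k))\<^sup>2) summable_on UNIV"
  proof -
    have "(\<lambda>k. (cmod (q k))\<^sup>2) summable_on A" using A(1) by simp
    then show ?thesis by (subst summable_on_cong_neutral[of A UNIV]) (auto simp: q)
  qed
  then have Q: "ell2_coeff (Abs_ell2 q) = q" by (simp add: Abs_ell2_inverse)
  have "(norm (a - Abs_ell2 q))\<^sup>2 \<le> (e / 2)\<^sup>2 + (e / 2)\<^sup>2"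
    unfolding norm_ell2_sq
  proof (rule infsum_le_finite_sums[OF ell2_summable])
    fix F :: "'k set" assume F: "finite F"
    have "(\<Sum>k\<in>F. (cmod (ell2_coeff (a - Abs_ell2 q) k))\<^sup>2)
        \<le> (\<Sum>k\<in>F \<union> A. (cmod (ell2_coeff (a - Abs_ell2 q) k))\<^sup>2)"
      using F A by (intro sum_mono2) auto
    also have "\<dots> = (\<Sum>k\<in>A. (cmod (ell2_coeff (a - Abs_ell2 q) k))\<^sup>2)
        + (\<Sum>k\<in>F - A. (cmod (ell2_coeff (a - Abs_ell2 q) k))\<^sup>2)"
      using F A by (subst sum.union_disjoint[symmetric]) (auto intro!: sum.cong)
    also have "(\<Sum>k\<in>F - A. (cmod (ell2_coeff (a - Abs_ell2 q) k))\<^sup>2)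
        = (\<Sum>k\<in>F \<union> A. (cmod (ell2_coeff a k))\<^sup>2) - (\<Sum>k\<in>A. (cmod (ell2_coeff a k))\<^sup>2)"
      using F A sum.union_disjoint[of A "F - A" "\<lambda>k. (cmod (ell2_coeff a k))\<^sup>2"]
      by (simp add: Q q Un_commute)
    also have "\<dots> \<le> (\<Sum>\<^sub>\<infinity>k. (cmod (ell2_coeff a k))\<^sup>2) - (\<Sum>k\<in>A. (cmod (ell2_coeff a k))\<^sup>2)"
      using F A by (intro diff_right_mono finite_sum_le_infsum ell2_summable) auto
    also have "\<dots> \<le> (e / 2)\<^sup>2" using A(2) by (simp add: dist_real_def)
    also have "(\<Sum>k\<in>A. (cmod (ell2_coeff (a - Abs_ell2 q) k))\<^sup>2) \<le> (\<Sum>k\<in>A. (2 * c)\<^sup>2)"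
      by (intro sum_mono power_mono) (auto simp: Q q less_imp_le[OF xy])
    also have "\<dots> \<le> (e / 2)\<^sup>2"
    proof -
      let ?n = "real (card A)"
      have "?n * 1 \<le> (?n + 1)\<^sup>2" by (simp add: power2_eq_square algebra_simps)
      then have "?n / (?n + 1)\<^sup>2 \<le> 1" by (simp add: divide_le_eq)
      then have "(e/2)\<^sup>2 * (?n / (?n + 1)\<^sup>2) \<le> (e/2)\<^sup>2 * 1" by (intro mult_left_mono) auto
      moreover have "(\<Sum>k\<in>A. (2 * c)\<^sup>2) = (e/2)\<^sup>2 * (?n / (?n + 1)\<^sup>2)"
      proof -
        have "2 * c = (e/2) / (?n + 1)" by (simp add: c_def field_simps)
        then have "(2 * c)\<^sup>2 = (e/2)\<^sup>2 / (?n + 1)\<^sup>2" by (simp only: power_divide)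
        then show ?thesis by simp
      qed
      ultimately show ?thesis by simp
    qed
    finally show "(\<Sum>k\<in>F. (cmod (ell2_coeff (a - Abs_ell2 q) k))\<^sup>2) \<le> (e / 2)\<^sup>2 + (e / 2)\<^sup>2" by simp
  qed
  also have "\<dots> < e\<^sup>2" using assms by (simp add: power2_eq_square)
  finally have "dist a (Abs_ell2 q) < e"
    using assms by (simp add: dist_norm power2_less_imp_less)
  then show thesis using that q_def by blast
qed

instance ell2 :: (countable) second_countable_topology
proof
  define g where "g = (\<lambda>l :: ('a \<times> rat \<times> rat) list.
    Abs_ell2 (\<lambda>k. case map_of l k of None \<Rightarrow> 0 | Some (x, y) \<Rightarrow> Complex (of_rat x) (of_rat y)))"
  define B where "B = (\<lambda>(l, n). ball (g l) (1 / real (Suc n))) ` UNIV"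
  have "topological_basis B"
  proof (rule topological_basisI)
    fix U :: "'a ell2 set" and a assume "open U" "a \<in> U"
    then obtain e where e: "e > 0" "ball a e \<subseteq> U" using open_contains_ball by blast
    obtain n where n: "1 / real (Suc n) < e / 2"
      using reals_Archimedean[of "e / 2"] e(1) by (auto simp: inverse_eq_divide)
    obtain l where l: "dist a (g l) < 1 / real (Suc n)"
      using ell2_dense[of "1 / real (Suc n)" a] unfolding g_def by auto
    have "ball (g l) (1 / real (Suc n)) \<subseteq> U"
    proof
      fix b assume "b \<in> ball (g l) (1 / real (Suc n))"
      then have "dist a b < e" using l n dist_triangle[of a b "g l"] by auto
      then show "b \<in> U" using e(2) by auto
    qed
    moreover have "a \<in> ball (g l) (1 / real (Suc n))" using l by (simp add: dist_commute)
    moreover have "ball (g l) (1 / real (Suc n)) \<in> B" unfolding B_def by (rule image_eqI[of _ _ "(l, n)"]) auto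
    ultimately show "\<exists>B'\<in>B. a \<in> B' \<and> B' \<subseteq> U" by blast
  qed (auto simp: B_def)
  then have "open = generate_topology B" by (rule topological_basis_imp_subbasis)
  moreover have "countable B" by (simp add: B_def)
  ultimately show "\<exists>B::'a ell2 set set. countable B \<and> open = generate_topology B" by blast
qed


section \<open>Fourier series and Sobolev spaces on the torus\<close>

text \<open>
  The torus is the cube \<open>[0, 2\<pi>)\<^sup>d\<close> with Lebesgue measure, where \<open>d = CARD('d)\<close>. An element \<open>u\<close> of some
  \<open>H\<^sup>r\<close>, \<open>r\<close> real, is a formal Fourier series \<open>\<Sum>\<^sub>k u(k) e\<^sub>k\<close> and is represented by its family of
  Fourier coefficients, so that \<open>u k\<close> is the \<open>k\<close>-th coefficient (the pairing with \<open>e\<^sub>k\<close>). All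
  spaces \<open>H\<^sup>r\<close>, including those of negative order, are thereby subsets of a single type, and the
  embeddings between them are inclusions.
\<close>

type_synonym 'd fseries = "int ^ 'd \<Rightarrow> complex"

definition torus :: "(real ^ 'd::finite) measure"
  where "torus = restrict_space lborel {x. \<forall>i. 0 \<le> x $ i \<and> x $ i < 2 * pi}"

definition freq_dot :: "int ^ 'd::finite \<Rightarrow> real ^ 'd \<Rightarrow> real"
  where "freq_dot k x = (\<Sum>i\<in>UNIV. real_of_int (k $ i) * x $ i)"

definition freq_norm :: "int ^ 'd::finite \<Rightarrow> real"
  where "freq_norm k = sqrt (\<Sum>i\<in>UNIV. (real_of_int (k $ i))\<^sup>2)"

definition jbracket :: "int ^ 'd::finite \<Rightarrow> real"
  where "jbracket k = sqrt (1 + (freq_norm k)\<^sup>2)"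

definition fbasis :: "int ^ 'd::finite \<Rightarrow> real ^ 'd \<Rightarrow> complex"
  where "fbasis k x = of_real ((2 * pi) powr (- real CARD('d) / 2)) * exp (\<i> * of_real (freq_dot k x))"

definition fourier_coeff :: "(real ^ 'd::finite \<Rightarrow> complex) \<Rightarrow> 'd fseries"
  where "fourier_coeff g k = of_real ((2 * pi) powr (- real CARD('d) / 2)) *
    (LINT x|torus. g x * exp (- (\<i> * of_real (freq_dot k x))))"

text \<open>
  The function on the torus with the given Fourier coefficients. The series converges absolutely
  for elements of \<open>H\<^sup>r\<close> with \<open>r > d/2\<close>, the only ones to which this is applied.
\<close>

definition fun_of :: "('d::finite) fseries \<Rightarrow> real ^ 'd \<Rightarrow> complex"
  where "fun_of u x = (\<Sum>\<^sub>\<infinity>k. u k * fbasis k x)"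

definition Linf_norm :: "('d::finite) fseries \<Rightarrow> real"
  where "Linf_norm u = real_of_ereal (esssup torus (\<lambda>x. ereal (cmod (fun_of u x))))"

definition sob :: "real \<Rightarrow> ('d::finite) fseries set"
  where "sob r = {u. (\<lambda>k. jbracket k powr (2 * r) * (cmod (u k))\<^sup>2) summable_on UNIV}"

definition sob_norm :: "real \<Rightarrow> ('d::finite) fseries \<Rightarrow> real"
  where "sob_norm r u = sqrt (\<Sum>\<^sub>\<infinity>k. jbracket k powr (2 * r) * (cmod (u k))\<^sup>2)"

definition sob_dist :: "real \<Rightarrow> ('d::finite) fseries \<Rightarrow> 'd fseries \<Rightarrow> real"
  where "sob_dist r u v = sob_norm r (\<lambda>k. u k - v k)"

definition sob_top :: "real \<Rightarrow> ('d::finite) fseries topology"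
  where "sob_top r = Metric_space.mtopology (sob r) (sob_dist r)"

definition sob_borel :: "real \<Rightarrow> ('d::finite) fseries measure"
  where "sob_borel r = sigma (sob r) {U. openin (sob_top r) U}"

text \<open>The isometry \<open>(1 - \<Delta>)\<^sup>r\<^sup>/\<^sup>2\<close> from \<open>H\<^sup>r\<close> onto the square-summable families.\<close>

definition bessel :: "real \<Rightarrow> ('d::finite) fseries \<Rightarrow> (int ^ 'd) ell2"
  where "bessel r u = Abs_ell2 (\<lambda>k. jbracket k powr r *\<^sub>R u k)"

lemma jbracket_pos: "jbracket k > 0"
  unfolding jbracket_def by (simp add: add_pos_nonneg)

lemma bessel_sq: "(cmod (jbracket k powr r *\<^sub>R z))\<^sup>2 = jbracket k powr (2 * r) * (cmod z)\<^sup>2"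
  by (simp add: power_mult_distrib power2_eq_square powr_add[symmetric])

lemma bessel_coeff:
  assumes "u \<in> sob r"
  shows "ell2_coeff (bessel r u) k = jbracket k powr r *\<^sub>R u k"
proof -
  have "(\<lambda>k. (cmod (jbracket k powr r *\<^sub>R u k))\<^sup>2) summable_on UNIV"
    using assms unfolding sob_def bessel_sq by (simp only: mem_Collect_eq)
  then show ?thesis unfolding bessel_def by (subst Abs_ell2_inverse) auto
qed

lemma norm_bessel: "u \<in> sob r \<Longrightarrow> norm (bessel r u) = sob_norm r u"
  using norm_ell2_sq[of "bessel r u"] unfolding sob_norm_def
  by (simp only: bessel_coeff bessel_sq real_sqrt_unique norm_ge_zero)

lemma bessel_inj: "inj_on (bessel r) (sob r)"
proof (rule inj_onI, rule ext)
  fix u v :: "('d::finite) fseries" and k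
  assume "u \<in> sob r" "v \<in> sob r" "bessel r u = bessel r v"
  then have "jbracket k powr r *\<^sub>R u k = jbracket k powr r *\<^sub>R v k" by (metis bessel_coeff)
  then show "u k = v k" using jbracket_pos[of k] by simp
qed

lemma bessel_surj: "\<exists>u\<in>sob r. bessel r u = a"
proof
  define u where "u k = jbracket k powr (- r) *\<^sub>R ell2_coeff a k" for k
  have u: "jbracket k powr r *\<^sub>R u k = ell2_coeff a k" for k
    using jbracket_pos[of k] by (simp add: u_def powr_minus del: scaleR_complex_def)
  show "u \<in> sob r"
    unfolding sob_def bessel_sq[symmetric] by (simp only: u ell2_summable mem_Collect_eq)
  show "bessel r u = a"
    unfolding bessel_def u by (rule ell2_coeff_inverse)
qed

lemma sob_dist_bessel:
  assumes "u \<in> sob r" "v \<in> sob r"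
  shows "sob_dist r u v = dist (bessel r u) (bessel r v)"
proof -
  have "ell2_coeff (bessel r u - bessel r v) k = jbracket k powr r *\<^sub>R (u k - v k)" for k
    using assms by (simp add: bessel_coeff scaleR_diff_right del: scaleR_complex_def)
  then show ?thesis
    using norm_ell2_sq[of "bessel r u - bessel r v"] unfolding sob_dist_def sob_norm_def dist_norm
    by (simp only: bessel_sq real_sqrt_unique norm_ge_zero)
qed

lemma Metric_space_sob: "Metric_space (sob r) (sob_dist r)"
proof
  fix u v w :: "('d::finite) fseries"
  show "0 \<le> sob_dist r u v"
    unfolding sob_dist_def sob_norm_def by (simp add: infsum_nonneg)
  show "sob_dist r u v = sob_dist r v u"
    by (simp add: sob_dist_def sob_norm_def norm_minus_commute)
  show "(sob_dist r u v = 0) = (u = v)" if "u \<in> sob r" "v \<in> sob r"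
    using that by (simp add: sob_dist_bessel inj_on_eq_iff[OF bessel_inj])
  show "sob_dist r u w \<le> sob_dist r u v + sob_dist r v w"
    if "u \<in> sob r" "v \<in> sob r" "w \<in> sob r"
    using that by (simp add: sob_dist_bessel dist_triangle)
qed

lemma topspace_sob_top: "topspace (sob_top r) = sob r"
  unfolding sob_top_def by (rule Metric_space.topspace_mtopology[OF Metric_space_sob])

text \<open>The span of the \<open>e\<^sub>k\<close> with \<open>\<bar>k\<bar> \<le> n\<close> in terms of coefficients, and the projection onto it.\<close>

definition trig_space :: "nat \<Rightarrow> ('d::finite) fseries set"
  where "trig_space n = {u. \<forall>k. freq_norm k > real n \<longrightarrow> u k = 0}"

definition trig_proj :: "nat \<Rightarrow> ('d::finite) fseries \<Rightarrow> 'd fseries"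
  where "trig_proj n u = (\<lambda>k. if freq_norm k \<le> real n then u k else 0)"

definition neg_laplace :: "('d::finite) fseries \<Rightarrow> 'd fseries"
  where "neg_laplace u = (\<lambda>k. of_real ((freq_norm k)\<^sup>2) * u k)"

definition nonlin :: "nat \<Rightarrow> ('d::finite) fseries \<Rightarrow> 'd fseries"
  where "nonlin \<sigma> u = fourier_coeff (\<lambda>x. of_real (cmod (fun_of u x) ^ (2 * \<sigma>)) * fun_of u x)"

text \<open>
  For \<open>s > d/2\<close> every element of \<open>H\<^sup>s\<close> is bounded. Membership in \<open>H\<^sup>s\<close> is the part
  \<open>\<parallel>F(u)\<parallel>\<^sub>s < \<infinity>\<close> of the estimate.
\<close>

definition nonlin_const :: "'d::finite itself \<Rightarrow> real \<Rightarrow> nat \<Rightarrow> real \<Rightarrow> bool"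
  where "nonlin_const _ s \<sigma> K \<longleftrightarrow> K > 0 \<and>
    (\<forall>u :: 'd fseries. u \<in> sob s \<longrightarrow> nonlin \<sigma> u \<in> sob s \<and>
      sob_norm s (nonlin \<sigma> u) \<le> K * Linf_norm u ^ (2 * \<sigma>) * sob_norm s u)"

definition bounded_on_balls :: "real \<Rightarrow> real \<Rightarrow> (('d::finite) fseries \<Rightarrow> 'd fseries) \<Rightarrow> bool"
  where "bounded_on_balls r r' \<phi> \<longleftrightarrow>
    (\<forall>R. \<exists>M. \<forall>u\<in>sob r. sob_norm r u \<le> R \<longrightarrow> sob_norm r' (\<phi> u) \<le> M)"

definition galerkin_loc_lipschitz :: "nat \<Rightarrow> (('d::finite) fseries \<Rightarrow> 'd fseries) \<Rightarrow> bool"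
  where "galerkin_loc_lipschitz n \<phi> \<longleftrightarrow>
    (\<forall>u\<in>trig_space n. \<exists>\<epsilon>>0. \<exists>L. \<forall>v\<in>trig_space n. \<forall>w\<in>trig_space n.
      sob_dist 0 u v < \<epsilon> \<longrightarrow> sob_dist 0 u w < \<epsilon> \<longrightarrow>
      sob_dist 0 (trig_proj n (\<phi> v)) (trig_proj n (\<phi> w)) \<le> L * sob_dist 0 v w)"

definition has_sob_integral ::
    "real \<Rightarrow> 'a measure \<Rightarrow> ('a \<Rightarrow> ('d::finite) fseries) \<Rightarrow> 'd fseries \<Rightarrow> bool"
  where "has_sob_integral r N g z \<longleftrightarrow> (\<forall>t\<in>space N. g t \<in> sob r) \<and> z \<in> sob r \<and>
    has_bochner_integral N (\<lambda>t. bessel r (g t)) (bessel r z)"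


section \<open>Brownian motion and the Ito integral\<close>

text \<open>Filtrations are indexed by the reals; only times \<open>t \<ge> 0\<close> matter.\<close>

definition standard_filtration :: "'w measure \<Rightarrow> (real \<Rightarrow> 'w measure) \<Rightarrow> bool"
  where "standard_filtration M \<F> \<longleftrightarrow>
    (\<forall>t\<ge>0. subalgebra M (\<F> t)) \<and>
    (\<forall>r t. 0 \<le> r \<longrightarrow> r \<le> t \<longrightarrow> sets (\<F> r) \<subseteq> sets (\<F> t)) \<and>
    (\<forall>t\<ge>0. sets (\<F> t) = (\<Inter>r\<in>{t<..}. sets (\<F> r))) \<and>
    null_sets M \<subseteq> sets (\<F> 0)"

definition brownian_motion ::
    "'w measure \<Rightarrow> (real \<Rightarrow> 'w measure) \<Rightarrow> (real \<Rightarrow> 'w \<Rightarrow> real) \<Rightarrow> bool"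
  where "brownian_motion M \<F> W \<longleftrightarrow>
    (\<forall>t\<ge>0. W t \<in> borel_measurable (\<F> t)) \<and>
    (AE \<omega> in M. W 0 \<omega> = 0) \<and>
    (AE \<omega> in M. continuous_on {0..} (\<lambda>t. W t \<omega>)) \<and>
    (\<forall>r t. 0 \<le> r \<longrightarrow> r < t \<longrightarrow>
      distributed M lborel (\<lambda>\<omega>. W t \<omega> - W r \<omega>) (\<lambda>x. ennreal (normal_density 0 (sqrt (t - r)) x)) \<and>
      prob_space.indep_set M (sets (\<F> r))
        {(\<lambda>\<omega>. W t \<omega> - W r \<omega>) -` B \<inter> space M | B. B \<in> sets borel})"

text \<open>
  Elementary adapted processes \<open>\<Sum>\<^sub>i\<^sub><\<^sub>n 1\<^bsub>(\<tau>\<^sub>i, \<tau>\<^sub>i\<^sub>+\<^sub>1]\<^esub> \<xi>\<^sub>i\<close> on \<open>[0, T]\<close>, with bounded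
  \<open>\<F>\<^sub>\<tau>\<^sub>i\<close>-measurable \<open>\<xi>\<^sub>i\<close>.
\<close>

definition elementary :: "'w measure \<Rightarrow> (real \<Rightarrow> 'w measure) \<Rightarrow> real \<Rightarrow>
    nat \<Rightarrow> (nat \<Rightarrow> real) \<Rightarrow> (nat \<Rightarrow> 'w \<Rightarrow> 'b::real_normed_vector) \<Rightarrow> bool"
  where "elementary M \<F> T n \<tau> \<xi> \<longleftrightarrow> \<tau> 0 = 0 \<and> \<tau> n = T \<and>
    (\<forall>i<n. \<tau> i \<le> \<tau> (Suc i) \<and> \<xi> i \<in> borel_measurable (\<F> (\<tau> i)) \<and> bounded (\<xi> i ` space M))"

definition elementary_process ::
    "nat \<Rightarrow> (nat \<Rightarrow> real) \<Rightarrow> (nat \<Rightarrow> 'w \<Rightarrow> 'b::real_normed_vector) \<Rightarrow> real \<Rightarrow> 'w \<Rightarrow> 'b"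
  where "elementary_process n \<tau> \<xi> t \<omega> = (\<Sum>i<n. indicator {\<tau> i<..\<tau> (Suc i)} t *\<^sub>R \<xi> i \<omega>)"

definition elementary_ito :: "(real \<Rightarrow> 'w \<Rightarrow> real) \<Rightarrow>
    nat \<Rightarrow> (nat \<Rightarrow> real) \<Rightarrow> (nat \<Rightarrow> 'w \<Rightarrow> 'b::real_normed_vector) \<Rightarrow> 'w \<Rightarrow> 'b"
  where "elementary_ito W n \<tau> \<xi> \<omega> = (\<Sum>i<n. (W (\<tau> (Suc i)) \<omega> - W (\<tau> i) \<omega>) *\<^sub>R \<xi> i \<omega>)"

text \<open>
  \<open>I\<close> is (a version of) \<open>\<integral>\<^sub>0\<^sup>T \<Phi> dW\<close>, the limit in probability of the integrals of elementary processes
  that converge to \<open>\<Phi>\<close> in \<open>L\<^sup>2(0, T)\<close> almost surely. This is the usual extension of the Ito integral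
  to adapted integrands with almost surely square-integrable paths; \<open>I\<close> is determined up to
  null sets.
\<close>

definition has_ito_integral :: "'w measure \<Rightarrow> (real \<Rightarrow> 'w measure) \<Rightarrow> (real \<Rightarrow> 'w \<Rightarrow> real) \<Rightarrow>
    real \<Rightarrow> (real \<Rightarrow> 'w \<Rightarrow> 'b::{banach, second_countable_topology}) \<Rightarrow> ('w \<Rightarrow> 'b) \<Rightarrow> bool"
  where "has_ito_integral M \<F> W T \<Phi> I \<longleftrightarrow>
    (AE \<omega> in M. (\<lambda>t. \<Phi> t \<omega>) \<in> borel_measurable (restrict_space lborel {0..T})) \<and>
    I \<in> borel_measurable M \<and>
    (\<exists>n \<tau> \<xi>. (\<forall>m. elementary M \<F> T (n m) (\<tau> m) (\<xi> m)) \<and>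
      (AE \<omega> in M. (\<lambda>m. \<integral>\<^sup>+t. ennreal ((norm (elementary_process (n m) (\<tau> m) (\<xi> m) t \<omega> - \<Phi> t \<omega>))\<^sup>2)
        \<partial>restrict_space lborel {0..T}) \<longlonglongrightarrow> 0) \<and>
      (\<forall>\<epsilon>>0. (\<lambda>m. measure M {\<omega>\<in>space M. norm (elementary_ito W (n m) (\<tau> m) (\<xi> m) \<omega> - I \<omega>) > \<epsilon>})
        \<longlonglongrightarrow> 0))"

definition has_sob_ito_integral :: "real \<Rightarrow> 'w measure \<Rightarrow> (real \<Rightarrow> 'w measure) \<Rightarrow> (real \<Rightarrow> 'w \<Rightarrow> real) \<Rightarrow>
    real \<Rightarrow> (real \<Rightarrow> 'w \<Rightarrow> ('d::finite) fseries) \<Rightarrow> ('w \<Rightarrow> 'd fseries) \<Rightarrow> bool"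
  where "has_sob_ito_integral r M \<F> W T \<Phi> I \<longleftrightarrow>
    (\<forall>\<omega>\<in>space M. I \<omega> \<in> sob r \<and> (\<forall>t\<in>{0..T}. \<Phi> t \<omega> \<in> sob r)) \<and>
    has_ito_integral M \<F> W T (\<lambda>t \<omega>. bessel r (\<Phi> t \<omega>)) (\<lambda>\<omega>. bessel r (I \<omega>))"


section \<open>The stochastic nonlinear Schroedinger equation\<close>

definition strong_solution :: "real \<Rightarrow> nat \<Rightarrow> complex \<Rightarrow> (('d::finite) fseries \<Rightarrow> 'd fseries) \<Rightarrow>
    'w measure \<Rightarrow> (real \<Rightarrow> 'w measure) \<Rightarrow> (real \<Rightarrow> 'w \<Rightarrow> real) \<Rightarrow>
    'd fseries \<Rightarrow> (real \<Rightarrow> 'w \<Rightarrow> 'd fseries) \<Rightarrow> bool"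
  where "strong_solution s \<sigma> \<alpha> \<phi> M \<F> W x u \<longleftrightarrow>
    (\<forall>t\<ge>0. u t \<in> measurable (\<F> t) (sob_borel s)) \<and>
    (AE \<omega> in M. continuous_map (top_of_set {0..}) (sob_top s) (\<lambda>t. u t \<omega>)) \<and>
    (AE \<omega> in M. u 0 \<omega> = x) \<and>
    (\<forall>t\<ge>0. \<exists>D S.
      (AE \<omega> in M. has_sob_integral (- s - 1) (restrict_space lborel {0..t})
        (\<lambda>\<rho> k. neg_laplace (u \<rho> \<omega>) k - \<alpha> * nonlin \<sigma> (u \<rho> \<omega>) k) (D \<omega>)) \<and>
      has_sob_ito_integral (- s - 1) M \<F> W t (\<lambda>\<rho> \<omega>. \<phi> (u \<rho> \<omega>)) S \<and>
      (AE \<omega> in M. u t \<omega> = (\<lambda>k. x k + \<i> * D \<omega> k + S \<omega> k)))"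

text \<open>
  In the following, \<open>u x t \<omega>\<close> is the value at time \<open>t\<close> of the solution with initial value \<open>x\<close>.
\<close>

definition transition_op :: "'w measure \<Rightarrow> (('d::finite) fseries \<Rightarrow> real \<Rightarrow> 'w \<Rightarrow> 'd fseries) \<Rightarrow>
    real \<Rightarrow> ('d fseries \<Rightarrow> real) \<Rightarrow> 'd fseries \<Rightarrow> real"
  where "transition_op M u t g x = (LINT \<omega>|M. g (u x t \<omega>))"

definition invariant_measure :: "real \<Rightarrow> 'w measure \<Rightarrow>
    (('d::finite) fseries \<Rightarrow> real \<Rightarrow> 'w \<Rightarrow> 'd fseries) \<Rightarrow> 'd fseries measure \<Rightarrow> bool"
  where "invariant_measure s M u \<mu> \<longleftrightarrow> prob_space \<mu> \<and> sets \<mu> = sets (sob_borel s) \<and>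
    (\<forall>t\<ge>0. \<forall>g \<in> borel_measurable (sob_borel s). bounded (g ` sob s) \<longrightarrow>
      (LINT x|\<mu>. g x) = (LINT x|\<mu>. transition_op M u t g x))"

end

theory Submission
  imports Defs
begin

text \<open>
  Under the isometry \<open>(1 - \<Delta>)\<^sup>s\<^sup>/\<^sup>2\<close> the equation becomes one on square-summable families, in which the
  linear part is skew and drops out of the energy balance. For two solutions \<open>U\<close>, \<open>V\<close> and \<open>\<epsilon> > 0\<close> the
  process \<open>(\<epsilon> + \<parallel>U - V\<parallel>\<^sup>2)\<^sup>\<kappa>\<close>, discounted by the exponential of its Ito drift rate, satisfies the
  mean and maximal inequalities of a nonnegative supermartingale. This is proved without an Ito
  formula: the logarithm of the projection to finitely many modes is expanded along a grid, the
  martingale part of the expansion is compensated exactly by the Gaussian Laplace transform, and the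
  inequalities survive the passage to the limit in the mesh, the projection and \<open>\<epsilon>\<close>.

  With \<open>V = 0\<close> and \<open>\<kappa> = -1/2\<close> it follows that a nonzero solution never vanishes; with \<open>V = 0\<close> and
  \<open>\<kappa> = p/2\<close> the limit \<open>\<epsilon> \<rightarrow> 0\<close> and the energy condition then give the decay of \<open>\<parallel>u(t)\<parallel>\<^sup>p\<close> in mean and,
  by the maximal inequality, almost surely. With \<open>\<kappa> = 1/2\<close> solutions depend continuously in
  probability on the initial value, so that the transition semigroup preserves measurability, and
  testing an invariant measure with \<open>min 1 \<parallel>x\<parallel>\<close> as \<open>t \<rightarrow> \<infinity>\<close> shows that it is \<open>\<delta>\<^sub>0\<close>.

  The nonlinearity is Lipschitz on balls since it is polynomial along lines, hence determined by
  finitely many values through Lagrange interpolation, and is bounded on balls.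
\<close>

section \<open>Convergence to zero in probability\<close>

text \<open>The equation is given in \<open>H^(-s-1)\<close>, at each fixed time almost surely, with
  a stochastic integral known only as a limit in probability, and nothing is integrable a priori.
  This favours the logarithm: \<kappa> times its martingale part on a grid is a sum of
  \<open>\<theta> dW\<close> with adapted, possibly unbounded \<theta>, and
  \<open>exp (\<theta> dW - \<theta>^2 dt / 2)\<close> has conditional mean exactly 1 without moment
  assumptions. Fatou's lemma then loses only in the harmless direction. Truncation to finitely many
  modes makes the linear part bounded and keeps it skew. The shift \<epsilon> keeps the logarithm
  smooth at 0 and the weight \<open>2 X / (\<epsilon> + |X|^2)\<close> bounded. Removing it is the
  delicate point, because the rate contains \<open>(X . b)^2 / |X|^4\<close>, which need not have a
  limit at X = 0; this is why nonvanishing precedes decay. For \<kappa> = p/2 the limiting rate is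
  at most p times the left side of the energy condition, hence at most p B, which is the origin of
  the exponent -p B.\<close>

lemma LIMSEQ_0_le:
  fixes f g :: "nat \<Rightarrow> real"
  assumes "\<And>n. f n \<le> g n" "g \<longlonglongrightarrow> 0" "\<And>n. 0 \<le> f n"
  shows "f \<longlonglongrightarrow> 0"
  by (rule tendsto_sandwich[of "\<lambda>_. 0" f _ g]) (use assms in auto)

context prob_space
begin

text \<open>Only real sequences are covered; convergence in probability in a Hilbert space enters
  through norms. Measurability is part of the notion because the probabilities of non-measurable
  events would be meaningless.\<close>

definition null_in_prob :: "(nat \<Rightarrow> 'a \<Rightarrow> real) \<Rightarrow> bool"
  where "null_in_prob Z \<longleftrightarrow> (\<forall>n. Z n \<in> borel_measurable M) \<and>
    (\<forall>\<eta>>0. (\<lambda>n. prob {\<omega>\<in>space M. \<bar>Z n \<omega>\<bar> > \<eta>}) \<longlonglongrightarrow> 0)"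

lemma null_in_probD:
  assumes "null_in_prob Z"
  shows "Z n \<in> borel_measurable M"
    and "\<eta> > 0 \<Longrightarrow> (\<lambda>n. prob {\<omega>\<in>space M. \<bar>Z n \<omega>\<bar> > \<eta>}) \<longlonglongrightarrow> 0"
  using assms unfolding null_in_prob_def by auto

lemma null_in_prob_AE:
  assumes [measurable]: "\<And>n. Z n \<in> borel_measurable M"
    and lim: "AE \<omega> in M. (\<lambda>n. Z n \<omega>) \<longlonglongrightarrow> 0"
  shows "null_in_prob Z"
  unfolding null_in_prob_def
proof (intro conjI allI impI)
  fix \<eta> :: real assume \<eta>: "\<eta> > 0"
  have "(\<lambda>n. integral\<^sup>L M (\<lambda>\<omega>. indicator {\<omega>\<in>space M. \<bar>Z n \<omega>\<bar> > \<eta>} \<omega> :: real)) \<longlonglongrightarrow> integral\<^sup>L M (\<lambda>\<omega>. 0)"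
  proof (rule integral_dominated_convergence[where w = "\<lambda>_. 1"])
    show "AE \<omega> in M. (\<lambda>n. indicator {\<omega>\<in>space M. \<bar>Z n \<omega>\<bar> > \<eta>} \<omega> :: real) \<longlonglongrightarrow> 0"
      using lim
    proof eventually_elim
      fix \<omega> assume "(\<lambda>n. Z n \<omega>) \<longlonglongrightarrow> 0"
      then have "\<forall>\<^sub>F n in sequentially. \<bar>Z n \<omega>\<bar> < \<eta>"
        using \<eta> by (simp add: tendsto_iff dist_real_def)
      then have "\<forall>\<^sub>F n in sequentially. indicator {\<omega>\<in>space M. \<bar>Z n \<omega>\<bar> > \<eta>} \<omega> = (0::real)"
        by eventually_elim (auto simp: indicator_def)
      then show "(\<lambda>n. indicator {\<omega>\<in>space M. \<bar>Z n \<omega>\<bar> > \<eta>} \<omega> :: real) \<longlonglongrightarrow> 0"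
        by (rule tendsto_eventually)
    qed
  qed (auto simp: indicator_def)
  then show "(\<lambda>n. prob {\<omega>\<in>space M. \<bar>Z n \<omega>\<bar> > \<eta>}) \<longlonglongrightarrow> 0" by simp
qed simp

text \<open>Stated by domination, so that one application absorbs a triangle inequality: |V| >
  \<eta> forces one of the two bounds above \<eta>/2.\<close>

lemma null_in_prob_add:
  assumes Z: "null_in_prob Z" and Y: "null_in_prob Y"
    and [measurable]: "\<And>n. V n \<in> borel_measurable M"
    and le: "\<And>n. AE \<omega> in M. \<bar>V n \<omega>\<bar> \<le> \<bar>Z n \<omega>\<bar> + \<bar>Y n \<omega>\<bar>"
  shows "null_in_prob V"
  unfolding null_in_prob_def
proof (intro conjI allI impI)
  note [measurable] = null_in_probD(1)[OF Z] null_in_probD(1)[OF Y]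
  fix \<eta> :: real assume \<eta>: "\<eta> > 0"
  let ?P = "\<lambda>Z n \<eta>. prob {\<omega>\<in>space M. \<bar>Z n \<omega>\<bar> > \<eta>}"
  have "?P V n \<eta> \<le> ?P Z n (\<eta>/2) + ?P Y n (\<eta>/2)" for n
  proof -
    have "?P V n \<eta> \<le> prob ({\<omega>\<in>space M. \<bar>Z n \<omega>\<bar> > \<eta>/2} \<union> {\<omega>\<in>space M. \<bar>Y n \<omega>\<bar> > \<eta>/2})"
    proof (rule finite_measure_mono_AE)
      show "AE \<omega> in M. \<omega> \<in> {\<omega>\<in>space M. \<bar>V n \<omega>\<bar> > \<eta>} \<longrightarrow>
          \<omega> \<in> {\<omega>\<in>space M. \<bar>Z n \<omega>\<bar> > \<eta>/2} \<union> {\<omega>\<in>space M. \<bar>Y n \<omega>\<bar> > \<eta>/2}"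
        using le[of n] by eventually_elim auto
    qed simp
    also have "\<dots> \<le> ?P Z n (\<eta>/2) + ?P Y n (\<eta>/2)"
      by (rule measure_Un_le) auto
    finally show ?thesis .
  qed
  moreover have "(\<lambda>n. ?P Z n (\<eta>/2) + ?P Y n (\<eta>/2)) \<longlonglongrightarrow> 0"
    using null_in_probD(2)[OF Z, of "\<eta>/2"] null_in_probD(2)[OF Y, of "\<eta>/2"] \<eta>
    by (intro tendsto_add_zero) simp_all
  ultimately show "(\<lambda>n. ?P V n \<eta>) \<longlonglongrightarrow> 0"
    by (rule LIMSEQ_0_le) simp
qed simp

lemma null_in_prob_cmult:
  assumes Z: "null_in_prob Z"
    and [measurable]: "\<And>n. V n \<in> borel_measurable M"
    and le: "\<And>n. AE \<omega> in M. \<bar>V n \<omega>\<bar> \<le> C * \<bar>Z n \<omega>\<bar>"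
  shows "null_in_prob V"
  unfolding null_in_prob_def
proof (intro conjI allI impI)
  note [measurable] = null_in_probD(1)[OF Z]
  fix \<eta> :: real assume \<eta>: "\<eta> > 0"
  let ?P = "\<lambda>Z n \<eta>. prob {\<omega>\<in>space M. \<bar>Z n \<omega>\<bar> > \<eta>}"
  \<comment> \<open>The maximum with 1 keeps the divisor positive, since C may be
    nonpositive.\<close>
  define D where "D = max C 1"
  have D: "D > 0" "C \<le> D" by (auto simp: D_def)
  have "?P V n \<eta> \<le> ?P Z n (\<eta>/D)" for n
  proof (rule finite_measure_mono_AE)
    show "AE \<omega> in M. \<omega> \<in> {\<omega>\<in>space M. \<bar>V n \<omega>\<bar> > \<eta>} \<longrightarrow> \<omega> \<in> {\<omega>\<in>space M. \<bar>Z n \<omega>\<bar> > \<eta>/D}"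
      using le[of n]
    proof eventually_elim
      fix \<omega> assume *: "\<bar>V n \<omega>\<bar> \<le> C * \<bar>Z n \<omega>\<bar>"
      have "C * \<bar>Z n \<omega>\<bar> \<le> D * \<bar>Z n \<omega>\<bar>" using D by (intro mult_right_mono) auto
      with * show "\<omega> \<in> {\<omega>\<in>space M. \<bar>V n \<omega>\<bar> > \<eta>} \<longrightarrow> \<omega> \<in> {\<omega>\<in>space M. \<bar>Z n \<omega>\<bar> > \<eta>/D}"
        using D by (auto simp: field_simps)
    qed
  qed simp
  moreover have "(\<lambda>n. ?P Z n (\<eta>/D)) \<longlonglongrightarrow> 0"
    using \<eta> D by (intro null_in_probD(2)[OF Z]) simp
  ultimately show "(\<lambda>n. ?P V n \<eta>) \<longlonglongrightarrow> 0"
    by (rule LIMSEQ_0_le) simp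
qed simp

lemma null_in_prob_sum:
  assumes "finite I" and "\<And>i. i \<in> I \<Longrightarrow> null_in_prob (Z i)"
  shows "null_in_prob (\<lambda>n \<omega>. \<Sum>i\<in>I. \<bar>Z i n \<omega>\<bar>)"
  using assms
proof (induction I rule: finite_induct)
  case empty
  then show ?case by (intro null_in_prob_AE) auto
next
  case (insert i I)
  have [measurable]: "\<And>n. Z i n \<in> borel_measurable M" "\<And>n. (\<lambda>\<omega>. \<Sum>i\<in>I. \<bar>Z i n \<omega>\<bar>) \<in> borel_measurable M"
    using null_in_probD(1)[of "Z i"] null_in_probD(1)[OF insert.IH] insert.prems by auto
  show ?case
  proof (rule null_in_prob_add)
    show "null_in_prob (Z i)" using insert.prems by simp
    show "null_in_prob (\<lambda>n \<omega>. \<Sum>i\<in>I. \<bar>Z i n \<omega>\<bar>)" using insert by simp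
    show "AE \<omega> in M. \<bar>\<Sum>j\<in>insert i I. \<bar>Z j n \<omega>\<bar>\<bar> \<le> \<bar>Z i n \<omega>\<bar> + \<bar>\<Sum>j\<in>I. \<bar>Z j n \<omega>\<bar>\<bar>" for n
      using insert.hyps by (simp add: sum_nonneg)
    show "(\<lambda>\<omega>. \<Sum>j\<in>insert i I. \<bar>Z j n \<omega>\<bar>) \<in> borel_measurable M" for n
      using insert.hyps by simp
  qed
qed

lemma null_in_prob_compose:
  assumes Z: "null_in_prob Z" and r: "filterlim r at_top sequentially"
  shows "null_in_prob (\<lambda>n. Z (r n))"
  unfolding null_in_prob_def
proof (intro conjI allI impI)
  fix \<eta> :: real assume "\<eta> > 0"
  then have "(\<lambda>n. prob {\<omega>\<in>space M. \<bar>Z n \<omega>\<bar> > \<eta>}) \<longlonglongrightarrow> 0" by (rule null_in_probD[OF Z])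
  from filterlim_compose[OF this r]
  show "(\<lambda>n. prob {\<omega>\<in>space M. \<bar>Z (r n) \<omega>\<bar> > \<eta>}) \<longlonglongrightarrow> 0" .
qed (rule null_in_probD[OF Z])

text \<open>Borel-Cantelli: along indices at which \<open>|Z| > 2^-k\<close> has probability at most
  \<open>2^-k\<close> the exceptional events are summable, so almost every path leaves them
  eventually.\<close>

lemma null_in_prob_subseq:
  assumes Z: "null_in_prob Z"
  obtains r :: "nat \<Rightarrow> nat" where "strict_mono r" "AE \<omega> in M. (\<lambda>n. Z (r n) \<omega>) \<longlonglongrightarrow> 0"
proof -
  note [measurable] = null_in_probD(1)[OF Z]
  let ?P = "\<lambda>n \<eta>. prob {\<omega>\<in>space M. \<bar>Z n \<omega>\<bar> > \<eta>}"
  have ex: "\<exists>n>m. ?P n ((1/2)^k) < (1/2)^k" for m k :: nat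
  proof -
    have "\<forall>\<^sub>F n in sequentially. ?P n ((1/2)^k) < (1/2)^k"
      using null_in_probD(2)[OF Z, of "(1/2)^k"] by (intro order_tendstoD) auto
    then obtain n0 where "\<And>n. n \<ge> n0 \<Longrightarrow> ?P n ((1/2)^k) < (1/2)^k"
      unfolding eventually_sequentially by auto
    then show ?thesis by (intro exI[of _ "max n0 (Suc m)"]) auto
  qed
  \<comment> \<open>Each choice lies beyond the previous index, so the recursion produces a strictly
    increasing sequence.\<close>
  define r where "r = rec_nat (SOME n. ?P n ((1/2)^0) < (1/2)^0)
    (\<lambda>k m. SOME n. n > m \<and> ?P n ((1/2)^(Suc k)) < (1/2)^(Suc k))"
  have r0: "?P (r 0) ((1/2)^0) < (1/2)^0"
    unfolding r_def old.nat.rec by (rule someI_ex) (use ex[of 0 0] in blast)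
  have rS: "r (Suc k) > r k \<and> ?P (r (Suc k)) ((1/2)^(Suc k)) < (1/2)^(Suc k)" for k
    unfolding r_def old.nat.rec by (rule someI_ex) (use ex in blast)
  have sm: "strict_mono r" using rS by (simp add: strict_mono_Suc_iff)
  have rk: "?P (r k) ((1/2)^k) \<le> (1/2)^k" for k
    using r0 rS by (cases k) (auto simp: less_imp_le)
  have "AE \<omega> in M. \<forall>\<^sub>F n in sequentially. \<omega> \<in> space M - {\<omega>\<in>space M. \<bar>Z (r n) \<omega>\<bar> > (1/2)^n}"
  proof (rule borel_cantelli_AE1)
    show "summable (\<lambda>i. measure M {\<omega> \<in> space M. \<bar>Z (r i) \<omega>\<bar> > (1/2)^i})"
      by (rule summable_comparison_test'[of "\<lambda>i. (1/2::real)^i"]) (use rk in auto)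
  qed (auto simp: emeasure_eq_measure)
  then have "AE \<omega> in M. (\<lambda>n. Z (r n) \<omega>) \<longlonglongrightarrow> 0"
  proof eventually_elim
    fix \<omega> assume "\<forall>\<^sub>F n in sequentially. \<omega> \<in> space M - {\<omega>\<in>space M. \<bar>Z (r n) \<omega>\<bar> > (1/2)^n}"
    then have "\<forall>\<^sub>F n in sequentially. norm (Z (r n) \<omega>) \<le> (1/2)^n"
      by eventually_elim (auto simp: not_less)
    then show "(\<lambda>n. Z (r n) \<omega>) \<longlonglongrightarrow> 0"
      by (rule Lim_null_comparison) (simp add: LIMSEQ_realpow_zero)
  qed
  with sm show ?thesis by (rule that)
qed

text \<open>Strict inequality is an open condition: a path with limit above \<eta> has its
  approximations above \<eta> eventually. Fatou's lemma for the indicators does the rest.\<close>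

lemma prob_greater_limit:
  assumes [measurable]: "\<And>n. Z n \<in> borel_measurable M" "Y \<in> borel_measurable M"
    and lim: "AE \<omega> in M. (\<lambda>n. Z n \<omega>) \<longlonglongrightarrow> Y \<omega>"
    and K: "\<And>n. prob {\<omega>\<in>space M. Z n \<omega> > (\<eta>::real)} \<le> K"
  shows "prob {\<omega>\<in>space M. Y \<omega> > \<eta>} \<le> K"
proof -
  have K0: "K \<ge> 0" using K[of 0] measure_nonneg order_trans by blast
  have "emeasure M {\<omega>\<in>space M. Y \<omega> > \<eta>} = (\<integral>\<^sup>+\<omega>. indicator {\<omega>\<in>space M. Y \<omega> > \<eta>} \<omega> \<partial>M)"
    by simp
  also have "\<dots> \<le> (\<integral>\<^sup>+\<omega>. liminf (\<lambda>n. indicator {\<omega>\<in>space M. Z n \<omega> > \<eta>} \<omega>) \<partial>M)"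
  proof (rule nn_integral_mono_AE, use lim in eventually_elim)
    fix \<omega> assume l: "(\<lambda>n. Z n \<omega>) \<longlonglongrightarrow> Y \<omega>"
    show "indicator {\<omega>\<in>space M. Y \<omega> > \<eta>} \<omega> \<le> liminf (\<lambda>n. indicator {\<omega>\<in>space M. Z n \<omega> > \<eta>} \<omega> :: ennreal)"
    proof (cases "\<omega> \<in> space M \<and> Y \<omega> > \<eta>")
      case True
      then have "\<forall>\<^sub>F n in sequentially. Z n \<omega> > \<eta>" using l by (intro order_tendstoD) auto
      then have "\<forall>\<^sub>F n in sequentially. (1::ennreal) \<le> indicator {\<omega>\<in>space M. Z n \<omega> > \<eta>} \<omega>"
        by eventually_elim (use True in auto)
      then have "1 \<le> liminf (\<lambda>n. indicator {\<omega>\<in>space M. Z n \<omega> > \<eta>} \<omega> :: ennreal)"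
        by (rule Liminf_bounded)
      with True show ?thesis by simp
    qed auto
  qed
  also have "\<dots> \<le> liminf (\<lambda>n. \<integral>\<^sup>+\<omega>. indicator {\<omega>\<in>space M. Z n \<omega> > \<eta>} \<omega> \<partial>M)"
    by (rule nn_integral_liminf) auto
  also have "\<dots> = liminf (\<lambda>n. ennreal (prob {\<omega>\<in>space M. Z n \<omega> > \<eta>}))"
    by (simp add: emeasure_eq_measure)
  also have "\<dots> \<le> liminf (\<lambda>n. ennreal K)"
    by (intro Liminf_mono always_eventually allI ennreal_leI K)
  also have "\<dots> = ennreal K" by (simp add: Liminf_const)
  finally show ?thesis using K0 by (simp add: emeasure_eq_measure)
qed

text \<open>The bound has the shape of Lenglart's inequality: \<delta> is free, so it is first taken
  small to make \<open>K \<eta> * \<delta>\<close> negligible, and then n large. It lets smallness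
  in probability of an energy replace a second moment.\<close>

lemma null_in_prob_criterion:
  assumes [measurable]: "\<And>n. Z n \<in> borel_measurable M" and V: "null_in_prob V"
    and K: "\<And>n \<eta> \<delta>. \<eta> > 0 \<Longrightarrow> \<delta> > 0 \<Longrightarrow>
      prob {\<omega>\<in>space M. \<bar>Z n \<omega>\<bar> > \<eta>} \<le> K \<eta> * \<delta> + prob {\<omega>\<in>space M. \<bar>V n \<omega>\<bar> > \<delta>}"
  shows "null_in_prob Z"
  unfolding null_in_prob_def
proof (intro conjI allI impI)
  fix \<eta> :: real assume \<eta>: "\<eta> > 0"
  show "(\<lambda>n. prob {\<omega>\<in>space M. \<bar>Z n \<omega>\<bar> > \<eta>}) \<longlonglongrightarrow> 0"
  proof (rule LIMSEQ_I)
    fix r :: real assume r: "0 < r"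
    \<comment> \<open>The absolute value and the +1 make \<delta> positive and
      \<open>K \<eta> * \<delta>\<close> at most r/2 whatever the sign of
      \<open>K \<eta>\<close>.\<close>
    define \<delta> where "\<delta> = r / (2 * (\<bar>K \<eta>\<bar> + 1))"
    have \<delta>: "\<delta> > 0" using r by (simp add: \<delta>_def)
    have "K \<eta> * \<delta> \<le> (\<bar>K \<eta>\<bar> + 1) * \<delta>" using \<delta> by (intro mult_right_mono) auto
    also have "\<dots> = r / 2" using r unfolding \<delta>_def by (simp add: field_simps add_nonneg_eq_0_iff)
    finally have 1: "K \<eta> * \<delta> \<le> r / 2" .
    obtain N where N: "\<And>n. n \<ge> N \<Longrightarrow> norm (prob {\<omega>\<in>space M. \<bar>V n \<omega>\<bar> > \<delta>} - 0) < r / 2"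
      using LIMSEQ_D[OF null_in_probD(2)[OF V \<delta>], of "r/2"] r by auto
    have "norm (prob {\<omega>\<in>space M. \<bar>Z n \<omega>\<bar> > \<eta>} - 0) < r" if "n \<ge> N" for n
      using N[OF that] 1 K[OF \<eta> \<delta>, of n] by simp
    then show "\<exists>no. \<forall>n\<ge>no. norm (prob {\<omega>\<in>space M. \<bar>Z n \<omega>\<bar> > \<eta>} - 0) < r" by blast
  qed
qed simp

lemma nn_integral_markov:
  assumes [measurable]: "Z \<in> borel_measurable M" and "\<eta> > 0" "C \<ge> 0"
    and le: "(\<integral>\<^sup>+\<omega>. ennreal (Z \<omega>) \<partial>M) \<le> ennreal C"
  shows "prob {\<omega>\<in>space M. Z \<omega> > \<eta>} \<le> C / \<eta>"
proof -
  have "ennreal (\<eta> * prob {\<omega>\<in>space M. Z \<omega> > \<eta>}) = (\<integral>\<^sup>+\<omega>. ennreal \<eta> * indicator {\<omega>\<in>space M. Z \<omega> > \<eta>} \<omega> \<partial>M)"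
    using assms(2) by (simp add: nn_integral_cmult emeasure_eq_measure ennreal_mult)
  also have "\<dots> \<le> (\<integral>\<^sup>+\<omega>. ennreal (Z \<omega>) \<partial>M)"
    by (intro nn_integral_mono) (auto simp: indicator_def intro!: ennreal_leI)
  also note le
  finally show ?thesis using assms by (simp add: ennreal_le_iff field_simps)
qed

end

section \<open>Martingale sums against Brownian increments\<close>

abbreviation gauss :: "real \<Rightarrow> real measure"
  where "gauss v \<equiv> density lborel (\<lambda>x. ennreal (normal_density 0 (sqrt v) x))"

lemma gauss_moment:
  assumes "v > 0"
  shows "has_bochner_integral (gauss v) (\<lambda>x. x) 0"
    and "has_bochner_integral (gauss v) (\<lambda>x. x\<^sup>2) v"
    and "has_bochner_integral (gauss v) (\<lambda>x. x^4) (3 * v\<^sup>2)"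
    and "has_bochner_integral (gauss v) (\<lambda>x. 1) (1::real)"
proof -
  have s: "sqrt v > 0" "(sqrt v)\<^sup>2 = v" using assms by auto
  note [intro!] = has_bochner_integral_density AE_I2
  have c: "has_bochner_integral lborel (\<lambda>x. normal_density 0 (sqrt v) x *\<^sub>R x ^ n) c"
    if "has_bochner_integral lborel (\<lambda>x. normal_density 0 (sqrt v) x * (x - 0) ^ m) c" "m = n" for m n c
    using that by simp
  show "has_bochner_integral (gauss v) (\<lambda>x. x) 0"
    using c[OF normal_moment_odd[OF s(1), of 0 0], of 1] by auto
  have "fact (2*1) / ((2 / v)^1 * fact 1) = v" using assms by (simp add: fact_numeral)
  then show "has_bochner_integral (gauss v) (\<lambda>x. x\<^sup>2) v"
    using c[OF normal_moment_even[OF s(1), of 0 1], of 2] unfolding s(2) by auto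
  have "fact (2*2) / ((2 / v)^2 * fact 2) = 3 * v\<^sup>2"
    using assms by (simp add: fact_numeral power2_eq_square field_simps)
  then show "has_bochner_integral (gauss v) (\<lambda>x. x^4) (3 * v\<^sup>2)"
    using c[OF normal_moment_even[OF s(1), of 0 2], of 4] unfolding s(2) by auto
  have "fact (2*0) / ((2 / v)^0 * fact 0) = (1::real)" by simp
  then show "has_bochner_integral (gauss v) (\<lambda>x. 1) (1::real)"
    using c[OF normal_moment_even[OF s(1), of 0 0], of 0] by auto
qed

text \<open>The variance is \<open>3 v^2 - 2 v^2 + v^2\<close> by the fourth moment. The centred
  square is the noise that drives the error in quadratic variations.\<close>

lemma gauss_moment_sq:
  assumes "v > 0"
  shows "has_bochner_integral (gauss v) (\<lambda>x. x\<^sup>2 - v) 0"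
    and "has_bochner_integral (gauss v) (\<lambda>x. (x\<^sup>2 - v)\<^sup>2) (2 * v\<^sup>2)"
proof -
  note m = gauss_moment[OF assms]
  show "has_bochner_integral (gauss v) (\<lambda>x. x\<^sup>2 - v) 0"
    using has_bochner_integral_diff[OF m(2) has_bochner_integral_mult_right[OF m(4), of v]] by simp
  have "has_bochner_integral (gauss v) (\<lambda>x. x^4 - (2 * v) * x\<^sup>2 + v\<^sup>2 * 1) (3 * v\<^sup>2 - (2 * v) * v + v\<^sup>2 * 1)"
    by (intro has_bochner_integral_add has_bochner_integral_diff has_bochner_integral_mult_right m)
  then show "has_bochner_integral (gauss v) (\<lambda>x. (x\<^sup>2 - v)\<^sup>2) (2 * v\<^sup>2)"
    by (rule has_bochner_integral_cong[THEN iffD1, rotated -1])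
      (simp_all add: power2_eq_square power4_eq_xxxx algebra_simps)
qed

text \<open>Completing the square: the exponential tilt turns the density into the Gaussian density
  with mean \<open>\<theta> * v\<close> and the same variance, whose mass is 1. The exact
  compensation of the exponentials below rests on this.\<close>

lemma gauss_exp:
  assumes "v > 0"
  shows "(\<integral>\<^sup>+x. ennreal (exp (\<theta> * x - \<theta>\<^sup>2 * v / 2)) \<partial>gauss v) = 1"
proof -
  have s: "sqrt v > 0" "(sqrt v)\<^sup>2 = v" using assms by auto
  have "normal_density 0 (sqrt v) x * exp (\<theta> * x - \<theta>\<^sup>2 * v / 2) = normal_density (\<theta> * v) (sqrt v) x" for x
  proof -
    have "- (x - 0)\<^sup>2 / (2 * v) + (\<theta> * x - \<theta>\<^sup>2 * v / 2) = - (x - \<theta> * v)\<^sup>2 / (2 * v)"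
      using assms by (simp add: field_simps power2_eq_square)
    then show ?thesis unfolding normal_density_def s(2) by (simp add: exp_add[symmetric])
  qed
  then have "(\<integral>\<^sup>+x. ennreal (exp (\<theta> * x - \<theta>\<^sup>2 * v / 2)) \<partial>gauss v)
      = (\<integral>\<^sup>+x. ennreal (normal_density (\<theta> * v) (sqrt v) x) \<partial>lborel)"
    by (subst nn_integral_density) (auto simp: ennreal_mult[symmetric])
  also have "\<dots> = 1"
    using prob_space.emeasure_space_1[OF prob_space_normal_density[OF s(1), of "\<theta> * v"]]
    by (simp add: emeasure_density)
  finally show ?thesis .
qed

section \<open>Brownian increments and their independence of the past\<close>

locale brownian = prob_space M for M :: "'w measure" +
  fixes \<F> :: "real \<Rightarrow> 'w measure" and W :: "real \<Rightarrow> 'w \<Rightarrow> real"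
  assumes filt: "standard_filtration M \<F>" and bm: "brownian_motion M \<F> W"
begin

lemma subalg: "0 \<le> t \<Longrightarrow> subalgebra M (\<F> t)"
  using filt unfolding standard_filtration_def by blast

lemma space_F [simp]: "0 \<le> t \<Longrightarrow> space (\<F> t) = space M"
  using subalg[of t] unfolding subalgebra_def by blast

lemma sets_F_mono: "0 \<le> r \<Longrightarrow> r \<le> t \<Longrightarrow> sets (\<F> r) \<subseteq> sets (\<F> t)"
  using filt unfolding standard_filtration_def by blast

lemma F_mono:
  assumes "h \<in> measurable (\<F> r) N" "0 \<le> r" "r \<le> t"
  shows "h \<in> measurable (\<F> t) N"
proof (rule measurable_from_subalg[OF _ assms(1)])
  show "subalgebra (\<F> t) (\<F> r)"
    using assms sets_F_mono[of r t] by (simp add: subalgebra_def)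
qed

lemma F_M: "h \<in> measurable (\<F> r) N \<Longrightarrow> 0 \<le> r \<Longrightarrow> h \<in> measurable M N"
  using measurable_from_subalg[OF subalg] .

text \<open>Completeness of the filtration: processes may be redefined on a null set of sample
  points without losing adaptedness.\<close>

lemma null_in_F: "N \<in> null_sets M \<Longrightarrow> 0 \<le> t \<Longrightarrow> N \<in> sets (\<F> t)"
  using filt unfolding standard_filtration_def by blast

lemma W_F: "0 \<le> t \<Longrightarrow> W t \<in> borel_measurable (\<F> t)"
  using bm unfolding brownian_motion_def by blast

lemma W_M [measurable]: "0 \<le> t \<Longrightarrow> W t \<in> borel_measurable M"
  using F_M[OF W_F] .

text \<open>Freezing: the whole past enters as the identity map into \<open>\<F> r\<close>, which is
  independent of the increment. The joint law is therefore a product, and Tonelli integrates out the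
  Gaussian variable with the past held fixed.\<close>

lemma nn_integral_increment:
  assumes r: "0 \<le> r" "r < t" and h[measurable]: "h \<in> borel_measurable (\<F> r \<Otimes>\<^sub>M borel)"
  shows "(\<integral>\<^sup>+\<omega>. h (\<omega>, W t \<omega> - W r \<omega>) \<partial>M) = (\<integral>\<^sup>+\<omega>. (\<integral>\<^sup>+x. h (\<omega>, x) \<partial>gauss (t - r)) \<partial>M)"
proof -
  let ?D = "\<lambda>\<omega>. W t \<omega> - W r \<omega>"
  have [measurable]: "W t \<in> borel_measurable M" "W r \<in> borel_measurable M" using r by auto
  have id[measurable]: "(\<lambda>\<omega>. \<omega>) \<in> measurable M (\<F> r)"
    by (rule F_M[OF measurable_ident[unfolded id_def] r(1)])
  have ind: "indep_set (sets (\<F> r)) {?D -` B \<inter> space M | B. B \<in> sets borel}"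
    and dist: "distributed M lborel ?D (\<lambda>x. ennreal (normal_density 0 (sqrt (t - r)) x))"
    using bm[unfolded brownian_motion_def] r by blast+
  interpret X: prob_space "distr M (\<F> r) (\<lambda>\<omega>. \<omega>)" by (rule prob_space_distr[OF id])
  interpret Y: prob_space "distr M borel ?D" by (rule prob_space_distr) simp
  \<comment> \<open>On measurable rectangles the equality is precisely the independence of the
    increment from \<open>\<F> r\<close>.\<close>
  have D: "distr M (\<F> r) (\<lambda>\<omega>. \<omega>) \<Otimes>\<^sub>M distr M borel ?D = distr M (\<F> r \<Otimes>\<^sub>M borel) (\<lambda>\<omega>. (\<omega>, ?D \<omega>))"
  proof (rule pair_measure_eqI)
    fix A B assume "A \<in> sets (distr M (\<F> r) (\<lambda>\<omega>. \<omega>))" "B \<in> sets (distr M borel ?D)"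
    then have A[measurable]: "A \<in> sets (\<F> r)" and B[measurable]: "B \<in> sets borel" by auto
    have "A \<in> sets M" using A subalg[OF r(1)] unfolding subalgebra_def by blast
    then have "A \<subseteq> space M" by (rule sets.sets_into_space)
    moreover have "prob (A \<inter> (?D -` B \<inter> space M)) = prob A * prob (?D -` B \<inter> space M)"
      by (rule indep_setD[OF ind A]) (use B in blast)
    moreover have "(\<lambda>\<omega>. (\<omega>, ?D \<omega>)) -` (A \<times> B) \<inter> space M = A \<inter> (?D -` B \<inter> space M)"
      by auto
    ultimately show "emeasure (distr M (\<F> r) (\<lambda>\<omega>. \<omega>)) A * emeasure (distr M borel ?D) B
        = emeasure (distr M (\<F> r \<Otimes>\<^sub>M borel) (\<lambda>\<omega>. (\<omega>, ?D \<omega>))) (A \<times> B)"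
      by (simp add: emeasure_distr emeasure_eq_measure ennreal_mult[symmetric] Int_absorb2)
  qed (simp_all add: X.sigma_finite_measure_axioms Y.sigma_finite_measure_axioms cong: sets_pair_measure_cong)
  have G: "distr M borel ?D = gauss (t - r)"
    using distributed_distr_eq_density[OF dist] by (simp cong: distr_cong)
  interpret G: prob_space "gauss (t - r)"
    using prob_space_normal_density[of "sqrt (t - r)" 0] r by simp
  have s: "sets (distr M (\<F> r) (\<lambda>\<omega>. \<omega>) \<Otimes>\<^sub>M gauss (t - r)) = sets (\<F> r \<Otimes>\<^sub>M borel)"
    by (intro sets_pair_measure_cong) auto
  have h1: "h \<in> borel_measurable (distr M (\<F> r) (\<lambda>\<omega>. \<omega>) \<Otimes>\<^sub>M gauss (t - r))"
    using h measurable_cong_sets[OF s refl] by blast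
  have h2: "(\<lambda>\<omega>. \<integral>\<^sup>+x. h (\<omega>, x) \<partial>gauss (t - r)) \<in> borel_measurable (\<F> r)"
    by (rule G.borel_measurable_nn_integral) 
      (use h in \<open>simp add: split_beta' measurable_cong_sets[OF sets_pair_measure_cong[OF refl, of "gauss (t-r)" borel] refl]\<close>)
  have "(\<integral>\<^sup>+\<omega>. h (\<omega>, ?D \<omega>) \<partial>M) = (\<integral>\<^sup>+y. h y \<partial>distr M (\<F> r \<Otimes>\<^sub>M borel) (\<lambda>\<omega>. (\<omega>, ?D \<omega>)))"
    by (subst nn_integral_distr) auto
  also have "\<dots> = (\<integral>\<^sup>+y. h y \<partial>(distr M (\<F> r) (\<lambda>\<omega>. \<omega>) \<Otimes>\<^sub>M gauss (t - r)))"
    unfolding D[symmetric] G ..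
  also have "\<dots> = (\<integral>\<^sup>+\<omega>. (\<integral>\<^sup>+x. h (\<omega>, x) \<partial>gauss (t - r)) \<partial>distr M (\<F> r) (\<lambda>\<omega>. \<omega>))"
    by (rule G.nn_integral_fst[OF h1, symmetric])
  also have "\<dots> = (\<integral>\<^sup>+\<omega>. (\<integral>\<^sup>+x. h (\<omega>, x) \<partial>gauss (t - r)) \<partial>M)"
    by (rule nn_integral_distr[OF id]) (use h2 in simp)
  finally show ?thesis .
qed

text \<open>With \<theta> frozen the inner integral is 1. Extended nonnegative integrals spare any
  integrability of \<theta> or Y.\<close>

lemma nn_integral_exp_increment:
  assumes r: "0 \<le> r" "r < t" and [measurable]: "Y \<in> borel_measurable (\<F> r)" "\<theta> \<in> borel_measurable (\<F> r)"
  shows "(\<integral>\<^sup>+\<omega>. Y \<omega> * ennreal (exp (\<theta> \<omega> * (W t \<omega> - W r \<omega>) - (\<theta> \<omega>)\<^sup>2 * (t - r) / 2)) \<partial>M) = (\<integral>\<^sup>+\<omega>. Y \<omega> \<partial>M)"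
proof -
  have "(\<integral>\<^sup>+\<omega>. Y \<omega> * ennreal (exp (\<theta> \<omega> * (W t \<omega> - W r \<omega>) - (\<theta> \<omega>)\<^sup>2 * (t - r) / 2)) \<partial>M)
    = (\<integral>\<^sup>+\<omega>. (\<integral>\<^sup>+x. Y \<omega> * ennreal (exp (\<theta> \<omega> * x - (\<theta> \<omega>)\<^sup>2 * (t - r) / 2)) \<partial>gauss (t - r)) \<partial>M)"
    using nn_integral_increment[OF r, of "\<lambda>(\<omega>, x). Y \<omega> * ennreal (exp (\<theta> \<omega> * x - (\<theta> \<omega>)\<^sup>2 * (t - r) / 2))"]
    by simp
  also have "\<dots> = (\<integral>\<^sup>+\<omega>. Y \<omega> \<partial>M)"
    using r by (simp add: nn_integral_cmult gauss_exp)
  finally show ?thesis .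
qed

text \<open>The cross term carries the mean of z, which is 0. In the extended nonnegative form the
  identity also covers infinite second moments of S or h.\<close>

lemma nn_integral_centered_increment:
  fixes S h :: "'w \<Rightarrow> 'b::{real_inner, second_countable_topology}"
  assumes r: "0 \<le> r" "r < t" and S[measurable]: "S \<in> borel_measurable (\<F> r)"
    and h[measurable]: "h \<in> borel_measurable (\<F> r)" and [measurable]: "z \<in> borel_measurable borel"
    and z1: "has_bochner_integral (gauss (t - r)) z 0"
    and z2: "has_bochner_integral (gauss (t - r)) (\<lambda>x. (z x)\<^sup>2) v" and v: "v \<ge> 0"
  shows "(\<integral>\<^sup>+\<omega>. ennreal ((norm (S \<omega> + z (W t \<omega> - W r \<omega>) *\<^sub>R h \<omega>))\<^sup>2) \<partial>M)
    = (\<integral>\<^sup>+\<omega>. ennreal ((norm (S \<omega>))\<^sup>2) \<partial>M) + ennreal v * (\<integral>\<^sup>+\<omega>. ennreal ((norm (h \<omega>))\<^sup>2) \<partial>M)"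
proof -
  have [measurable]: "S \<in> borel_measurable M" "h \<in> borel_measurable M"
    using F_M[OF S r(1)] F_M[OF h r(1)] by auto
  have in_int: "(\<integral>\<^sup>+x. ennreal ((norm (a + z x *\<^sub>R b))\<^sup>2) \<partial>gauss (t - r)) = ennreal ((norm a)\<^sup>2) + ennreal v * ennreal ((norm b)\<^sup>2)"
    for a b :: 'b
  proof -
    have "has_bochner_integral (gauss (t - r)) (\<lambda>x. (norm a)\<^sup>2 * 1 + (2 * (a \<bullet> b)) * z x + (norm b)\<^sup>2 * (z x)\<^sup>2)
       ((norm a)\<^sup>2 * 1 + (2 * (a \<bullet> b)) * 0 + (norm b)\<^sup>2 * v)"
      by (intro has_bochner_integral_add has_bochner_integral_mult_right z1 z2 gauss_moment) (use r in auto)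
    moreover have "(norm a)\<^sup>2 * 1 + (2 * (a \<bullet> b)) * z x + (norm b)\<^sup>2 * (z x)\<^sup>2 = (norm (a + z x *\<^sub>R b))\<^sup>2" for x
      unfolding power2_norm_eq_inner by (simp add: inner_simps inner_commute power2_eq_square algebra_simps)
    ultimately have *: "has_bochner_integral (gauss (t - r)) (\<lambda>x. (norm (a + z x *\<^sub>R b))\<^sup>2) ((norm a)\<^sup>2 + v * (norm b)\<^sup>2)"
      by (simp add: mult.commute)
    have "(\<integral>\<^sup>+x. ennreal ((norm (a + z x *\<^sub>R b))\<^sup>2) \<partial>gauss (t - r)) = ennreal ((norm a)\<^sup>2 + v * (norm b)\<^sup>2)"
      using * by (subst nn_integral_eq_integral) (auto simp: has_bochner_integral_iff)
    then show ?thesis using v by (simp add: ennreal_mult)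
  qed
  have "(\<integral>\<^sup>+\<omega>. ennreal ((norm (S \<omega> + z (W t \<omega> - W r \<omega>) *\<^sub>R h \<omega>))\<^sup>2) \<partial>M)
      = (\<integral>\<^sup>+\<omega>. (\<integral>\<^sup>+x. ennreal ((norm (S \<omega> + z x *\<^sub>R h \<omega>))\<^sup>2) \<partial>gauss (t - r)) \<partial>M)"
    using nn_integral_increment[OF r, of "\<lambda>(\<omega>, x). ennreal ((norm (S \<omega> + z x *\<^sub>R h \<omega>))\<^sup>2)"] by simp
  also have "\<dots> = (\<integral>\<^sup>+\<omega>. ennreal ((norm (S \<omega>))\<^sup>2) \<partial>M) + ennreal v * (\<integral>\<^sup>+\<omega>. ennreal ((norm (h \<omega>))\<^sup>2) \<partial>M)"
    unfolding in_int by (simp add: nn_integral_add nn_integral_cmult)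
  finally show ?thesis .
qed

end

section \<open>Martingale sums and exponentials along a finite grid of times\<close>

locale brownian_grid = brownian M \<F> W for M :: "'w measure" and \<F> W +
  fixes t :: "nat \<Rightarrow> real" and n :: nat
  assumes t0: "0 \<le> t 0" and t_less: "\<And>i. i < n \<Longrightarrow> t i < t (Suc i)"
begin

lemma t_mono: "i \<le> j \<Longrightarrow> j \<le> n \<Longrightarrow> t i \<le> t j"
proof (induction rule: dec_induct)
  case (step k)
  then show ?case using t_less[of k] by simp
qed simp

lemma t_nonneg: "i \<le> n \<Longrightarrow> 0 \<le> t i"
  using t_mono[of 0 i] t0 by linarith

definition dW :: "nat \<Rightarrow> 'w \<Rightarrow> real"
  where "dW i \<omega> = W (t (Suc i)) \<omega> - W (t i) \<omega>"

definition dt :: "nat \<Rightarrow> real"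
  where "dt i = t (Suc i) - t i"

lemma dt_pos: "i < n \<Longrightarrow> 0 < dt i"
  using t_less by (simp add: dt_def)

definition adapted :: "(nat \<Rightarrow> 'w \<Rightarrow> 'b::topological_space) \<Rightarrow> bool"
  where "adapted h \<longleftrightarrow> (\<forall>i<n. h i \<in> borel_measurable (\<F> (t i)))"

text \<open>Two instances are used: the increment itself, which gives Ito sums, and its centred
  square, which gives the error in quadratic variations. In both, v collects the variances.\<close>

definition noise :: "(nat \<Rightarrow> real \<Rightarrow> real) \<Rightarrow> (nat \<Rightarrow> real) \<Rightarrow> bool"
  where "noise z v \<longleftrightarrow> (\<forall>i<n. z i \<in> borel_measurable borel \<and>
    has_bochner_integral (gauss (dt i)) (z i) 0 \<and>
    has_bochner_integral (gauss (dt i)) (\<lambda>x. (z i x)\<^sup>2) (v i) \<and> 0 \<le> v i)"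

lemma noise_id: "noise (\<lambda>i x. x) dt"
  unfolding noise_def
proof (intro allI impI conjI)
  fix i assume "i < n"
  note dt_pos[OF this]
  from gauss_moment(1,2)[OF this] less_imp_le[OF this]
  show "has_bochner_integral (gauss (dt i)) (\<lambda>x. x) 0"
    "has_bochner_integral (gauss (dt i)) (\<lambda>x. x\<^sup>2) (dt i)" "0 \<le> dt i" by this
qed simp

lemma noise_sq: "noise (\<lambda>i x. x\<^sup>2 - dt i) (\<lambda>i. 2 * (dt i)\<^sup>2)"
  unfolding noise_def
proof (intro allI impI conjI)
  fix i assume "i < n"
  note gauss_moment_sq[OF dt_pos[OF this]]
  then show "has_bochner_integral (gauss (dt i)) (\<lambda>x. x\<^sup>2 - dt i) 0"
    "has_bochner_integral (gauss (dt i)) (\<lambda>x. (x\<^sup>2 - dt i)\<^sup>2) (2 * (dt i)\<^sup>2)" by this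
qed simp_all

lemma dW_F: "i < k \<Longrightarrow> k \<le> n \<Longrightarrow> dW i \<in> borel_measurable (\<F> (t k))"
proof -
  assume *: "i < k" "k \<le> n"
  have "W (t j) \<in> borel_measurable (\<F> (t k))" if "j \<le> k" for j
    using * that by (intro F_mono[OF W_F[of "t j"]] t_nonneg t_mono) auto
  from this[of i] this[of "Suc i"] * show ?thesis
    unfolding dW_def[abs_def] by auto
qed

lemma adapted_F: "adapted h \<Longrightarrow> i < n \<Longrightarrow> i \<le> k \<Longrightarrow> k \<le> n \<Longrightarrow> h i \<in> borel_measurable (\<F> (t k))"
  unfolding adapted_def by (rule F_mono[of _ "t i"]) (auto intro: t_nonneg t_mono)

lemma adapted_M: "adapted h \<Longrightarrow> i < n \<Longrightarrow> h i \<in> borel_measurable M"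
  unfolding adapted_def by (rule F_M[of _ "t i"]) (auto intro: t_nonneg)

lemma noise_F: "noise z v \<Longrightarrow> i < k \<Longrightarrow> k \<le> n \<Longrightarrow> (\<lambda>\<omega>. z i (dW i \<omega>)) \<in> borel_measurable (\<F> (t k))"
  unfolding noise_def by (rule measurable_compose[OF dW_F]) auto

lemma martingale_sum_F:
  fixes h :: "nat \<Rightarrow> 'w \<Rightarrow> 'b::{real_normed_vector, second_countable_topology}"
  assumes "noise z v" "adapted h" "b \<le> n"
  shows "(\<lambda>\<omega>. \<Sum>i\<in>{a..<b}. z i (dW i \<omega>) *\<^sub>R h i \<omega>) \<in> borel_measurable (\<F> (t b))"
  by (intro borel_measurable_sum borel_measurable_scaleR noise_F[OF assms(1)] adapted_F[OF assms(2)])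
    (use assms(3) in auto)

lemma martingale_sum_M:
  fixes h :: "nat \<Rightarrow> 'w \<Rightarrow> 'b::{real_normed_vector, second_countable_topology}"
  assumes "noise z v" "adapted h" "b \<le> n"
  shows "(\<lambda>\<omega>. \<Sum>i\<in>{a..<b}. z i (dW i \<omega>) *\<^sub>R h i \<omega>) \<in> borel_measurable M"
  by (rule F_M[OF martingale_sum_F[OF assms]]) (use assms t_nonneg in auto)

text \<open>Induction on the right end: each new term is orthogonal to the past. The range from a to
  b serves the blocks of a grid.\<close>

lemma ito_isometry:
  fixes h :: "nat \<Rightarrow> 'w \<Rightarrow> 'b::{real_inner, second_countable_topology}"
  assumes z: "noise z v" and h: "adapted h" and "a \<le> b" "b \<le> n"
  shows "(\<integral>\<^sup>+\<omega>. ennreal ((norm (\<Sum>i\<in>{a..<b}. z i (dW i \<omega>) *\<^sub>R h i \<omega>))\<^sup>2) \<partial>M)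
    = (\<Sum>i\<in>{a..<b}. ennreal (v i) * (\<integral>\<^sup>+\<omega>. ennreal ((norm (h i \<omega>))\<^sup>2) \<partial>M))"
  using assms(3,4)
proof (induction b rule: dec_induct)
  case base
  then show ?case by simp
next
  case (step k)
  then have k: "k < n" by simp
  have "(\<integral>\<^sup>+\<omega>. ennreal ((norm ((\<Sum>i\<in>{a..<k}. z i (dW i \<omega>) *\<^sub>R h i \<omega>) + z k (W (t (Suc k)) \<omega> - W (t k) \<omega>) *\<^sub>R h k \<omega>))\<^sup>2) \<partial>M)
    = (\<integral>\<^sup>+\<omega>. ennreal ((norm (\<Sum>i\<in>{a..<k}. z i (dW i \<omega>) *\<^sub>R h i \<omega>))\<^sup>2) \<partial>M)
      + ennreal (v k) * (\<integral>\<^sup>+\<omega>. ennreal ((norm (h k \<omega>))\<^sup>2) \<partial>M)"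
    using z k t_less[OF k] t_nonneg[of k] adapted_F[OF h k] martingale_sum_F[OF z h, of k a]
    by (intro nn_integral_centered_increment) (auto simp: noise_def dt_def)
  then show ?case
    using step k by (simp add: sum.atLeastLessThan_Suc dW_def)
qed

text \<open>Discrete stopping: a term is kept while the energy accumulated up to and including it is
  at most \<delta>. This test is already decided at the left end of the interval, so adaptedness
  survives.\<close>

lemma truncation:
  fixes h :: "nat \<Rightarrow> 'w \<Rightarrow> 'b::{real_normed_vector, second_countable_topology}"
  assumes v: "\<And>i. i < n \<Longrightarrow> 0 \<le> v i" and h: "adapted h" and \<delta>: "0 \<le> \<delta>"
  obtains h' :: "nat \<Rightarrow> 'w \<Rightarrow> 'b" where "adapted h'"
    "\<And>\<omega>. (\<Sum>i<n. v i * (norm (h' i \<omega>))\<^sup>2) \<le> \<delta>"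
    "\<And>\<omega> i. (\<Sum>i<n. v i * (norm (h i \<omega>))\<^sup>2) \<le> \<delta> \<Longrightarrow> i < n \<Longrightarrow> h' i \<omega> = h i \<omega>"
proof
  define q where "q k \<omega> = (\<Sum>i<Suc k. v i * (norm (h i \<omega>))\<^sup>2)" for k \<omega>
  define h' where "h' i \<omega> = (if q i \<omega> \<le> \<delta> then h i \<omega> else 0)" for i \<omega>
  have q: "q i \<in> borel_measurable (\<F> (t i))" if "i < n" for i
    unfolding q_def[abs_def] 
    by (intro borel_measurable_sum borel_measurable_times borel_measurable_power measurable_compose[OF _ borel_measurable_norm]
        borel_measurable_const adapted_F[OF h]) (use that in auto)
  show "adapted h'"
    unfolding adapted_def
  proof (intro allI impI)
    fix i assume i: "i < n"
    note [measurable] = q[OF i] adapted_F[OF h i order_refl less_imp_le[OF i]]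
    show "h' i \<in> borel_measurable (\<F> (t i))" unfolding h'_def[abs_def] by measurable
  qed
  have "(\<Sum>i<k. v i * (norm (h' i \<omega>))\<^sup>2) \<le> \<delta>" if "k \<le> n" for k \<omega>
    using that
  proof (induction k)
    case (Suc k)
    show ?case
    \<comment> \<open>Below the threshold the truncated sum is at most \<open>q k\<close>; above it
      the new term is 0 and the induction hypothesis carries over.\<close>
    proof (cases "q k \<omega> \<le> \<delta>")
      case True
      have "(\<Sum>i<Suc k. v i * (norm (h' i \<omega>))\<^sup>2) \<le> q k \<omega>"
        unfolding q_def h'_def using v Suc.prems by (intro sum_mono mult_left_mono) auto
      with True show ?thesis by linarith
    next
      case False
      then show ?thesis using Suc by (simp add: h'_def)
    qed
  qed (use \<delta> in simp)
  then show "(\<Sum>i<n. v i * (norm (h' i \<omega>))\<^sup>2) \<le> \<delta>" for \<omega> by simp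
  fix \<omega> i assume le: "(\<Sum>i<n. v i * (norm (h i \<omega>))\<^sup>2) \<le> \<delta>" and i: "i < n"
  have "q i \<omega> \<le> (\<Sum>i<n. v i * (norm (h i \<omega>))\<^sup>2)"
    unfolding q_def using i v by (intro sum_mono2) auto
  then show "h' i \<omega> = h i \<omega>" using le by (simp add: h'_def)
qed

text \<open>Lenglart's argument: the truncated integrand has energy at most \<delta> everywhere, so
  Markov's inequality applies to it, and its sums agree with the original ones where the energy is
  at most \<delta>. Squares are taken block by block because each block will be one step of a
  coarser mesh.\<close>

lemma prob_block_sum:
  fixes h :: "nat \<Rightarrow> 'w \<Rightarrow> 'b::{real_inner, second_countable_topology}"
  assumes z: "noise z v" and h: "adapted h" and n: "n = m * L" and \<eta>: "\<eta> > 0" and \<delta>: "\<delta> \<ge> 0"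
  shows "prob {\<omega>\<in>space M. (\<Sum>j<m. (norm (\<Sum>i\<in>{j*L..<j*L+L}. z i (dW i \<omega>) *\<^sub>R h i \<omega>))\<^sup>2) > \<eta>}
    \<le> \<delta> / \<eta> + prob {\<omega>\<in>space M. (\<Sum>i<n. v i * (norm (h i \<omega>))\<^sup>2) > \<delta>}"
proof -
  have v: "\<And>i. i < n \<Longrightarrow> 0 \<le> v i" using z by (simp add: noise_def)
  obtain h' :: "nat \<Rightarrow> 'w \<Rightarrow> 'b" where h': "adapted h'"
    "\<And>\<omega>. (\<Sum>i<n. v i * (norm (h' i \<omega>))\<^sup>2) \<le> \<delta>"
    "\<And>\<omega> i. (\<Sum>i<n. v i * (norm (h i \<omega>))\<^sup>2) \<le> \<delta> \<Longrightarrow> i < n \<Longrightarrow> h' i \<omega> = h i \<omega>"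
    by (rule truncation[of v h \<delta>, OF v h \<delta> that])
  have jL: "j * L + L \<le> n" if "j < m" for j
    using that n by (metis add.commute mult_Suc mult_le_mono1 Suc_leI)
  define Z where "Z h \<omega> = (\<Sum>j<m. (norm (\<Sum>i\<in>{j*L..<j*L+L}. z i (dW i \<omega>) *\<^sub>R h i \<omega>))\<^sup>2)" for h :: "nat \<Rightarrow> 'w \<Rightarrow> 'b" and \<omega>
  have Z_meas: "Z h \<in> borel_measurable M" if "adapted h" for h
    unfolding Z_def[abs_def]
    by (intro borel_measurable_sum borel_measurable_power measurable_compose[OF _ borel_measurable_norm] martingale_sum_M[OF z that])
      (use jL in auto)
  note [measurable] = Z_meas[OF h] Z_meas[OF h'(1)]
  have Q[measurable]: "(\<lambda>\<omega>. \<Sum>i<n. v i * (norm (h i \<omega>))\<^sup>2) \<in> borel_measurable M"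
    by (intro borel_measurable_sum borel_measurable_times borel_measurable_power measurable_compose[OF _ borel_measurable_norm]
        borel_measurable_const adapted_M[OF h]) auto
  note [measurable] = adapted_M[OF h'(1)]
  have "(\<integral>\<^sup>+\<omega>. ennreal (Z h' \<omega>) \<partial>M)
      = (\<Sum>j<m. \<integral>\<^sup>+\<omega>. ennreal ((norm (\<Sum>i\<in>{j*L..<j*L+L}. z i (dW i \<omega>) *\<^sub>R h' i \<omega>))\<^sup>2) \<partial>M)"
    unfolding Z_def using jL
    by (subst nn_integral_sum[symmetric])
      (auto intro!: measurable_compose[OF _ measurable_ennreal] borel_measurable_power measurable_compose[OF _ borel_measurable_norm]
         martingale_sum_M[OF z h'(1)] simp: sum_ennreal)
  also have "\<dots> = (\<Sum>j<m. \<Sum>i\<in>{j*L..<j*L+L}. ennreal (v i) * (\<integral>\<^sup>+\<omega>. ennreal ((norm (h' i \<omega>))\<^sup>2) \<partial>M))"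
    using jL by (intro sum.cong refl ito_isometry[OF z h'(1)]) auto
  also have "\<dots> = (\<Sum>i<n. ennreal (v i) * (\<integral>\<^sup>+\<omega>. ennreal ((norm (h' i \<omega>))\<^sup>2) \<partial>M))"
    unfolding n by (rule sum.nat_group)
  also have "\<dots> = (\<Sum>i<n. \<integral>\<^sup>+\<omega>. ennreal (v i * (norm (h' i \<omega>))\<^sup>2) \<partial>M)"
    using v by (intro sum.cong refl) (simp add: ennreal_mult nn_integral_cmult)
  also have "\<dots> = (\<integral>\<^sup>+\<omega>. (\<Sum>i<n. ennreal (v i * (norm (h' i \<omega>))\<^sup>2)) \<partial>M)"
    by (rule nn_integral_sum[symmetric]) simp
  also have "\<dots> = (\<integral>\<^sup>+\<omega>. ennreal (\<Sum>i<n. v i * (norm (h' i \<omega>))\<^sup>2) \<partial>M)"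
    using v by (subst sum_ennreal) auto
  also have "\<dots> \<le> (\<integral>\<^sup>+\<omega>. ennreal \<delta> \<partial>M)"
    by (intro nn_integral_mono ennreal_leI h')
  also have "\<dots> = ennreal \<delta>" by (simp add: emeasure_space_1)
  finally have *: "prob {\<omega>\<in>space M. Z h' \<omega> > \<eta>} \<le> \<delta> / \<eta>"
    by (intro nn_integral_markov \<eta> \<delta>) auto
  have eq: "Z h' \<omega> = Z h \<omega>" if "(\<Sum>i<n. v i * (norm (h i \<omega>))\<^sup>2) \<le> \<delta>" for \<omega>
    unfolding Z_def using jL h'(3)[OF that] by (intro sum.cong refl arg_cong[where f = "\<lambda>x. (norm x)\<^sup>2"]) fastforce
  have "prob {\<omega>\<in>space M. Z h \<omega> > \<eta>}
      \<le> prob ({\<omega>\<in>space M. Z h' \<omega> > \<eta>} \<union> {\<omega>\<in>space M. (\<Sum>i<n. v i * (norm (h i \<omega>))\<^sup>2) > \<delta>})"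
    using eq by (intro finite_measure_mono) (auto simp: not_less)
  also have "\<dots> \<le> prob {\<omega>\<in>space M. Z h' \<omega> > \<eta>} + prob {\<omega>\<in>space M. (\<Sum>i<n. v i * (norm (h i \<omega>))\<^sup>2) > \<delta>}"
    by (rule measure_Un_le) auto
  finally show ?thesis using * unfolding Z_def by linarith
qed

text \<open>A single block of length n, with the threshold squared.\<close>

lemma prob_martingale_sum:
  fixes h :: "nat \<Rightarrow> 'w \<Rightarrow> 'b::{real_inner, second_countable_topology}"
  assumes z: "noise z v" and h: "adapted h" and \<eta>: "\<eta> > 0" and \<delta>: "\<delta> \<ge> 0"
  shows "prob {\<omega>\<in>space M. norm (\<Sum>i<n. z i (dW i \<omega>) *\<^sub>R h i \<omega>) > \<eta>}
    \<le> \<delta> / \<eta>\<^sup>2 + prob {\<omega>\<in>space M. (\<Sum>i<n. v i * (norm (h i \<omega>))\<^sup>2) > \<delta>}"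
proof -
  have "(norm x > \<eta>) = ((norm x)\<^sup>2 > \<eta>\<^sup>2)" for x :: 'b
    using \<eta> by (smt (verit) norm_ge_zero power2_le_imp_le power_strict_mono zero_less_numeral)
  then show ?thesis
    using prob_block_sum[OF z h, of 1 n "\<eta>\<^sup>2" \<delta>] \<eta> \<delta> by (simp add: lessThan_atLeast0)
qed

context
  fixes \<theta> :: "nat \<Rightarrow> 'w \<Rightarrow> real"
  assumes \<theta>: "adapted \<theta>"
begin

text \<open>The discrete stochastic exponential. Dividing by the conditional Laplace transform of
  the Gaussian increments makes it an exact martingale on every grid.\<close>

definition expo :: "nat \<Rightarrow> 'w \<Rightarrow> real"
  where "expo k \<omega> = exp (\<Sum>i<k. \<theta> i \<omega> * dW i \<omega> - (\<theta> i \<omega>)\<^sup>2 * dt i / 2)"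

lemma expo_F: "k \<le> n \<Longrightarrow> expo k \<in> borel_measurable (\<F> (t k))"
  unfolding expo_def[abs_def]
  by (intro measurable_compose[OF _ borel_measurable_exp] borel_measurable_sum borel_measurable_diff borel_measurable_divide
      borel_measurable_times borel_measurable_power borel_measurable_const adapted_F[OF \<theta>] dW_F)
    auto

lemma expo_M: "k \<le> n \<Longrightarrow> expo k \<in> borel_measurable M"
  by (rule F_M[OF expo_F]) (auto intro: t_nonneg)

text \<open>Testing against events of the past expresses the martingale property without conditional
  expectations.\<close>

lemma expo_martingale:
  assumes A: "A \<in> sets (\<F> (t j))" and "j \<le> k" "k \<le> n"
  shows "(\<integral>\<^sup>+\<omega>. ennreal (expo k \<omega>) * indicator A \<omega> \<partial>M) = (\<integral>\<^sup>+\<omega>. ennreal (expo j \<omega>) * indicator A \<omega> \<partial>M)"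
  using assms(2,3)
proof (induction k rule: dec_induct)
  case (step k)
  then have k: "k < n" by simp
  have A': "A \<in> sets (\<F> (t k))"
    using sets_F_mono[of "t j" "t k"] A step k t_mono[of j k] t_nonneg[of j] by auto
  note [measurable] = A' expo_F[OF less_imp_le[OF k]] adapted_F[OF \<theta> k order_refl less_imp_le[OF k]]
  have "(\<integral>\<^sup>+\<omega>. (ennreal (expo k \<omega>) * indicator A \<omega>) *
      ennreal (exp (\<theta> k \<omega> * (W (t (Suc k)) \<omega> - W (t k) \<omega>) - (\<theta> k \<omega>)\<^sup>2 * (t (Suc k) - t k) / 2)) \<partial>M)
    = (\<integral>\<^sup>+\<omega>. ennreal (expo k \<omega>) * indicator A \<omega> \<partial>M)"
    using t_less[OF k] t_nonneg[of k] k by (intro nn_integral_exp_increment) auto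
  moreover have "expo (Suc k) \<omega> = expo k \<omega> * exp (\<theta> k \<omega> * (W (t (Suc k)) \<omega> - W (t k) \<omega>) - (\<theta> k \<omega>)\<^sup>2 * (t (Suc k) - t k) / 2)" for \<omega>
    unfolding expo_def by (simp add: exp_add[symmetric] dW_def dt_def)
  ultimately show ?case
    using step by (simp add: ennreal_mult expo_def mult_ac)
qed simp

lemma expo_mean: "k \<le> n \<Longrightarrow> (\<integral>\<^sup>+\<omega>. ennreal (expo k \<omega>) \<partial>M) = 1"
proof -
  assume k: "k \<le> n"
  have "space M \<in> sets (\<F> (t 0))" using sets.top[of "\<F> (t 0)"] t0 by simp
  from expo_martingale[OF this _ k]
  have "(\<integral>\<^sup>+\<omega>. ennreal (expo k \<omega>) * indicator (space M) \<omega> \<partial>M) = (\<integral>\<^sup>+\<omega>. indicator (space M) \<omega> \<partial>M)"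
    by (simp add: expo_def)
  also have "\<dots> = 1" by (simp add: emeasure_space_1)
  finally show ?thesis by (simp cong: nn_integral_cong)
qed

text \<open>Doob's maximal inequality, by decomposition at the first passage above c.\<close>

lemma expo_maximal:
  assumes c: "c > 0"
  shows "prob {\<omega>\<in>space M. \<exists>k\<le>n. expo k \<omega> > c} \<le> 1 / c"
proof -
  define A where "A j = {\<omega>\<in>space M. expo j \<omega> > c \<and> (\<forall>i<j. expo i \<omega> \<le> c)}" for j
  have AF: "A j \<in> sets (\<F> (t j))" if j: "j \<le> n" for j
  proof -
    have *: "space M = space (\<F> (t j))" using t_nonneg[OF j] by simp
    have [measurable]: "expo i \<in> borel_measurable (\<F> (t j))" if "i \<le> j" for i
      using that j by (intro F_mono[OF expo_F[of i]] t_nonneg t_mono) auto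
    have "A j = {\<omega>\<in>space (\<F> (t j)). expo j \<omega> > c \<and> (\<forall>i\<in>{..<j}. expo i \<omega> \<le> c)}"
      unfolding A_def * by auto
    also have "\<dots> \<in> sets (\<F> (t j))"
      by (intro sets.sets_Collect_conj sets.sets_Collect_finite_All) auto
    finally show ?thesis .
  qed
  have AM[measurable]: "A j \<in> sets M" if "j \<le> n" for j
    using AF[OF that] subalg[OF t_nonneg[OF that]] unfolding subalgebra_def by blast
  have eq: "{\<omega>\<in>space M. \<exists>k\<le>n. expo k \<omega> > c} = (\<Union>j\<le>n. A j)"
  proof (intro equalityI subsetI)
    fix \<omega> assume "\<omega> \<in> {\<omega>\<in>space M. \<exists>k\<le>n. expo k \<omega> > c}"
    then obtain k where k: "\<omega> \<in> space M" "k \<le> n" "expo k \<omega> > c" by auto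
    define j where "j = (LEAST k. expo k \<omega> > c)"
    have "expo j \<omega> > c" unfolding j_def by (rule LeastI[of "\<lambda>k. expo k \<omega> > c", OF k(3)])
    moreover have "j \<le> k" unfolding j_def by (rule Least_le[of "\<lambda>k. expo k \<omega> > c", OF k(3)])
    moreover have "\<forall>i<j. expo i \<omega> \<le> c" unfolding j_def using not_less_Least not_less by blast
    ultimately show "\<omega> \<in> (\<Union>j\<le>n. A j)" using k by (auto simp: A_def)
  qed (auto simp: A_def)
  have disj: "disjoint_family_on A {..n}"
    unfolding disjoint_family_on_def A_def by (auto, meson linorder_neqE_nat not_less)
  have "ennreal c * emeasure M (\<Union>j\<le>n. A j) = (\<Sum>j\<le>n. ennreal c * emeasure M (A j))"
    using disj by (subst sum_emeasure[symmetric]) (auto simp: sum_distrib_left)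
  also have "\<dots> \<le> (\<Sum>j\<le>n. \<integral>\<^sup>+\<omega>. ennreal (expo j \<omega>) * indicator (A j) \<omega> \<partial>M)"
  proof (intro sum_mono)
    fix j assume "j \<in> {..n}"
    then have [measurable]: "A j \<in> sets M" by simp
    have "ennreal c * emeasure M (A j) = (\<integral>\<^sup>+\<omega>. ennreal c * indicator (A j) \<omega> \<partial>M)"
      by (simp add: nn_integral_cmult)
    also have "\<dots> \<le> (\<integral>\<^sup>+\<omega>. ennreal (expo j \<omega>) * indicator (A j) \<omega> \<partial>M)"
      by (intro nn_integral_mono) (auto simp: A_def indicator_def intro!: ennreal_leI)
    finally show "ennreal c * emeasure M (A j) \<le> (\<integral>\<^sup>+\<omega>. ennreal (expo j \<omega>) * indicator (A j) \<omega> \<partial>M)" .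
  qed
  \<comment> \<open>First passage at j is an event of \<open>\<F> (t j)\<close>, so the exponential
    at j may be replaced by the terminal one; by disjointness the sum is then at most the total mean
    1.\<close>
  also have "\<dots> = (\<Sum>j\<le>n. \<integral>\<^sup>+\<omega>. ennreal (expo n \<omega>) * indicator (A j) \<omega> \<partial>M)"
    by (intro sum.cong refl expo_martingale[symmetric] AF) auto
  also have "\<dots> = (\<integral>\<^sup>+\<omega>. ennreal (expo n \<omega>) * (\<Sum>j\<le>n. indicator (A j) \<omega>) \<partial>M)"
    using expo_M[of n] by (subst nn_integral_sum[symmetric]) (auto simp: sum_distrib_left)
  also have "\<dots> \<le> (\<integral>\<^sup>+\<omega>. ennreal (expo n \<omega>) * 1 \<partial>M)"
  proof (intro nn_integral_mono mult_left_mono)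
    fix \<omega>
    have "(\<Sum>j\<le>n. indicator (A j) \<omega>) = (indicator (\<Union>j\<le>n. A j) \<omega> :: ennreal)"
      by (rule indicator_UN_disjoint[symmetric, OF _ disj]) simp
    then show "(\<Sum>j\<le>n. indicator (A j) \<omega>) \<le> (1 :: ennreal)" by (simp add: indicator_def)
  qed simp
  also have "\<dots> = 1" using expo_mean[of n] by simp
  finally have "ennreal (c * prob (\<Union>j\<le>n. A j)) \<le> ennreal 1"
    using c by (simp add: emeasure_eq_measure ennreal_mult)
  then show ?thesis unfolding eq using c by (simp add: field_simps)
qed

end

end

section \<open>Riemann sums of Ito integrals\<close>

text \<open>Intervals are open on the left and closed on the right, so on each refined interval the
  process is constant and can be read off at the right end.\<close>

lemma step_function_refinement:
  fixes \<tau> \<rho> :: "nat \<Rightarrow> real"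
  assumes \<rho>: "\<And>i j. i < j \<Longrightarrow> j \<le> N \<Longrightarrow> \<rho> i < \<rho> j"
    and \<tau>: "\<And>i. i < n \<Longrightarrow> \<tau> i \<le> \<tau> (Suc i)" "\<tau> ` {..n} \<subseteq> \<rho> ` {..N}"
  shows "elementary_ito W n \<tau> \<xi> \<omega> =
      (\<Sum>j<N. (W (\<rho> (Suc j)) \<omega> - W (\<rho> j) \<omega>) *\<^sub>R elementary_process n \<tau> \<xi> (\<rho> (Suc j)) \<omega>)"
    and "j < N \<Longrightarrow> \<rho> j < r \<Longrightarrow> r \<le> \<rho> (Suc j) \<Longrightarrow>
      elementary_process n \<tau> \<xi> r \<omega> = elementary_process n \<tau> \<xi> (\<rho> (Suc j)) \<omega>"
proof -
  have \<rho>_less: "\<rho> i < \<rho> j \<longleftrightarrow> i < j" if "i \<le> N" "j \<le> N" for i j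
    using \<rho> that by (metis linorder_neqE_nat order_less_asym order_less_irrefl)
  have idx: "\<exists>a\<le>N. \<tau> i = \<rho> a" if "i \<le> n" for i using \<tau>(2) that by auto
  show "elementary_process n \<tau> \<xi> r \<omega> = elementary_process n \<tau> \<xi> (\<rho> (Suc j)) \<omega>"
    if j: "j < N" "\<rho> j < r" "r \<le> \<rho> (Suc j)"
    unfolding elementary_process_def
  proof (intro sum.cong refl arg_cong2[where f = "(*\<^sub>R)"])
    fix i assume "i \<in> {..<n}"
    then obtain a b where ab: "a \<le> N" "b \<le> N" "\<tau> i = \<rho> a" "\<tau> (Suc i) = \<rho> b"
      using idx[of i] idx[of "Suc i"] by auto
    have "\<rho> a < r \<longleftrightarrow> \<rho> a < \<rho> (Suc j)"
    proof
      assume *: "\<rho> a < \<rho> (Suc j)"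
      then have "a \<le> j" using \<rho>_less[of a "Suc j"] ab j by simp
      then have "\<rho> a \<le> \<rho> j" using \<rho>[of a j] j by (cases "a = j") auto
      then show "\<rho> a < r" using j by simp
    qed (use j in simp)
    moreover have "r \<le> \<rho> b \<longleftrightarrow> \<rho> (Suc j) \<le> \<rho> b"
    proof
      assume *: "r \<le> \<rho> b"
      then have "j < b" using \<rho>_less[of j b] ab j by simp
      then have "Suc j = b \<or> Suc j < b" by auto
      then show "\<rho> (Suc j) \<le> \<rho> b" using \<rho>[of "Suc j" b] ab by auto
    qed (use j in simp)
    ultimately show "indicator {\<tau> i<..\<tau> (Suc i)} r = (indicator {\<tau> i<..\<tau> (Suc i)} (\<rho> (Suc j)) :: real)"
      by (simp add: ab indicator_def)
  qed
  \<comment> \<open>The indicator selects the refined intervals inside the interval of index i, over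
    which the increments of W telescope.\<close>
  have key: "(\<Sum>j<N. (W (\<rho> (Suc j)) \<omega> - W (\<rho> j) \<omega>) * indicator {\<tau> i<..\<tau> (Suc i)} (\<rho> (Suc j)))
      = W (\<tau> (Suc i)) \<omega> - W (\<tau> i) \<omega>" if i: "i < n" for i
  proof -
    obtain a b where ab: "a \<le> N" "b \<le> N" "\<tau> i = \<rho> a" "\<tau> (Suc i) = \<rho> b"
      using idx[of i] idx[of "Suc i"] i by auto
    then have "a \<le> b" using \<tau>(1)[OF i] \<rho>_less[of b a] by auto
    have ind: "indicator {\<tau> i<..\<tau> (Suc i)} (\<rho> (Suc j)) = (if j \<in> {a..<b} then 1 else 0 :: real)" if "j < N" for j
      using \<rho>_less[of a "Suc j"] \<rho>_less[of b "Suc j"] ab that by (auto simp: indicator_def)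
    have "(\<Sum>j<N. (W (\<rho> (Suc j)) \<omega> - W (\<rho> j) \<omega>) * indicator {\<tau> i<..\<tau> (Suc i)} (\<rho> (Suc j)))
      = (\<Sum>j<N. if j \<in> {a..<b} then W (\<rho> (Suc j)) \<omega> - W (\<rho> j) \<omega> else 0)"
      by (intro sum.cong refl) (simp add: ind)
    also have "\<dots> = (\<Sum>j\<in>{..<N} \<inter> {a..<b}. W (\<rho> (Suc j)) \<omega> - W (\<rho> j) \<omega>)"
      by (rule sum.inter_restrict[symmetric]) simp
    also have "{..<N} \<inter> {a..<b} = {a..<b}" using ab by auto
    also have "(\<Sum>j\<in>{a..<b}. W (\<rho> (Suc j)) \<omega> - W (\<rho> j) \<omega>) = W (\<rho> b) \<omega> - W (\<rho> a) \<omega>"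
      using \<open>a \<le> b\<close> by (rule sum_Suc_diff')
    finally show ?thesis using ab by simp
  qed
  have "(\<Sum>j<N. (W (\<rho> (Suc j)) \<omega> - W (\<rho> j) \<omega>) *\<^sub>R elementary_process n \<tau> \<xi> (\<rho> (Suc j)) \<omega>)
    = (\<Sum>j<N. \<Sum>i<n. ((W (\<rho> (Suc j)) \<omega> - W (\<rho> j) \<omega>) * indicator {\<tau> i<..\<tau> (Suc i)} (\<rho> (Suc j))) *\<^sub>R \<xi> i \<omega>)"
    unfolding elementary_process_def scaleR_sum_right scaleR_scaleR ..
  also have "\<dots> = (\<Sum>i<n. (\<Sum>j<N. (W (\<rho> (Suc j)) \<omega> - W (\<rho> j) \<omega>) * indicator {\<tau> i<..\<tau> (Suc i)} (\<rho> (Suc j))) *\<^sub>R \<xi> i \<omega>)"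
    unfolding scaleR_sum_left by (rule sum.swap)
  also have "\<dots> = elementary_ito W n \<tau> \<xi> \<omega>"
    unfolding elementary_ito_def by (intro sum.cong refl) (simp only: key lessThan_iff)
  finally show "elementary_ito W n \<tau> \<xi> \<omega> =
      (\<Sum>j<N. (W (\<rho> (Suc j)) \<omega> - W (\<rho> j) \<omega>) *\<^sub>R elementary_process n \<tau> \<xi> (\<rho> (Suc j)) \<omega>)" ..
qed

lemma finite_set_enumeration:
  fixes P :: "real set"
  assumes "finite P" "P \<noteq> {}"
  shows "\<exists>N \<rho>. (\<forall>i j. i < j \<longrightarrow> j \<le> N \<longrightarrow> \<rho> i < \<rho> j) \<and> \<rho> ` {..N::nat} = P"
proof (intro exI conjI allI impI)
  let ?xs = "sorted_list_of_set P"
  have ne: "length ?xs > 0" using assms by (simp add: card_gt_0_iff)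
  fix i j assume "i < j" "j \<le> length ?xs - 1"
  then show "?xs ! i < ?xs ! j"
    using ne by (intro sorted_wrt_nth_less[OF strict_sorted_list_of_set]) auto
next
  let ?xs = "sorted_list_of_set P"
  have ne: "length ?xs > 0" using assms by (simp add: card_gt_0_iff)
  have "{..length ?xs - 1} = {..<length ?xs}" using ne by auto
  then have "(\<lambda>j. ?xs ! j) ` {..length ?xs - 1} = set ?xs"
    unfolding set_conv_nth by auto
  then show "(\<lambda>j. ?xs ! j) ` {..length ?xs - 1} = P" using assms(1) by simp
qed

context brownian
begin

text \<open>Elementary processes without the boundedness demand, because the values of a continuous
  adapted process at mesh points need not be bounded.\<close>

definition step_process :: "real \<Rightarrow> nat \<Rightarrow> (nat \<Rightarrow> real) \<Rightarrow> (nat \<Rightarrow> 'w \<Rightarrow> 'b::topological_space) \<Rightarrow> bool"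
  where "step_process T n \<tau> \<xi> \<longleftrightarrow> \<tau> 0 = 0 \<and> \<tau> n = T \<and>
    (\<forall>i<n. \<tau> i \<le> \<tau> (Suc i) \<and> \<xi> i \<in> borel_measurable (\<F> (\<tau> i)))"

lemma step_process_nonneg:
  assumes "step_process T n \<tau> \<xi>" "i \<le> n"
  shows "0 \<le> \<tau> i" "\<tau> i \<le> T"
proof -
  have m: "\<tau> a \<le> \<tau> b" if "a \<le> b" "b \<le> n" for a b
    using that
  proof (induction b rule: dec_induct)
    case (step k)
    then show ?case using assms(1) unfolding step_process_def by (metis Suc_le_lessD less_imp_le order_trans)
  qed simp
  have "\<tau> 0 = 0" "\<tau> n = T" using assms(1) unfolding step_process_def by blast+
  then show "0 \<le> \<tau> i" "\<tau> i \<le> T" using m[of 0 i] m[of i n] assms(2) by simp_all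
qed

text \<open>A coefficient contributes at r only if its interval starts before r, and every such
  start is at most q.\<close>

lemma step_process_value_F:
  fixes \<xi> :: "nat \<Rightarrow> 'w \<Rightarrow> 'b::{real_normed_vector, second_countable_topology}"
  assumes s: "step_process T n \<tau> \<xi>" and r: "0 \<le> q" "\<And>i. i \<le> n \<Longrightarrow> \<tau> i < r \<Longrightarrow> \<tau> i \<le> q"
  shows "(\<lambda>\<omega>. elementary_process n \<tau> \<xi> r \<omega>) \<in> borel_measurable (\<F> q)"
  unfolding elementary_process_def
proof (intro borel_measurable_sum)
  fix i assume i: "i \<in> {..<n}"
  show "(\<lambda>\<omega>. indicator {\<tau> i<..\<tau> (Suc i)} r *\<^sub>R \<xi> i \<omega>) \<in> borel_measurable (\<F> q)"
  proof (cases "\<tau> i < r")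
    case True
    have "\<xi> i \<in> borel_measurable (\<F> (\<tau> i))"
      using s i unfolding step_process_def by blast
    then have "\<xi> i \<in> borel_measurable (\<F> q)"
      by (rule F_mono) (use i step_process_nonneg[OF s, of i] r(2)[OF _ True] in simp_all)
    then show ?thesis by simp
  qed simp
qed

text \<open>On the common refinement the difference of two integrals is one martingale sum. J is its
  energy: the squared L2 distance of the integrands, written as a finite sum so that its
  measurability in \<omega> is evident.\<close>

lemma step_process_prob:
  fixes \<xi> \<xi>' :: "nat \<Rightarrow> 'w \<Rightarrow> 'b::{real_inner, second_countable_topology}"
  assumes s: "step_process T n \<tau> \<xi>" and s': "step_process T n' \<tau>' \<xi>'"
  obtains J where "J \<in> borel_measurable M" "\<And>\<omega>. 0 \<le> J \<omega>"
    "\<And>\<omega>. ennreal (J \<omega>) \<le> (\<integral>\<^sup>+r. ennreal ((norm (elementary_process n \<tau> \<xi> r \<omega> - elementary_process n' \<tau>' \<xi>' r \<omega>))\<^sup>2)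
        \<partial>restrict_space lborel {0..T})"
    "\<And>\<eta> \<delta>. \<eta> > 0 \<Longrightarrow> \<delta> \<ge> 0 \<Longrightarrow>
      prob {\<omega>\<in>space M. norm (elementary_ito W n \<tau> \<xi> \<omega> - elementary_ito W n' \<tau>' \<xi>' \<omega>) > \<eta>}
        \<le> \<delta> / \<eta>\<^sup>2 + prob {\<omega>\<in>space M. J \<omega> > \<delta>}"
proof -
  define P where "P = \<tau> ` {..n} \<union> \<tau>' ` {..n'}"
  have P: "finite P" "P \<noteq> {}" by (auto simp: P_def)
  obtain N :: nat and \<rho> where \<rho>': "\<forall>i j. i < j \<longrightarrow> j \<le> N \<longrightarrow> \<rho> i < \<rho> j" and \<rho>P: "\<rho> ` {..N} = P"
    using finite_set_enumeration[OF P] by blast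
  have \<rho>: "\<rho> i < \<rho> j" if "i < j" "j \<le> N" for i j using \<rho>' that by blast
  have PT: "0 \<le> x" "x \<le> T" if "x \<in> P" for x
    using that unfolding P_def by (auto intro: step_process_nonneg[OF s] step_process_nonneg[OF s'])
  have \<rho>T: "0 \<le> \<rho> j" "\<rho> j \<le> T" if "j \<le> N" for j
    using PT[of "\<rho> j"] \<rho>P that by auto
  interpret G: brownian_grid M \<F> W \<rho> N
    by unfold_locales (use \<rho> \<rho>T in auto)
  have sub: "\<tau> ` {..n} \<subseteq> \<rho> ` {..N}" "\<tau>' ` {..n'} \<subseteq> \<rho> ` {..N}" unfolding \<rho>P P_def by auto
  note ref = step_function_refinement[of N \<rho> n \<tau>, OF \<rho> _ sub(1)]
    and ref' = step_function_refinement[of N \<rho> n' \<tau>', OF \<rho> _ sub(2)]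
  have \<tau>le: "\<And>i. i < n \<Longrightarrow> \<tau> i \<le> \<tau> (Suc i)" "\<And>i. i < n' \<Longrightarrow> \<tau>' i \<le> \<tau>' (Suc i)"
    using s s' unfolding step_process_def by blast+
  define h where "h j \<omega> = elementary_process n \<tau> \<xi> (\<rho> (Suc j)) \<omega> - elementary_process n' \<tau>' \<xi>' (\<rho> (Suc j)) \<omega>" for j \<omega>
  \<comment> \<open>No point of P lies strictly between consecutive points of the refinement. Hence
    the value on a refined interval, although read off at its right end, is known at its left
    end.\<close>
  have le: "x \<le> \<rho> j" if x: "x \<in> P" "x < \<rho> (Suc j)" "j < N" for x j
  proof -
    obtain a where a: "x = \<rho> a" "a \<le> N" using x(1) \<rho>P by auto
    have "\<not> Suc j < a" using x(2) a \<rho>[of "Suc j" a] by force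
    moreover have "a \<noteq> Suc j" using x(2) a by auto
    ultimately have "a < j \<or> a = j" by linarith
    then show ?thesis using \<rho>[of a j] x a by auto
  qed
  have h: "G.adapted h"
    unfolding G.adapted_def h_def[abs_def]
    by (intro allI impI borel_measurable_diff step_process_value_F[OF s] step_process_value_F[OF s'])
      (auto intro!: le simp: P_def \<rho>T)
  define J where "J \<omega> = (\<Sum>j<N. G.dt j * (norm (h j \<omega>))\<^sup>2)" for \<omega>
  have J0: "0 \<le> J \<omega>" for \<omega>
    unfolding J_def by (intro sum_nonneg mult_nonneg_nonneg) (use G.dt_pos in \<open>auto intro: less_imp_le\<close>)
  have hM: "h j \<in> borel_measurable M" if "j < N" for j using G.adapted_M[OF h that] .
  have JM: "J \<in> borel_measurable M"
    unfolding J_def[abs_def]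
    by (intro borel_measurable_sum borel_measurable_times borel_measurable_power
        measurable_compose[OF hM borel_measurable_norm] borel_measurable_const) auto
  have Jle: "ennreal (J \<omega>) \<le> (\<integral>\<^sup>+r. ennreal ((norm (elementary_process n \<tau> \<xi> r \<omega> - elementary_process n' \<tau>' \<xi>' r \<omega>))\<^sup>2)
        \<partial>restrict_space lborel {0..T})" for \<omega>
  proof -
    define A where "A j = {\<rho> j<..\<rho> (Suc j)}" for j
    define g where "g r = ennreal ((norm (elementary_process n \<tau> \<xi> r \<omega> - elementary_process n' \<tau>' \<xi>' r \<omega>))\<^sup>2)" for r
    have disj: "disjoint_family_on A {..<N}"
      unfolding disjoint_family_on_def
    proof (intro ballI impI)
      fix i j assume ij: "i \<in> {..<N}" "j \<in> {..<N}" "i \<noteq> j"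
      have "\<rho> (Suc i) \<le> \<rho> j \<or> \<rho> (Suc j) \<le> \<rho> i"
        using ij G.t_mono[of "Suc i" j] G.t_mono[of "Suc j" i] by (metis Suc_leI lessThan_iff less_imp_le linorder_neqE_nat)
      then show "A i \<inter> A j = {}" by (auto simp: A_def)
    qed
    have AT: "A j \<subseteq> {0..T}" if "j < N" for j using \<rho>T[of j] \<rho>T[of "Suc j"] that by (auto simp: A_def)
    have gA: "g r * indicator (A j) r = ennreal ((norm (h j \<omega>))\<^sup>2) * indicator (A j) r" if "j < N" for j r
      using ref(2)[OF _ _ _ that, of r \<xi> \<omega>] ref'(2)[OF _ _ _ that, of r \<xi>' \<omega>] \<tau>le that
      by (auto simp: g_def h_def A_def indicator_def)
    have "ennreal (J \<omega>) = (\<Sum>j<N. ennreal ((norm (h j \<omega>))\<^sup>2) * emeasure lborel (A j))"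
      unfolding J_def A_def using G.t_less G.dt_pos
      by (subst sum_ennreal[symmetric]) (auto intro!: sum.cong simp: G.dt_def ennreal_mult mult.commute less_imp_le)
    also have "\<dots> = (\<Sum>j<N. \<integral>\<^sup>+r. ennreal ((norm (h j \<omega>))\<^sup>2) * indicator (A j) r \<partial>lborel)"
      by (intro sum.cong refl nn_integral_cmult_indicator[symmetric]) (simp add: A_def)
    also have "\<dots> = (\<integral>\<^sup>+r. (\<Sum>j<N. ennreal ((norm (h j \<omega>))\<^sup>2) * indicator (A j) r) \<partial>lborel)"
      by (rule nn_integral_sum[symmetric]) (simp add: A_def)
    also have "\<dots> = (\<integral>\<^sup>+r. (\<Sum>j<N. g r * indicator (A j) r) \<partial>lborel)"
      by (intro nn_integral_cong sum.cong refl gA[symmetric]) auto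
    also have "\<dots> \<le> (\<integral>\<^sup>+r. g r * indicator {0..T} r \<partial>lborel)"
    proof (intro nn_integral_mono)
      fix r :: real
      have "(\<Sum>j<N. g r * indicator (A j) r) = g r * indicator (\<Union>j<N. A j) r"
        unfolding sum_distrib_left[symmetric] by (subst indicator_UN_disjoint[OF _ disj]) auto
      also have "\<dots> \<le> g r * indicator {0..T} r"
      proof (intro mult_left_mono)
        have "(\<Union>j<N. A j) \<subseteq> {0..T}" using AT by blast
        then show "indicator (\<Union>j<N. A j) r \<le> (indicator {0..T} r :: ennreal)" by (auto simp: indicator_def)
      qed simp
      finally show "(\<Sum>j<N. g r * indicator (A j) r) \<le> g r * indicator {0..T} r" .
    qed
    also have "\<dots> = (\<integral>\<^sup>+r. g r \<partial>restrict_space lborel {0..T})"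
      by (subst nn_integral_restrict_space) auto
    finally show ?thesis unfolding g_def .
  qed
  have diff: "elementary_ito W n \<tau> \<xi> \<omega> - elementary_ito W n' \<tau>' \<xi>' \<omega> = (\<Sum>j<N. G.dW j \<omega> *\<^sub>R h j \<omega>)" for \<omega>
  proof -
    have "elementary_ito W n \<tau> \<xi> \<omega> = (\<Sum>j<N. G.dW j \<omega> *\<^sub>R elementary_process n \<tau> \<xi> (\<rho> (Suc j)) \<omega>)"
      unfolding G.dW_def by (rule ref(1)) (use \<tau>le in auto)
    moreover have "elementary_ito W n' \<tau>' \<xi>' \<omega> = (\<Sum>j<N. G.dW j \<omega> *\<^sub>R elementary_process n' \<tau>' \<xi>' (\<rho> (Suc j)) \<omega>)"
      unfolding G.dW_def by (rule ref'(1)) (use \<tau>le in auto)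
    ultimately show ?thesis by (simp only: h_def scaleR_diff_right sum_subtractf)
  qed
  show ?thesis
  proof (rule that[OF JM J0 Jle])
    fix \<eta> \<delta> :: real assume "\<eta> > 0" "\<delta> \<ge> 0"
    from G.prob_martingale_sum[OF G.noise_id h this]
    show "prob {\<omega>\<in>space M. norm (elementary_ito W n \<tau> \<xi> \<omega> - elementary_ito W n' \<tau>' \<xi>' \<omega>) > \<eta>}
        \<le> \<delta> / \<eta>\<^sup>2 + prob {\<omega>\<in>space M. J \<omega> > \<delta>}"
      unfolding diff J_def .
  qed
qed

text \<open>Evaluation at left ends is what makes these Ito sums; m = 0 gives the empty sum.\<close>

definition riemann_ito :: "(real \<Rightarrow> 'w \<Rightarrow> 'b::real_normed_vector) \<Rightarrow> real \<Rightarrow> nat \<Rightarrow> 'w \<Rightarrow> 'b"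
  where "riemann_ito b T m = elementary_ito W m (\<lambda>i. real i * (T / real m)) (\<lambda>i. b (real i * (T / real m)))"

end

lemma uniform_step_value:
  fixes g :: "real \<Rightarrow> 'b::real_vector"
  assumes \<delta>: "\<delta> > 0" and r: "0 < r" "r \<le> real m * \<delta>"
  shows "\<exists>i<m. real i * \<delta> < r \<and> r \<le> real (Suc i) * \<delta> \<and>
    (\<Sum>j<m. indicator {real j * \<delta><..real (Suc j) * \<delta>} r *\<^sub>R g (real j * \<delta>)) = g (real i * \<delta>)"
proof -
  \<comment> \<open>The intervals are closed on the right, so the index is the ceiling minus 1
    rather than the floor.\<close>
  define i where "i = nat (\<lceil>r / \<delta>\<rceil> - 1)"
  have c: "\<lceil>r / \<delta>\<rceil> \<ge> 1" using \<delta> r by (simp add: less_ceiling_iff int_one_le_iff_zero_less)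
  have ri: "real i = of_int \<lceil>r / \<delta>\<rceil> - 1" unfolding i_def using c by (simp add: of_nat_nat)
  have "real i < r / \<delta>" "r / \<delta> \<le> real i + 1" unfolding ri by linarith+
  then have i: "real i * \<delta> < r" "r \<le> real (Suc i) * \<delta>" using \<delta> by (simp_all add: field_simps)
  have "real i * \<delta> < real m * \<delta>" using i(1) r(2) by linarith
  then have im: "i < m" using \<delta> by simp
  have other: "r \<notin> {real j * \<delta><..real (Suc j) * \<delta>}" if "j \<noteq> i" for j
  proof (cases "j < i")
    case True
    then have "real (Suc j) * \<delta> \<le> real i * \<delta>" using \<delta> by (intro mult_right_mono) auto
    then show ?thesis using i by auto
  next
    case False
    then have "real (Suc i) * \<delta> \<le> real j * \<delta>" using \<delta> that by (intro mult_right_mono) auto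
    then show ?thesis using i by auto
  qed
  have "(\<Sum>j<m. indicator {real j * \<delta><..real (Suc j) * \<delta>} r *\<^sub>R g (real j * \<delta>))
      = (\<Sum>j<m. if j = i then g (real i * \<delta>) else 0)"
  proof (intro sum.cong refl)
    fix j
    show "indicator {real j * \<delta><..real (Suc j) * \<delta>} r *\<^sub>R g (real j * \<delta>) = (if j = i then g (real i * \<delta>) else 0)"
      using other[of j] i by (cases "j = i") (simp_all add: indicator_def)
  qed
  also have "\<dots> = g (real i * \<delta>)" using im by (simp add: sum.delta)
  finally show ?thesis using i im by blast
qed

text \<open>Uniform continuity gives uniform closeness except at r = 0, which lies in no interval of
  the mesh and is a null set.\<close>

lemma uniform_step_L2:
  fixes g :: "real \<Rightarrow> 'b::real_normed_vector"
  assumes T: "0 \<le> T" and g: "continuous_on {0..T} g"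
  shows "(\<lambda>m. \<integral>\<^sup>+r. ennreal ((norm ((\<Sum>j<Suc m. indicator {real j * (T / real (Suc m))<..real (Suc j) * (T / real (Suc m))} r
      *\<^sub>R g (real j * (T / real (Suc m)))) - g r))\<^sup>2) \<partial>restrict_space lborel {0..T}) \<longlonglongrightarrow> 0"
    (is "(\<lambda>m. ?I m) \<longlonglongrightarrow> 0")
proof (rule tendsto_zero_ennreal)
  fix e :: real assume e: "0 < e"
  \<comment> \<open>Chosen so that \<open>T * \<epsilon>^2\<close> stays below e, also for T =
    0.\<close>
  define \<epsilon> where "\<epsilon> = sqrt (e / (T + 1))"
  have \<epsilon>: "\<epsilon> > 0" "\<epsilon>\<^sup>2 = e / (T + 1)" using e T by (auto simp: \<epsilon>_def)
  have "uniformly_continuous_on {0..T} g"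
    using g by (intro compact_uniformly_continuous) auto
  then obtain d where d: "d > 0" "\<And>x y. x \<in> {0..T} \<Longrightarrow> y \<in> {0..T} \<Longrightarrow> dist y x < d \<Longrightarrow> dist (g y) (g x) < \<epsilon>"
    using \<epsilon>(1) unfolding uniformly_continuous_on_def by blast
  have "(\<lambda>m. T / real (Suc m)) \<longlonglongrightarrow> 0"
    by (rule LIMSEQ_Suc[OF lim_const_over_n])
  then have "\<forall>\<^sub>F m in sequentially. T / real (Suc m) < d" using d(1) by (rule order_tendstoD)
  then show "\<forall>\<^sub>F m in sequentially. ?I m < ennreal e"
  proof eventually_elim
    fix m assume md: "T / real (Suc m) < d"
    let ?\<delta> = "T / real (Suc m)"
    have le: "(norm ((\<Sum>j<Suc m. indicator {real j * ?\<delta><..real (Suc j) * ?\<delta>} r *\<^sub>R g (real j * ?\<delta>)) - g r))\<^sup>2 \<le> \<epsilon>\<^sup>2"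
      if r: "0 < r" "r \<le> T" for r
    proof -
      have "?\<delta> > 0" using r by simp
      moreover have "r \<le> real (Suc m) * ?\<delta>" using r by simp
      ultimately obtain i where i: "i < Suc m" "real i * ?\<delta> < r" "r \<le> real (Suc i) * ?\<delta>"
        "(\<Sum>j<Suc m. indicator {real j * ?\<delta><..real (Suc j) * ?\<delta>} r *\<^sub>R g (real j * ?\<delta>)) = g (real i * ?\<delta>)"
        using uniform_step_value[of ?\<delta> r "Suc m" g] r(1) by blast
      have "real (Suc i) * ?\<delta> = real i * ?\<delta> + ?\<delta>" by (simp only: of_nat_Suc[of i] distrib_right mult_1_left add.commute)
      then have "r - real i * ?\<delta> \<le> ?\<delta>" using i(3) by linarith
      then have "dist (real i * ?\<delta>) r < d" using i(2) md by (simp add: dist_real_def)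
      moreover have "0 \<le> real i * ?\<delta>" using T by simp
      ultimately have "dist (g (real i * ?\<delta>)) (g r) < \<epsilon>" using i(2) r by (intro d(2)) auto
      then show ?thesis unfolding i(4) by (intro power_mono) (auto simp: dist_norm)
    qed
    have "?I m \<le> (\<integral>\<^sup>+r. ennreal (\<epsilon>\<^sup>2) \<partial>restrict_space lborel {0..T})"
    proof (rule nn_integral_mono_AE)
      have "AE r in lborel. r \<noteq> (0::real)" by (rule AE_lborel_singleton)
      then show "AE r in restrict_space lborel {0..T}.
          ennreal ((norm ((\<Sum>j<Suc m. indicator {real j * ?\<delta><..real (Suc j) * ?\<delta>} r *\<^sub>R g (real j * ?\<delta>)) - g r))\<^sup>2) \<le> ennreal (\<epsilon>\<^sup>2)"
      proof (subst AE_restrict_space_iff)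
        assume "AE r in lborel. r \<noteq> (0::real)"
        then show "AE r in lborel. r \<in> {0..T} \<longrightarrow>
          ennreal ((norm ((\<Sum>j<Suc m. indicator {real j * ?\<delta><..real (Suc j) * ?\<delta>} r *\<^sub>R g (real j * ?\<delta>)) - g r))\<^sup>2) \<le> ennreal (\<epsilon>\<^sup>2)"
        proof eventually_elim
          case (elim r)
          show ?case using elim le[of r] by (intro impI ennreal_leI) simp
        qed
      qed simp
    qed
    also have "\<dots> = ennreal (e / (T + 1)) * ennreal T"
      using T by (simp add: \<epsilon> emeasure_restrict_space space_restrict_space)
    also have "\<dots> = ennreal (e / (T + 1) * T)" using e T by (intro ennreal_mult[symmetric]) auto
    also have "\<dots> < ennreal e" using e T by (intro ennreal_lessI) (auto simp: field_simps)
    finally show "?I m < ennreal e" .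
  qed
qed

context brownian
begin

text \<open>The abstract integral is a limit along some unspecified elementary processes. The
  left-point processes approach the same integrand in L2 on almost every path, so the two kinds of
  step processes are L2-close almost surely, and comparing their integrals forces the same limit in
  probability.\<close>

lemma riemann_ito_null:
  fixes b :: "real \<Rightarrow> 'w \<Rightarrow> 'b::{real_inner, banach, second_countable_topology}"
  assumes T: "0 \<le> T" and I: "has_ito_integral M \<F> W T \<Phi> I"
    and bF: "\<And>r. 0 \<le> r \<Longrightarrow> b r \<in> borel_measurable (\<F> r)"
    and cont: "\<And>\<omega>. \<omega> \<in> space M \<Longrightarrow> continuous_on {0..} (\<lambda>r. b r \<omega>)"
    and eq: "AE \<omega> in M. \<forall>r\<in>{0..T}. \<Phi> r \<omega> = b r \<omega>"
  shows "null_in_prob (\<lambda>m \<omega>. norm (riemann_ito b T m \<omega> - I \<omega>))"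
proof -
  obtain n \<tau> \<xi> where el: "\<And>m. elementary M \<F> T (n m) (\<tau> m) (\<xi> m)"
    and L2: "AE \<omega> in M. (\<lambda>m. \<integral>\<^sup>+t. ennreal ((norm (elementary_process (n m) (\<tau> m) (\<xi> m) t \<omega> - \<Phi> t \<omega>))\<^sup>2)
        \<partial>restrict_space lborel {0..T}) \<longlonglongrightarrow> 0"
    and lim: "\<And>\<epsilon>. \<epsilon> > 0 \<Longrightarrow> (\<lambda>m. prob {\<omega>\<in>space M. norm (elementary_ito W (n m) (\<tau> m) (\<xi> m) \<omega> - I \<omega>) > \<epsilon>}) \<longlonglongrightarrow> 0"
    using I unfolding has_ito_integral_def by blast
  have I_meas[measurable]: "I \<in> borel_measurable M" and
    \<Phi>_meas: "AE \<omega> in M. (\<lambda>t. \<Phi> t \<omega>) \<in> borel_measurable (restrict_space lborel {0..T})"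
    using I unfolding has_ito_integral_def by blast+
  have st: "step_process T (n m) (\<tau> m) (\<xi> m)" for m
    using el[of m] unfolding elementary_def step_process_def by blast
  let ?\<tau> = "\<lambda>m i. real i * (T / real (Suc m))"
  have st': "step_process T (Suc m) (?\<tau> m) (\<lambda>i. b (?\<tau> m i))" for m
    unfolding step_process_def using T by (auto intro!: bF mult_right_mono divide_right_mono)
  let ?P = "\<lambda>m. elementary_process (n m) (\<tau> m) (\<xi> m)"
  let ?Q = "\<lambda>m. elementary_process (Suc m) (?\<tau> m) (\<lambda>i. b (?\<tau> m i))"
  have ito_M: "elementary_ito W k t z \<in> borel_measurable M"
    if s: "step_process T k t z" for k t and z :: "nat \<Rightarrow> 'w \<Rightarrow> 'b"
    unfolding elementary_ito_def[abs_def]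
  proof (intro borel_measurable_sum borel_measurable_scaleR borel_measurable_diff)
    fix i assume i: "i \<in> {..<k}"
    then have nn: "0 \<le> t i" "0 \<le> t (Suc i)" using step_process_nonneg[OF s] by auto
    have "z i \<in> borel_measurable (\<F> (t i))" using s i unfolding step_process_def by blast
    then show "z i \<in> borel_measurable M" using nn(1) by (rule F_M)
    show "W (t i) \<in> borel_measurable M" "W (t (Suc i)) \<in> borel_measurable M" using nn by simp_all
  qed
  define Good where "Good m J \<longleftrightarrow> J \<in> borel_measurable M \<and> (\<forall>\<omega>. 0 \<le> J \<omega>) \<and>
    (\<forall>\<omega>. ennreal (J \<omega>) \<le> (\<integral>\<^sup>+r. ennreal ((norm (?Q m r \<omega> - ?P m r \<omega>))\<^sup>2) \<partial>restrict_space lborel {0..T})) \<and>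
    (\<forall>\<eta>>0. \<forall>\<delta>\<ge>0. prob {\<omega>\<in>space M. norm (elementary_ito W (Suc m) (?\<tau> m) (\<lambda>i. b (?\<tau> m i)) \<omega>
        - elementary_ito W (n m) (\<tau> m) (\<xi> m) \<omega>) > \<eta>} \<le> \<delta> / \<eta>\<^sup>2 + prob {\<omega>\<in>space M. J \<omega> > \<delta>})" for m J
  have "\<exists>J. Good m J" for m
  proof (rule step_process_prob[OF st'[of m] st[of m]], goal_cases)
    case (1 J)
    show ?case unfolding Good_def by (rule exI[of _ J]) (intro conjI allI impI 1)
  qed
  then have "\<exists>J. \<forall>m. Good m (J m)" by (intro choice allI)
  then obtain J where G: "\<And>m. Good m (J m)" by blast
  have J: "\<And>m. J m \<in> borel_measurable M" "\<And>m \<omega>. 0 \<le> J m \<omega>"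
    "\<And>m \<omega>. ennreal (J m \<omega>) \<le> (\<integral>\<^sup>+r. ennreal ((norm (?Q m r \<omega> - ?P m r \<omega>))\<^sup>2) \<partial>restrict_space lborel {0..T})"
    using G unfolding Good_def by blast+
  have JP: "prob {\<omega>\<in>space M. norm (elementary_ito W (Suc m) (?\<tau> m) (\<lambda>i. b (?\<tau> m i)) \<omega>
        - elementary_ito W (n m) (\<tau> m) (\<xi> m) \<omega>) > \<eta>} \<le> \<delta> / \<eta>\<^sup>2 + prob {\<omega>\<in>space M. J m \<omega> > \<delta>}"
    if "\<eta> > 0" "\<delta> \<ge> 0" for m \<eta> \<delta>
    using G[of m] that unfolding Good_def by blast
  have "AE \<omega> in M. (\<lambda>m. J m \<omega>) \<longlonglongrightarrow> 0"
    using L2 \<Phi>_meas eq AE_space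
  proof eventually_elim
    case (elim \<omega>)
    let ?R = "restrict_space lborel {0..T}"
    have [measurable]: "(\<lambda>t. \<Phi> t \<omega>) \<in> borel_measurable ?R" by (rule elim)
    have ep[measurable]: "(\<lambda>r. elementary_process k t z r \<omega>) \<in> borel_measurable ?R"
      for k t and z :: "nat \<Rightarrow> 'w \<Rightarrow> 'b"
      unfolding elementary_process_def by (intro measurable_restrict_space1) measurable
    have "(\<lambda>m. \<integral>\<^sup>+r. ennreal ((norm (?Q m r \<omega> - b r \<omega>))\<^sup>2) \<partial>?R) \<longlonglongrightarrow> 0"
      unfolding elementary_process_def
      by (rule uniform_step_L2[OF T]) (rule continuous_on_subset[OF cont[OF elim(4)]], auto)
    then have "(\<lambda>m. \<integral>\<^sup>+r. ennreal ((norm (?Q m r \<omega> - \<Phi> r \<omega>))\<^sup>2) \<partial>?R) \<longlonglongrightarrow> 0"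
    proof (rule back_subst[where P = "\<lambda>f. f \<longlonglongrightarrow> 0"], intro ext nn_integral_cong)
      fix m r assume "r \<in> space ?R"
      then have "\<Phi> r \<omega> = b r \<omega>" using elim(3) by (simp add: space_restrict_space)
      then show "ennreal ((norm (?Q m r \<omega> - b r \<omega>))\<^sup>2) = ennreal ((norm (?Q m r \<omega> - \<Phi> r \<omega>))\<^sup>2)"
        by (simp only:)
    qed
    then have l: "(\<lambda>m. 2 * (\<integral>\<^sup>+r. ennreal ((norm (?Q m r \<omega> - \<Phi> r \<omega>))\<^sup>2) \<partial>?R)
        + 2 * (\<integral>\<^sup>+r. ennreal ((norm (?P m r \<omega> - \<Phi> r \<omega>))\<^sup>2) \<partial>?R)) \<longlonglongrightarrow> 2 * 0 + 2 * 0"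
      using elim(1) by (intro tendsto_add ennreal_tendsto_cmult) auto
    \<comment> \<open>Both step processes are close to \<Phi>, so their mutual distance is at most
      twice the sum of the two squared distances.\<close>
    have le: "ennreal (J m \<omega>) \<le> 2 * (\<integral>\<^sup>+r. ennreal ((norm (?Q m r \<omega> - \<Phi> r \<omega>))\<^sup>2) \<partial>?R)
        + 2 * (\<integral>\<^sup>+r. ennreal ((norm (?P m r \<omega> - \<Phi> r \<omega>))\<^sup>2) \<partial>?R)" for m
    proof -
      note J(3)[of m \<omega>]
      also have "(\<integral>\<^sup>+r. ennreal ((norm (?Q m r \<omega> - ?P m r \<omega>))\<^sup>2) \<partial>?R)
        \<le> (\<integral>\<^sup>+r. 2 * ennreal ((norm (?Q m r \<omega> - \<Phi> r \<omega>))\<^sup>2) + 2 * ennreal ((norm (?P m r \<omega> - \<Phi> r \<omega>))\<^sup>2) \<partial>?R)"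
      proof (rule nn_integral_mono)
        fix r
        have "(norm (?Q m r \<omega> - ?P m r \<omega>))\<^sup>2 \<le> 2 * (norm (?Q m r \<omega> - \<Phi> r \<omega>))\<^sup>2 + 2 * (norm (?P m r \<omega> - \<Phi> r \<omega>))\<^sup>2"
          using norm_add_sq_le[of "?Q m r \<omega> - \<Phi> r \<omega>" "\<Phi> r \<omega> - ?P m r \<omega>"] by (simp add: norm_minus_commute)
        then have "ennreal ((norm (?Q m r \<omega> - ?P m r \<omega>))\<^sup>2) \<le> ennreal (2 * (norm (?Q m r \<omega> - \<Phi> r \<omega>))\<^sup>2 + 2 * (norm (?P m r \<omega> - \<Phi> r \<omega>))\<^sup>2)"
          by (rule ennreal_leI)
        then show "ennreal ((norm (?Q m r \<omega> - ?P m r \<omega>))\<^sup>2)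
          \<le> 2 * ennreal ((norm (?Q m r \<omega> - \<Phi> r \<omega>))\<^sup>2) + 2 * ennreal ((norm (?P m r \<omega> - \<Phi> r \<omega>))\<^sup>2)"
          by (simp add: ennreal_mult)
      qed
      also have "\<dots> = 2 * (\<integral>\<^sup>+r. ennreal ((norm (?Q m r \<omega> - \<Phi> r \<omega>))\<^sup>2) \<partial>?R)
        + 2 * (\<integral>\<^sup>+r. ennreal ((norm (?P m r \<omega> - \<Phi> r \<omega>))\<^sup>2) \<partial>?R)"
        by (simp add: nn_integral_add nn_integral_cmult)
      finally show ?thesis .
    qed
    have "(\<lambda>m. ennreal (J m \<omega>)) \<longlonglongrightarrow> 0"
      by (rule tendsto_sandwich[OF _ _ tendsto_const l[simplified]]) (use le in auto)
    then show ?case using J(2) by (simp add: ennreal_tendsto_0_iff)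
  qed
  then have Jn: "null_in_prob J" by (intro null_in_prob_AE J)
  let ?R = "\<lambda>m. elementary_ito W (Suc m) (?\<tau> m) (\<lambda>i. b (?\<tau> m i))"
  let ?E = "\<lambda>m. elementary_ito W (n m) (\<tau> m) (\<xi> m)"
  note [measurable] = ito_M[OF st] ito_M[OF st']
  have 1: "null_in_prob (\<lambda>m \<omega>. norm (?R m \<omega> - ?E m \<omega>))"
  proof (rule null_in_prob_criterion[OF _ Jn])
    fix m and \<eta> \<delta> :: real assume "\<eta> > 0" "\<delta> > 0"
    then show "prob {\<omega>\<in>space M. \<bar>norm (?R m \<omega> - ?E m \<omega>)\<bar> > \<eta>} \<le> (1 / \<eta>\<^sup>2) * \<delta> + prob {\<omega>\<in>space M. \<bar>J m \<omega>\<bar> > \<delta>}"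
      using JP[of \<eta> \<delta> m] J(2) by simp
  qed measurable
  have 2: "null_in_prob (\<lambda>m \<omega>. norm (?E m \<omega> - I \<omega>))"
    unfolding null_in_prob_def using lim by simp
  have 3: "null_in_prob (\<lambda>m \<omega>. norm (?R m \<omega> - I \<omega>))"
  proof (rule null_in_prob_add[OF 1 2])
    show "AE \<omega> in M. \<bar>norm (?R m \<omega> - I \<omega>)\<bar> \<le> \<bar>norm (?R m \<omega> - ?E m \<omega>)\<bar> + \<bar>norm (?E m \<omega> - I \<omega>)\<bar>" for m
    proof (rule AE_I2)
      fix \<omega>
      show "\<bar>norm (?R m \<omega> - I \<omega>)\<bar> \<le> \<bar>norm (?R m \<omega> - ?E m \<omega>)\<bar> + \<bar>norm (?E m \<omega> - I \<omega>)\<bar>"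
        using norm_triangle_ineq[of "?R m \<omega> - ?E m \<omega>" "?E m \<omega> - I \<omega>"] by (simp del: of_nat_Suc)
    qed
  qed measurable
  show ?thesis
    unfolding null_in_prob_def
  proof (intro conjI allI impI)
    \<comment> \<open>The argument above runs over m + 1 intervals; for m = 0 the sum is
      empty.\<close>
    fix m show "(\<lambda>\<omega>. norm (riemann_ito b T m \<omega> - I \<omega>)) \<in> borel_measurable M"
    proof (cases m)
      case 0
      then show ?thesis by (simp add: riemann_ito_def elementary_ito_def)
    next
      case (Suc k)
      then show ?thesis using null_in_probD(1)[OF 3, of k] by (simp add: riemann_ito_def)
    qed
  next
    fix \<eta> :: real assume "\<eta> > 0"
    note f = null_in_probD(2)[OF 3 this]
    show "(\<lambda>m. prob {\<omega>\<in>space M. \<bar>norm (riemann_ito b T m \<omega> - I \<omega>)\<bar> > \<eta>}) \<longlonglongrightarrow> 0"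
      unfolding riemann_ito_def by (rule LIMSEQ_imp_Suc[OF f])
  qed
qed

end

section \<open>Local errors of Ito integrals\<close>

lemma real_mult_div_Suc:
  "real (j * Suc L) * (\<delta> / real (Suc L)) = real j * \<delta>"
  "i \<noteq> 0 \<Longrightarrow> real i * \<delta> / real (i * Suc L) = \<delta> / real (Suc L)"
  unfolding of_nat_mult by (simp_all del: of_nat_Suc)

text \<open>What is retained of the Ito integral: at each fixed time, S is the limit in probability
  of left-point sums. Continuity of b is required at every sample point, so that oscillations along
  meshes are controlled path by path.\<close>

locale ito_integral = brownian M \<F> W for M :: "'w measure" and \<F> W +
  fixes b S :: "real \<Rightarrow> 'w \<Rightarrow> 'b::{real_inner, banach, second_countable_topology}"
  assumes b_F: "0 \<le> r \<Longrightarrow> b r \<in> borel_measurable (\<F> r)"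
    and b_cont: "\<omega> \<in> space M \<Longrightarrow> continuous_on {0..} (\<lambda>r. b r \<omega>)"
    and S_M: "0 \<le> r \<Longrightarrow> S r \<in> borel_measurable M"
    and S_lim: "0 \<le> r \<Longrightarrow> null_in_prob (\<lambda>m \<omega>. norm (riemann_ito b r m \<omega> - S r \<omega>))"
begin

text \<open>The local error made when the integrand is frozen over one mesh step, as in the Euler
  scheme.\<close>

definition ito_error :: "real \<Rightarrow> nat \<Rightarrow> 'w \<Rightarrow> 'b"
  where "ito_error \<delta> i \<omega> = S (real (Suc i) * \<delta>) \<omega> - S (real i * \<delta>) \<omega>
    - (W (real (Suc i) * \<delta>) \<omega> - W (real i * \<delta>) \<omega>) *\<^sub>R b (real i * \<delta>) \<omega>"

text \<open>Each coarse step is cut into \<open>Suc L\<close> pieces. For every i this is a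
  left-point sum up to time \<open>i * \<delta>\<close>, and all i share one grid, so consecutive
  sums differ by exactly one block.\<close>

definition fine_sum :: "real \<Rightarrow> nat \<Rightarrow> nat \<Rightarrow> 'w \<Rightarrow> 'b"
  where "fine_sum \<delta> L i \<omega> = (\<Sum>k<i * Suc L. (W (real (Suc k) * (\<delta> / real (Suc L))) \<omega>
    - W (real k * (\<delta> / real (Suc L))) \<omega>) *\<^sub>R b (real k * (\<delta> / real (Suc L))) \<omega>)"

lemma fine_sum_limit:
  assumes "\<delta> \<ge> 0"
  shows "null_in_prob (\<lambda>L \<omega>. norm (fine_sum \<delta> L i \<omega> - S (real i * \<delta>) \<omega>))"
proof -
  have eq: "fine_sum \<delta> L i \<omega> = riemann_ito b (real i * \<delta>) (i * Suc L) \<omega>" for L \<omega>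
  proof (cases "i = 0")
    case False
    then have "real i * \<delta> / real (i * Suc L) = \<delta> / real (Suc L)" by (rule real_mult_div_Suc)
    then show ?thesis unfolding fine_sum_def riemann_ito_def elementary_ito_def by (simp only:)
  qed (simp add: fine_sum_def riemann_ito_def elementary_ito_def)
  show ?thesis
  proof (cases "i = 0")
    case True
    have "riemann_ito b 0 m \<omega> = 0" for m \<omega> by (simp add: riemann_ito_def elementary_ito_def)
    then show ?thesis using S_lim[of 0] True by (simp add: fine_sum_def)
  next
    case False
    have "filterlim (\<lambda>L. i * Suc L) at_top sequentially"
      by (rule filterlim_at_top_mono[of "\<lambda>L. L"]) (use False in \<open>auto simp: filterlim_ident intro!: always_eventually trans_le_add2\<close>)
    from null_in_prob_compose[OF S_lim this, of "real i * \<delta>"] assms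
    show ?thesis unfolding eq by simp
  qed
qed

text \<open>The counterpart of \<open>ito_error\<close> on the refined grid;
  \<open>k div Suc L\<close> is the coarse step that contains the fine index k.\<close>

definition fine_error :: "real \<Rightarrow> nat \<Rightarrow> nat \<Rightarrow> 'w \<Rightarrow> 'b"
  where "fine_error \<delta> L i \<omega> = (\<Sum>k\<in>{i * Suc L..<i * Suc L + Suc L}. (W (real (Suc k) * (\<delta> / real (Suc L))) \<omega>
    - W (real k * (\<delta> / real (Suc L))) \<omega>) *\<^sub>R (b (real k * (\<delta> / real (Suc L))) \<omega> - b (real (k div Suc L) * \<delta>) \<omega>))"

lemma fine_error_eq:
  "fine_error \<delta> L i \<omega> = fine_sum \<delta> L (Suc i) \<omega> - fine_sum \<delta> L i \<omega>
    - (W (real (Suc i) * \<delta>) \<omega> - W (real i * \<delta>) \<omega>) *\<^sub>R b (real i * \<delta>) \<omega>"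
proof -
  let ?e = "\<delta> / real (Suc L)"
  let ?I = "{i * Suc L..<i * Suc L + Suc L}"
  let ?w = "\<lambda>k. W (real k * ?e) \<omega>"
  have "k div Suc L = i" if "k \<in> ?I" for k
    using that by (intro div_nat_eqI) (auto simp: mult.commute)
  then have "fine_error \<delta> L i \<omega> = (\<Sum>k\<in>?I. (?w (Suc k) - ?w k) *\<^sub>R b (real k * ?e) \<omega>
      - (?w (Suc k) - ?w k) *\<^sub>R b (real i * \<delta>) \<omega>)"
    unfolding fine_error_def by (intro sum.cong refl) (simp only: scaleR_diff_right)
  also have "\<dots> = (\<Sum>k\<in>?I. (?w (Suc k) - ?w k) *\<^sub>R b (real k * ?e) \<omega>)
      - (\<Sum>k\<in>?I. ?w (Suc k) - ?w k) *\<^sub>R b (real i * \<delta>) \<omega>"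
    unfolding scaleR_sum_left by (rule sum_subtractf)
  also have "(\<Sum>k\<in>?I. ?w (Suc k) - ?w k) = ?w (i * Suc L + Suc L) - ?w (i * Suc L)"
    by (rule sum_Suc_diff') simp
  also have "real (i * Suc L + Suc L) * ?e = real (Suc i) * \<delta>"
  proof -
    have "i * Suc L + Suc L = Suc i * Suc L" by simp
    then show ?thesis by (simp only: real_mult_div_Suc)
  qed
  also have "real (i * Suc L) * ?e = real i * \<delta>" by (rule real_mult_div_Suc)
  also have "(\<Sum>k\<in>?I. (?w (Suc k) - ?w k) *\<^sub>R b (real k * ?e) \<omega>) = fine_sum \<delta> L (Suc i) \<omega> - fine_sum \<delta> L i \<omega>"
  proof -
    have "{..<Suc i * Suc L} = {..<i * Suc L} \<union> ?I" by auto
    moreover have "(\<Sum>k\<in>{..<i * Suc L} \<union> ?I. (?w (Suc k) - ?w k) *\<^sub>R b (real k * ?e) \<omega>)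
      = (\<Sum>k<i * Suc L. (?w (Suc k) - ?w k) *\<^sub>R b (real k * ?e) \<omega>) + (\<Sum>k\<in>?I. (?w (Suc k) - ?w k) *\<^sub>R b (real k * ?e) \<omega>)"
      by (rule sum.union_disjoint) auto
    ultimately show ?thesis unfolding fine_sum_def by (simp only: add_diff_cancel_left')
  qed
  finally show ?thesis .
qed

text \<open>Adding up the finitely many errors yields one subsequence that works for all coarse
  steps simultaneously.\<close>

lemma fine_error_limit:
  assumes "\<delta> \<ge> 0"
  obtains r :: "nat \<Rightarrow> nat" where
    "AE \<omega> in M. \<forall>i<m. (\<lambda>L. fine_error \<delta> (r L) i \<omega>) \<longlonglongrightarrow> ito_error \<delta> i \<omega>"
proof -
  have "null_in_prob (\<lambda>L \<omega>. \<Sum>i\<in>{..m}. \<bar>norm (fine_sum \<delta> L i \<omega> - S (real i * \<delta>) \<omega>)\<bar>)"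
    by (intro null_in_prob_sum fine_sum_limit assms) auto
  then obtain r where r: "AE \<omega> in M. (\<lambda>L. \<Sum>i\<in>{..m}. \<bar>norm (fine_sum \<delta> (r L) i \<omega> - S (real i * \<delta>) \<omega>)\<bar>) \<longlonglongrightarrow> 0"
    by (rule null_in_prob_subseq)
  have "AE \<omega> in M. \<forall>i<m. (\<lambda>L. fine_error \<delta> (r L) i \<omega>) \<longlonglongrightarrow> ito_error \<delta> i \<omega>"
    using r
  proof (eventually_elim, intro allI impI)
    fix \<omega> i assume s: "(\<lambda>L. \<Sum>i\<in>{..m}. \<bar>norm (fine_sum \<delta> (r L) i \<omega> - S (real i * \<delta>) \<omega>)\<bar>) \<longlonglongrightarrow> 0" and i: "i < m"
    have l: "(\<lambda>L. fine_sum \<delta> (r L) j \<omega>) \<longlonglongrightarrow> S (real j * \<delta>) \<omega>" if "j \<le> m" for j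
    proof -
      have "norm (fine_sum \<delta> (r L) j \<omega> - S (real j * \<delta>) \<omega>) \<le> (\<Sum>i\<in>{..m}. \<bar>norm (fine_sum \<delta> (r L) i \<omega> - S (real i * \<delta>) \<omega>)\<bar>)" for L
        using that member_le_sum[of j "{..m}" "\<lambda>i. \<bar>norm (fine_sum \<delta> (r L) i \<omega> - S (real i * \<delta>) \<omega>)\<bar>"] by simp
      then have "(\<lambda>L. fine_sum \<delta> (r L) j \<omega> - S (real j * \<delta>) \<omega>) \<longlonglongrightarrow> 0"
        by (intro Lim_null_comparison[OF _ s] always_eventually allI)
      then show ?thesis by (simp add: LIM_zero_iff)
    qed
    show "(\<lambda>L. fine_error \<delta> (r L) i \<omega>) \<longlonglongrightarrow> ito_error \<delta> i \<omega>"
      unfolding fine_error_eq ito_error_def using i by (intro tendsto_diff l tendsto_const) auto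
  qed
  then show ?thesis by (rule that)
qed

text \<open>The energy of all fine errors together, as it enters
  \<open>prob_block_sum\<close>.\<close>

definition fine_energy :: "real \<Rightarrow> nat \<Rightarrow> nat \<Rightarrow> 'w \<Rightarrow> real"
  where "fine_energy \<delta> m L \<omega> = (\<Sum>k<m * Suc L. (\<delta> / real (Suc L))
    * (norm (b (real k * (\<delta> / real (Suc L))) \<omega> - b (real (k div Suc L) * \<delta>) \<omega>))\<^sup>2)"

lemma fine_energy_le:
  assumes \<delta>: "\<delta> \<ge> 0" and osc: "\<And>x y. 0 \<le> x \<Longrightarrow> x \<le> y \<Longrightarrow> y \<le> x + \<delta> \<Longrightarrow> y \<le> real m * \<delta> \<Longrightarrow>
      norm (b y \<omega> - b x \<omega>) \<le> \<epsilon>"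
  shows "fine_energy \<delta> m L \<omega> \<le> real m * \<delta> * \<epsilon>\<^sup>2"
proof -
  let ?e = "\<delta> / real (Suc L)"
  have "(norm (b (real k * ?e) \<omega> - b (real (k div Suc L) * \<delta>) \<omega>))\<^sup>2 \<le> \<epsilon>\<^sup>2" if k: "k < m * Suc L" for k
  proof (intro power_mono osc)
    have d: "real (j * Suc L) * ?e = real j * \<delta>" for j by (rule real_mult_div_Suc)
    have e: "?e \<ge> 0" using \<delta> by simp
    show "0 \<le> real (k div Suc L) * \<delta>" using \<delta> by simp
    have "real (k div Suc L * Suc L) * ?e \<le> real k * ?e"
      using e by (intro mult_right_mono) (simp_all only: of_nat_le_iff div_times_less_eq_dividend)
    then show "real (k div Suc L) * \<delta> \<le> real k * ?e" unfolding d .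
    have "k \<le> (k div Suc L + 1) * Suc L"
      using dividend_less_div_times[of "Suc L" k] by simp
    then have "real k * ?e \<le> real ((k div Suc L + 1) * Suc L) * ?e"
      using e by (intro mult_right_mono) (simp_all only: of_nat_le_iff)
    then have "real k * ?e \<le> real (k div Suc L + 1) * \<delta>" unfolding d .
    then show "real k * ?e \<le> real (k div Suc L) * \<delta> + \<delta>" by (simp only: of_nat_add of_nat_1 distrib_right mult_1_left)
    have "real k * ?e \<le> real (m * Suc L) * ?e"
      using e k by (intro mult_right_mono) (simp_all only: of_nat_le_iff less_imp_le)
    then show "real k * ?e \<le> real m * \<delta>" unfolding d .
  qed auto
  then have "fine_energy \<delta> m L \<omega> \<le> (\<Sum>k<m * Suc L. ?e * \<epsilon>\<^sup>2)"
    unfolding fine_energy_def using \<delta> by (intro sum_mono mult_left_mono) auto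
  also have "\<dots> = real (m * Suc L) * (?e * \<epsilon>\<^sup>2)" by (simp only: sum_constant card_lessThan)
  also have "\<dots> = real m * \<delta> * \<epsilon>\<^sup>2"
    unfolding mult.assoc[symmetric, of _ ?e] real_mult_div_Suc ..
  finally show ?thesis .
qed

lemma fine_energy_nonneg: "\<delta> \<ge> 0 \<Longrightarrow> 0 \<le> fine_energy \<delta> m L \<omega>"
  unfolding fine_energy_def by (intro sum_nonneg) auto

lemma b_uniform:
  assumes "\<omega> \<in> space M" "\<epsilon> > 0"
  obtains d where "d > 0" "\<And>x y. 0 \<le> x \<Longrightarrow> 0 \<le> y \<Longrightarrow> x \<le> T \<Longrightarrow> y \<le> T \<Longrightarrow> \<bar>y - x\<bar> < d \<Longrightarrow> norm (b y \<omega> - b x \<omega>) < \<epsilon>"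
proof -
  have "uniformly_continuous_on {0..T} (\<lambda>r. b r \<omega>)"
    by (intro compact_uniformly_continuous continuous_on_subset[OF b_cont[OF assms(1)]]) auto
  then obtain d where "d > 0" "\<And>x y. x \<in> {0..T} \<Longrightarrow> y \<in> {0..T} \<Longrightarrow> dist y x < d \<Longrightarrow> dist (b y \<omega>) (b x \<omega>) < \<epsilon>"
    using assms(2) unfolding uniformly_continuous_on_def by blast
  then show ?thesis by (intro that[of d]) (auto simp: dist_norm)
qed

lemma b_bounded:
  assumes "\<omega> \<in> space M"
  obtains B where "\<And>x. 0 \<le> x \<Longrightarrow> x \<le> T \<Longrightarrow> norm (b x \<omega>) \<le> B"
proof -
  have "compact ((\<lambda>r. b r \<omega>) ` {0..T})"
    by (intro compact_continuous_image continuous_on_subset[OF b_cont[OF assms(1)]]) auto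
  then have "bounded ((\<lambda>r. b r \<omega>) ` {0..T})" by (rule compact_imp_bounded)
  then obtain B where "\<forall>x\<in>{0..T}. norm (b x \<omega>) \<le> B" unfolding bounded_iff by auto
  then show ?thesis by (intro that[of B]) auto
qed

lemma b_M: "0 \<le> r \<Longrightarrow> b r \<in> borel_measurable M"
  using F_M[OF b_F] .

lemma fine_energy_M: "\<delta> \<ge> 0 \<Longrightarrow> fine_energy \<delta> m L \<in> borel_measurable M"
  unfolding fine_energy_def[abs_def]
  by (intro borel_measurable_sum borel_measurable_times borel_measurable_power borel_measurable_const
      measurable_compose[OF _ borel_measurable_norm] borel_measurable_diff b_M) auto

text \<open>The supremum over refinements makes the error bound independent of L, so that it
  survives the limit of L to infinity.\<close>

definition max_energy :: "real \<Rightarrow> nat \<Rightarrow> 'w \<Rightarrow> real"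
  where "max_energy T n \<omega> = (SUP L. fine_energy (T / real (Suc n)) (Suc n) L \<omega>)"

text \<open>The two times compared in each term lie in the same closed coarse step, so uniform
  continuity of the path of b bounds the energy by T times a squared oscillation, for all
  refinements at once.\<close>

lemma max_energy:
  assumes T: "T \<ge> 0"
  shows "null_in_prob (max_energy T)"
    and "\<omega> \<in> space M \<Longrightarrow> fine_energy (T / real (Suc n)) (Suc n) L \<omega> \<le> max_energy T n \<omega>"
proof -
  let ?\<delta> = "\<lambda>n. T / real (Suc n)"
  have m\<delta>: "real (Suc n) * ?\<delta> n = T" for n by (simp del: of_nat_Suc)
  have \<delta>: "?\<delta> n \<ge> 0" for n using T by simp
  have bdd: "bdd_above (range (\<lambda>L. fine_energy (?\<delta> n) (Suc n) L \<omega>))" if \<omega>: "\<omega> \<in> space M" for n \<omega>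
  proof -
    obtain B where B: "\<And>x. 0 \<le> x \<Longrightarrow> x \<le> T \<Longrightarrow> norm (b x \<omega>) \<le> B"
      using b_bounded[OF \<omega>, of T] by blast
    have "norm (b y \<omega> - b x \<omega>) \<le> 2 * B" if "0 \<le> x" "x \<le> y" "y \<le> real (Suc n) * ?\<delta> n" for x y
      using B[of x] B[of y] that norm_triangle_ineq4[of "b y \<omega>" "b x \<omega>"] unfolding m\<delta> by linarith
    then have "fine_energy (?\<delta> n) (Suc n) L \<omega> \<le> real (Suc n) * ?\<delta> n * (2 * B)\<^sup>2" for L
      by (intro fine_energy_le \<delta>) auto
    then show ?thesis by (intro bdd_aboveI2)
  qed
  show le: "fine_energy (?\<delta> n) (Suc n) L \<omega> \<le> max_energy T n \<omega>" if "\<omega> \<in> space M" for n L \<omega>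
    unfolding max_energy_def by (intro cSUP_upper bdd that) auto
  show "null_in_prob (max_energy T)"
  proof (rule null_in_prob_AE)
    show "max_energy T n \<in> borel_measurable M" for n
      unfolding max_energy_def[abs_def]
      by (rule borel_measurable_cSUP) (auto intro: fine_energy_M \<delta> bdd simp del: of_nat_Suc)
    show "AE \<omega> in M. (\<lambda>n. max_energy T n \<omega>) \<longlonglongrightarrow> 0"
    proof (rule AE_I2, rule LIMSEQ_I)
      fix \<omega> and r :: real assume \<omega>: "\<omega> \<in> space M" and r: "0 < r"
      \<comment> \<open>Then T times \<epsilon> squared is below r.\<close>
      define \<epsilon> where "\<epsilon> = sqrt (r / (T + 1))"
      have \<epsilon>: "\<epsilon> > 0" "\<epsilon>\<^sup>2 = r / (T + 1)" using r T by (auto simp: \<epsilon>_def)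
      obtain d where d: "d > 0" "\<And>x y. 0 \<le> x \<Longrightarrow> 0 \<le> y \<Longrightarrow> x \<le> T \<Longrightarrow> y \<le> T \<Longrightarrow> \<bar>y - x\<bar> < d \<Longrightarrow> norm (b y \<omega> - b x \<omega>) < \<epsilon>"
        using b_uniform[OF \<omega> \<epsilon>(1), of T] by blast
      have "(\<lambda>n. ?\<delta> n) \<longlonglongrightarrow> 0" by (rule LIMSEQ_Suc[OF lim_const_over_n])
      then have "\<forall>\<^sub>F n in sequentially. ?\<delta> n < d" using d(1) by (rule order_tendstoD)
      then obtain N where N: "\<And>n. n \<ge> N \<Longrightarrow> ?\<delta> n < d" unfolding eventually_sequentially by blast
      have "norm (max_energy T n \<omega> - 0) < r" if n: "n \<ge> N" for n
      proof -
        have "norm (b y \<omega> - b x \<omega>) \<le> \<epsilon>" if xy: "0 \<le> x" "x \<le> y" "y \<le> x + ?\<delta> n" "y \<le> real (Suc n) * ?\<delta> n" for x y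
        proof (rule less_imp_le, rule d(2))
          show "\<bar>y - x\<bar> < d" using N[OF n] xy by linarith
        qed (use xy[unfolded m\<delta>] in auto)
        then have "fine_energy (?\<delta> n) (Suc n) L \<omega> \<le> real (Suc n) * ?\<delta> n * \<epsilon>\<^sup>2" for L
          by (intro fine_energy_le \<delta>) auto
        then have "max_energy T n \<omega> \<le> T * (r / (T + 1))"
          unfolding max_energy_def m\<delta> \<epsilon>(2) by (intro cSUP_least) auto
        also have "\<dots> < r" using r T by (simp add: field_simps)
        finally show ?thesis
          using le[OF \<omega>, of n 0] fine_energy_nonneg[OF \<delta>, of n "Suc n" 0 \<omega>] by simp
      qed
      then show "\<exists>no. \<forall>n\<ge>no. norm (max_energy T n \<omega> - 0) < r" by blast
    qed
  qed
qed

lemma ito_error_M: "\<delta> \<ge> 0 \<Longrightarrow> ito_error \<delta> i \<in> borel_measurable M"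
  unfolding ito_error_def[abs_def]
  by (intro borel_measurable_diff borel_measurable_scaleR S_M b_M W_M) auto

lemma fine_grid:
  assumes \<delta>: "\<delta> > 0"
  shows "brownian_grid M \<F> W (\<lambda>k. real k * (\<delta> / real (Suc L)))  n"
proof (unfold_locales, goal_cases)
  case (2 i)
  show ?case using \<delta> by (intro mult_strict_right_mono) simp_all
qed simp

text \<open>The coarse time assigned to a fine index never lies after the fine time itself.\<close>

lemma fine_F:
  assumes \<delta>: "\<delta> > 0" and g: "g \<in> borel_measurable (\<F> (real (k div Suc L) * \<delta>))"
  shows "g \<in> borel_measurable (\<F> (real k * (\<delta> / real (Suc L))))"
proof (rule F_mono[OF g])
  let ?e = "\<delta> / real (Suc L)"
  have e: "?e \<ge> 0" using \<delta> by simp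
  have "real (k div Suc L * Suc L) * ?e \<le> real k * ?e"
    using e by (intro mult_right_mono) (simp_all only: of_nat_le_iff div_times_less_eq_dividend)
  then show "real (k div Suc L) * \<delta> \<le> real k * ?e" unfolding real_mult_div_Suc .
qed (use \<delta> in simp)

lemma fine_adapted:
  assumes \<delta>: "\<delta> > 0"
  shows "(\<lambda>\<omega>. b (real k * (\<delta> / real (Suc L))) \<omega> - b (real (k div Suc L) * \<delta>) \<omega>)
      \<in> borel_measurable (\<F> (real k * (\<delta> / real (Suc L))))"
proof (rule borel_measurable_diff)
  show "b (real k * (\<delta> / real (Suc L))) \<in> borel_measurable (\<F> (real k * (\<delta> / real (Suc L))))"
    by (rule b_F) (use \<delta> in simp)
  show "b (real (k div Suc L) * \<delta>) \<in> borel_measurable (\<F> (real k * (\<delta> / real (Suc L))))"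
    by (rule fine_F[OF \<delta> b_F]) (use \<delta> in simp)
qed

text \<open>The block estimate on the refined grid, with its energy bounded by
  \<open>max_energy\<close>. L tends to infinity first, along an almost sure subsequence, and only
  then n.\<close>

lemma ito_error_square_null:
  assumes T: "T > 0"
  shows "null_in_prob (\<lambda>n \<omega>. \<Sum>i<Suc n. (norm (ito_error (T / real (Suc n)) i \<omega>))\<^sup>2)"
proof (rule null_in_prob_criterion[OF _ max_energy(1)[of T]])
  fix n
  have \<delta>: "T / real (Suc n) > 0" using T by simp
  define \<delta> where "\<delta> = T / real (Suc n)"
  note \<delta> = \<delta>[folded \<delta>_def]
  have [measurable]: "\<And>i. ito_error \<delta> i \<in> borel_measurable M" by (rule ito_error_M) (use \<delta> in simp)
  have Z: "(\<lambda>\<omega>. \<Sum>i<Suc n. (norm (ito_error \<delta> i \<omega>))\<^sup>2) \<in> borel_measurable M" by measurable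
  from Z[unfolded \<delta>_def]
  show "(\<lambda>\<omega>. \<Sum>i<Suc n. (norm (ito_error (T / real (Suc n)) i \<omega>))\<^sup>2) \<in> borel_measurable M" .
  fix \<eta> \<kappa> :: real assume \<eta>: "\<eta> > 0" and \<kappa>: "\<kappa> > 0"
  obtain r where r: "AE \<omega> in M. \<forall>i<Suc n. (\<lambda>L. fine_error \<delta> (r L) i \<omega>) \<longlonglongrightarrow> ito_error \<delta> i \<omega>"
    by (rule fine_error_limit[OF less_imp_le[OF \<delta>]])
  have meas: "(\<lambda>\<omega>. \<Sum>i<Suc n. (norm (fine_error \<delta> L i \<omega>))\<^sup>2) \<in> borel_measurable M"
    and bound: "prob {\<omega>\<in>space M. (\<Sum>i<Suc n. (norm (fine_error \<delta> L i \<omega>))\<^sup>2) > \<eta>} \<le> \<kappa> / \<eta> + prob {\<omega>\<in>space M. max_energy T n \<omega> > \<kappa>}" for L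
  proof -
    let ?e = "\<delta> / real (Suc L)"
    interpret G: brownian_grid M \<F> W "\<lambda>k. real k * ?e" "Suc n * Suc L" by (rule fine_grid[OF \<delta>])
    let ?h = "\<lambda>k \<omega>. b (real k * ?e) \<omega> - b (real (k div Suc L) * \<delta>) \<omega>"
    have h: "G.adapted ?h" unfolding G.adapted_def using fine_adapted[OF \<delta>] by blast
    have fe: "fine_error \<delta> L i \<omega> = (\<Sum>k\<in>{i * Suc L..<i * Suc L + Suc L}. G.dW k \<omega> *\<^sub>R ?h k \<omega>)" for i \<omega>
      unfolding fine_error_def G.dW_def ..
    have dt: "G.dt k = ?e" for k
      unfolding G.dt_def by (simp only: of_nat_Suc[of k] distrib_right mult_1_left add_diff_cancel_right')
    have en: "fine_energy \<delta> (Suc n) L \<omega> = (\<Sum>k<Suc n * Suc L. G.dt k * (norm (?h k \<omega>))\<^sup>2)" for \<omega>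
      unfolding fine_energy_def dt ..
    show "(\<lambda>\<omega>. \<Sum>i<Suc n. (norm (fine_error \<delta> L i \<omega>))\<^sup>2) \<in> borel_measurable M"
    proof (rule borel_measurable_sum)
      fix i assume "i \<in> {..<Suc n}"
      then have "Suc i * Suc L \<le> Suc n * Suc L" by (intro mult_le_mono1) auto
      then have "i * Suc L + Suc L \<le> Suc n * Suc L" by simp
      then have "fine_error \<delta> L i \<in> borel_measurable M"
        unfolding fe[abs_def] by (rule G.martingale_sum_M[OF G.noise_id h])
      then show "(\<lambda>\<omega>. (norm (fine_error \<delta> L i \<omega>))\<^sup>2) \<in> borel_measurable M" by measurable
    qed
    have "prob {\<omega>\<in>space M. (\<Sum>i<Suc n. (norm (fine_error \<delta> L i \<omega>))\<^sup>2) > \<eta>}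
      \<le> \<kappa> / \<eta> + prob {\<omega>\<in>space M. fine_energy \<delta> (Suc n) L \<omega> > \<kappa>}"
      unfolding fe en by (rule G.prob_block_sum[OF G.noise_id h refl]) (use \<eta> \<kappa> in auto)
    also have "prob {\<omega>\<in>space M. fine_energy \<delta> (Suc n) L \<omega> > \<kappa>} \<le> prob {\<omega>\<in>space M. max_energy T n \<omega> > \<kappa>}"
    proof (rule finite_measure_mono)
      show "{\<omega>\<in>space M. fine_energy \<delta> (Suc n) L \<omega> > \<kappa>} \<subseteq> {\<omega>\<in>space M. max_energy T n \<omega> > \<kappa>}"
        using max_energy(2)[of T _ n L] T unfolding \<delta>_def by force
      show "{\<omega>\<in>space M. max_energy T n \<omega> > \<kappa>} \<in> sets M"
        using null_in_probD(1)[OF max_energy(1)[of T], of n] T by simp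
    qed
    finally show "prob {\<omega>\<in>space M. (\<Sum>i<Suc n. (norm (fine_error \<delta> L i \<omega>))\<^sup>2) > \<eta>} \<le> \<kappa> / \<eta> + prob {\<omega>\<in>space M. max_energy T n \<omega> > \<kappa>}"
      by simp
  qed
  have "prob {\<omega>\<in>space M. (\<Sum>i<Suc n. (norm (ito_error \<delta> i \<omega>))\<^sup>2) > \<eta>} \<le> \<kappa> / \<eta> + prob {\<omega>\<in>space M. max_energy T n \<omega> > \<kappa>}"
  proof (rule prob_greater_limit[OF meas Z])
    show "AE \<omega> in M. (\<lambda>L. \<Sum>i<Suc n. (norm (fine_error \<delta> (r L) i \<omega>))\<^sup>2) \<longlonglongrightarrow> (\<Sum>i<Suc n. (norm (ito_error \<delta> i \<omega>))\<^sup>2)"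
      using r by eventually_elim (intro tendsto_sum tendsto_power tendsto_norm, simp)
  qed (rule bound)
  moreover have "\<bar>\<Sum>i<Suc n. (norm (ito_error \<delta> i \<omega>))\<^sup>2\<bar> = (\<Sum>i<Suc n. (norm (ito_error \<delta> i \<omega>))\<^sup>2)" for \<omega>
    by (intro abs_of_nonneg sum_nonneg) simp
  moreover have "prob {\<omega>\<in>space M. max_energy T n \<omega> > \<kappa>} \<le> prob {\<omega>\<in>space M. \<bar>max_energy T n \<omega>\<bar> > \<kappa>}"
    using null_in_probD(1)[OF max_energy(1)[of T], of n] T by (intro finite_measure_mono) auto
  ultimately show "prob {\<omega>\<in>space M. \<bar>\<Sum>i<Suc n. (norm (ito_error (T / real (Suc n)) i \<omega>))\<^sup>2\<bar> > \<eta>}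
      \<le> (1 / \<eta>) * \<kappa> + prob {\<omega>\<in>space M. \<bar>max_energy T n \<omega>\<bar> > \<kappa>}"
    unfolding \<delta>_def by (simp del: of_nat_Suc)
qed (use T in simp)

text \<open>Square summability of the local errors does not control the sum of their norms, as the
  number of steps grows. The gain comes from their being martingale differences: with c frozen at
  the coarse times everything is one martingale sum on the refined grid, whose energy only gains the
  factor \<open>C\<^sup>2\<close>.\<close>

lemma ito_error_inner_null:
  fixes c :: "real \<Rightarrow> 'w \<Rightarrow> 'b"
  assumes T: "T > 0" and c_F: "\<And>r. 0 \<le> r \<Longrightarrow> c r \<in> borel_measurable (\<F> r)"
    and c: "\<And>r \<omega>. norm (c r \<omega>) \<le> C"
  shows "null_in_prob (\<lambda>n \<omega>. \<Sum>i<Suc n. c (real i * (T / real (Suc n))) \<omega> \<bullet> ito_error (T / real (Suc n)) i \<omega>)"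
proof (rule null_in_prob_criterion[OF _ max_energy(1)[of T]])
  fix n
  have \<delta>: "T / real (Suc n) > 0" using T by simp
  define \<delta> where "\<delta> = T / real (Suc n)"
  note \<delta> = \<delta>[folded \<delta>_def]
  have cM: "\<And>r. 0 \<le> r \<Longrightarrow> c r \<in> borel_measurable M" using F_M[OF c_F] .
  have Z0: "(\<lambda>\<omega>. \<Sum>i<Suc n. c (real i * \<delta>) \<omega> \<bullet> ito_error \<delta> i \<omega>) \<in> borel_measurable M"
  proof (rule borel_measurable_sum)
    fix i
    have "c (real i * \<delta>) \<in> borel_measurable M" by (rule cM) (use \<delta> in simp)
    moreover have "ito_error \<delta> i \<in> borel_measurable M" by (rule ito_error_M) (use \<delta> in simp)
    ultimately show "(\<lambda>\<omega>. c (real i * \<delta>) \<omega> \<bullet> ito_error \<delta> i \<omega>) \<in> borel_measurable M" by measurable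
  qed
  then have Z: "(\<lambda>\<omega>. \<bar>\<Sum>i<Suc n. c (real i * \<delta>) \<omega> \<bullet> ito_error \<delta> i \<omega>\<bar>) \<in> borel_measurable M"
    by (rule borel_measurable_abs)
  from Z0[unfolded \<delta>_def]
  show "(\<lambda>\<omega>. \<Sum>i<Suc n. c (real i * (T / real (Suc n))) \<omega> \<bullet> ito_error (T / real (Suc n)) i \<omega>) \<in> borel_measurable M" .
  fix \<eta> \<kappa> :: real assume \<eta>: "\<eta> > 0" and \<kappa>: "\<kappa> > 0"
  obtain r where r: "AE \<omega> in M. \<forall>i<Suc n. (\<lambda>L. fine_error \<delta> (r L) i \<omega>) \<longlonglongrightarrow> ito_error \<delta> i \<omega>"
    by (rule fine_error_limit[OF less_imp_le[OF \<delta>]])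
  have C0: "0 \<le> C" using c[of 0 undefined] norm_ge_zero order_trans by blast
  have meas: "(\<lambda>\<omega>. \<bar>\<Sum>i<Suc n. c (real i * \<delta>) \<omega> \<bullet> fine_error \<delta> L i \<omega>\<bar>) \<in> borel_measurable M"
    and bound: "prob {\<omega>\<in>space M. \<bar>\<Sum>i<Suc n. c (real i * \<delta>) \<omega> \<bullet> fine_error \<delta> L i \<omega>\<bar> > \<eta>}
      \<le> C\<^sup>2 * \<kappa> / \<eta>\<^sup>2 + prob {\<omega>\<in>space M. max_energy T n \<omega> > \<kappa>}" for L
  proof -
    let ?e = "\<delta> / real (Suc L)"
    interpret G: brownian_grid M \<F> W "\<lambda>k. real k * ?e" "Suc n * Suc L" by (rule fine_grid[OF \<delta>])
    let ?h = "\<lambda>k \<omega>. b (real k * ?e) \<omega> - b (real (k div Suc L) * \<delta>) \<omega>"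
    \<comment> \<open>Evaluating c at the coarse time of each fine index merges the blocks into a
      single martingale sum with a scalar integrand.\<close>
    let ?g = "\<lambda>k \<omega>. c (real (k div Suc L) * \<delta>) \<omega> \<bullet> ?h k \<omega>"
    have g: "G.adapted ?g" unfolding G.adapted_def
    proof (intro allI impI borel_measurable_inner)
      fix k assume k: "k < Suc n * Suc L"
      show "c (real (k div Suc L) * \<delta>) \<in> borel_measurable (\<F> (real k * ?e))"
        by (rule fine_F[OF \<delta> c_F]) (use \<delta> in simp)
      show "?h k \<in> borel_measurable (\<F> (real k * ?e))" by (rule fine_adapted[OF \<delta>])
    qed
    have dt: "G.dt k = ?e" for k
      unfolding G.dt_def by (simp only: of_nat_Suc[of k] distrib_right mult_1_left add_diff_cancel_right')
    have fe: "(\<Sum>i<Suc n. c (real i * \<delta>) \<omega> \<bullet> fine_error \<delta> L i \<omega>) = (\<Sum>k<Suc n * Suc L. G.dW k \<omega> *\<^sub>R ?g k \<omega>)" for \<omega>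
    proof -
      have "c (real i * \<delta>) \<omega> \<bullet> fine_error \<delta> L i \<omega> = (\<Sum>k\<in>{i * Suc L..<i * Suc L + Suc L}. G.dW k \<omega> *\<^sub>R ?g k \<omega>)" for i
        unfolding fine_error_def inner_sum_right G.dW_def
      proof (intro sum.cong refl)
        fix k assume k: "k \<in> {i * Suc L..<i * Suc L + Suc L}"
        have "k div Suc L = i" using k by (intro div_nat_eqI) (auto simp: mult.commute)
        then show "c (real i * \<delta>) \<omega> \<bullet> ((W (real (Suc k) * ?e) \<omega> - W (real k * ?e) \<omega>) *\<^sub>R ?h k \<omega>)
          = (W (real (Suc k) * ?e) \<omega> - W (real k * ?e) \<omega>) *\<^sub>R (c (real (k div Suc L) * \<delta>) \<omega> \<bullet> ?h k \<omega>)"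
          by (simp only: inner_scaleR_right real_scaleR_def)
      qed
      then have "(\<Sum>i<Suc n. c (real i * \<delta>) \<omega> \<bullet> fine_error \<delta> L i \<omega>)
        = (\<Sum>i<Suc n. \<Sum>k\<in>{i * Suc L..<i * Suc L + Suc L}. G.dW k \<omega> *\<^sub>R ?g k \<omega>)" by (intro sum.cong refl)
      also have "\<dots> = (\<Sum>k<Suc n * Suc L. G.dW k \<omega> *\<^sub>R ?g k \<omega>)" by (rule sum.nat_group)
      finally show ?thesis .
    qed
    have "(\<lambda>\<omega>. \<Sum>k\<in>{0..<Suc n * Suc L}. G.dW k \<omega> *\<^sub>R ?g k \<omega>) \<in> borel_measurable M"
      by (rule G.martingale_sum_M[OF G.noise_id g]) simp
    then show "(\<lambda>\<omega>. \<bar>\<Sum>i<Suc n. c (real i * \<delta>) \<omega> \<bullet> fine_error \<delta> L i \<omega>\<bar>) \<in> borel_measurable M"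
      unfolding fe unfolding lessThan_atLeast0 by (rule borel_measurable_abs)
    have le: "(\<Sum>k<Suc n * Suc L. G.dt k * (norm (?g k \<omega>))\<^sup>2) \<le> C\<^sup>2 * fine_energy \<delta> (Suc n) L \<omega>" for \<omega>
      unfolding fine_energy_def dt sum_distrib_left
    proof (intro sum_mono)
      fix k
      have "norm (?g k \<omega>) \<le> C * norm (?h k \<omega>)"
        by (rule order_trans[OF Cauchy_Schwarz_ineq2[folded real_norm_def] mult_right_mono[OF c]]) simp
      then have "(norm (?g k \<omega>))\<^sup>2 \<le> (C * norm (?h k \<omega>))\<^sup>2" by (intro power_mono) auto
      then have "?e * (norm (?g k \<omega>))\<^sup>2 \<le> ?e * (C * norm (?h k \<omega>))\<^sup>2" using \<delta> by (intro mult_left_mono) auto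
      also have "\<dots> = C\<^sup>2 * (?e * (norm (?h k \<omega>))\<^sup>2)" by (simp only: power_mult_distrib mult_ac)
      finally show "?e * (norm (?g k \<omega>))\<^sup>2 \<le> C\<^sup>2 * (?e * (norm (?h k \<omega>))\<^sup>2)" .
    qed
    have "prob {\<omega>\<in>space M. \<bar>\<Sum>i<Suc n. c (real i * \<delta>) \<omega> \<bullet> fine_error \<delta> L i \<omega>\<bar> > \<eta>}
      \<le> C\<^sup>2 * \<kappa> / \<eta>\<^sup>2 + prob {\<omega>\<in>space M. (\<Sum>k<Suc n * Suc L. G.dt k * (norm (?g k \<omega>))\<^sup>2) > C\<^sup>2 * \<kappa>}"
      unfolding fe real_norm_def[symmetric] by (rule G.prob_martingale_sum[OF G.noise_id g \<eta>]) (use \<kappa> in simp)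
    also have "prob {\<omega>\<in>space M. (\<Sum>k<Suc n * Suc L. G.dt k * (norm (?g k \<omega>))\<^sup>2) > C\<^sup>2 * \<kappa>} \<le> prob {\<omega>\<in>space M. max_energy T n \<omega> > \<kappa>}"
    proof (rule finite_measure_mono)
      show "{\<omega>\<in>space M. (\<Sum>k<Suc n * Suc L. G.dt k * (norm (?g k \<omega>))\<^sup>2) > C\<^sup>2 * \<kappa>} \<subseteq> {\<omega>\<in>space M. max_energy T n \<omega> > \<kappa>}"
      proof safe
        fix \<omega> assume \<omega>: "\<omega> \<in> space M" "C\<^sup>2 * \<kappa> < (\<Sum>k<Suc n * Suc L. G.dt k * (norm (?g k \<omega>))\<^sup>2)"
        have "C\<^sup>2 * \<kappa> < C\<^sup>2 * fine_energy \<delta> (Suc n) L \<omega>" using \<omega>(2) le[of \<omega>] by linarith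
        then have "\<kappa> < fine_energy \<delta> (Suc n) L \<omega>" by (rule mult_left_less_imp_less) simp
        then show "\<kappa> < max_energy T n \<omega>"
          using max_energy(2)[OF less_imp_le[OF T] \<omega>(1), of n L] unfolding \<delta>_def by linarith
      qed
      show "{\<omega>\<in>space M. max_energy T n \<omega> > \<kappa>} \<in> sets M"
        using null_in_probD(1)[OF max_energy(1)[of T], of n] T by simp
    qed
    finally show "prob {\<omega>\<in>space M. \<bar>\<Sum>i<Suc n. c (real i * \<delta>) \<omega> \<bullet> fine_error \<delta> L i \<omega>\<bar> > \<eta>}
      \<le> C\<^sup>2 * \<kappa> / \<eta>\<^sup>2 + prob {\<omega>\<in>space M. max_energy T n \<omega> > \<kappa>}" by simp
  qed
  have "prob {\<omega>\<in>space M. \<bar>\<Sum>i<Suc n. c (real i * \<delta>) \<omega> \<bullet> ito_error \<delta> i \<omega>\<bar> > \<eta>} \<le> C\<^sup>2 * \<kappa> / \<eta>\<^sup>2 + prob {\<omega>\<in>space M. max_energy T n \<omega> > \<kappa>}"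
  proof (rule prob_greater_limit[OF meas Z])
    show "AE \<omega> in M. (\<lambda>L. \<bar>\<Sum>i<Suc n. c (real i * \<delta>) \<omega> \<bullet> fine_error \<delta> (r L) i \<omega>\<bar>)
        \<longlonglongrightarrow> \<bar>\<Sum>i<Suc n. c (real i * \<delta>) \<omega> \<bullet> ito_error \<delta> i \<omega>\<bar>"
      using r by eventually_elim (intro tendsto_rabs tendsto_sum tendsto_inner tendsto_const, simp)
  qed (rule bound)
  moreover have "prob {\<omega>\<in>space M. max_energy T n \<omega> > \<kappa>} \<le> prob {\<omega>\<in>space M. \<bar>max_energy T n \<omega>\<bar> > \<kappa>}"
    using null_in_probD(1)[OF max_energy(1)[of T], of n] T by (intro finite_measure_mono) auto
  ultimately show "prob {\<omega>\<in>space M. \<bar>\<Sum>i<Suc n. c (real i * (T / real (Suc n))) \<omega> \<bullet> ito_error (T / real (Suc n)) i \<omega>\<bar> > \<eta>}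
      \<le> (C\<^sup>2 / \<eta>\<^sup>2) * \<kappa> + prob {\<omega>\<in>space M. \<bar>max_energy T n \<omega>\<bar> > \<kappa>}"
    unfolding \<delta>_def by (simp del: of_nat_Suc)
qed (use T in simp)

end

lemma uniformly_close:
  fixes f :: "real \<Rightarrow> 'b::real_normed_vector"
  assumes "continuous_on {0..T} f" "\<epsilon> > 0"
  obtains d where "d > 0" "\<And>x y. 0 \<le> x \<Longrightarrow> x \<le> T \<Longrightarrow> 0 \<le> y \<Longrightarrow> y \<le> T \<Longrightarrow> \<bar>y - x\<bar> < d \<Longrightarrow> norm (f y - f x) < \<epsilon>"
proof -
  have "uniformly_continuous_on {0..T} f" using assms(1) by (intro compact_uniformly_continuous) auto
  then obtain d where d: "d > 0" "\<forall>x\<in>{0..T}. \<forall>y\<in>{0..T}. dist y x < d \<longrightarrow> dist (f y) (f x) < \<epsilon>"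
    using assms(2) unfolding uniformly_continuous_on_def by blast
  show ?thesis by (rule that[OF d(1)]) (use d(2) in \<open>auto simp: dist_norm\<close>)
qed

lemma continuous_bounded:
  fixes f :: "real \<Rightarrow> 'b::real_normed_vector"
  assumes "continuous_on {0..T} f"
  obtains B where "B \<ge> 0" "\<And>x. 0 \<le> x \<Longrightarrow> x \<le> T \<Longrightarrow> norm (f x) \<le> B"
proof -
  have "bounded (f ` {0..T})" using assms by (intro compact_imp_bounded compact_continuous_image) auto
  then obtain B where B: "\<forall>x\<in>{0..T}. norm (f x) \<le> B" unfolding bounded_iff by auto
  show ?thesis by (rule that[of "max B 0"]) (use B in \<open>auto intro: max.coboundedI1\<close>)
qed

section \<open>Quadratic variation along uniform meshes\<close>

context brownian
begin

text \<open>The centred squares of the increments have variance \<open>2 \<delta>^2\<close>; summed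
  over T/\<delta> steps against a weight that is bounded along the path, the energy is of order
  \<delta>.\<close>

lemma quadratic_variation_null:
  fixes \<beta> :: "real \<Rightarrow> 'w \<Rightarrow> real"
  assumes T: "T > 0" and \<beta>_F: "\<And>r. 0 \<le> r \<Longrightarrow> \<beta> r \<in> borel_measurable (\<F> r)"
    and cont: "\<And>\<omega>. \<omega> \<in> space M \<Longrightarrow> continuous_on {0..} (\<lambda>r. \<beta> r \<omega>)"
  shows "null_in_prob (\<lambda>n \<omega>. \<Sum>i<Suc n. \<beta> (real i * (T / real (Suc n))) \<omega> *
    ((W (real (Suc i) * (T / real (Suc n))) \<omega> - W (real i * (T / real (Suc n))) \<omega>)\<^sup>2 - T / real (Suc n)))"
    (is "null_in_prob ?Z")
proof -
  let ?\<delta> = "\<lambda>n. T / real (Suc n)"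
  define V where "V n \<omega> = (\<Sum>i<Suc n. 2 * (?\<delta> n)\<^sup>2 * (\<beta> (real i * ?\<delta> n) \<omega>)\<^sup>2)" for n \<omega>
  have \<delta>: "?\<delta> n > 0" for n using T by simp
  have \<beta>M: "\<beta> (real i * ?\<delta> n) \<in> borel_measurable M" for i n
    by (rule F_M[OF \<beta>_F]) (use T in simp_all)
  have WM: "W (real i * ?\<delta> n) \<in> borel_measurable M" for i n
    by (rule W_M) (use T in simp)
  have V_M: "V n \<in> borel_measurable M" for n
    unfolding V_def[abs_def] by (intro borel_measurable_sum borel_measurable_times borel_measurable_power borel_measurable_const \<beta>M)
  have Z_M: "?Z n \<in> borel_measurable M" for n
    by (intro borel_measurable_sum borel_measurable_times borel_measurable_power borel_measurable_const borel_measurable_diff \<beta>M WM)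
  have Vnull: "null_in_prob V"
  proof (rule null_in_prob_AE[OF V_M], rule AE_I2)
    fix \<omega> assume \<omega>: "\<omega> \<in> space M"
    have "continuous_on {0..T} (\<lambda>r. \<beta> r \<omega>)" by (rule continuous_on_subset[OF cont[OF \<omega>]]) auto
    then obtain B where B: "\<And>x. 0 \<le> x \<Longrightarrow> x \<le> T \<Longrightarrow> norm (\<beta> x \<omega>) \<le> B"
      using continuous_bounded by blast
    have V0: "0 \<le> V n \<omega>" for n unfolding V_def by (intro sum_nonneg) auto
    have "V n \<omega> \<le> 2 * T * B\<^sup>2 * ?\<delta> n" for n
    proof -
      have "V n \<omega> \<le> (\<Sum>i<Suc n. 2 * (?\<delta> n)\<^sup>2 * B\<^sup>2)"
        unfolding V_def
      proof (intro sum_mono mult_left_mono)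
        fix i assume i: "i \<in> {..<Suc n}"
        have "real i * ?\<delta> n \<le> real (Suc n) * ?\<delta> n" using i \<delta>[of n] by (intro mult_right_mono) auto
        then have "real i * ?\<delta> n \<le> T" by (simp del: of_nat_Suc)
        then have "\<bar>\<beta> (real i * ?\<delta> n) \<omega>\<bar> \<le> B" using B[of "real i * ?\<delta> n"] T by simp
        then have "\<bar>\<beta> (real i * ?\<delta> n) \<omega>\<bar>\<^sup>2 \<le> B\<^sup>2" by (intro power_mono) auto
        then show "(\<beta> (real i * ?\<delta> n) \<omega>)\<^sup>2 \<le> B\<^sup>2" by simp
      qed simp
      also have "\<dots> = (real (Suc n) * ?\<delta> n) * (2 * B\<^sup>2 * ?\<delta> n)"
        by (simp only: sum_constant card_lessThan power2_eq_square mult_ac)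
      also have "\<dots> = 2 * T * B\<^sup>2 * ?\<delta> n" by (simp del: of_nat_Suc)
      finally show ?thesis .
    qed
    moreover have "(\<lambda>n. 2 * T * B\<^sup>2 * ?\<delta> n) \<longlonglongrightarrow> 2 * T * B\<^sup>2 * 0"
      by (intro tendsto_mult tendsto_const LIMSEQ_Suc[OF lim_const_over_n])
    ultimately show "(\<lambda>n. V n \<omega>) \<longlonglongrightarrow> 0" using V0 by (intro LIMSEQ_0_le[of "\<lambda>n. V n \<omega>"]) auto
  qed
  show ?thesis
  proof (rule null_in_prob_criterion[OF Z_M Vnull])
    fix n and \<eta> \<kappa> :: real assume \<eta>: "\<eta> > 0" and \<kappa>: "\<kappa> > 0"
    interpret G: brownian_grid M \<F> W "\<lambda>k. real k * ?\<delta> n" "Suc n"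
    proof (unfold_locales, goal_cases)
      case (2 i)
      show ?case using \<delta>[of n] by (intro mult_strict_right_mono) simp_all
    qed simp
    have dt: "G.dt k = ?\<delta> n" for k
      unfolding G.dt_def by (simp only: of_nat_Suc[of k] distrib_right mult_1_left add_diff_cancel_right')
    have h: "G.adapted (\<lambda>i. \<beta> (real i * ?\<delta> n))"
      unfolding G.adapted_def by (intro allI impI \<beta>_F) (use T in simp)
    have Zeq: "?Z n \<omega> = (\<Sum>i<Suc n. ((G.dW i \<omega>)\<^sup>2 - G.dt i) *\<^sub>R \<beta> (real i * ?\<delta> n) \<omega>)" for \<omega>
      unfolding dt G.dW_def real_scaleR_def by (intro sum.cong refl mult.commute)
    have Veq: "V n \<omega> = (\<Sum>i<Suc n. 2 * (G.dt i)\<^sup>2 * (norm (\<beta> (real i * ?\<delta> n) \<omega>))\<^sup>2)" for \<omega>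
      unfolding V_def dt by simp
    have "prob {\<omega>\<in>space M. \<bar>?Z n \<omega>\<bar> > \<eta>} \<le> \<kappa> / \<eta>\<^sup>2 + prob {\<omega>\<in>space M. V n \<omega> > \<kappa>}"
      unfolding Zeq Veq real_norm_def[symmetric]
      by (rule G.prob_martingale_sum[OF G.noise_sq h \<eta>]) (use \<kappa> in simp)
    also have "prob {\<omega>\<in>space M. V n \<omega> > \<kappa>} \<le> prob {\<omega>\<in>space M. \<bar>V n \<omega>\<bar> > \<kappa>}"
      using V_M[of n] by (intro finite_measure_mono) auto
    finally show "prob {\<omega>\<in>space M. \<bar>?Z n \<omega>\<bar> > \<eta>} \<le> (1 / \<eta>\<^sup>2) * \<kappa> + prob {\<omega>\<in>space M. \<bar>V n \<omega>\<bar> > \<kappa>}"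
      by simp
  qed
qed

end

section \<open>The pathwise expansion of the logarithm\<close>

text \<open>Cauchy-Schwarz for the cross terms. It serves to discard parts of increments whose
  squares sum to a null sequence.\<close>

lemma perturb_sum_squares:
  fixes p r :: "nat \<Rightarrow> nat \<Rightarrow> 'b::real_inner" and N :: "nat \<Rightarrow> nat"
  assumes p: "(\<lambda>l. \<Sum>i<N l. (norm (p l i))\<^sup>2) \<longlonglongrightarrow> P" and r: "(\<lambda>l. \<Sum>i<N l. (norm (r l i))\<^sup>2) \<longlonglongrightarrow> 0"
  shows "(\<lambda>l. \<Sum>i<N l. (norm (p l i + r l i))\<^sup>2) \<longlonglongrightarrow> P"
proof -
  have 1: "\<bar>\<Sum>i<N l. p l i \<bullet> r l i\<bar> \<le> sqrt (\<Sum>i<N l. (norm (p l i))\<^sup>2) * sqrt (\<Sum>i<N l. (norm (r l i))\<^sup>2)" for l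
  proof -
    have "\<bar>\<Sum>i<N l. p l i \<bullet> r l i\<bar> \<le> (\<Sum>i<N l. \<bar>norm (p l i)\<bar> * \<bar>norm (r l i)\<bar>)"
      by (rule order_trans[OF sum_abs sum_mono]) (simp add: Cauchy_Schwarz_ineq2)
    also have "\<dots> \<le> L2_set (\<lambda>i. norm (p l i)) {..<N l} * L2_set (\<lambda>i. norm (r l i)) {..<N l}"
      by (rule L2_set_mult_ineq)
    finally show ?thesis unfolding L2_set_def .
  qed
  have 2: "(\<lambda>l. sqrt (\<Sum>i<N l. (norm (p l i))\<^sup>2) * sqrt (\<Sum>i<N l. (norm (r l i))\<^sup>2)) \<longlonglongrightarrow> 0"
    using tendsto_mult[OF tendsto_real_sqrt[OF p] tendsto_real_sqrt[OF r]] by simp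
  have "(\<lambda>l. \<Sum>i<N l. p l i \<bullet> r l i) \<longlonglongrightarrow> 0"
    by (rule Lim_null_comparison[OF _ 2], rule always_eventually) (simp add: 1)
  then have 3: "(\<lambda>l. (\<Sum>i<N l. (norm (p l i))\<^sup>2) + 2 * (\<Sum>i<N l. p l i \<bullet> r l i) + (\<Sum>i<N l. (norm (r l i))\<^sup>2)) \<longlonglongrightarrow> P + 2 * 0 + 0"
    by (intro tendsto_add tendsto_mult tendsto_const p r)
  have 4: "(norm (x + y))\<^sup>2 = (norm x)\<^sup>2 + 2 * (x \<bullet> y) + (norm y)\<^sup>2" for x y :: 'b
    unfolding power2_norm_eq_inner by (simp add: inner_simps inner_commute)
  show ?thesis using 3 by (simp add: 4 sum.distrib sum_distrib_left)
qed

text \<open>The expression inside the absolute value has derivative \<open>y^2 / (1 + y)\<close>,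
  which is at most \<open>2 x^2\<close> for |y| \<le> |x| \<le> 1/2.\<close>

lemma ln_one_plus_third_order:
  fixes x :: real
  assumes x: "\<bar>x\<bar> \<le> 1/2"
  shows "\<bar>ln (1 + x) - x + x\<^sup>2 / 2\<bar> \<le> 2 * \<bar>x\<bar> * x\<^sup>2"
proof -
  define g where "g y = ln (1 + y) - y + y\<^sup>2 / 2" for y :: real
  have g0: "g 0 = 0" by (simp add: g_def)
  have der: "(g has_field_derivative y\<^sup>2 / (1 + y)) (at y within {- \<bar>x\<bar>..\<bar>x\<bar>})" if "y \<in> {- \<bar>x\<bar>..\<bar>x\<bar>}" for y
    unfolding g_def
    by (rule derivative_eq_intros refl | use that x in \<open>simp add: power2_eq_square field_simps\<close>)+
  have bd: "norm (y\<^sup>2 / (1 + y)) \<le> 2 * x\<^sup>2" if y: "y \<in> {- \<bar>x\<bar>..\<bar>x\<bar>}" for y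
  proof -
    have "y\<^sup>2 \<le> x\<^sup>2" using y by (intro abs_le_square_iff[THEN iffD1]) auto
    moreover have "1 / (1 + y) \<le> 2" using y x by (simp add: field_simps)
    moreover have "1 + y > 0" using y x by auto
    ultimately have "y\<^sup>2 * (1 / (1 + y)) \<le> x\<^sup>2 * 2" by (intro mult_mono) auto
    then show ?thesis using \<open>1 + y > 0\<close> by simp
  qed
  have "norm (g x - g 0) \<le> 2 * x\<^sup>2 * norm (x - 0)"
    by (rule field_differentiable_bound[OF _ der bd]) auto
  then show ?thesis unfolding g0 by (simp add: g_def mult_ac)
qed

text \<open>Meshes are indexed by an arbitrary sequence N tending to infinity, because the error
  sums converge almost surely only along subsequences.\<close>

context
  fixes T :: real and N :: "nat \<Rightarrow> nat" and \<delta> :: "nat \<Rightarrow> real"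
  assumes T: "T > 0" and N: "\<And>l. N l > 0" "filterlim N at_top sequentially"
  defines "\<delta> \<equiv> \<lambda>l. T / real (N l)"
begin

lemma \<delta>_pos: "\<delta> l > 0" using T N(1)[of l] by (simp add: \<delta>_def)

lemma N_\<delta>: "real (N l) * \<delta> l = T" using N(1)[of l] by (simp add: \<delta>_def)

lemma \<delta>_lim: "\<delta> \<longlonglongrightarrow> 0"
  unfolding \<delta>_def by (rule filterlim_compose[OF lim_const_over_n N(2)])

lemma mesh_point: "i \<le> N l \<Longrightarrow> 0 \<le> real i * \<delta> l \<and> real i * \<delta> l \<le> T"
  using \<delta>_pos[of l] mult_right_mono[of "real i" "real (N l)" "\<delta> l"] by (simp add: N_\<delta>)

lemma mesh_Suc: "real (Suc i) * \<delta> l - real i * \<delta> l = \<delta> l"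
  by (simp add: algebra_simps)

lemma mesh_oscillation:
  fixes f :: "real \<Rightarrow> 'b::real_normed_vector"
  assumes f: "continuous_on {0..T} f" and e: "\<epsilon> > 0"
  shows "\<forall>\<^sub>F l in sequentially. \<forall>i<N l. \<forall>x\<in>{real i * \<delta> l..real (Suc i) * \<delta> l}. norm (f x - f (real i * \<delta> l)) < \<epsilon>"
proof -
  obtain d where d: "d > 0" "\<And>x y. 0 \<le> x \<Longrightarrow> x \<le> T \<Longrightarrow> 0 \<le> y \<Longrightarrow> y \<le> T \<Longrightarrow> \<bar>y - x\<bar> < d \<Longrightarrow> norm (f y - f x) < \<epsilon>"
    using uniformly_close[OF f e] by blast
  have "\<forall>\<^sub>F l in sequentially. \<delta> l < d" using \<delta>_lim d(1) by (rule order_tendstoD)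
  then show ?thesis
  proof (eventually_elim, intro allI impI ballI)
    fix l i x assume l: "\<delta> l < d" "i < N l" "x \<in> {real i * \<delta> l..real (Suc i) * \<delta> l}"
    show "norm (f x - f (real i * \<delta> l)) < \<epsilon>"
    proof (rule d(2))
      show "\<bar>x - real i * \<delta> l\<bar> < d" using l mesh_Suc[of i l] by auto
      show "0 \<le> x" "x \<le> T" "0 \<le> real i * \<delta> l" "real i * \<delta> l \<le> T"
        using l mesh_point[of i l] mesh_point[of "Suc i" l] by auto
    qed
  qed
qed

lemma riemann_sum_limit:
  fixes g :: "real \<Rightarrow> real"
  assumes g: "continuous_on {0..T} g"
  shows "(\<lambda>l. \<Sum>i<N l. \<delta> l * g (real i * \<delta> l)) \<longlonglongrightarrow> integral {0..T} g"
proof (rule LIMSEQ_I)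
  fix r :: real assume r: "0 < r"
  define \<epsilon> where "\<epsilon> = r / (2 * T)"
  have \<epsilon>: "\<epsilon> > 0" using r T by (simp add: \<epsilon>_def)
  obtain L where L: "\<And>l i x. l \<ge> L \<Longrightarrow> i < N l \<Longrightarrow> x \<in> {real i * \<delta> l..real (Suc i) * \<delta> l} \<Longrightarrow> norm (g x - g (real i * \<delta> l)) < \<epsilon>"
    using mesh_oscillation[OF g \<epsilon>] unfolding eventually_sequentially by blast
  have "norm ((\<Sum>i<N l. \<delta> l * g (real i * \<delta> l)) - integral {0..T} g) < r" if l: "l \<ge> L" for l
  proof -
    have int: "g integrable_on {x..y}" if "0 \<le> x" "y \<le> T" for x y
      by (rule integrable_continuous_interval[OF continuous_on_subset[OF g]]) (use that in auto)
    have "\<bar>(\<Sum>i<k. \<delta> l * g (real i * \<delta> l)) - integral {0..real k * \<delta> l} g\<bar> \<le> real k * (\<delta> l * \<epsilon>)" if "k \<le> N l" for k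
      using that
    proof (induction k)
      case (Suc k)
      let ?a = "real k * \<delta> l" and ?b = "real (Suc k) * \<delta> l"
      have ab: "0 \<le> ?a" "?a \<le> ?b" "?b \<le> T" "?b - ?a = \<delta> l"
        using mesh_point[of k l] mesh_point[of "Suc k" l] mesh_Suc[of k l] \<delta>_pos[of l] Suc.prems by auto
      have 1: "integral {0..?b} g = integral {0..?a} g + integral {?a..?b} g"
        by (rule Henstock_Kurzweil_Integration.integral_combine[symmetric, OF ab(1,2) int]) (use ab in auto)
      have "norm (integral {?a..?b} (\<lambda>x. g x - g ?a)) \<le> \<epsilon> * (?b - ?a)"
      proof (rule integral_bound[OF ab(2)])
        show "continuous_on {?a..?b} (\<lambda>x. g x - g ?a)"
          by (intro continuous_on_diff continuous_on_const continuous_on_subset[OF g]) (use ab in auto)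
        fix x assume "x \<in> {?a..?b}"
        then show "norm (g x - g ?a) \<le> \<epsilon>" using L[OF l, of k x] Suc.prems by linarith
      qed
      moreover have "integral {?a..?b} (\<lambda>x. g x - g ?a) = integral {?a..?b} g - \<delta> l * g ?a"
        using int[of ?a ?b] ab by (subst Henstock_Kurzweil_Integration.integral_diff) auto
      ultimately have 2: "\<bar>integral {?a..?b} g - \<delta> l * g ?a\<bar> \<le> \<delta> l * \<epsilon>" using ab(4) by (simp add: mult.commute)
      have 3: "real (Suc k) * (\<delta> l * \<epsilon>) = real k * (\<delta> l * \<epsilon>) + \<delta> l * \<epsilon>" by (simp add: algebra_simps)
      have "\<bar>(\<Sum>i<k. \<delta> l * g (real i * \<delta> l)) - integral {0..real k * \<delta> l} g\<bar> \<le> real k * (\<delta> l * \<epsilon>)" using Suc by simp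
      then show ?case using 2 unfolding 1 3 sum.lessThan_Suc by linarith
    qed simp
    from this[of "N l"] have "\<bar>(\<Sum>i<N l. \<delta> l * g (real i * \<delta> l)) - integral {0..T} g\<bar> \<le> T * \<epsilon>"
      by (simp add: N_\<delta> mult.assoc[symmetric])
    also have "\<dots> < r" using r T by (simp add: \<epsilon>_def)
    finally show ?thesis by simp
  qed
  then show "\<exists>no. \<forall>n\<ge>no. norm ((\<Sum>i<N n. \<delta> n * g (real i * \<delta> n)) - integral {0..T} g) < r" by blast
qed

text \<open>One factor \<delta> is left over after a convergent Riemann sum has been split
  off.\<close>

lemma sum_delta_square_null:
  fixes a :: "real \<Rightarrow> 'b::real_normed_vector"
  assumes a: "continuous_on {0..T} a"
  shows "(\<lambda>l. \<Sum>i<N l. (norm (\<delta> l *\<^sub>R a (real i * \<delta> l)))\<^sup>2) \<longlonglongrightarrow> 0"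
proof -
  have "continuous_on {0..T} (\<lambda>r. (norm (a r))\<^sup>2)" by (intro continuous_intros a)
  from tendsto_mult[OF \<delta>_lim riemann_sum_limit[OF this]]
  have "(\<lambda>l. \<delta> l * (\<Sum>i<N l. \<delta> l * (norm (a (real i * \<delta> l)))\<^sup>2)) \<longlonglongrightarrow> 0" by simp
  then show ?thesis
    using \<delta>_pos by (simp add: sum_distrib_left power_mult_distrib power2_eq_square mult_ac abs_of_pos)
qed

text \<open>Second-order Taylor expansion of the logarithm along the mesh, in deterministic form: h1
  to h4 are all that is used of the noise. It is solved for the martingale sum, since that sum
  stands in the exponent of the grid martingale.\<close>

theorem log_norm_expansion:
  fixes X b a :: "real \<Rightarrow> 'b::real_inner" and w :: "real \<Rightarrow> real" and e :: "nat \<Rightarrow> nat \<Rightarrow> 'b" and \<epsilon> :: real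
  assumes \<epsilon>: "\<epsilon> > 0" and X: "continuous_on {0..T} X" and b: "continuous_on {0..T} b" and a: "continuous_on {0..T} a"
  defines "\<gamma> \<equiv> \<lambda>r. 1 / (\<epsilon> + (norm (X r))\<^sup>2)"
    and "dw \<equiv> \<lambda>l i. w (real (Suc i) * \<delta> l) - w (real i * \<delta> l)"
    and "t \<equiv> \<lambda>l i. real i * \<delta> l"
  assumes inc: "\<And>l i. i < N l \<Longrightarrow> X (t l (Suc i)) - X (t l i) = \<delta> l *\<^sub>R a (t l i) + dw l i *\<^sub>R b (t l i) + e l i"
    and h1: "(\<lambda>l. \<Sum>i<N l. 2 * \<gamma> (t l i) * (X (t l i) \<bullet> e l i)) \<longlonglongrightarrow> 0"
    and h2: "(\<lambda>l. \<Sum>i<N l. (norm (e l i))\<^sup>2) \<longlonglongrightarrow> 0"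
    and h3: "(\<lambda>l. \<Sum>i<N l. \<gamma> (t l i) * (norm (b (t l i)))\<^sup>2 * ((dw l i)\<^sup>2 - \<delta> l)) \<longlonglongrightarrow> 0"
    and h4: "(\<lambda>l. \<Sum>i<N l. (\<gamma> (t l i))\<^sup>2 * (X (t l i) \<bullet> b (t l i))\<^sup>2 * ((dw l i)\<^sup>2 - \<delta> l)) \<longlonglongrightarrow> 0"
  shows "(\<lambda>l. \<Sum>i<N l. 2 * \<gamma> (t l i) * (X (t l i) \<bullet> b (t l i)) * dw l i) \<longlonglongrightarrow>
    ln (\<epsilon> + (norm (X T))\<^sup>2) - ln (\<epsilon> + (norm (X 0))\<^sup>2)
      - integral {0..T} (\<lambda>r. 2 * \<gamma> r * (X r \<bullet> a r) + \<gamma> r * (norm (b r))\<^sup>2 - 2 * (\<gamma> r)\<^sup>2 * (X r \<bullet> b r)\<^sup>2)"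
proof -
  have den: "\<epsilon> + (norm (X r))\<^sup>2 > 0" for r using \<epsilon> by (simp add: add_pos_nonneg)
  have \<gamma>_pos: "\<gamma> r > 0" for r unfolding \<gamma>_def using den by simp
  have \<gamma>_le: "\<gamma> r \<le> 1 / \<epsilon>" for r unfolding \<gamma>_def using \<epsilon> den[of r] by (intro divide_left_mono mult_pos_pos) auto
  have \<gamma>_cont: "continuous_on {0..T} \<gamma>"
    unfolding \<gamma>_def using den by (intro continuous_intros X) (simp add: less_imp_neq[symmetric])
  have t_in: "0 \<le> t l i" "t l i \<le> T" if "i \<le> N l" for l i using mesh_point[OF that] by (auto simp: t_def)
  obtain Xm where Xm: "Xm \<ge> 0" "\<And>x. 0 \<le> x \<Longrightarrow> x \<le> T \<Longrightarrow> norm (X x) \<le> Xm"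
    using continuous_bounded[OF X] by blast
  \<comment> \<open>Here d is the full increment, q its noise part and f the rest, whose squares sum
    to a null sequence.\<close>
  define d where "d l i = X (t l (Suc i)) - X (t l i)" for l i
  define q where "q l i = dw l i *\<^sub>R b (t l i)" for l i
  define f where "f l i = \<delta> l *\<^sub>R a (t l i) + e l i" for l i
  have d_eq: "d l i = q l i + f l i" if "i < N l" for l i
    unfolding d_def q_def f_def inc[OF that] by simp
  have F: "(\<lambda>l. \<Sum>i<N l. (norm (f l i))\<^sup>2) \<longlonglongrightarrow> 0"
    unfolding f_def by (rule perturb_sum_squares[OF _ h2]) (use sum_delta_square_null[OF a] in \<open>simp add: t_def\<close>)
  let ?Ib = "integral {0..T} (\<lambda>r. \<gamma> r * (norm (b r))\<^sup>2)"
  let ?Iq = "integral {0..T} (\<lambda>r. (\<gamma> r)\<^sup>2 * (X r \<bullet> b r)\<^sup>2)"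
  let ?Ia = "integral {0..T} (\<lambda>r. 2 * \<gamma> r * (X r \<bullet> a r))"
  have cb: "continuous_on {0..T} (\<lambda>r. \<gamma> r * (norm (b r))\<^sup>2)" by (intro continuous_intros \<gamma>_cont b)
  have cq: "continuous_on {0..T} (\<lambda>r. (\<gamma> r)\<^sup>2 * (X r \<bullet> b r)\<^sup>2)" by (intro continuous_intros \<gamma>_cont b X)
  have ca: "continuous_on {0..T} (\<lambda>r. 2 * \<gamma> r * (X r \<bullet> a r))" by (intro continuous_intros \<gamma>_cont a X)
  \<comment> \<open>The square root of \<gamma> is moved into the vectors, so that
    \<open>perturb_sum_squares\<close> also covers the weighted sums.\<close>
  have Qg: "(\<lambda>l. \<Sum>i<N l. (norm (sqrt (\<gamma> (t l i)) *\<^sub>R q l i))\<^sup>2) \<longlonglongrightarrow> ?Ib"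
  proof -
    have "(\<lambda>l. (\<Sum>i<N l. \<gamma> (t l i) * (norm (b (t l i)))\<^sup>2 * ((dw l i)\<^sup>2 - \<delta> l))
        + (\<Sum>i<N l. \<delta> l * (\<gamma> (t l i) * (norm (b (t l i)))\<^sup>2))) \<longlonglongrightarrow> 0 + ?Ib"
      using riemann_sum_limit[OF cb] by (intro tendsto_add h3) (simp add: t_def)
    moreover have "(norm (sqrt (\<gamma> (t l i)) *\<^sub>R q l i))\<^sup>2 = \<gamma> (t l i) * (norm (b (t l i)))\<^sup>2 * ((dw l i)\<^sup>2 - \<delta> l)
        + \<delta> l * (\<gamma> (t l i) * (norm (b (t l i)))\<^sup>2)" for l i
      using less_imp_le[OF \<gamma>_pos[of "t l i"]] by (simp add: q_def power_mult_distrib algebra_simps)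
    ultimately show ?thesis by (simp add: sum.distrib)
  qed
  have Fg: "(\<lambda>l. \<Sum>i<N l. (norm (sqrt (\<gamma> (t l i)) *\<^sub>R f l i))\<^sup>2) \<longlonglongrightarrow> 0"
  proof (rule LIMSEQ_0_le)
    show "(\<lambda>l. 1 / \<epsilon> * (\<Sum>i<N l. (norm (f l i))\<^sup>2)) \<longlonglongrightarrow> 0"
      using tendsto_mult_left[OF F, of "1 / \<epsilon>"] by simp
    show "(\<Sum>i<N l. (norm (sqrt (\<gamma> (t l i)) *\<^sub>R f l i))\<^sup>2) \<le> 1 / \<epsilon> * (\<Sum>i<N l. (norm (f l i))\<^sup>2)" for l
      unfolding sum_distrib_left
    proof (intro sum_mono)
      fix i
      have "(norm (sqrt (\<gamma> (t l i)) *\<^sub>R f l i))\<^sup>2 = \<gamma> (t l i) * (norm (f l i))\<^sup>2"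
        using less_imp_le[OF \<gamma>_pos[of "t l i"]] by (simp add: power_mult_distrib)
      also have "\<dots> \<le> 1 / \<epsilon> * (norm (f l i))\<^sup>2" by (intro mult_right_mono \<gamma>_le) simp
      finally show "(norm (sqrt (\<gamma> (t l i)) *\<^sub>R f l i))\<^sup>2 \<le> 1 / \<epsilon> * (norm (f l i))\<^sup>2" .
    qed
  qed (simp add: sum_nonneg)
  have Dg: "(\<lambda>l. \<Sum>i<N l. \<gamma> (t l i) * (norm (d l i))\<^sup>2) \<longlonglongrightarrow> ?Ib"
  proof -
    have "(norm (sqrt (\<gamma> (t l i)) *\<^sub>R q l i + sqrt (\<gamma> (t l i)) *\<^sub>R f l i))\<^sup>2 = \<gamma> (t l i) * (norm (d l i))\<^sup>2"
      if "i < N l" for l i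
      unfolding scaleR_right_distrib[symmetric] d_eq[OF that, symmetric]
      using less_imp_le[OF \<gamma>_pos[of "t l i"]] by (simp add: power_mult_distrib)
    then show ?thesis using perturb_sum_squares[OF Qg Fg] by simp
  qed
  have small: "\<forall>\<^sub>F l in sequentially. \<forall>i<N l. norm (d l i) < c" if "c > 0" for c
    using mesh_oscillation[OF X that]
  proof (eventually_elim, intro allI impI)
    fix l i assume *: "\<forall>i<N l. \<forall>x\<in>{real i * \<delta> l..real (Suc i) * \<delta> l}. norm (X x - X (real i * \<delta> l)) < c" and i: "i < N l"
    have "real (Suc i) * \<delta> l \<in> {real i * \<delta> l..real (Suc i) * \<delta> l}"
      using mesh_Suc[of i l] \<delta>_pos[of l] by simp
    then show "norm (d l i) < c" using * i unfolding d_def t_def by blast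
  qed
  \<comment> \<open>The relative increment of \<open>\<epsilon> + |X|^2\<close>; the logarithms of
    \<open>1 + x\<close> therefore telescope.\<close>
  define x where "x l i = \<gamma> (t l i) * (2 * (X (t l i) \<bullet> d l i) + (norm (d l i))\<^sup>2)" for l i
  have x_ratio: "\<epsilon> + (norm (X (t l (Suc i))))\<^sup>2 = (\<epsilon> + (norm (X (t l i)))\<^sup>2) * (1 + x l i)" for l i
  proof -
    have "X (t l (Suc i)) = X (t l i) + d l i" by (simp add: d_def)
    then have "(norm (X (t l (Suc i))))\<^sup>2 = (norm (X (t l i)))\<^sup>2 + (2 * (X (t l i) \<bullet> d l i) + (norm (d l i))\<^sup>2)"
      unfolding power2_norm_eq_inner by (simp add: inner_simps inner_commute)
    then show ?thesis using den[of "t l i"] unfolding x_def \<gamma>_def by (simp add: field_simps)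
  qed
  have x_bound: "\<bar>x l i\<bar> \<le> (2 * Xm + norm (d l i)) / \<epsilon> * norm (d l i)" if "i < N l" for l i
  proof -
    have "\<bar>2 * (X (t l i) \<bullet> d l i) + (norm (d l i))\<^sup>2\<bar> \<le> 2 * (norm (X (t l i)) * norm (d l i)) + (norm (d l i))\<^sup>2"
      using Cauchy_Schwarz_ineq2[of "X (t l i)" "d l i"] zero_le_power2[of "norm (d l i)"] by linarith
    also have "\<dots> \<le> 2 * (Xm * norm (d l i)) + (norm (d l i))\<^sup>2"
      using Xm(2)[of "t l i"] t_in[of i l] that by (intro add_right_mono mult_left_mono mult_right_mono) auto
    finally have *: "\<bar>2 * (X (t l i) \<bullet> d l i) + (norm (d l i))\<^sup>2\<bar> \<le> (2 * Xm + norm (d l i)) * norm (d l i)"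
      by (simp add: power2_eq_square algebra_simps)
    have "\<bar>x l i\<bar> \<le> 1 / \<epsilon> * ((2 * Xm + norm (d l i)) * norm (d l i))"
      unfolding x_def abs_mult using \<gamma>_le[of "t l i"] \<gamma>_pos[of "t l i"] * \<epsilon> by (intro mult_mono) auto
    then show ?thesis by simp
  qed
  have x_small: "\<forall>\<^sub>F l in sequentially. \<forall>i<N l. \<bar>x l i\<bar> < c" if c: "c > 0" for c
  proof -
    \<comment> \<open>The bound 1 replaces the factor \<open>2 Xm + |d|\<close> by
      \<open>2 Xm + 1\<close>; the second bound then gives |x| \<le> c/2.\<close>
    define h where "h = min 1 (c * \<epsilon> / (2 * Xm + 1) / 2)"
    have h: "h > 0" "h \<le> 1" "h \<le> c * \<epsilon> / (2 * Xm + 1) / 2" using c \<epsilon> Xm by (auto simp: h_def)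
    show ?thesis using small[OF h(1)]
    proof (eventually_elim, intro allI impI)
      fix l i assume *: "\<forall>i<N l. norm (d l i) < h" and i: "i < N l"
      have dh: "norm (d l i) < h" using * i by blast
      have "(2 * Xm + norm (d l i)) / \<epsilon> * norm (d l i) \<le> (2 * Xm + 1) / \<epsilon> * h"
        using dh h \<epsilon> Xm by (intro mult_mono divide_right_mono) auto
      also have "\<dots> \<le> (2 * Xm + 1) / \<epsilon> * (c * \<epsilon> / (2 * Xm + 1) / 2)"
        using h \<epsilon> Xm by (intro mult_left_mono) auto
      also have "\<dots> = c / 2" using \<epsilon> Xm(1) by (simp add: field_simps add_nonneg_eq_0_iff)
      also have "\<dots> < c" using c by simp
      finally show "\<bar>x l i\<bar> < c" using x_bound[OF i] by linarith
    qed
  qed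
  \<comment> \<open>The martingale part of x, which alone determines the limit of the sum of
    squares; r collects all other terms.\<close>
  define p where "p l i = 2 * \<gamma> (t l i) * (X (t l i) \<bullet> b (t l i)) * dw l i" for l i
  define r where "r l i = x l i - p l i" for l i
  have P2: "(\<lambda>l. \<Sum>i<N l. (norm (p l i))\<^sup>2) \<longlonglongrightarrow> 4 * ?Iq"
  proof -
    have "(\<lambda>l. 4 * (\<Sum>i<N l. (\<gamma> (t l i))\<^sup>2 * (X (t l i) \<bullet> b (t l i))\<^sup>2 * ((dw l i)\<^sup>2 - \<delta> l))
        + 4 * (\<Sum>i<N l. \<delta> l * ((\<gamma> (t l i))\<^sup>2 * (X (t l i) \<bullet> b (t l i))\<^sup>2))) \<longlonglongrightarrow> 4 * 0 + 4 * ?Iq"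
      using riemann_sum_limit[OF cq] by (intro tendsto_add tendsto_mult tendsto_const h4) (simp add: t_def)
    moreover have "(norm (p l i))\<^sup>2 = 4 * ((\<gamma> (t l i))\<^sup>2 * (X (t l i) \<bullet> b (t l i))\<^sup>2 * ((dw l i)\<^sup>2 - \<delta> l))
        + 4 * (\<delta> l * ((\<gamma> (t l i))\<^sup>2 * (X (t l i) \<bullet> b (t l i))\<^sup>2))" for l i
      by (simp add: p_def power_mult_distrib algebra_simps)
    ultimately show ?thesis by (simp add: sum.distrib sum_distrib_left)
  qed
  \<comment> \<open>The term with f is null in square sum. For the term
    \<open>\<gamma> |d|^2\<close>, the largest |d|^2 tends to 0 and is pulled out of a bounded
    sum.\<close>
  have R2: "(\<lambda>l. \<Sum>i<N l. (norm (r l i))\<^sup>2) \<longlonglongrightarrow> 0"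
  proof -
    let ?F = "\<lambda>l. \<Sum>i<N l. (norm (f l i))\<^sup>2" and ?D = "\<lambda>l. \<Sum>i<N l. \<gamma> (t l i) * (norm (d l i))\<^sup>2"
    define C where "C = 2 * (2 * Xm / \<epsilon>)\<^sup>2"
    have r_eq: "r l i = 2 * \<gamma> (t l i) * (X (t l i) \<bullet> f l i) + \<gamma> (t l i) * (norm (d l i))\<^sup>2" if "i < N l" for l i
    proof -
      have "X (t l i) \<bullet> d l i = (X (t l i) \<bullet> b (t l i)) * dw l i + X (t l i) \<bullet> f l i"
        unfolding d_eq[OF that] by (simp add: q_def inner_right_distrib)
      then show ?thesis unfolding r_def x_def p_def by (simp add: algebra_simps)
    qed
    have r_le: "(norm (r l i))\<^sup>2 \<le> C * (norm (f l i))\<^sup>2 + 2 / \<epsilon> * (norm (d l i))\<^sup>2 * (\<gamma> (t l i) * (norm (d l i))\<^sup>2)" if i: "i < N l" for l i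
    proof -
      have "\<bar>2 * \<gamma> (t l i) * (X (t l i) \<bullet> f l i)\<bar> \<le> 2 * (1 / \<epsilon>) * (Xm * norm (f l i))"
        unfolding abs_mult
      proof (intro mult_mono)
        show "\<bar>X (t l i) \<bullet> f l i\<bar> \<le> Xm * norm (f l i)"
          using Cauchy_Schwarz_ineq2[of "X (t l i)" "f l i"] mult_right_mono[OF Xm(2)[of "t l i"], of "norm (f l i)"] t_in[of i l] i
          by auto
      qed (use \<gamma>_le[of "t l i"] \<gamma>_pos[of "t l i"] \<epsilon> Xm in auto)
      then have "\<bar>2 * \<gamma> (t l i) * (X (t l i) \<bullet> f l i)\<bar> \<le> (2 * Xm / \<epsilon>) * norm (f l i)" by (simp add: field_simps)
      then have "\<bar>2 * \<gamma> (t l i) * (X (t l i) \<bullet> f l i)\<bar>\<^sup>2 \<le> ((2 * Xm / \<epsilon>) * norm (f l i))\<^sup>2" by (intro power_mono) auto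
      then have 1: "(norm (2 * \<gamma> (t l i) * (X (t l i) \<bullet> f l i)))\<^sup>2 \<le> (2 * Xm / \<epsilon>)\<^sup>2 * (norm (f l i))\<^sup>2"
        by (simp only: power_mult_distrib[of "2 * Xm / \<epsilon>"] real_norm_def)
      have "\<gamma> (t l i) * (\<gamma> (t l i) * ((norm (d l i))\<^sup>2 * (norm (d l i))\<^sup>2)) \<le> 1 / \<epsilon> * (\<gamma> (t l i) * ((norm (d l i))\<^sup>2 * (norm (d l i))\<^sup>2))"
        using \<gamma>_le[of "t l i"] \<gamma>_pos[of "t l i"] by (intro mult_right_mono) auto
      then have 2: "(norm (\<gamma> (t l i) * (norm (d l i))\<^sup>2))\<^sup>2 \<le> 1 / \<epsilon> * (norm (d l i))\<^sup>2 * (\<gamma> (t l i) * (norm (d l i))\<^sup>2)"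
        by (simp add: power2_eq_square mult_ac)
      show ?thesis unfolding r_eq[OF i] C_def
        using norm_add_sq_le[of "2 * \<gamma> (t l i) * (X (t l i) \<bullet> f l i)" "\<gamma> (t l i) * (norm (d l i))\<^sup>2"] 1 2
        by (simp add: algebra_simps)
    qed
    obtain K where K: "\<And>l. ?D l \<le> K"
      using convergent_imp_Bseq[OF convergentI[OF Dg]] unfolding Bseq_def by (metis abs_le_D1 real_norm_def)
    have K0: "K \<ge> 0"
      by (intro order_trans[OF _ K[of 0]] sum_nonneg mult_nonneg_nonneg less_imp_le[OF \<gamma>_pos] zero_le_power2)
    have "(\<lambda>l. \<Sum>i<N l. (norm (r l i))\<^sup>2) \<longlonglongrightarrow> 0"
    proof (rule LIMSEQ_I)
      fix h :: real assume h: "0 < h"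
      \<comment> \<open>Chosen so that \<open>2 / \<epsilon> * c^2 * K\<close> is at most
        h/2.\<close>
      define c where "c = sqrt (h * \<epsilon> / (4 * (K + 1)))"
      have c: "c > 0" "c\<^sup>2 = h * \<epsilon> / (4 * (K + 1))" using h \<epsilon> K0 by (auto simp: c_def)
      have "(\<lambda>l. C * ?F l) \<longlonglongrightarrow> 0" using tendsto_mult_left[OF F, of C] by simp
      then have "\<forall>\<^sub>F l in sequentially. C * ?F l < h / 2" using h by (intro order_tendstoD) auto
      then have "\<forall>\<^sub>F l in sequentially. norm ((\<Sum>i<N l. (norm (r l i))\<^sup>2) - 0) < h"
        using small[OF c(1)]
      proof eventually_elim
        fix l assume l1: "C * ?F l < h / 2" and l2: "\<forall>i<N l. norm (d l i) < c"
        have "(\<Sum>i<N l. (norm (r l i))\<^sup>2) \<le> (\<Sum>i<N l. C * (norm (f l i))\<^sup>2 + 2 / \<epsilon> * c\<^sup>2 * (\<gamma> (t l i) * (norm (d l i))\<^sup>2))"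
        proof (intro sum_mono)
          fix i assume i: "i \<in> {..<N l}"
          have "(norm (d l i))\<^sup>2 \<le> c\<^sup>2" using l2 i by (intro power_mono) (auto intro: less_imp_le)
          then have "2 / \<epsilon> * (norm (d l i))\<^sup>2 * (\<gamma> (t l i) * (norm (d l i))\<^sup>2) \<le> 2 / \<epsilon> * c\<^sup>2 * (\<gamma> (t l i) * (norm (d l i))\<^sup>2)"
            using \<epsilon> \<gamma>_pos[of "t l i"] by (intro mult_right_mono mult_left_mono) auto
          then show "(norm (r l i))\<^sup>2 \<le> C * (norm (f l i))\<^sup>2 + 2 / \<epsilon> * c\<^sup>2 * (\<gamma> (t l i) * (norm (d l i))\<^sup>2)"
            using r_le[of i l] i by simp
        qed
        also have "\<dots> = C * ?F l + 2 / \<epsilon> * c\<^sup>2 * ?D l" by (simp add: sum.distrib sum_distrib_left)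
        also have "2 / \<epsilon> * c\<^sup>2 * ?D l \<le> 2 / \<epsilon> * c\<^sup>2 * K" using \<epsilon> K by (intro mult_left_mono) auto
        also have "2 / \<epsilon> * c\<^sup>2 * K = h / 2 * (K / (K + 1))" unfolding c(2) using \<epsilon> K0 by (auto simp: divide_simps)
        also have "\<dots> \<le> h / 2 * 1" using h K0 by (intro mult_left_mono) auto
        finally show "norm ((\<Sum>i<N l. (norm (r l i))\<^sup>2) - 0) < h" using l1 by (simp add: sum_nonneg)
      qed
      then show "\<exists>no. \<forall>n\<ge>no. norm ((\<Sum>i<N n. (norm (r n i))\<^sup>2) - 0) < h" by (simp add: eventually_sequentially)
    qed
    then show ?thesis .
  qed
  have X2: "(\<lambda>l. \<Sum>i<N l. (x l i)\<^sup>2) \<longlonglongrightarrow> 4 * ?Iq"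
    using perturb_sum_squares[OF P2 R2] by (simp add: r_def)
  \<comment> \<open>The third-order remainder, at most the largest |x| times a bounded sum of
    squares, up to a constant.\<close>
  define \<rho> where "\<rho> l i = ln (1 + x l i) - x l i + (x l i)\<^sup>2 / 2" for l i
  have rho: "(\<lambda>l. \<Sum>i<N l. \<rho> l i) \<longlonglongrightarrow> 0"
  proof -
    obtain K where K: "\<And>l. (\<Sum>i<N l. (x l i)\<^sup>2) \<le> K"
      using convergent_imp_Bseq[OF convergentI[OF X2]] unfolding Bseq_def by (metis abs_le_D1 real_norm_def)
    have K0: "K \<ge> 0" by (rule order_trans[OF _ K[of 0]]) (simp add: sum_nonneg)
    show ?thesis
    proof (rule LIMSEQ_I)
      fix h :: real assume h: "0 < h"
      define c where "c = min (1/2) (h / (4 * (K + 1)))"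
      have c: "c > 0" unfolding c_def using h K0 by simp
      have c2: "c \<le> 1/2" "c \<le> h / (4 * (K + 1))"
        unfolding c_def by (rule min.cobounded1, rule min.cobounded2)
      have "\<forall>\<^sub>F l in sequentially. norm ((\<Sum>i<N l. \<rho> l i) - 0) < h"
        using x_small[OF c]
      proof eventually_elim
        fix l assume l: "\<forall>i<N l. \<bar>x l i\<bar> < c"
        have "\<bar>\<Sum>i<N l. \<rho> l i\<bar> \<le> (\<Sum>i<N l. 2 * c * (x l i)\<^sup>2)"
        proof (rule order_trans[OF sum_abs sum_mono])
          fix i assume i: "i \<in> {..<N l}"
          have "\<bar>\<rho> l i\<bar> \<le> 2 * \<bar>x l i\<bar> * (x l i)\<^sup>2"
            unfolding \<rho>_def using l i c2 by (intro ln_one_plus_third_order) (meson less_imp_le lessThan_iff order_trans)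
          also have "\<dots> \<le> 2 * c * (x l i)\<^sup>2" using l i by (intro mult_right_mono mult_left_mono) (auto intro: less_imp_le)
          finally show "\<bar>\<rho> l i\<bar> \<le> 2 * c * (x l i)\<^sup>2" .
        qed
        also have "\<dots> = 2 * c * (\<Sum>i<N l. (x l i)\<^sup>2)" by (simp add: sum_distrib_left)
        also have "\<dots> \<le> 2 * (h / (4 * (K + 1))) * K" using c c2 K K0 h by (intro mult_mono) (auto simp: sum_nonneg)
        also have "\<dots> = h / 2 * (K / (K + 1))" using K0 by (auto simp: divide_simps)
        also have "\<dots> \<le> h / 2 * 1" using h K0 by (intro mult_left_mono) auto
        finally show "norm ((\<Sum>i<N l. \<rho> l i) - 0) < h" using h by simp
      qed
      then show "\<exists>no. \<forall>n\<ge>no. norm ((\<Sum>i<N n. \<rho> n i) - 0) < h" by (simp add: eventually_sequentially)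
    qed
  qed
  let ?LN = "ln (\<epsilon> + (norm (X T))\<^sup>2) - ln (\<epsilon> + (norm (X 0))\<^sup>2)"
  have tele: "(\<Sum>i<N l. ln (1 + x l i)) = ?LN" for l
  proof -
    have "ln (1 + x l i) = ln (\<epsilon> + (norm (X (t l (Suc i))))\<^sup>2) - ln (\<epsilon> + (norm (X (t l i)))\<^sup>2)" for i
    proof -
      have "1 + x l i > 0" using x_ratio[of l i] den[of "t l i"] den[of "t l (Suc i)"] by (simp add: zero_less_mult_iff)
      then show ?thesis unfolding x_ratio[of l i] using den[of "t l i"] by (simp add: ln_mult)
    qed
    then have "(\<Sum>i<N l. ln (1 + x l i)) = ln (\<epsilon> + (norm (X (t l (N l))))\<^sup>2) - ln (\<epsilon> + (norm (X (t l 0)))\<^sup>2)"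
      using sum_lessThan_telescope[of "\<lambda>j. ln (\<epsilon> + (norm (X (t l j)))\<^sup>2)" "N l"] by (simp only:)
    then show ?thesis unfolding t_def N_\<delta> by simp
  qed
  have A: "(\<lambda>l. \<Sum>i<N l. 2 * \<gamma> (t l i) * (X (t l i) \<bullet> \<delta> l *\<^sub>R a (t l i))) \<longlonglongrightarrow> ?Ia"
    using riemann_sum_limit[OF ca] by (simp add: t_def mult_ac)
  have p_eq: "p l i = ln (1 + x l i) - \<rho> l i + (x l i)\<^sup>2 / 2 - 2 * \<gamma> (t l i) * (X (t l i) \<bullet> \<delta> l *\<^sub>R a (t l i))
      - 2 * \<gamma> (t l i) * (X (t l i) \<bullet> e l i) - \<gamma> (t l i) * (norm (d l i))\<^sup>2" if "i < N l" for l i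
  proof -
    have "X (t l i) \<bullet> d l i = (X (t l i) \<bullet> b (t l i)) * dw l i + X (t l i) \<bullet> \<delta> l *\<^sub>R a (t l i) + X (t l i) \<bullet> e l i"
      unfolding d_def inc[OF that] by (simp add: inner_right_distrib)
    then show ?thesis unfolding \<rho>_def x_def p_def by (simp add: algebra_simps)
  qed
  \<comment> \<open>Every sum on the right has a known limit: the squares of x contribute
    \<open>4 * ?Iq / 2\<close>, the squared increments \<open>?Ib\<close> and the drift
    \<open>?Ia\<close>.\<close>
  have P_eq: "(\<Sum>i<N l. p l i) = ?LN - (\<Sum>i<N l. \<rho> l i) + (\<Sum>i<N l. (x l i)\<^sup>2) / 2
      - (\<Sum>i<N l. 2 * \<gamma> (t l i) * (X (t l i) \<bullet> \<delta> l *\<^sub>R a (t l i)))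
      - (\<Sum>i<N l. 2 * \<gamma> (t l i) * (X (t l i) \<bullet> e l i)) - (\<Sum>i<N l. \<gamma> (t l i) * (norm (d l i))\<^sup>2)" for l
  proof -
    have "(\<Sum>i<N l. p l i) = (\<Sum>i<N l. ln (1 + x l i) - \<rho> l i + (x l i)\<^sup>2 / 2
        - 2 * \<gamma> (t l i) * (X (t l i) \<bullet> \<delta> l *\<^sub>R a (t l i))
        - 2 * \<gamma> (t l i) * (X (t l i) \<bullet> e l i) - \<gamma> (t l i) * (norm (d l i))\<^sup>2)"
      by (intro sum.cong refl p_eq) simp
    then show ?thesis by (simp only: tele sum.distrib sum_subtractf sum_divide_distrib)
  qed
  have "(\<lambda>l. \<Sum>i<N l. p l i) \<longlonglongrightarrow> ?LN - 0 + 4 * ?Iq / 2 - ?Ia - 0 - ?Ib"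
    unfolding P_eq by (intro tendsto_add tendsto_diff tendsto_divide tendsto_const rho X2 A h1 Dg) simp
  moreover have "integral {0..T} (\<lambda>r. 2 * \<gamma> r * (X r \<bullet> a r) + \<gamma> r * (norm (b r))\<^sup>2 - 2 * (\<gamma> r)\<^sup>2 * (X r \<bullet> b r)\<^sup>2)
    = ?Ia + ?Ib - 2 * ?Iq"
  proof -
    have i: "(\<lambda>r. 2 * \<gamma> r * (X r \<bullet> a r)) integrable_on {0..T}" "(\<lambda>r. \<gamma> r * (norm (b r))\<^sup>2) integrable_on {0..T}"
      "(\<lambda>r. 2 * ((\<gamma> r)\<^sup>2 * (X r \<bullet> b r)\<^sup>2)) integrable_on {0..T}"
      using ca cb cq by (auto intro!: integrable_continuous_interval continuous_on_mult continuous_on_const)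
    show ?thesis
      unfolding mult.assoc[of 2 "(\<gamma> _)\<^sup>2"]
      by (simp only: Henstock_Kurzweil_Integration.integral_diff[OF integrable_add[OF i(1,2)] i(3)]
        Henstock_Kurzweil_Integration.integral_add[OF i(1,2)] integral_mult_right)
  qed
  moreover have "?LN - 0 + 4 * ?Iq / 2 - ?Ia - 0 - ?Ib = ?LN - (?Ia + ?Ib - 2 * ?Iq)" by simp
  ultimately show ?thesis by (simp only: p_def)
qed

text \<open>The hypothesis on A is a mean value estimate; on a fine mesh the oscillation of a over
  each step is below c.\<close>

lemma increment_error:
  fixes A a :: "real \<Rightarrow> 'b::real_normed_vector"
  assumes a: "continuous_on {0..T} a"
    and A: "\<And>x y c. 0 \<le> x \<Longrightarrow> x \<le> y \<Longrightarrow> (\<And>r. r \<in> {x..y} \<Longrightarrow> norm (a r - a x) \<le> c) \<Longrightarrow>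
      norm (A y - A x - (y - x) *\<^sub>R a x) \<le> c * (y - x)"
    and c: "c > 0"
  shows "\<forall>\<^sub>F l in sequentially. \<forall>i<N l.
    norm (A (real (Suc i) * \<delta> l) - A (real i * \<delta> l) - \<delta> l *\<^sub>R a (real i * \<delta> l)) \<le> c * \<delta> l"
  using mesh_oscillation[OF a c]
proof (eventually_elim, intro allI impI)
  fix l i
  assume *: "\<forall>i<N l. \<forall>x\<in>{real i * \<delta> l..real (Suc i) * \<delta> l}. norm (a x - a (real i * \<delta> l)) < c" and i: "i < N l"
  have "norm (A (real (Suc i) * \<delta> l) - A (real i * \<delta> l) - (real (Suc i) * \<delta> l - real i * \<delta> l) *\<^sub>R a (real i * \<delta> l))
      \<le> c * (real (Suc i) * \<delta> l - real i * \<delta> l)"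
  proof (rule A)
    show "0 \<le> real i * \<delta> l" "real i * \<delta> l \<le> real (Suc i) * \<delta> l" using \<delta>_pos[of l] mesh_Suc[of i l] by simp_all
    show "norm (a r - a (real i * \<delta> l)) \<le> c" if "r \<in> {real i * \<delta> l..real (Suc i) * \<delta> l}" for r
      using * i that by (intro less_imp_le) blast
  qed
  then show "norm (A (real (Suc i) * \<delta> l) - A (real i * \<delta> l) - \<delta> l *\<^sub>R a (real i * \<delta> l)) \<le> c * \<delta> l"
    unfolding mesh_Suc .
qed

text \<open>The true drift increment differs from \<delta> times a by at most c \<delta> per step,
  for every c > 0 on fine meshes. These differences sum to a null sequence in norm and may be
  counted among the errors e.\<close>

theorem log_norm_expansion_drift:
  fixes X b a A :: "real \<Rightarrow> 'b::real_inner" and w :: "real \<Rightarrow> real" and e :: "nat \<Rightarrow> nat \<Rightarrow> 'b" and \<epsilon> :: real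
  assumes \<epsilon>: "\<epsilon> > 0" and X: "continuous_on {0..T} X" and b: "continuous_on {0..T} b" and a: "continuous_on {0..T} a"
    and A: "\<And>x y c. 0 \<le> x \<Longrightarrow> x \<le> y \<Longrightarrow> (\<And>r. r \<in> {x..y} \<Longrightarrow> norm (a r - a x) \<le> c) \<Longrightarrow>
      norm (A y - A x - (y - x) *\<^sub>R a x) \<le> c * (y - x)"
  defines "\<gamma> \<equiv> \<lambda>r. 1 / (\<epsilon> + (norm (X r))\<^sup>2)"
    and "dw \<equiv> \<lambda>l i. w (real (Suc i) * \<delta> l) - w (real i * \<delta> l)"
    and "t \<equiv> \<lambda>l i. real i * \<delta> l"
  assumes inc: "\<And>l i. i < N l \<Longrightarrow> X (t l (Suc i)) - X (t l i) = A (t l (Suc i)) - A (t l i) + dw l i *\<^sub>R b (t l i) + e l i"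
    and h1: "(\<lambda>l. \<Sum>i<N l. 2 * \<gamma> (t l i) * (X (t l i) \<bullet> e l i)) \<longlonglongrightarrow> 0"
    and h2: "(\<lambda>l. \<Sum>i<N l. (norm (e l i))\<^sup>2) \<longlonglongrightarrow> 0"
    and h3: "(\<lambda>l. \<Sum>i<N l. \<gamma> (t l i) * (norm (b (t l i)))\<^sup>2 * ((dw l i)\<^sup>2 - \<delta> l)) \<longlonglongrightarrow> 0"
    and h4: "(\<lambda>l. \<Sum>i<N l. (\<gamma> (t l i))\<^sup>2 * (X (t l i) \<bullet> b (t l i))\<^sup>2 * ((dw l i)\<^sup>2 - \<delta> l)) \<longlonglongrightarrow> 0"
  shows "(\<lambda>l. \<Sum>i<N l. 2 * \<gamma> (t l i) * (X (t l i) \<bullet> b (t l i)) * dw l i) \<longlonglongrightarrow>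
    ln (\<epsilon> + (norm (X T))\<^sup>2) - ln (\<epsilon> + (norm (X 0))\<^sup>2)
      - integral {0..T} (\<lambda>r. 2 * \<gamma> r * (X r \<bullet> a r) + \<gamma> r * (norm (b r))\<^sup>2 - 2 * (\<gamma> r)\<^sup>2 * (X r \<bullet> b r)\<^sup>2)"
proof -
  define k where "k l i = A (t l (Suc i)) - A (t l i) - \<delta> l *\<^sub>R a (t l i)" for l i
  have k: "\<forall>\<^sub>F l in sequentially. \<forall>i<N l. norm (k l i) \<le> c * \<delta> l" if "c > 0" for c
    using increment_error[OF a A that] unfolding k_def t_def .
  have den: "\<epsilon> + (norm (X r))\<^sup>2 > 0" for r using \<epsilon> by (simp add: add_pos_nonneg)
  have \<gamma>_pos: "\<gamma> r > 0" for r unfolding \<gamma>_def using den by simp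
  have \<gamma>_le: "\<gamma> r \<le> 1 / \<epsilon>" for r unfolding \<gamma>_def using \<epsilon> den[of r] by (intro divide_left_mono mult_pos_pos) auto
  obtain Xm where Xm: "Xm \<ge> 0" "\<And>x. 0 \<le> x \<Longrightarrow> x \<le> T \<Longrightarrow> norm (X x) \<le> Xm"
    using continuous_bounded[OF X] by blast
  have sum_le: "\<forall>\<^sub>F l in sequentially. (\<Sum>i<N l. norm (k l i)) \<le> c * T" if "c > 0" for c
    using k[OF that]
  proof eventually_elim
    fix l assume "\<forall>i<N l. norm (k l i) \<le> c * \<delta> l"
    then have "(\<Sum>i<N l. norm (k l i)) \<le> (\<Sum>i<N l. c * \<delta> l)" by (intro sum_mono) auto
    also have "\<dots> = c * (real (N l) * \<delta> l)" by simp
    finally show "(\<Sum>i<N l. norm (k l i)) \<le> c * T" by (simp add: N_\<delta>)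
  qed
  have K: "(\<lambda>l. \<Sum>i<N l. norm (k l i)) \<longlonglongrightarrow> 0"
  proof (rule tendstoI)
    fix h :: real assume h: "0 < h"
    then have c: "h / (2 * T) > 0" using T by simp
    show "\<forall>\<^sub>F l in sequentially. dist (\<Sum>i<N l. norm (k l i)) 0 < h"
      using sum_le[OF c]
    proof eventually_elim
      case (elim l)
      have "h / (2 * T) * T < h" using h T by simp
      then show ?case using elim by (simp add: sum_nonneg dist_real_def)
    qed
  qed
  have k1: "(\<lambda>l. \<Sum>i<N l. 2 * \<gamma> (t l i) * (X (t l i) \<bullet> k l i)) \<longlonglongrightarrow> 0"
  proof (rule Lim_null_comparison[OF always_eventually[OF allI]])
    show "(\<lambda>l. 2 * (1 / \<epsilon>) * Xm * (\<Sum>i<N l. norm (k l i))) \<longlonglongrightarrow> 0"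
      using tendsto_mult_left[OF K, of "2 * (1 / \<epsilon>) * Xm"] by simp
    show "norm (\<Sum>i<N l. 2 * \<gamma> (t l i) * (X (t l i) \<bullet> k l i)) \<le> 2 * (1 / \<epsilon>) * Xm * (\<Sum>i<N l. norm (k l i))" for l
      unfolding sum_distrib_left
    proof (rule order_trans[OF norm_sum sum_mono])
      fix i assume "i \<in> {..<N l}"
      then have "norm (X (t l i)) \<le> Xm" using Xm(2)[of "t l i"] mesh_point[of i l] by (simp add: t_def)
      then have "\<bar>X (t l i) \<bullet> k l i\<bar> \<le> Xm * norm (k l i)"
        using Cauchy_Schwarz_ineq2[of "X (t l i)" "k l i"] mult_right_mono[of "norm (X (t l i))" Xm "norm (k l i)"] by simp
      then have "2 * \<gamma> (t l i) * \<bar>X (t l i) \<bullet> k l i\<bar> \<le> 2 * (1 / \<epsilon>) * (Xm * norm (k l i))"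
        using \<gamma>_le[of "t l i"] \<gamma>_pos[of "t l i"] \<epsilon> by (intro mult_mono) auto
      then show "norm (2 * \<gamma> (t l i) * (X (t l i) \<bullet> k l i)) \<le> 2 * (1 / \<epsilon>) * Xm * norm (k l i)"
        using \<gamma>_pos[of "t l i"] by (simp add: abs_mult mult_ac)
    qed
  qed
  have k2: "(\<lambda>l. \<Sum>i<N l. (norm (k l i))\<^sup>2) \<longlonglongrightarrow> 0"
  proof (rule LIMSEQ_0_le)
    show "(\<lambda>l. (\<Sum>i<N l. norm (k l i)) * (\<Sum>i<N l. norm (k l i))) \<longlonglongrightarrow> 0"
      using tendsto_mult[OF K K] by simp
    show "(\<Sum>i<N l. (norm (k l i))\<^sup>2) \<le> (\<Sum>i<N l. norm (k l i)) * (\<Sum>i<N l. norm (k l i))" for l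
      unfolding sum_distrib_right power2_eq_square
      by (intro sum_mono mult_left_mono member_le_sum) auto
  qed (simp add: sum_nonneg)
  have 1: "X (t l (Suc i)) - X (t l i) = \<delta> l *\<^sub>R a (t l i) + dw l i *\<^sub>R b (t l i) + (e l i + k l i)" if "i < N l" for l i
    unfolding inc[OF that] k_def by simp
  have 2: "(\<lambda>l. \<Sum>i<N l. 2 * \<gamma> (t l i) * (X (t l i) \<bullet> (e l i + k l i))) \<longlonglongrightarrow> 0"
    using tendsto_add[OF h1 k1] by (simp add: inner_right_distrib distrib_left sum.distrib)
  have 3: "(\<lambda>l. \<Sum>i<N l. (norm (e l i + k l i))\<^sup>2) \<longlonglongrightarrow> 0" by (rule perturb_sum_squares[OF h2 k2])
  from 1 2 3 h3 h4 show ?thesis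
    unfolding \<gamma>_def dw_def t_def by (rule log_norm_expansion[OF \<epsilon> X b a])
qed

end

section \<open>Exponential supermartingales\<close>

context prob_space
begin

text \<open>The consequences of the supermartingale property that survive limits: a bound for the means
  and the maximal inequality along arithmetic progressions.\<close>

definition supermart :: "real \<Rightarrow> (real \<Rightarrow> 'a \<Rightarrow> real) \<Rightarrow> bool"
  where "supermart y Y \<longleftrightarrow> 0 \<le> y \<and> (\<forall>t\<ge>0. Y t \<in> borel_measurable M) \<and>
    (\<forall>t\<ge>0. \<forall>\<omega>\<in>space M. 0 \<le> Y t \<omega>) \<and>
    (\<forall>t\<ge>0. (\<integral>\<^sup>+\<omega>. ennreal (Y t \<omega>) \<partial>M) \<le> ennreal y) \<and>
    (\<forall>h>0. \<forall>m. \<forall>c>0. prob {\<omega>\<in>space M. \<exists>j\<le>m::nat. Y (real j * h) \<omega> > c} \<le> y / c)"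

text \<open>Fatou's lemma, with bounds that may vary along the approximation.\<close>

lemma mean_liminf:
  assumes [measurable]: "\<And>l. Z l \<in> borel_measurable M"
    and le: "AE \<omega> in M. ennreal (Y \<omega>) \<le> liminf (\<lambda>l. ennreal (Z l \<omega>))"
    and K: "\<And>l. (\<integral>\<^sup>+\<omega>. ennreal (Z l \<omega>) \<partial>M) \<le> ennreal (y l)" and y: "y \<longlonglongrightarrow> y'"
  shows "(\<integral>\<^sup>+\<omega>. ennreal (Y \<omega>) \<partial>M) \<le> ennreal y'"
proof -
  have "(\<integral>\<^sup>+\<omega>. ennreal (Y \<omega>) \<partial>M) \<le> (\<integral>\<^sup>+\<omega>. liminf (\<lambda>l. ennreal (Z l \<omega>)) \<partial>M)"
    by (rule nn_integral_mono_AE[OF le])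
  also have "\<dots> \<le> liminf (\<lambda>l. \<integral>\<^sup>+\<omega>. ennreal (Z l \<omega>) \<partial>M)" by (rule nn_integral_liminf) simp
  also have "\<dots> \<le> liminf (\<lambda>l. ennreal (y l))" by (intro Liminf_mono always_eventually allI K)
  also have "\<dots> = ennreal y'" by (intro lim_imp_Liminf tendsto_ennrealI y) simp
  finally show ?thesis .
qed

text \<open>The strict inequality makes the events lower semicontinuous, so Fatou's lemma applies to
  their indicators for all j jointly.\<close>

lemma maximal_liminf:
  assumes [measurable]: "\<And>l j. j \<le> m \<Longrightarrow> Z l j \<in> borel_measurable M" "\<And>j. j \<le> m \<Longrightarrow> Y j \<in> borel_measurable M"
    and le: "AE \<omega> in M. \<forall>j\<le>m::nat. ennreal (Y j \<omega>) \<le> liminf (\<lambda>l. ennreal (Z l j \<omega>))"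
    and K: "\<And>l. prob {\<omega>\<in>space M. \<exists>j\<le>m. Z l j \<omega> > c} \<le> y l" and y: "y \<longlonglongrightarrow> y'" and c: "c > 0"
  shows "prob {\<omega>\<in>space M. \<exists>j\<le>m. Y j \<omega> > c} \<le> y'"
proof -
  let ?A = "\<lambda>l. {\<omega>\<in>space M. \<exists>j\<le>m. Z l j \<omega> > c}"
  let ?B = "{\<omega>\<in>space M. \<exists>j\<le>m. Y j \<omega> > c}"
  have A[measurable]: "?A l \<in> sets M" for l
  proof -
    have "?A l = (\<Union>j\<in>{..m}. {\<omega>\<in>space M. Z l j \<omega> > c})" by auto
    also have "\<dots> \<in> sets M" by (intro sets.finite_UN) auto
    finally show ?thesis .
  qed
  have B[measurable]: "?B \<in> sets M"
  proof -
    have "?B = (\<Union>j\<in>{..m}. {\<omega>\<in>space M. Y j \<omega> > c})" by auto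
    also have "\<dots> \<in> sets M" by (intro sets.finite_UN) auto
    finally show ?thesis .
  qed
  have "(\<integral>\<^sup>+\<omega>. ennreal (indicator ?B \<omega>) \<partial>M) \<le> ennreal y'"
  proof (rule mean_liminf[OF _ _ _ y])
    show "AE \<omega> in M. ennreal (indicator ?B \<omega>) \<le> liminf (\<lambda>l. ennreal (indicator (?A l) \<omega>))"
      using le
    proof eventually_elim
      fix \<omega> assume le: "\<forall>j\<le>m. ennreal (Y j \<omega>) \<le> liminf (\<lambda>l. ennreal (Z l j \<omega>))"
      show "ennreal (indicator ?B \<omega>) \<le> liminf (\<lambda>l. ennreal (indicator (?A l) \<omega>))"
      proof (cases "\<omega> \<in> ?B")
        case True
        then obtain j where j: "\<omega> \<in> space M" "j \<le> m" "Y j \<omega> > c" by auto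
        have "ennreal c < ennreal (Y j \<omega>)" using j c by (simp add: ennreal_less_iff)
        also have "\<dots> \<le> liminf (\<lambda>l. ennreal (Z l j \<omega>))" using le j by blast
        finally have "\<forall>\<^sub>F l in sequentially. ennreal c < ennreal (Z l j \<omega>)" by (rule less_LiminfD)
        then have "\<forall>\<^sub>F l in sequentially. 1 \<le> ennreal (indicator (?A l) \<omega>)"
        proof eventually_elim
          case (elim l)
          then have "c < Z l j \<omega>" using c by (simp add: ennreal_less_iff)
          then have "\<omega> \<in> ?A l" using j by blast
          then show ?case by simp
        qed
        then have "1 \<le> liminf (\<lambda>l. ennreal (indicator (?A l) \<omega>))" by (rule Liminf_bounded)
        with True show ?thesis by simp
      qed simp
    qed
    show "(\<integral>\<^sup>+\<omega>. ennreal (indicator (?A l) \<omega>) \<partial>M) \<le> ennreal (y l)" for l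
      using K[of l] by (simp add: ennreal_indicator emeasure_eq_measure ennreal_leI)
  qed simp
  then show ?thesis
    using LIMSEQ_le_const[OF y, of 0] order_trans[OF measure_nonneg K]
    by (simp add: ennreal_indicator emeasure_eq_measure)
qed

text \<open>Domination by the lower limit is enough, so a strict loss in the limit is
  allowed.\<close>

lemma supermart_limit:
  assumes Y: "\<And>n. supermart (y n) (Y n)" and y: "y \<longlonglongrightarrow> y'"
    and meas: "\<And>t. 0 \<le> t \<Longrightarrow> Y' t \<in> borel_measurable M"
    and nonneg: "\<And>t \<omega>. 0 \<le> t \<Longrightarrow> \<omega> \<in> space M \<Longrightarrow> 0 \<le> Y' t \<omega>"
    and le: "AE \<omega> in M. \<forall>t\<ge>0. ennreal (Y' t \<omega>) \<le> liminf (\<lambda>n. ennreal (Y n t \<omega>))"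
  shows "supermart y' Y'"
  unfolding supermart_def
proof (intro conjI allI impI ballI)
  have y0: "0 \<le> y n" for n using Y[of n] unfolding supermart_def by blast
  then show "0 \<le> y'" by (intro LIMSEQ_le_const[OF y]) auto
  have Ym: "Y n t \<in> borel_measurable M" if "0 \<le> t" for n t using Y[of n] that unfolding supermart_def by blast
  show "(\<integral>\<^sup>+\<omega>. ennreal (Y' t \<omega>) \<partial>M) \<le> ennreal y'" if t: "0 \<le> t" for t
  proof (rule mean_liminf[OF Ym[OF t] _ _ y])
    show "AE \<omega> in M. ennreal (Y' t \<omega>) \<le> liminf (\<lambda>n. ennreal (Y n t \<omega>))" using le by eventually_elim (use t in simp)
    show "(\<integral>\<^sup>+\<omega>. ennreal (Y n t \<omega>) \<partial>M) \<le> ennreal (y n)" for n using Y[of n] t unfolding supermart_def by blast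
  qed
  show "prob {\<omega>\<in>space M. \<exists>j\<le>m::nat. Y' (real j * h) \<omega> > c} \<le> y' / c" if h: "0 < h" and c: "0 < c" for h m c
  proof (rule maximal_liminf[where Z = "\<lambda>n j. Y n (real j * h)" and y = "\<lambda>n. y n / c"])
    show "AE \<omega> in M. \<forall>j\<le>m. ennreal (Y' (real j * h) \<omega>) \<le> liminf (\<lambda>n. ennreal (Y n (real j * h) \<omega>))"
      using le by eventually_elim (use h in simp)
    show "prob {\<omega>\<in>space M. \<exists>j\<le>m. Y n (real j * h) \<omega> > c} \<le> y n / c" for n
      using Y[of n] h c unfolding supermart_def by blast
    show "(\<lambda>n. y n / c) \<longlonglongrightarrow> y' / c" using c by (intro tendsto_divide y tendsto_const) simp
  qed (use h c in \<open>auto intro!: Ym meas\<close>)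
qed (use meas nonneg in auto)

text \<open>The maximal inequality on dyadic grids passes to the union of increasing events;
  continuity of paths extends the bound from dyadic to all times.\<close>

lemma supermart_bounded_paths:
  assumes Y: "supermart y Y" and cont: "\<And>\<omega>. \<omega> \<in> space M \<Longrightarrow> continuous_on {0..} (\<lambda>t. Y t \<omega>)" and c: "c > 0"
  obtains A where "A \<in> sets M" "prob A \<le> y / c" "\<And>\<omega> t. \<omega> \<in> space M - A \<Longrightarrow> 0 \<le> t \<Longrightarrow> Y t \<omega> \<le> c"
proof -
  \<comment> \<open>Mesh \<open>2^-k\<close> with \<open>4^k\<close> steps reaches time
    \<open>2^k\<close>, so resolution and horizon grow together.\<close>
  define A where "A k = {\<omega>\<in>space M. \<exists>j\<le>4^k. Y (real j * (1 / 2^k)) \<omega> > c}" for k :: nat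
  have Ym: "Y t \<in> borel_measurable M" if "0 \<le> t" for t using Y that unfolding supermart_def by blast
  have Am: "A k \<in> sets M" for k
  proof -
    have "A k = (\<Union>j\<in>{..4^k}. {\<omega>\<in>space M. Y (real j * (1 / 2^k)) \<omega> > c})" by (auto simp: A_def)
    also have "\<dots> \<in> sets M"
    proof (intro sets.finite_UN)
      fix j :: nat
      have [measurable]: "Y (real j * (1 / 2^k)) \<in> borel_measurable M" by (rule Ym) simp
      show "{\<omega>\<in>space M. Y (real j * (1 / 2^k)) \<omega> > c} \<in> sets M" by measurable
    qed simp
    finally show ?thesis .
  qed
  have "A k \<subseteq> A (Suc k)" for k
  proof
    fix \<omega> assume "\<omega> \<in> A k"
    then obtain j where j: "\<omega> \<in> space M" "j \<le> 4^k" "Y (real j * (1 / 2^k)) \<omega> > c" unfolding A_def by auto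
    have "real (2 * j) * (1 / 2^Suc k) = real j * (1 / 2^k)" by simp
    moreover have "2 * j \<le> 4^Suc k" using j(2) by simp
    ultimately show "\<omega> \<in> A (Suc k)" using j unfolding A_def by (intro CollectI conjI exI[of _ "2 * j"]) simp_all
  qed
  then have inc: "incseq A" by (rule incseq_SucI)
  have "prob (A k) \<le> y / c" for k
  proof -
    have "0 < 1 / (2::real)^k" by simp
    then show ?thesis using Y c unfolding supermart_def A_def by blast
  qed
  moreover have "(\<lambda>k. prob (A k)) \<longlonglongrightarrow> prob (\<Union>k. A k)"
    using Am inc by (intro finite_Lim_measure_incseq) auto
  ultimately have P: "prob (\<Union>k. A k) \<le> y / c" by (intro LIMSEQ_le_const2) auto
  have "Y t \<omega> \<le> c" if \<omega>: "\<omega> \<in> space M - (\<Union>k. A k)" and t: "0 \<le> t" for \<omega> t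
  proof -
    \<comment> \<open>The largest dyadic number of level k that does not exceed t.\<close>
    define s where "s k = of_int \<lfloor>t * 2^k\<rfloor> * (1 / 2^k :: real)" for k :: nat
    have sn: "s k = real (nat \<lfloor>t * 2^k\<rfloor>) * (1 / 2^k)" for k using t by (simp add: s_def)
    have st: "s k \<le> t" "t - 1 / 2^k \<le> s k" for k
    proof -
      have "of_int \<lfloor>t * 2^k\<rfloor> \<le> t * 2^k" "t * 2^k - 1 \<le> of_int \<lfloor>t * 2^k\<rfloor>" by linarith+
      moreover have "x * (1 / p) \<le> t \<and> t - 1 / p \<le> x * (1 / p)" if "x \<le> t * p" "t * p - 1 \<le> x" "p > 0" for x p :: real
      proof -
        have "t - 1 / p = (t * p - 1) * (1 / p)" "t = (t * p) * (1 / p)" using that(3) by (simp_all add: field_simps)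
        then show ?thesis
          using mult_right_mono[OF that(1), of "1 / p"] mult_right_mono[OF that(2), of "1 / p"] that(3) by simp
      qed
      ultimately have "s k \<le> t \<and> t - 1 / 2^k \<le> s k" unfolding s_def by simp
      then show "s k \<le> t" "t - 1 / 2^k \<le> s k" by simp_all
    qed
    have s_lim: "s \<longlonglongrightarrow> t"
    proof (rule tendsto_sandwich[OF always_eventually always_eventually _ tendsto_const])
      have "(\<lambda>k. t - (1 / 2)^k) \<longlonglongrightarrow> t - 0" by (intro tendsto_diff tendsto_const LIMSEQ_realpow_zero) auto
      then show "(\<lambda>k. t - 1 / 2^k) \<longlonglongrightarrow> t" by (simp add: power_one_over)
    qed (use st in auto)
    have s0: "0 \<le> s k" for k unfolding sn by simp
    have "(\<lambda>k. Y (s k) \<omega>) \<longlonglongrightarrow> Y t \<omega>"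
      using continuous_on_tendsto_compose[OF cont[of \<omega>] s_lim] \<omega> t s0 by simp
    moreover have "\<forall>\<^sub>F k in sequentially. Y (s k) \<omega> \<le> c"
    proof -
      obtain k0 :: nat where k0: "t \<le> 2^k0" using real_arch_pow[of 2 t] by (auto intro: less_imp_le)
      have "Y (s k) \<omega> \<le> c" if k: "k \<ge> k0" for k
      proof -
        have "t * 2^k \<le> 2^k * 2^k" using k0 k by (intro mult_right_mono order_trans[OF k0 power_increasing]) auto
        then have "t * 2^k \<le> 4^k" by (simp add: power_mult_distrib[symmetric])
        then have "\<lfloor>t * 2^k\<rfloor> \<le> 4^k" by (simp add: floor_le_iff)
        then have "nat \<lfloor>t * 2^k\<rfloor> \<le> 4^k" by (simp add: nat_le_iff)
        then show ?thesis using \<omega> unfolding A_def sn by (auto simp: not_less)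
      qed
      then show ?thesis unfolding eventually_sequentially by blast
    qed
    ultimately show ?thesis by (rule tendsto_upperbound) simp
  qed
  with P Am show ?thesis by (intro that[of "\<Union>k. A k"]) auto
qed

end

text \<open>g bounds the energy production \<open>2 X . a\<close>, and only this bound enters the
  rate: this is how a skew linear part disappears. A is described by a mean value estimate instead
  of as an integral.\<close>

locale ito_process = ito_integral M \<F> W b S for M :: "'w measure" and \<F> W
    and b S :: "real \<Rightarrow> 'w \<Rightarrow> 'b::{real_inner, banach, second_countable_topology}" +
  fixes X a A :: "real \<Rightarrow> 'w \<Rightarrow> 'b" and g :: "real \<Rightarrow> 'w \<Rightarrow> real" and x0 :: 'b
  assumes X_F: "0 \<le> r \<Longrightarrow> X r \<in> borel_measurable (\<F> r)"
    and X_cont: "\<omega> \<in> space M \<Longrightarrow> continuous_on {0..} (\<lambda>r. X r \<omega>)"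
    and a_cont: "\<omega> \<in> space M \<Longrightarrow> continuous_on {0..} (\<lambda>r. a r \<omega>)"
    and g_F: "0 \<le> r \<Longrightarrow> g r \<in> borel_measurable (\<F> r)"
    and g_cont: "\<omega> \<in> space M \<Longrightarrow> continuous_on {0..} (\<lambda>r. g r \<omega>)"
    and X_eq: "0 \<le> r \<Longrightarrow> AE \<omega> in M. X r \<omega> = X 0 \<omega> + A r \<omega> + S r \<omega>"
    and A_inc: "AE \<omega> in M. \<forall>x y c. 0 \<le> x \<longrightarrow> x \<le> y \<longrightarrow> (\<forall>r\<in>{x..y}. norm (a r \<omega> - a x \<omega>) \<le> c) \<longrightarrow>
      norm (A y \<omega> - A x \<omega> - (y - x) *\<^sub>R a x \<omega>) \<le> c * (y - x)"
    and drift: "AE \<omega> in M. \<forall>r\<ge>0. \<bar>2 * (X r \<omega> \<bullet> a r \<omega>)\<bar> \<le> g r \<omega>"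
    and X_0: "AE \<omega> in M. X 0 \<omega> = x0"
begin

context
  fixes \<kappa> \<epsilon> :: real
  assumes \<epsilon>: "\<epsilon> > 0"
begin

definition gam :: "real \<Rightarrow> 'w \<Rightarrow> real"
  where "gam r \<omega> = 1 / (\<epsilon> + (norm (X r \<omega>))\<^sup>2)"

text \<open>\<kappa> times the Ito drift of \<open>ln (\<epsilon> + |X|^2)\<close>, with
  \<open>2 X . a\<close> replaced by its bound g (hence the absolute value of \<kappa>), plus half
  the square of the noise coefficient \<open>2 \<kappa> gam (X . b)\<close>. The second-order term
  of the logarithm and that half square combine to the coefficient
  \<open>2 \<kappa>^2 - 2 \<kappa>\<close>.\<close>

definition rate :: "real \<Rightarrow> 'w \<Rightarrow> real"
  where "rate r \<omega> = \<bar>\<kappa>\<bar> * (gam r \<omega> * g r \<omega>) + \<kappa> * (gam r \<omega> * (norm (b r \<omega>))\<^sup>2)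
    + (2 * \<kappa>\<^sup>2 - 2 * \<kappa>) * ((gam r \<omega>)\<^sup>2 * (X r \<omega> \<bullet> b r \<omega>)\<^sup>2)"

definition lyap :: "real \<Rightarrow> 'w \<Rightarrow> real"
  where "lyap t \<omega> = (\<epsilon> + (norm (X t \<omega>))\<^sup>2) powr \<kappa> * exp (- integral {0..t} (\<lambda>r. rate r \<omega>))"

lemma den_pos: "\<epsilon> + (norm (X r \<omega>))\<^sup>2 > 0" using \<epsilon> by (simp add: add_pos_nonneg)

lemma gam_pos: "gam r \<omega> > 0" unfolding gam_def using den_pos by simp

lemma gam_F: "0 \<le> r \<Longrightarrow> gam r \<in> borel_measurable (\<F> r)"
proof -
  assume "0 \<le> r"
  note [measurable] = X_F[OF this]
  show ?thesis unfolding gam_def[abs_def] by measurable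
qed

lemma gam_cont: "\<omega> \<in> space M \<Longrightarrow> continuous_on {0..} (\<lambda>r. gam r \<omega>)"
  unfolding gam_def using den_pos[of _ \<omega>]
  by (intro continuous_intros X_cont) (auto simp: less_imp_neq[symmetric])

lemma rate_F: "0 \<le> r \<Longrightarrow> rate r \<in> borel_measurable (\<F> r)"
proof -
  assume r: "0 \<le> r"
  note [measurable] = X_F[OF r] gam_F[OF r] b_F[OF r] g_F[OF r]
  show ?thesis unfolding rate_def[abs_def] by measurable
qed

lemma rate_cont: "\<omega> \<in> space M \<Longrightarrow> continuous_on {0..} (\<lambda>r. rate r \<omega>)"
  unfolding rate_def by (intro continuous_intros gam_cont g_cont b_cont X_cont)

text \<open>The Riemann sums are measurable in \<omega>, hence so is their limit.\<close>

lemma rate_integral_M: "0 \<le> t \<Longrightarrow> (\<lambda>\<omega>. integral {0..t} (\<lambda>r. rate r \<omega>)) \<in> borel_measurable M"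
proof (cases "t = 0")
  case False
  assume "0 \<le> t"
  with False have t: "0 < t" by simp
  show ?thesis
  proof (rule borel_measurable_LIMSEQ_real)
    show "(\<lambda>l. \<Sum>i<Suc l. t / real (Suc l) * rate (real i * (t / real (Suc l))) \<omega>)
        \<longlonglongrightarrow> integral {0..t} (\<lambda>r. rate r \<omega>)" if \<omega>: "\<omega> \<in> space M" for \<omega>
      by (rule riemann_sum_limit[OF t, of Suc])
        (auto intro: filterlim_Suc continuous_on_subset[OF rate_cont[OF \<omega>]])
    show "(\<lambda>\<omega>. \<Sum>i<Suc l. t / real (Suc l) * rate (real i * (t / real (Suc l))) \<omega>) \<in> borel_measurable M" for l
      using t by (intro borel_measurable_sum borel_measurable_times borel_measurable_const F_M[OF rate_F]) auto
  qed
qed simp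

lemma lyap_M: "0 \<le> t \<Longrightarrow> lyap t \<in> borel_measurable M"
proof -
  assume t: "0 \<le> t"
  note [measurable] = F_M[OF X_F[OF t] t] rate_integral_M[OF t]
  show ?thesis unfolding lyap_def[abs_def] by measurable
qed

text \<open>The uniform bound that \<open>ito_error_inner_null\<close> requires of its weight; it
  degenerates as \<epsilon> tends to 0.\<close>

lemma gam_X_le: "norm ((2 * gam r \<omega>) *\<^sub>R X r \<omega>) \<le> 1 / \<epsilon> + 1"
proof -
  let ?x = "norm (X r \<omega>)"
  have "2 * ?x \<le> 1 + ?x\<^sup>2" using sum_squares_bound[of 1 ?x] by simp
  also have "\<dots> \<le> (1 / \<epsilon> + 1) * (\<epsilon> + ?x\<^sup>2)"
    using \<epsilon> by (simp add: distrib_left distrib_right)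
  finally have "2 * ?x / (\<epsilon> + ?x\<^sup>2) \<le> 1 / \<epsilon> + 1" using den_pos[of r \<omega>] by (simp add: pos_divide_le_eq)
  then show ?thesis using gam_pos[of r \<omega>] by (simp add: gam_def abs_mult)
qed

text \<open>The four error sums in the hypotheses h1 to h4 of
  \<open>log_norm_expansion_drift\<close>, indexed by q so that one subsequence can be extracted for
  all of them.\<close>

definition mesh_error :: "real \<Rightarrow> nat \<Rightarrow> nat \<Rightarrow> 'w \<Rightarrow> real"
  where "mesh_error \<delta> q n \<omega> = (\<Sum>i<n.
    if q = 0 then ((2 * gam (real i * \<delta>) \<omega>) *\<^sub>R X (real i * \<delta>) \<omega>) \<bullet> ito_error \<delta> i \<omega>
    else if q = 1 then (norm (ito_error \<delta> i \<omega>))\<^sup>2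
    else if q = 2 then gam (real i * \<delta>) \<omega> * (norm (b (real i * \<delta>) \<omega>))\<^sup>2
      * ((W (real (Suc i) * \<delta>) \<omega> - W (real i * \<delta>) \<omega>)\<^sup>2 - \<delta>)
    else (gam (real i * \<delta>) \<omega>)\<^sup>2 * (X (real i * \<delta>) \<omega> \<bullet> b (real i * \<delta>) \<omega>)\<^sup>2
      * ((W (real (Suc i) * \<delta>) \<omega> - W (real i * \<delta>) \<omega>)\<^sup>2 - \<delta>))"

lemma mesh_error_null:
  assumes T: "T > 0"
  shows "null_in_prob (\<lambda>n. mesh_error (T / real (Suc n)) q (Suc n))"
proof -
  consider "q = 0" | "q = 1" | "q = 2" | "q > 2" by linarith
  then show ?thesis
  proof cases
    case 1
    have "null_in_prob (\<lambda>n \<omega>. \<Sum>i<Suc n. ((2 * gam (real i * (T / real (Suc n))) \<omega>) *\<^sub>R X (real i * (T / real (Suc n))) \<omega>)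
        \<bullet> ito_error (T / real (Suc n)) i \<omega>)"
    proof (rule ito_error_inner_null[OF T _ gam_X_le])
      fix r :: real assume r: "0 \<le> r"
      note [measurable] = X_F[OF r] gam_F[OF r]
      show "(\<lambda>\<omega>. (2 * gam r \<omega>) *\<^sub>R X r \<omega>) \<in> borel_measurable (\<F> r)" by measurable
    qed
    then show ?thesis unfolding mesh_error_def[abs_def] 1 by (simp only: if_True simp_thms)
  next
    case 2
    show ?thesis using ito_error_square_null[OF T] unfolding mesh_error_def[abs_def] 2 by (simp only: if_True if_False one_neq_zero simp_thms)
  next
    case 3
    have "null_in_prob (\<lambda>n \<omega>. \<Sum>i<Suc n. (gam (real i * (T / real (Suc n))) \<omega> * (norm (b (real i * (T / real (Suc n))) \<omega>))\<^sup>2) *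
      ((W (real (Suc i) * (T / real (Suc n))) \<omega> - W (real i * (T / real (Suc n))) \<omega>)\<^sup>2 - T / real (Suc n)))"
    proof (rule quadratic_variation_null[OF T])
      fix r :: real assume r: "0 \<le> r"
      note [measurable] = b_F[OF r] gam_F[OF r]
      show "(\<lambda>\<omega>. gam r \<omega> * (norm (b r \<omega>))\<^sup>2) \<in> borel_measurable (\<F> r)" by measurable
    qed (intro continuous_intros gam_cont b_cont)
    moreover have "(2::nat) \<noteq> 0" "(2::nat) \<noteq> 1" by simp_all
    ultimately show ?thesis unfolding mesh_error_def[abs_def] 3 by (simp only: if_True if_False simp_thms)
  next
    case 4
    have "null_in_prob (\<lambda>n \<omega>. \<Sum>i<Suc n. ((gam (real i * (T / real (Suc n))) \<omega>)\<^sup>2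
      * (X (real i * (T / real (Suc n))) \<omega> \<bullet> b (real i * (T / real (Suc n))) \<omega>)\<^sup>2) *
      ((W (real (Suc i) * (T / real (Suc n))) \<omega> - W (real i * (T / real (Suc n))) \<omega>)\<^sup>2 - T / real (Suc n)))"
    proof (rule quadratic_variation_null[OF T])
      fix r :: real assume r: "0 \<le> r"
      note [measurable] = b_F[OF r] gam_F[OF r] X_F[OF r]
      show "(\<lambda>\<omega>. (gam r \<omega>)\<^sup>2 * (X r \<omega> \<bullet> b r \<omega>)\<^sup>2) \<in> borel_measurable (\<F> r)" by measurable
    qed (intro continuous_intros gam_cont b_cont X_cont)
    moreover have "q \<noteq> 0" "q \<noteq> 1" "q \<noteq> 2" using 4 by simp_all
    ultimately show ?thesis unfolding mesh_error_def[abs_def] by (simp only: if_False)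
  qed
qed

text \<open>Horizon \<open>j * h\<close> with \<open>j * Suc k\<close> steps has the same mesh width
  as h with \<open>Suc k\<close> steps, so different horizons share one family of meshes.\<close>

lemma mesh_error_null_multiple:
  assumes h: "h > 0" and j: "j > 0"
  shows "null_in_prob (\<lambda>k. mesh_error (h / real (Suc k)) q (j * Suc k))"
proof -
  have r: "filterlim (\<lambda>k. j * Suc k - 1) at_top sequentially"
  proof (rule filterlim_at_top_mono[OF filterlim_ident always_eventually], intro allI)
    fix k :: nat
    have "1 * Suc k \<le> j * Suc k" using j by (intro mult_le_mono1) simp
    then have "1 * Suc k - 1 \<le> j * Suc k - 1" by (rule diff_le_mono)
    then show "k \<le> j * Suc k - 1" by (simp only: mult_1_left diff_Suc_1)
  qed
  have S: "Suc (j * Suc k - 1) = j * Suc k" for k using j by simp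
  have T: "real j * h > 0" using h j by simp
  have "real j * h / real (j * Suc k) = h / real (Suc k)" for k using j by (intro real_mult_div_Suc) simp
  with null_in_prob_compose[OF mesh_error_null[OF T, of q] r] show ?thesis unfolding S by (simp only:)
qed

lemma mesh_error_subseq:
  assumes h: "h > 0"
  obtains r :: "nat \<Rightarrow> nat" where "strict_mono r"
    "AE \<omega> in M. \<forall>j\<in>{1..m}. \<forall>q<4. (\<lambda>l. mesh_error (h / real (Suc (r l))) q (j * Suc (r l)) \<omega>) \<longlonglongrightarrow> 0"
proof -
  let ?I = "{1..m} \<times> {..<4::nat}"
  let ?E = "\<lambda>p k \<omega>. mesh_error (h / real (Suc k)) (snd p) (fst p * Suc k) \<omega>"
  have "null_in_prob (\<lambda>k \<omega>. \<Sum>p\<in>?I. \<bar>?E p k \<omega>\<bar>)"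
    by (rule null_in_prob_sum) (auto intro!: mesh_error_null_multiple h simp del: of_nat_Suc mult_Suc_right)
  then obtain r where r: "strict_mono r" "AE \<omega> in M. (\<lambda>l. \<Sum>p\<in>?I. \<bar>?E p (r l) \<omega>\<bar>) \<longlonglongrightarrow> 0"
    by (rule null_in_prob_subseq)
  have "AE \<omega> in M. \<forall>j\<in>{1..m}. \<forall>q<4. (\<lambda>l. mesh_error (h / real (Suc (r l))) q (j * Suc (r l)) \<omega>) \<longlonglongrightarrow> 0"
    using r(2)
  proof (eventually_elim, intro ballI allI impI)
    fix \<omega> j q assume lim: "(\<lambda>l. \<Sum>p\<in>?I. \<bar>?E p (r l) \<omega>\<bar>) \<longlonglongrightarrow> 0" and jq: "j \<in> {1..m}" "q < (4::nat)"
    show "(\<lambda>l. mesh_error (h / real (Suc (r l))) q (j * Suc (r l)) \<omega>) \<longlonglongrightarrow> 0"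
    proof (rule Lim_null_comparison[OF always_eventually[OF allI] lim])
      fix l
      show "norm (mesh_error (h / real (Suc (r l))) q (j * Suc (r l)) \<omega>) \<le> (\<Sum>p\<in>?I. \<bar>?E p (r l) \<omega>\<bar>)"
        using member_le_sum[of "(j, q)" ?I "\<lambda>p. \<bar>?E p (r l) \<omega>\<bar>"] jq by (simp del: of_nat_Suc mult_Suc_right)
    qed
  qed
  with r(1) show ?thesis by (rule that)
qed

definition theta :: "real \<Rightarrow> nat \<Rightarrow> 'w \<Rightarrow> real"
  where "theta \<delta> i \<omega> = 2 * \<kappa> * (gam (real i * \<delta>) \<omega> * (X (real i * \<delta>) \<omega> \<bullet> b (real i * \<delta>) \<omega>))"

text \<open>The exponential martingale on the mesh, scaled to start at the initial value of
  \<open>lyap\<close>.\<close>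

definition approx :: "real \<Rightarrow> nat \<Rightarrow> 'w \<Rightarrow> real"
  where "approx \<delta> n \<omega> = (\<epsilon> + (norm x0)\<^sup>2) powr \<kappa> * exp (\<Sum>i<n. theta \<delta> i \<omega> * (W (real (Suc i) * \<delta>) \<omega> - W (real i * \<delta>) \<omega>)
    - (theta \<delta> i \<omega>)\<^sup>2 * \<delta> / 2)"

lemma approx_martingale:
  assumes \<delta>: "\<delta> > 0"
  shows "approx \<delta> n \<in> borel_measurable M"
    and "(\<integral>\<^sup>+\<omega>. ennreal (approx \<delta> n \<omega>) \<partial>M) = ennreal ((\<epsilon> + (norm x0)\<^sup>2) powr \<kappa>)"
    and "c > 0 \<Longrightarrow> prob {\<omega>\<in>space M. \<exists>k\<le>n. approx \<delta> k \<omega> > c} \<le> (\<epsilon> + (norm x0)\<^sup>2) powr \<kappa> / c"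
proof -
  interpret G: brownian_grid M \<F> W "\<lambda>i. real i * \<delta>" n
  proof (unfold_locales, goal_cases)
    case (2 i)
    show ?case using \<delta> by (intro mult_strict_right_mono) simp_all
  qed simp
  have th: "G.adapted (theta \<delta>)"
    unfolding G.adapted_def
  proof (intro allI impI)
    fix i
    have r: "0 \<le> real i * \<delta>" using \<delta> by simp
    note [measurable] = b_F[OF r] gam_F[OF r] X_F[OF r]
    show "theta \<delta> i \<in> borel_measurable (\<F> (real i * \<delta>))" unfolding theta_def[abs_def] by measurable
  qed
  let ?y = "(\<epsilon> + (norm x0)\<^sup>2) powr \<kappa>"
  have y: "?y > 0" using \<epsilon> by (simp add: add_pos_nonneg less_imp_neq[symmetric])
  have dt: "G.dt i = \<delta>" for i unfolding G.dt_def by (simp add: algebra_simps)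
  have eq: "approx \<delta> k \<omega> = ?y * G.expo (theta \<delta>) k \<omega>" for k \<omega>
    unfolding approx_def G.expo_def[OF th] dt G.dW_def ..
  have em[measurable]: "G.expo (theta \<delta>) n \<in> borel_measurable M" by (rule G.expo_M[OF th order_refl])
  show "approx \<delta> n \<in> borel_measurable M" unfolding eq[abs_def] by measurable
  show "(\<integral>\<^sup>+\<omega>. ennreal (approx \<delta> n \<omega>) \<partial>M) = ennreal ?y"
    unfolding eq using y G.expo_mean[OF th, of n] by (simp add: ennreal_mult' nn_integral_cmult)
  assume c: "c > 0"
  have "(approx \<delta> k \<omega> > c) = (G.expo (theta \<delta>) k \<omega> > c / ?y)" for k \<omega>
    unfolding eq using y by (simp add: field_simps)
  then show "prob {\<omega>\<in>space M. \<exists>k\<le>n. approx \<delta> k \<omega> > c} \<le> ?y / c"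
    using G.expo_maximal[OF th, of "c / ?y"] c y by simp
qed

text \<open>\<kappa> times the logarithmic expansion, less half the sum of the squared noise
  coefficients, identifies the limit. Replacing the true drift by \<open>rate\<close> costs an
  inequality, so the limit only dominates \<open>lyap\<close>.\<close>

lemma approx_limit:
  assumes \<omega>: "\<omega> \<in> space M" and h: "h > 0" and j: "j > 0" and r: "strict_mono r"
    and err: "\<And>q. q < 4 \<Longrightarrow> (\<lambda>l. mesh_error (h / real (Suc (r l))) q (j * Suc (r l)) \<omega>) \<longlonglongrightarrow> 0"
    and S: "\<And>i l. X (real i * (h / real (Suc l))) \<omega> = X 0 \<omega> + A (real i * (h / real (Suc l))) \<omega> + S (real i * (h / real (Suc l))) \<omega>"
    and A: "\<And>x y c. 0 \<le> x \<Longrightarrow> x \<le> y \<Longrightarrow> (\<And>r. r \<in> {x..y} \<Longrightarrow> norm (a r \<omega> - a x \<omega>) \<le> c) \<Longrightarrow>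
      norm (A y \<omega> - A x \<omega> - (y - x) *\<^sub>R a x \<omega>) \<le> c * (y - x)"
    and dr: "\<And>r. 0 \<le> r \<Longrightarrow> \<bar>2 * (X r \<omega> \<bullet> a r \<omega>)\<bar> \<le> g r \<omega>"
    and X0: "X 0 \<omega> = x0"
  shows "\<exists>L. (\<lambda>l. approx (h / real (Suc (r l))) (j * Suc (r l)) \<omega>) \<longlonglongrightarrow> L \<and> lyap (real j * h) \<omega> \<le> L"
proof -
  define T where "T = real j * h"
  have T: "T > 0" using h j by (simp add: T_def)
  define N where "N l = j * Suc (r l)" for l
  have N: "N l > 0" for l using j by (simp add: N_def)
  have Nlim: "filterlim N at_top sequentially"
  proof (rule filterlim_at_top_mono[OF filterlim_ident always_eventually], intro allI)
    fix l
    have "l \<le> r l" using r by (rule seq_suble)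
    also have "r l \<le> 1 * Suc (r l)" by simp
    also have "\<dots> \<le> N l" unfolding N_def using j by (intro mult_le_mono1) simp
    finally show "l \<le> N l" .
  qed
  have \<delta>: "T / real (N l) = h / real (Suc (r l))" for l
    unfolding T_def N_def using j by (intro real_mult_div_Suc) simp
  have cX: "continuous_on {0..T} (\<lambda>r. X r \<omega>)" and cb: "continuous_on {0..T} (\<lambda>r. b r \<omega>)"
    and ca: "continuous_on {0..T} (\<lambda>r. a r \<omega>)" and cg: "continuous_on {0..T} (\<lambda>r. g r \<omega>)"
    and cgam: "continuous_on {0..T} (\<lambda>r. gam r \<omega>)" and crate: "continuous_on {0..T} (\<lambda>r. rate r \<omega>)"
    by (rule continuous_on_subset[OF X_cont[OF \<omega>]] continuous_on_subset[OF b_cont[OF \<omega>]] continuous_on_subset[OF a_cont[OF \<omega>]]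
        continuous_on_subset[OF g_cont[OF \<omega>]] continuous_on_subset[OF gam_cont[OF \<omega>]] continuous_on_subset[OF rate_cont[OF \<omega>]], simp)+
  let ?t = "\<lambda>l i. real i * (T / real (N l))"
  let ?dw = "\<lambda>l i. W (?t l (Suc i)) \<omega> - W (?t l i) \<omega>"
  let ?i = "\<lambda>r. 2 * gam r \<omega> * (X r \<omega> \<bullet> a r \<omega>) + gam r \<omega> * (norm (b r \<omega>))\<^sup>2 - 2 * (gam r \<omega>)\<^sup>2 * (X r \<omega> \<bullet> b r \<omega>)\<^sup>2"
  let ?ln = "\<lambda>r. ln (\<epsilon> + (norm (X r \<omega>))\<^sup>2)"
  have L1: "X (?t l (Suc i)) \<omega> - X (?t l i) \<omega> = A (?t l (Suc i)) \<omega> - A (?t l i) \<omega> + ?dw l i *\<^sub>R b (?t l i) \<omega>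
      + ito_error (T / real (N l)) i \<omega>" for l i
    unfolding \<delta> S[of _ "r l"] ito_error_def by simp
  have L2: "(\<lambda>l. \<Sum>i<N l. 2 * gam (?t l i) \<omega> * (X (?t l i) \<omega> \<bullet> ito_error (T / real (N l)) i \<omega>)) \<longlonglongrightarrow> 0"
    using err[of 0] unfolding mesh_error_def \<delta>[symmetric] N_def[symmetric] by simp
  have L3: "(\<lambda>l. \<Sum>i<N l. (norm (ito_error (T / real (N l)) i \<omega>))\<^sup>2) \<longlonglongrightarrow> 0"
    using err[of 1] unfolding mesh_error_def \<delta>[symmetric] N_def[symmetric] by simp
  have L4: "(\<lambda>l. \<Sum>i<N l. gam (?t l i) \<omega> * (norm (b (?t l i) \<omega>))\<^sup>2 * ((?dw l i)\<^sup>2 - T / real (N l))) \<longlonglongrightarrow> 0"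
    using err[of 2] unfolding mesh_error_def \<delta>[symmetric] N_def[symmetric] by simp
  have L5: "(\<lambda>l. \<Sum>i<N l. (gam (?t l i) \<omega>)\<^sup>2 * (X (?t l i) \<omega> \<bullet> b (?t l i) \<omega>)\<^sup>2 * ((?dw l i)\<^sup>2 - T / real (N l))) \<longlonglongrightarrow> 0"
    using err[of 3] unfolding mesh_error_def \<delta>[symmetric] N_def[symmetric] by simp
  from A L1 L2 L3 L4 L5
  have "(\<lambda>l. \<Sum>i<N l. 2 * gam (?t l i) \<omega> * (X (?t l i) \<omega> \<bullet> b (?t l i) \<omega>) * ?dw l i) \<longlonglongrightarrow> ?ln T - ?ln 0 - integral {0..T} ?i"
    unfolding gam_def
    by (rule log_norm_expansion_drift[OF T N Nlim \<epsilon> cX cb ca, where w = "\<lambda>r. W r \<omega>" and A = "\<lambda>r. A r \<omega>"])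
  then have 1: "(\<lambda>l. \<kappa> * (\<Sum>i<N l. 2 * gam (?t l i) \<omega> * (X (?t l i) \<omega> \<bullet> b (?t l i) \<omega>) * ?dw l i))
      \<longlonglongrightarrow> \<kappa> * (?ln T - ?ln 0 - integral {0..T} ?i)"
    by (intro tendsto_mult tendsto_const)
  let ?th = "\<lambda>r. (2 * \<kappa> * (gam r \<omega> * (X r \<omega> \<bullet> b r \<omega>)))\<^sup>2"
  have cth: "continuous_on {0..T} ?th" by (intro continuous_intros cgam cX cb)
  have ci: "continuous_on {0..T} ?i" by (intro continuous_intros cgam cX cb ca)
  have 2: "(\<lambda>l. (\<Sum>i<N l. T / real (N l) * ?th (?t l i)) / 2) \<longlonglongrightarrow> integral {0..T} ?th / 2"
    by (intro tendsto_divide tendsto_const riemann_sum_limit T N Nlim cth) simp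
  have 3: "(\<Sum>i<N l. theta (T / real (N l)) i \<omega> * ?dw l i - (theta (T / real (N l)) i \<omega>)\<^sup>2 * (T / real (N l)) / 2)
    = \<kappa> * (\<Sum>i<N l. 2 * gam (?t l i) \<omega> * (X (?t l i) \<omega> \<bullet> b (?t l i) \<omega>) * ?dw l i) - (\<Sum>i<N l. T / real (N l) * ?th (?t l i)) / 2" for l
    unfolding sum_distrib_left sum_divide_distrib sum_subtractf[symmetric] theta_def
    by (intro sum.cong refl) (simp add: mult_ac)
  define D where "D = \<kappa> * (?ln T - ?ln 0 - integral {0..T} ?i) - integral {0..T} ?th / 2"
  have lim: "(\<lambda>l. approx (h / real (Suc (r l))) (j * Suc (r l)) \<omega>) \<longlonglongrightarrow> (\<epsilon> + (norm x0)\<^sup>2) powr \<kappa> * exp D"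
    unfolding approx_def \<delta>[symmetric] N_def[symmetric] 3 D_def by (intro tendsto_intros 1 2)
  \<comment> \<open>The rate is at least \<kappa> times the drift of the logarithm plus half the
    squared noise coefficient; this is where the bound g on the energy production enters.\<close>
  have "- integral {0..T} (\<lambda>r. rate r \<omega>) \<le> - (\<kappa> * integral {0..T} ?i) - integral {0..T} ?th / 2"
  proof -
    have "\<kappa> * integral {0..T} ?i + integral {0..T} ?th / 2 = integral {0..T} (\<lambda>r. \<kappa> * ?i r + 1 / 2 * ?th r)"
      using ci cth by (subst Henstock_Kurzweil_Integration.integral_add)
        (auto intro!: integrable_continuous_interval continuous_on_mult continuous_on_const)
    also have "\<dots> \<le> integral {0..T} (\<lambda>r. rate r \<omega>)"
    proof (rule integral_le)
      show "(\<lambda>r. \<kappa> * ?i r + 1 / 2 * ?th r) integrable_on {0..T}"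
        by (intro integrable_continuous_interval continuous_intros ci cth)
      show "(\<lambda>r. rate r \<omega>) integrable_on {0..T}" by (intro integrable_continuous_interval crate)
      fix r assume "r \<in> {0..T}"
      then have r: "0 \<le> r" by simp
      have "\<kappa> * (2 * (X r \<omega> \<bullet> a r \<omega>)) \<le> \<bar>\<kappa>\<bar> * g r \<omega>"
        using mult_left_mono[OF dr[OF r], of "\<bar>\<kappa>\<bar>"] abs_ge_self[of "\<kappa> * (2 * (X r \<omega> \<bullet> a r \<omega>))"]
        unfolding abs_mult by simp
      then have "gam r \<omega> * (\<kappa> * (2 * (X r \<omega> \<bullet> a r \<omega>))) \<le> gam r \<omega> * (\<bar>\<kappa>\<bar> * g r \<omega>)"
        using gam_pos[of r \<omega>] by (intro mult_left_mono) auto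
      then show "\<kappa> * ?i r + 1 / 2 * ?th r \<le> rate r \<omega>"
        unfolding rate_def by (simp add: power_mult_distrib algebra_simps)
    qed
    finally show ?thesis by simp
  qed
  then have "\<kappa> * ?ln T - integral {0..T} (\<lambda>r. rate r \<omega>) \<le> \<kappa> * ?ln 0 + D"
    unfolding D_def by (simp add: algebra_simps)
  then have "exp (\<kappa> * ?ln T - integral {0..T} (\<lambda>r. rate r \<omega>)) \<le> exp (\<kappa> * ?ln 0 + D)" by simp
  moreover have "lyap T \<omega> = exp (\<kappa> * ?ln T - integral {0..T} (\<lambda>r. rate r \<omega>))"
    unfolding lyap_def powr_def using den_pos[of T \<omega>] by (simp add: exp_add[symmetric] less_imp_neq[symmetric])
  moreover have "exp (\<kappa> * ?ln 0 + D) = (\<epsilon> + (norm x0)\<^sup>2) powr \<kappa> * exp D"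
    unfolding powr_def X0[symmetric] using den_pos[of 0 \<omega>] by (simp add: exp_add less_imp_neq[symmetric])
  ultimately have "lyap T \<omega> \<le> (\<epsilon> + (norm x0)\<^sup>2) powr \<kappa> * exp D" by simp
  with lim show ?thesis unfolding T_def by blast
qed

text \<open>Gathers almost sure statements on one event: the equation at the countably many mesh
  points, and the error limits for all horizons along a common subsequence.\<close>

lemma lyap_liminf:
  assumes h: "h > 0"
  obtains r :: "nat \<Rightarrow> nat" where
    "AE \<omega> in M. \<forall>j\<le>m. ennreal (lyap (real j * h) \<omega>) \<le> liminf (\<lambda>l. ennreal (approx (h / real (Suc (r l))) (j * Suc (r l)) \<omega>))"
proof -
  obtain r where r: "strict_mono r"
    "AE \<omega> in M. \<forall>j\<in>{1..m}. \<forall>q<4. (\<lambda>l. mesh_error (h / real (Suc (r l))) q (j * Suc (r l)) \<omega>) \<longlonglongrightarrow> 0"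
    by (rule mesh_error_subseq[OF h])
  have "AE \<omega> in M. \<forall>i l. X (real i * (h / real (Suc l))) \<omega> = X 0 \<omega> + A (real i * (h / real (Suc l))) \<omega> + S (real i * (h / real (Suc l))) \<omega>"
    unfolding AE_all_countable by (intro allI X_eq) (use h in simp)
  then have "AE \<omega> in M. \<forall>j\<le>m. ennreal (lyap (real j * h) \<omega>) \<le> liminf (\<lambda>l. ennreal (approx (h / real (Suc (r l))) (j * Suc (r l)) \<omega>))"
    using r(2) A_inc drift X_0 AE_space
  proof (eventually_elim, intro allI impI)
    fix \<omega> j
    assume S: "\<forall>i l. X (real i * (h / real (Suc l))) \<omega> = X 0 \<omega> + A (real i * (h / real (Suc l))) \<omega> + S (real i * (h / real (Suc l))) \<omega>"
      and err: "\<forall>j\<in>{1..m}. \<forall>q<4. (\<lambda>l. mesh_error (h / real (Suc (r l))) q (j * Suc (r l)) \<omega>) \<longlonglongrightarrow> 0"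
      and A: "\<forall>x y c. 0 \<le> x \<longrightarrow> x \<le> y \<longrightarrow> (\<forall>r\<in>{x..y}. norm (a r \<omega> - a x \<omega>) \<le> c) \<longrightarrow>
      norm (A y \<omega> - A x \<omega> - (y - x) *\<^sub>R a x \<omega>) \<le> c * (y - x)"
      and dr: "\<forall>r\<ge>0. \<bar>2 * (X r \<omega> \<bullet> a r \<omega>)\<bar> \<le> g r \<omega>" and X0: "X 0 \<omega> = x0" and \<omega>: "\<omega> \<in> space M" and j: "j \<le> m"
    show "ennreal (lyap (real j * h) \<omega>) \<le> liminf (\<lambda>l. ennreal (approx (h / real (Suc (r l))) (j * Suc (r l)) \<omega>))"
    proof (cases "j = 0")
      case True
      then show ?thesis using X0 by (simp add: lyap_def approx_def Liminf_const)
    next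
      case False
      then have j0: "j > 0" and jm: "j \<in> {1..m}" using j by auto
      obtain L where L: "(\<lambda>l. approx (h / real (Suc (r l))) (j * Suc (r l)) \<omega>) \<longlonglongrightarrow> L" "lyap (real j * h) \<omega> \<le> L"
        using approx_limit[OF \<omega> h j0 r(1)] err[rule_format, OF jm] S A dr X0 by blast
      have "liminf (\<lambda>l. ennreal (approx (h / real (Suc (r l))) (j * Suc (r l)) \<omega>)) = ennreal L"
        by (intro lim_imp_Liminf tendsto_ennrealI L) simp
      then show ?thesis using L(2) by (simp add: ennreal_leI)
    qed
  qed
  then show ?thesis by (rule that)
qed

text \<open>Both inequalities hold for \<open>approx\<close> on every mesh and pass to
  \<open>lyap\<close> by Fatou. The times \<open>j * h\<close> are mesh points, so the maximum over
  them is at most the maximum over the mesh.\<close>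

theorem supermart_lyap: "supermart ((\<epsilon> + (norm x0)\<^sup>2) powr \<kappa>) lyap"
  unfolding supermart_def
proof (intro conjI allI impI ballI)
  let ?y = "(\<epsilon> + (norm x0)\<^sup>2) powr \<kappa>"
  show "0 \<le> ?y" by simp
  show "lyap t \<in> borel_measurable M" if "0 \<le> t" for t using that by (rule lyap_M)
  show "0 \<le> lyap t \<omega>" for t \<omega> unfolding lyap_def by simp
  show "(\<integral>\<^sup>+\<omega>. ennreal (lyap t \<omega>) \<partial>M) \<le> ennreal ?y" if t: "0 \<le> t" for t
  proof -
    \<comment> \<open>t is written as j times h with h > 0, which for t = 0 requires j = 0 and an
      arbitrary h.\<close>
    define h where "h = (if t = 0 then 1 else t)"
    define j where "j = (if t = 0 then 0 else 1 :: nat)"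
    have h: "h > 0" and th: "t = real j * h" using t by (auto simp: h_def j_def)
    obtain r where r: "AE \<omega> in M. \<forall>i\<le>1. ennreal (lyap (real i * h) \<omega>) \<le> liminf (\<lambda>l. ennreal (approx (h / real (Suc (r l))) (i * Suc (r l)) \<omega>))"
      by (rule lyap_liminf[OF h])
    have hl: "h / real (Suc (r l)) > 0" for l using h by simp
    show ?thesis unfolding th
    proof (rule mean_liminf[OF approx_martingale(1)[OF hl] _ _ tendsto_const])
      show "AE \<omega> in M. ennreal (lyap (real j * h) \<omega>) \<le> liminf (\<lambda>l. ennreal (approx (h / real (Suc (r l))) (j * Suc (r l)) \<omega>))"
        using r by eventually_elim (simp add: j_def)
      show "(\<integral>\<^sup>+\<omega>. ennreal (approx (h / real (Suc (r l))) (j * Suc (r l)) \<omega>) \<partial>M) \<le> ennreal ?y" for l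
        unfolding approx_martingale(2)[OF hl] by simp
    qed
  qed
  show "prob {\<omega>\<in>space M. \<exists>j\<le>m::nat. lyap (real j * h) \<omega> > c} \<le> ?y / c" if h: "0 < h" and c: "0 < c" for h m c
  proof -
    obtain r where r: "AE \<omega> in M. \<forall>j\<le>m. ennreal (lyap (real j * h) \<omega>) \<le> liminf (\<lambda>l. ennreal (approx (h / real (Suc (r l))) (j * Suc (r l)) \<omega>))"
      by (rule lyap_liminf[OF h])
    have hl: "h / real (Suc (r l)) > 0" for l using h by simp
    have am: "approx (h / real (Suc (r l))) k \<in> borel_measurable M" for l k by (rule approx_martingale(1)[OF hl])
    show ?thesis
    proof (rule maximal_liminf[OF am lyap_M r _ tendsto_const c])
      fix l
      have "prob {\<omega>\<in>space M. \<exists>j\<le>m. approx (h / real (Suc (r l))) (j * Suc (r l)) \<omega> > c}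
        \<le> prob {\<omega>\<in>space M. \<exists>k\<le>m * Suc (r l). approx (h / real (Suc (r l))) k \<omega> > c}"
      proof (rule finite_measure_mono)
        show "{\<omega>\<in>space M. \<exists>j\<le>m. approx (h / real (Suc (r l))) (j * Suc (r l)) \<omega> > c}
          \<subseteq> {\<omega>\<in>space M. \<exists>k\<le>m * Suc (r l). approx (h / real (Suc (r l))) k \<omega> > c}"
          using mult_le_mono1[of _ m "Suc (r l)"] by blast
        have "{\<omega>\<in>space M. \<exists>k\<le>m * Suc (r l). approx (h / real (Suc (r l))) k \<omega> > c}
          = (\<Union>k\<in>{..m * Suc (r l)}. {\<omega>\<in>space M. approx (h / real (Suc (r l))) k \<omega> > c})" by auto
        also have "\<dots> \<in> sets M"
        proof (intro sets.finite_UN)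
          fix k
          note [measurable] = am[of l k]
          show "{\<omega>\<in>space M. approx (h / real (Suc (r l))) k \<omega> > c} \<in> sets M" by measurable
        qed simp
        finally show "{\<omega>\<in>space M. \<exists>k\<le>m * Suc (r l). approx (h / real (Suc (r l))) k \<omega> > c} \<in> sets M" .
      qed
      also have "\<dots> \<le> ?y / c" by (rule approx_martingale(3)[OF hl c])
      finally show "prob {\<omega>\<in>space M. \<exists>j\<le>m. approx (h / real (Suc (r l))) (j * Suc (r l)) \<omega> > c} \<le> ?y / c" .
    qed (use h in simp)
  qed
qed

end

end

section \<open>Stochastic equations on the space of square-summable families\<close>

lemma ell2_eqI: "(\<And>k. ell2_coeff a k = ell2_coeff b k) \<Longrightarrow> a = b"
  by (metis ell2_coeff_inject ext)

lemma inner_ell2: "a \<bullet> b = (\<Sum>\<^sub>\<infinity>k. ell2_coeff a k \<bullet> ell2_coeff b k)"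
  by transfer rule

text \<open>The Fourier multiplier with symbol m; its value is guaranteed to be meaningful only for
  bounded m.\<close>

definition diag :: "('k \<Rightarrow> complex) \<Rightarrow> 'k ell2 \<Rightarrow> 'k ell2"
  where "diag m a = Abs_ell2 (\<lambda>k. m k * ell2_coeff a k)"

lemma diag_coeff:
  assumes "\<And>k. cmod (m k) \<le> C"
  shows "ell2_coeff (diag m a) k = m k * ell2_coeff a k"
proof -
  have "(\<lambda>k. (cmod (m k * ell2_coeff a k))\<^sup>2) summable_on UNIV"
  proof (rule summable_on_comparison_test)
    show "(\<lambda>k. C\<^sup>2 * (cmod (ell2_coeff a k))\<^sup>2) summable_on UNIV"
      by (rule summable_on_cmult_right[OF ell2_summable])
    show "(cmod (m k * ell2_coeff a k))\<^sup>2 \<le> C\<^sup>2 * (cmod (ell2_coeff a k))\<^sup>2" for k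
      using assms[of k] by (auto simp: norm_mult power_mult_distrib intro!: mult_right_mono power_mono)
  qed auto
  then show ?thesis unfolding diag_def by (subst Abs_ell2_inverse) auto
qed

lemma norm_diag_le:
  assumes "\<And>k. cmod (m k) \<le> C"
  shows "norm (diag m a) \<le> C * norm a"
proof -
  have C: "C \<ge> 0" using assms[of undefined] norm_ge_zero order_trans by blast
  have "(norm (diag m a))\<^sup>2 \<le> (C * norm a)\<^sup>2"
    unfolding norm_ell2_sq[of "diag m a"] diag_coeff[of m, OF assms]
  proof (rule infsum_le_finite_sums)
    show "(\<lambda>k. (cmod (m k * ell2_coeff a k))\<^sup>2) summable_on UNIV"
      using ell2_summable[of "diag m a"] unfolding diag_coeff[of m, OF assms] .
    fix F :: "'a set" assume F: "finite F"
    have "(\<Sum>k\<in>F. (cmod (m k * ell2_coeff a k))\<^sup>2) \<le> (\<Sum>k\<in>F. C\<^sup>2 * (cmod (ell2_coeff a k))\<^sup>2)"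
      using assms by (intro sum_mono) (auto simp: norm_mult power_mult_distrib intro!: mult_right_mono power_mono)
    also have "\<dots> \<le> C\<^sup>2 * (norm a)\<^sup>2"
      using sum_ell2_coeff_le[OF F, of a] by (simp add: sum_distrib_left[symmetric] mult_left_mono)
    finally show "(\<Sum>k\<in>F. (cmod (m k * ell2_coeff a k))\<^sup>2) \<le> (C * norm a)\<^sup>2" by (simp add: power_mult_distrib)
  qed
  then show ?thesis by (rule power2_le_imp_le) (use C in simp)
qed

lemma bounded_linear_diag:
  assumes "\<And>k. cmod (m k) \<le> C"
  shows "bounded_linear (diag m)"
proof (rule bounded_linear_intro[where K = C])
  note c = diag_coeff[of m, OF assms]
  show "diag m (x + y) = diag m x + diag m y" for x y
    by (rule ell2_eqI) (simp only: c ell2_coeff_simps distrib_left)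
  show "diag m (r *\<^sub>R x) = r *\<^sub>R diag m x" for r x
    by (rule ell2_eqI) (simp only: c ell2_coeff_simps mult_scaleR_right)
  show "norm (diag m x) \<le> norm x * C" for x
    using norm_diag_le[of m C x, OF assms] by (simp only: mult.commute)
qed

lemma inner_imaginary_multiple: "z \<bullet> (\<i> * of_real c * z) = 0"
  by (simp add: inner_complex_def)

text \<open>The function behind \<open>rate\<close>, with energy production bounded by
  \<open>2 |X| w\<close>, detached from the processes so that limits in \<epsilon>, X and b can be
  taken.\<close>

definition lrate :: "real \<Rightarrow> real \<Rightarrow> 'b::real_inner \<Rightarrow> 'b \<Rightarrow> real \<Rightarrow> real"
  where "lrate \<kappa> \<epsilon> X b w = (let \<gamma> = 1 / (\<epsilon> + (norm X)\<^sup>2) in \<bar>\<kappa>\<bar> * (\<gamma> * (2 * norm X * w)) + \<kappa> * (\<gamma> * (norm b)\<^sup>2)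
    + (2 * \<kappa>\<^sup>2 - 2 * \<kappa>) * (\<gamma>\<^sup>2 * (X \<bullet> b)\<^sup>2))"

text \<open>Both b and w are at most L |X|, and \<open>\<gamma> * |X|^2\<close> is at most 1. The
  bound is therefore independent of \<epsilon>, as the limits of \<epsilon> to 0 require.\<close>

lemma lrate_bound:
  assumes \<epsilon>: "\<epsilon> > 0" and L: "0 \<le> w" "w \<le> L * norm X" "norm b \<le> L * norm X" and L0: "0 \<le> L"
  shows "\<bar>lrate \<kappa> \<epsilon> X b w\<bar> \<le> \<bar>\<kappa>\<bar> * (2 * L) + \<bar>\<kappa>\<bar> * L\<^sup>2 + \<bar>2 * \<kappa>\<^sup>2 - 2 * \<kappa>\<bar> * L\<^sup>2"
proof (cases "X = 0")
  case True
  then show ?thesis using L L0 by (simp add: lrate_def)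
next
  case False
  then have X: "norm X > 0" by simp
  define \<gamma> where "\<gamma> = 1 / (\<epsilon> + (norm X)\<^sup>2)"
  have \<gamma>: "\<gamma> > 0" "\<gamma> * (norm X)\<^sup>2 \<le> 1" using \<epsilon> by (auto simp: \<gamma>_def divide_le_eq add_pos_nonneg)
  have "\<gamma> * (2 * norm X * w) \<le> \<gamma> * (2 * norm X * (L * norm X))" using \<gamma> L by (intro mult_left_mono) auto
  also have "\<dots> = (2 * L) * (\<gamma> * (norm X)\<^sup>2)" by (simp add: power2_eq_square)
  also have "\<dots> \<le> 2 * L * 1" using \<gamma> L0 by (intro mult_left_mono) auto
  finally have 1: "\<gamma> * (2 * norm X * w) \<le> 2 * L" by simp
  have "(norm b)\<^sup>2 \<le> (L * norm X)\<^sup>2" using L by (intro power_mono) auto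
  then have "\<gamma> * (norm b)\<^sup>2 \<le> \<gamma> * (L * norm X)\<^sup>2" using \<gamma> by (intro mult_left_mono) auto
  also have "\<dots> = L\<^sup>2 * (\<gamma> * (norm X)\<^sup>2)" by (simp add: power_mult_distrib)
  also have "\<dots> \<le> L\<^sup>2 * 1" using \<gamma> by (intro mult_left_mono) auto
  finally have 2: "\<gamma> * (norm b)\<^sup>2 \<le> L\<^sup>2" by simp
  have "(X \<bullet> b)\<^sup>2 \<le> (norm X)\<^sup>2 * (norm b)\<^sup>2"
    using Cauchy_Schwarz_ineq[of X b] by (simp add: power2_norm_eq_inner)
  then have "\<gamma>\<^sup>2 * (X \<bullet> b)\<^sup>2 \<le> \<gamma>\<^sup>2 * ((norm X)\<^sup>2 * (norm b)\<^sup>2)" by (intro mult_left_mono) auto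
  also have "\<dots> = (\<gamma> * (norm X)\<^sup>2) * (\<gamma> * (norm b)\<^sup>2)" by (simp add: power2_eq_square)
  also have "\<dots> \<le> 1 * L\<^sup>2" using \<gamma> 2 by (intro mult_mono) auto
  finally have 3: "\<gamma>\<^sup>2 * (X \<bullet> b)\<^sup>2 \<le> L\<^sup>2" by simp
  have "\<bar>lrate \<kappa> \<epsilon> X b w\<bar> \<le> \<bar>\<bar>\<kappa>\<bar> * (\<gamma> * (2 * norm X * w))\<bar> + \<bar>\<kappa> * (\<gamma> * (norm b)\<^sup>2)\<bar> + \<bar>(2 * \<kappa>\<^sup>2 - 2 * \<kappa>) * (\<gamma>\<^sup>2 * (X \<bullet> b)\<^sup>2)\<bar>"
    unfolding lrate_def Let_def \<gamma>_def[symmetric] by (intro order_trans[OF abs_triangle_ineq] add_mono abs_triangle_ineq order_refl)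
  also have "\<dots> = \<bar>\<kappa>\<bar> * (\<gamma> * (2 * norm X * w)) + \<bar>\<kappa>\<bar> * (\<gamma> * (norm b)\<^sup>2) + \<bar>2 * \<kappa>\<^sup>2 - 2 * \<kappa>\<bar> * (\<gamma>\<^sup>2 * (X \<bullet> b)\<^sup>2)"
    using \<gamma> L by (simp add: abs_mult)
  also have "\<dots> \<le> \<bar>\<kappa>\<bar> * (2 * L) + \<bar>\<kappa>\<bar> * L\<^sup>2 + \<bar>2 * \<kappa>\<^sup>2 - 2 * \<kappa>\<bar> * L\<^sup>2"
    using 1 2 3 by (intro add_mono mult_left_mono) auto
  finally show ?thesis .
qed

text \<open>Projection destroys the proportionality of b and w to X. For the limit of the
  projections \<epsilon> is fixed, so a bound that uses only \<gamma> \<le> 1/\<epsilon> can serve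
  as majorant.\<close>

lemma lrate_bound_crude:
  assumes \<epsilon>: "\<epsilon> > 0" and L: "0 \<le> w" "norm X \<le> R" "norm b \<le> L"
  shows "\<bar>lrate \<kappa> \<epsilon> X b w\<bar> \<le> \<bar>\<kappa>\<bar> * (1 / \<epsilon> * (2 * R * w)) + \<bar>\<kappa>\<bar> * (1 / \<epsilon> * L\<^sup>2) + \<bar>2 * \<kappa>\<^sup>2 - 2 * \<kappa>\<bar> * ((1 / \<epsilon>)\<^sup>2 * (R * L)\<^sup>2)"
proof -
  define \<gamma> where "\<gamma> = 1 / (\<epsilon> + (norm X)\<^sup>2)"
  have \<gamma>: "\<gamma> > 0" "\<gamma> \<le> 1 / \<epsilon>" using \<epsilon> unfolding \<gamma>_def
    by (auto simp: add_pos_nonneg intro!: divide_left_mono mult_pos_pos)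
  have R0: "0 \<le> R" using order_trans[OF norm_ge_zero L(2)] .
  have 1: "\<gamma> * (2 * norm X * w) \<le> 1 / \<epsilon> * (2 * R * w)"
    using \<gamma> L R0 \<epsilon> by (intro mult_mono) auto
  have 2: "\<gamma> * (norm b)\<^sup>2 \<le> 1 / \<epsilon> * L\<^sup>2"
    using \<gamma> L \<epsilon> by (intro mult_mono power_mono) auto
  have "\<bar>X \<bullet> b\<bar> \<le> R * L"
    using L order_trans[OF norm_ge_zero L(2)] by (intro order_trans[OF Cauchy_Schwarz_ineq2] mult_mono) auto
  then have "\<bar>X \<bullet> b\<bar>\<^sup>2 \<le> (R * L)\<^sup>2" by (intro power_mono) auto
  then have xb: "(X \<bullet> b)\<^sup>2 \<le> (R * L)\<^sup>2" by simp
  have "\<gamma>\<^sup>2 \<le> (1 / \<epsilon>)\<^sup>2" using \<gamma> by (intro power_mono) auto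
  then have 3: "\<gamma>\<^sup>2 * (X \<bullet> b)\<^sup>2 \<le> (1 / \<epsilon>)\<^sup>2 * (R * L)\<^sup>2"
    using xb by (rule mult_mono) auto
  have "\<bar>lrate \<kappa> \<epsilon> X b w\<bar> \<le> \<bar>\<bar>\<kappa>\<bar> * (\<gamma> * (2 * norm X * w))\<bar> + \<bar>\<kappa> * (\<gamma> * (norm b)\<^sup>2)\<bar> + \<bar>(2 * \<kappa>\<^sup>2 - 2 * \<kappa>) * (\<gamma>\<^sup>2 * (X \<bullet> b)\<^sup>2)\<bar>"
    unfolding lrate_def Let_def \<gamma>_def[symmetric] by (intro order_trans[OF abs_triangle_ineq] add_mono abs_triangle_ineq order_refl)
  also have "\<dots> = \<bar>\<kappa>\<bar> * (\<gamma> * (2 * norm X * w)) + \<bar>\<kappa>\<bar> * (\<gamma> * (norm b)\<^sup>2) + \<bar>2 * \<kappa>\<^sup>2 - 2 * \<kappa>\<bar> * (\<gamma>\<^sup>2 * (X \<bullet> b)\<^sup>2)"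
    using \<gamma> L by (simp add: abs_mult)
  also have "\<dots> \<le> \<bar>\<kappa>\<bar> * (1 / \<epsilon> * (2 * R * w)) + \<bar>\<kappa>\<bar> * (1 / \<epsilon> * L\<^sup>2) + \<bar>2 * \<kappa>\<^sup>2 - 2 * \<kappa>\<bar> * ((1 / \<epsilon>)\<^sup>2 * (R * L)\<^sup>2)"
    using 1 2 3 by (intro add_mono mult_left_mono) auto
  finally show ?thesis .
qed

lemma lrate_continuous:
  assumes "\<epsilon> > 0" "continuous_on S X" "continuous_on S b" "continuous_on S w"
  shows "continuous_on S (\<lambda>r. lrate \<kappa> \<epsilon> (X r) (b r) (w r))"
proof -
  have "\<epsilon> + (norm x)\<^sup>2 \<noteq> 0" for x :: 'b using assms(1) by (simp add: add_pos_nonneg less_imp_neq[symmetric])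
  then show ?thesis unfolding lrate_def Let_def by (intro continuous_intros assms ballI)
qed

lemma lrate_tendsto:
  assumes "\<epsilon> > 0" "(X \<longlongrightarrow> x) F" "(b \<longlongrightarrow> b') F"
  shows "((\<lambda>n. lrate \<kappa> \<epsilon> (X n) (b n) w) \<longlongrightarrow> lrate \<kappa> \<epsilon> x b' w) F"
proof -
  have "\<epsilon> + (norm x)\<^sup>2 \<noteq> 0" using assms(1) by (simp add: add_pos_nonneg less_imp_neq[symmetric])
  then show ?thesis unfolding lrate_def Let_def by (intro tendsto_intros assms)
qed

section \<open>The spectrally truncated equation and the comparison of two solutions\<close>

locale spectral_spde = brownian M \<F> W for M :: "'w measure" and \<F> W +
  fixes \<Phi> G :: "('k::countable) ell2 \<Rightarrow> 'k ell2" and freq :: "'k \<Rightarrow> real"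
  assumes freq_nonneg: "0 \<le> freq k"
    and \<Phi>_lip: "\<exists>L. \<forall>U V. norm U \<le> R \<longrightarrow> norm V \<le> R \<longrightarrow> norm (\<Phi> U - \<Phi> V) \<le> L * norm (U - V)"
    and G_lip: "\<exists>L. \<forall>U V. norm U \<le> R \<longrightarrow> norm V \<le> R \<longrightarrow> norm (G U - G V) \<le> L * norm (U - V)"
    and \<Phi>_0: "\<Phi> 0 = 0" and G_0: "G 0 = 0"
begin

lemma lip:
  obtains L where "L \<ge> 0" "\<And>U V. norm U \<le> R \<Longrightarrow> norm V \<le> R \<Longrightarrow> norm (\<Phi> U - \<Phi> V) \<le> L * norm (U - V)"
    "\<And>U V. norm U \<le> R \<Longrightarrow> norm V \<le> R \<Longrightarrow> norm (G U - G V) \<le> L * norm (U - V)"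
proof -
  obtain L1 where L1: "\<forall>U V. norm U \<le> R \<longrightarrow> norm V \<le> R \<longrightarrow> norm (\<Phi> U - \<Phi> V) \<le> L1 * norm (U - V)" using \<Phi>_lip by blast
  obtain L2 where L2: "\<forall>U V. norm U \<le> R \<longrightarrow> norm V \<le> R \<longrightarrow> norm (G U - G V) \<le> L2 * norm (U - V)" using G_lip by blast
  define L where "L = max 0 (max L1 L2)"
  have le: "L1 * x \<le> L * x" "L2 * x \<le> L * x" if "0 \<le> x" for x :: real
    using that by (auto simp: L_def intro!: mult_right_mono)
  show ?thesis
  proof (rule that[of L])
    show "L \<ge> 0" by (simp add: L_def)
    fix U V :: "'k ell2" assume UV: "norm U \<le> R" "norm V \<le> R"
    show "norm (\<Phi> U - \<Phi> V) \<le> L * norm (U - V)" using L1 UV le(1)[of "norm (U - V)"] by force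
    show "norm (G U - G V) \<le> L * norm (U - V)" using L2 UV le(2)[of "norm (U - V)"] by force
  qed
qed

lemma lip_continuous:
  fixes H :: "'k ell2 \<Rightarrow> 'k ell2"
  assumes "\<And>R. \<exists>L. \<forall>U V. norm U \<le> R \<longrightarrow> norm V \<le> R \<longrightarrow> norm (H U - H V) \<le> L * norm (U - V)"
  shows "continuous_on UNIV H"
  unfolding continuous_on_eq_continuous_at[OF open_UNIV] isCont_def
proof (intro ballI)
  fix U :: "'k ell2"
  obtain L where L: "\<forall>V1 V2. norm V1 \<le> norm U + 1 \<longrightarrow> norm V2 \<le> norm U + 1 \<longrightarrow> norm (H V1 - H V2) \<le> L * norm (V1 - V2)"
    using assms by blast
  have "((\<lambda>V. H V - H U) \<longlongrightarrow> 0) (at U)"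
  proof (rule Lim_null_comparison)
    have "((\<lambda>V. L * norm (V - U)) \<longlongrightarrow> L * norm (U - U)) (at U)" by (intro tendsto_intros)
    then show "((\<lambda>V. L * norm (V - U)) \<longlongrightarrow> 0) (at U)" by simp
    have "\<forall>\<^sub>F V in at U. dist V U < 1" by (rule eventually_at_ball'[THEN eventually_mono, of 1]) (auto simp: dist_commute)
    then show "\<forall>\<^sub>F V in at U. norm (H V - H U) \<le> L * norm (V - U)"
    proof eventually_elim
      fix V assume "dist V U < 1"
      then have "norm V \<le> norm U + 1" using norm_triangle_ineq2[of V U] by (simp add: dist_norm)
      then show "norm (H V - H U) \<le> L * norm (V - U)" using L by simp
    qed
  qed
  then show "(H \<longlongrightarrow> H U) (at U)" by (simp add: LIM_zero_iff)
qed

lemma \<Phi>_cont: "continuous_on UNIV \<Phi>" by (rule lip_continuous) (rule \<Phi>_lip)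
lemma G_cont: "continuous_on UNIV G" by (rule lip_continuous) (rule G_lip)

definition cutoff :: "nat \<Rightarrow> 'k \<Rightarrow> complex"
  where "cutoff n k = (if freq k \<le> real n then 1 else 0)"

definition proj :: "nat \<Rightarrow> 'k ell2 \<Rightarrow> 'k ell2"
  where "proj n = diag (cutoff n)"

text \<open>This is \<i> (A U - G U) on the modes up to n. The cutoff makes the unbounded A a
  bounded multiplier.\<close>

definition drift :: "nat \<Rightarrow> 'k ell2 \<Rightarrow> 'k ell2"
  where "drift n U = diag (\<lambda>k. \<i> * of_real ((freq k)\<^sup>2) * cutoff n k) U - diag (\<lambda>k. \<i> * cutoff n k) (G U)"

lemma cutoff_le: "cmod (cutoff n k) \<le> 1" "cmod (\<i> * cutoff n k) \<le> 1"
  "cmod (\<i> * of_real ((freq k)\<^sup>2) * cutoff n k) \<le> (real n)\<^sup>2"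
  using freq_nonneg[of k] by (auto simp: cutoff_def norm_mult norm_power intro!: power_mono)

lemmas proj_linear = bounded_linear_diag[of "cutoff n" 1 for n, OF cutoff_le(1), folded proj_def]

lemma proj_coeff: "ell2_coeff (proj n U) k = cutoff n k * ell2_coeff U k"
  unfolding proj_def by (rule diag_coeff[OF cutoff_le(1)])

lemma norm_proj_le: "norm (proj n U) \<le> norm U"
  unfolding proj_def using norm_diag_le[of "cutoff n" 1 U, OF cutoff_le(1)] by simp

lemma proj_diff: "proj n (U - V) = proj n U - proj n V"
  by (rule linear_diff[OF bounded_linear.linear[OF proj_linear]])

lemma drift_cont: "continuous_on UNIV (drift n)"
proof -
  note bounded_linear_diag[of "\<lambda>k. \<i> * of_real ((freq k)\<^sup>2) * cutoff n k", OF cutoff_le(3)]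
    bounded_linear_diag[of "\<lambda>k. \<i> * cutoff n k", OF cutoff_le(2)]
  then show ?thesis
    unfolding drift_def[abs_def]
    by (intro continuous_on_diff) (auto intro: bounded_linear.continuous_on continuous_on_id G_cont)
qed

text \<open>On each mode the linear part multiplies by an imaginary number, which gives a vector
  orthogonal in the real inner product. Only the nonlinearity remains, without any dependence on
  n.\<close>

lemma inner_proj_drift:
  "\<bar>proj n (U - V) \<bullet> (drift n U - drift n V)\<bar> \<le> norm (proj n (U - V)) * norm (G U - G V)"
proof -
  let ?m = "\<lambda>k. \<i> * of_real ((freq k)\<^sup>2) * cutoff n k" and ?c = "\<lambda>k. \<i> * cutoff n k"
  have lin: "diag ?m (U - V) = diag ?m U - diag ?m V" "diag ?c (G U - G V) = diag ?c (G U) - diag ?c (G V)"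
    by (intro linear_diff bounded_linear.linear bounded_linear_diag[OF cutoff_le(3)] bounded_linear_diag[OF cutoff_le(2)])+
  have "ell2_coeff (proj n (U - V)) k \<bullet> ell2_coeff (diag ?m (U - V)) k = 0" for k
    unfolding proj_coeff diag_coeff[of ?m, OF cutoff_le(3)]
    using inner_imaginary_multiple[of "ell2_coeff (U - V) k" "(freq k)\<^sup>2"] by (simp add: cutoff_def)
  then have "proj n (U - V) \<bullet> diag ?m (U - V) = 0" unfolding inner_ell2 by simp
  then have "proj n (U - V) \<bullet> (drift n U - drift n V) = - (proj n (U - V) \<bullet> diag ?c (G U - G V))"
    unfolding drift_def lin by (simp add: inner_diff_right)
  then have "\<bar>proj n (U - V) \<bullet> (drift n U - drift n V)\<bar> \<le> norm (proj n (U - V)) * norm (diag ?c (G U - G V))"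
    by (simp add: Cauchy_Schwarz_ineq2)
  also have "\<dots> \<le> norm (proj n (U - V)) * norm (G U - G V)"
    using norm_diag_le[of ?c 1 "G U - G V", OF cutoff_le(2)] by (intro mult_left_mono) auto
  finally show ?thesis .
qed

lemma proj_tendsto: "(\<lambda>n. proj n U) \<longlonglongrightarrow> U"
proof (rule LIMSEQ_I)
  fix r :: real assume r: "0 < r"
  obtain F where F: "finite F" "dist (\<Sum>k\<in>F. (cmod (ell2_coeff U k))\<^sup>2) (\<Sum>\<^sub>\<infinity>k. (cmod (ell2_coeff U k))\<^sup>2) \<le> (r / 2)\<^sup>2"
    using infsum_finite_approximation[OF ell2_summable, of "(r/2)\<^sup>2" U] r by auto
  obtain n0 :: nat where n0: "\<And>k. k \<in> F \<Longrightarrow> freq k \<le> real n0"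
  proof -
    obtain n0 :: nat where "Max (insert 0 (freq ` F)) \<le> real n0" using real_arch_simple by blast
    then show thesis using F(1) by (intro that[of n0]) (auto intro: order_trans[OF Max_ge])
  qed
  have "norm (proj n U - U) < r" if n: "n \<ge> n0" for n
  proof -
    have cut: "cutoff n k = 1" if "k \<in> F" for k using n0[OF that] n by (simp add: cutoff_def)
    have "(norm (proj n U - U))\<^sup>2 \<le> (r / 2)\<^sup>2"
      unfolding norm_ell2_sq
    proof (rule infsum_le_finite_sums[OF ell2_summable])
      fix A :: "'k set" assume A: "finite A"
      have le: "(cmod (ell2_coeff (proj n U - U) k))\<^sup>2 \<le> (if k \<in> F then 0 else (cmod (ell2_coeff U k))\<^sup>2)" for k
        using cut[of k] by (auto simp: proj_coeff cutoff_def)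
      have "(\<Sum>k\<in>A. (cmod (ell2_coeff (proj n U - U) k))\<^sup>2) \<le> (\<Sum>k\<in>A. if k \<in> F then 0 else (cmod (ell2_coeff U k))\<^sup>2)"
        by (intro sum_mono le)
      also have "\<dots> = (\<Sum>k\<in>A - F. (cmod (ell2_coeff U k))\<^sup>2)"
        using A by (intro sum.mono_neutral_cong_right) auto
      also have "\<dots> = (\<Sum>k\<in>(A - F) \<union> F. (cmod (ell2_coeff U k))\<^sup>2) - (\<Sum>k\<in>F. (cmod (ell2_coeff U k))\<^sup>2)"
        using A F by (subst sum.union_disjoint) auto
      also have "(\<Sum>k\<in>(A - F) \<union> F. (cmod (ell2_coeff U k))\<^sup>2) \<le> (\<Sum>\<^sub>\<infinity>k. (cmod (ell2_coeff U k))\<^sup>2)"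
        using A F by (intro finite_sum_le_infsum[OF ell2_summable]) auto
      also have "(\<Sum>\<^sub>\<infinity>k. (cmod (ell2_coeff U k))\<^sup>2) - (\<Sum>k\<in>F. (cmod (ell2_coeff U k))\<^sup>2) \<le> (r / 2)\<^sup>2"
        using F(2) by (simp add: dist_real_def)
      finally show "(\<Sum>k\<in>A. (cmod (ell2_coeff (proj n U - U) k))\<^sup>2) \<le> (r / 2)\<^sup>2" by simp
    qed
    then have "norm (proj n U - U) \<le> r / 2" by (rule power2_le_imp_le) (use r in simp)
    then show ?thesis using r by simp
  qed
  then show "\<exists>no. \<forall>n\<ge>no. norm (proj n U - U) < r" by blast
qed

text \<open>The equation is imposed on every finite truncation, where drift and noise take values in
  the space itself. Continuity is asked at all sample points, as \<open>ito_integral\<close> and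
  \<open>ito_process\<close> demand.\<close>

definition solution :: "'k ell2 \<Rightarrow> (real \<Rightarrow> 'w \<Rightarrow> 'k ell2) \<Rightarrow> bool"
  where "solution x U \<longleftrightarrow> (\<forall>r\<ge>0. U r \<in> borel_measurable (\<F> r)) \<and>
    (\<forall>\<omega>\<in>space M. continuous_on {0..} (\<lambda>r. U r \<omega>)) \<and> (AE \<omega> in M. U 0 \<omega> = x) \<and>
    (\<forall>n. \<exists>S A. ito_integral M \<F> W (\<lambda>r \<omega>. proj n (\<Phi> (U r \<omega>))) S \<and>
      (AE \<omega> in M. \<forall>r\<ge>0. ((\<lambda>r. A r \<omega>) has_vector_derivative drift n (U r \<omega>)) (at r within {0..})) \<and>
      (\<forall>r\<ge>0. AE \<omega> in M. proj n (U r \<omega>) = proj n (U 0 \<omega>) + A r \<omega> + S r \<omega>))"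

text \<open>Turns statements about a single solution into special cases of statements about
  two.\<close>

lemma solution_zero: "solution 0 (\<lambda>r \<omega>. 0)"
proof -
  have p0: "proj n 0 = 0" for n by (rule linear_0[OF bounded_linear.linear[OF proj_linear]])
  have "diag (\<lambda>k. \<i> * of_real ((freq k)\<^sup>2) * cutoff n k) 0 = 0" "diag (\<lambda>k. \<i> * cutoff n k) 0 = 0" for n
    by (rule linear_0[OF bounded_linear.linear[OF bounded_linear_diag]], rule cutoff_le)+
  then have "drift n 0 = 0" for n
    unfolding drift_def G_0 by (simp only: diff_self)
  moreover have "ito_integral M \<F> W (\<lambda>r \<omega>. proj n (\<Phi> 0)) (\<lambda>r \<omega>. 0)" for n
    by unfold_locales (auto simp: \<Phi>_0 p0 riemann_ito_def elementary_ito_def intro!: null_in_prob_AE)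
  ultimately show ?thesis
    unfolding solution_def by (auto simp: p0 intro!: exI[of _ "\<lambda>r \<omega>. 0"])
qed

end

lemma ito_integral_diff:
  assumes "ito_integral M \<F> W b1 S1" "ito_integral M \<F> W b2 S2"
  shows "ito_integral M \<F> W (\<lambda>r \<omega>. b1 r \<omega> - b2 r \<omega>) (\<lambda>r \<omega>. S1 r \<omega> - S2 r \<omega>)"
proof -
  interpret I1: ito_integral M \<F> W b1 S1 by fact
  interpret I2: ito_integral M \<F> W b2 S2 by fact
  show ?thesis
  proof
    fix r :: real assume r: "0 \<le> r"
    show "(\<lambda>\<omega>. b1 r \<omega> - b2 r \<omega>) \<in> borel_measurable (\<F> r)" by (intro borel_measurable_diff I1.b_F I2.b_F r)
    show SM: "(\<lambda>\<omega>. S1 r \<omega> - S2 r \<omega>) \<in> borel_measurable M" by (intro borel_measurable_diff I1.S_M I2.S_M r)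
    have eq: "I1.riemann_ito (\<lambda>r \<omega>. b1 r \<omega> - b2 r \<omega>) r m \<omega> = I1.riemann_ito b1 r m \<omega> - I1.riemann_ito b2 r m \<omega>" for m \<omega>
      unfolding I1.riemann_ito_def elementary_ito_def by (simp add: scaleR_diff_right sum_subtractf)
    have RM: "I1.riemann_ito (\<lambda>r \<omega>. b1 r \<omega> - b2 r \<omega>) r m \<in> borel_measurable M" for m
      unfolding I1.riemann_ito_def elementary_ito_def[abs_def] using r
      by (intro borel_measurable_sum borel_measurable_scaleR borel_measurable_diff I1.b_M I2.b_M I1.W_M) auto
    show "I1.null_in_prob (\<lambda>m \<omega>. norm (I1.riemann_ito (\<lambda>r \<omega>. b1 r \<omega> - b2 r \<omega>) r m \<omega> - (S1 r \<omega> - S2 r \<omega>)))"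
    proof (rule I1.null_in_prob_add[OF I1.S_lim[OF r] I2.S_lim[OF r]])
      show "(\<lambda>\<omega>. norm (I1.riemann_ito (\<lambda>r \<omega>. b1 r \<omega> - b2 r \<omega>) r m \<omega> - (S1 r \<omega> - S2 r \<omega>))) \<in> borel_measurable M" for m
        by (rule measurable_compose[OF borel_measurable_diff[OF RM SM] borel_measurable_norm])
      show "AE \<omega> in M. \<bar>norm (I1.riemann_ito (\<lambda>r \<omega>. b1 r \<omega> - b2 r \<omega>) r m \<omega> - (S1 r \<omega> - S2 r \<omega>))\<bar>
        \<le> \<bar>norm (I1.riemann_ito b1 r m \<omega> - S1 r \<omega>)\<bar> + \<bar>norm (I1.riemann_ito b2 r m \<omega> - S2 r \<omega>)\<bar>" for m
      proof (rule AE_I2)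
        fix \<omega>
        show "\<bar>norm (I1.riemann_ito (\<lambda>r \<omega>. b1 r \<omega> - b2 r \<omega>) r m \<omega> - (S1 r \<omega> - S2 r \<omega>))\<bar>
          \<le> \<bar>norm (I1.riemann_ito b1 r m \<omega> - S1 r \<omega>)\<bar> + \<bar>norm (I1.riemann_ito b2 r m \<omega> - S2 r \<omega>)\<bar>"
          unfolding eq using norm_triangle_ineq4[of "I1.riemann_ito b1 r m \<omega> - S1 r \<omega>" "I1.riemann_ito b2 r m \<omega> - S2 r \<omega>"]
          by (simp add: algebra_simps)
      qed
    qed
  qed (intro continuous_on_diff I1.b_cont I2.b_cont)
qed

lemma derivative_increment_bound:
  fixes A a :: "real \<Rightarrow> 'b::real_normed_vector"
  assumes A: "\<And>r. 0 \<le> r \<Longrightarrow> (A has_vector_derivative a r) (at r within {0..})"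
    and xy: "0 \<le> x" "x \<le> y" and c: "\<And>r. r \<in> {x..y} \<Longrightarrow> norm (a r - a x) \<le> c"
  shows "norm (A y - A x - (y - x) *\<^sub>R a x) \<le> c * (y - x)"
proof -
  have "norm (A y - A x - (y - x) *\<^sub>R a x) \<le> norm (y - x) * c"
  proof (rule vector_differentiable_bound_linearization[of "{x..y}"])
    fix r assume "r \<in> {x..y}"
    then show "(A has_vector_derivative a r) (at r within {x..y})"
      using xy by (intro has_vector_derivative_within_subset[OF A]) auto
  qed (use xy c in \<open>auto simp: closed_segment_eq_real_ivl\<close>)
  then show ?thesis using xy by (simp add: mult.commute)
qed

context spectral_spde
begin

lemma proj_continuous: "continuous_on S f \<Longrightarrow> continuous_on S (\<lambda>r. proj n (f r))"
  by (rule bounded_linear.continuous_on[OF proj_linear])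

lemma solutionD:
  assumes "solution x U"
  shows "0 \<le> r \<Longrightarrow> U r \<in> borel_measurable (\<F> r)" "\<omega> \<in> space M \<Longrightarrow> continuous_on {0..} (\<lambda>r. U r \<omega>)"
    "AE \<omega> in M. U 0 \<omega> = x"
  using assms unfolding solution_def by blast+

definition Lyap :: "real \<Rightarrow> real \<Rightarrow> (real \<Rightarrow> 'w \<Rightarrow> 'k ell2) \<Rightarrow> (real \<Rightarrow> 'w \<Rightarrow> 'k ell2) \<Rightarrow> real \<Rightarrow> 'w \<Rightarrow> real"
  where "Lyap \<kappa> \<epsilon> U V t \<omega> = (\<epsilon> + (norm (U t \<omega> - V t \<omega>))\<^sup>2) powr \<kappa> * exp (- integral {0..t} (\<lambda>r.
    lrate \<kappa> \<epsilon> (U r \<omega> - V r \<omega>) (\<Phi> (U r \<omega>) - \<Phi> (V r \<omega>)) (norm (G (U r \<omega>) - G (V r \<omega>)))))"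

context
  fixes x y U V
  assumes U: "solution x U" and V: "solution y V"
begin

lemma paths_cont:
  assumes "\<omega> \<in> space M"
  shows "continuous_on {0..} (\<lambda>r. U r \<omega> - V r \<omega>)" "continuous_on {0..} (\<lambda>r. \<Phi> (U r \<omega>) - \<Phi> (V r \<omega>))"
    "continuous_on {0..} (\<lambda>r. norm (G (U r \<omega>) - G (V r \<omega>)))" "continuous_on {0..} (\<lambda>r. drift n (U r \<omega>) - drift n (V r \<omega>))"
proof -
  note c = solutionD(2)[OF U assms] solutionD(2)[OF V assms]
  have comp: "continuous_on {0..} (\<lambda>r. H (Z r))" if "continuous_on UNIV H" "continuous_on {0..} Z"
    for H :: "'k ell2 \<Rightarrow> 'k ell2" and Z :: "real \<Rightarrow> 'k ell2"
    using continuous_on_compose2[OF that] by auto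
  show "continuous_on {0..} (\<lambda>r. U r \<omega> - V r \<omega>)" "continuous_on {0..} (\<lambda>r. \<Phi> (U r \<omega>) - \<Phi> (V r \<omega>))"
    "continuous_on {0..} (\<lambda>r. norm (G (U r \<omega>) - G (V r \<omega>)))" "continuous_on {0..} (\<lambda>r. drift n (U r \<omega>) - drift n (V r \<omega>))"
    by (intro continuous_intros c comp[OF \<Phi>_cont] comp[OF G_cont] comp[OF drift_cont])+
qed

text \<open>The process to expand is the projected difference. Its energy production is bounded by
  \<open>inner_proj_drift\<close>, which does not see the size of the linear part and is therefore
  harmless as n grows.\<close>

lemma supermart_truncated:
  assumes \<epsilon>: "\<epsilon> > 0"
  shows "supermart ((\<epsilon> + (norm (proj n (x - y)))\<^sup>2) powr \<kappa>) (\<lambda>t \<omega>.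
    (\<epsilon> + (norm (proj n (U t \<omega> - V t \<omega>)))\<^sup>2) powr \<kappa> * exp (- integral {0..t} (\<lambda>r.
      lrate \<kappa> \<epsilon> (proj n (U r \<omega> - V r \<omega>)) (proj n (\<Phi> (U r \<omega>) - \<Phi> (V r \<omega>))) (norm (G (U r \<omega>) - G (V r \<omega>))))))"
proof -
  obtain S1 A1 where 1: "ito_integral M \<F> W (\<lambda>r \<omega>. proj n (\<Phi> (U r \<omega>))) S1"
    "AE \<omega> in M. \<forall>r\<ge>0. ((\<lambda>r. A1 r \<omega>) has_vector_derivative drift n (U r \<omega>)) (at r within {0..})"
    "\<And>r. 0 \<le> r \<Longrightarrow> AE \<omega> in M. proj n (U r \<omega>) = proj n (U 0 \<omega>) + A1 r \<omega> + S1 r \<omega>"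
    using U unfolding solution_def by blast
  obtain S2 A2 where 2: "ito_integral M \<F> W (\<lambda>r \<omega>. proj n (\<Phi> (V r \<omega>))) S2"
    "AE \<omega> in M. \<forall>r\<ge>0. ((\<lambda>r. A2 r \<omega>) has_vector_derivative drift n (V r \<omega>)) (at r within {0..})"
    "\<And>r. 0 \<le> r \<Longrightarrow> AE \<omega> in M. proj n (V r \<omega>) = proj n (V 0 \<omega>) + A2 r \<omega> + S2 r \<omega>"
    using V unfolding solution_def by blast
  have "ito_integral M \<F> W (\<lambda>r \<omega>. proj n (\<Phi> (U r \<omega>)) - proj n (\<Phi> (V r \<omega>))) (\<lambda>r \<omega>. S1 r \<omega> - S2 r \<omega>)"
    by (rule ito_integral_diff[OF 1(1) 2(1)])
  then interpret I: ito_integral M \<F> W "\<lambda>r \<omega>. proj n (\<Phi> (U r \<omega>) - \<Phi> (V r \<omega>))" "\<lambda>r \<omega>. S1 r \<omega> - S2 r \<omega>"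
    unfolding proj_diff .
  note pm = borel_measurable_continuous_onI[OF linear_continuous_on[OF proj_linear]]
  have UV_F: "(\<lambda>\<omega>. proj n (U r \<omega> - V r \<omega>)) \<in> borel_measurable (\<F> r)" if "0 \<le> r" for r
    by (rule measurable_compose[OF _ pm]) (intro borel_measurable_diff solutionD(1)[OF U that] solutionD(1)[OF V that])
  have G_m: "G \<in> borel_measurable borel" by (rule borel_measurable_continuous_onI[OF G_cont])
  have GF: "(\<lambda>\<omega>. norm (G (U r \<omega>) - G (V r \<omega>))) \<in> borel_measurable (\<F> r)" if "0 \<le> r" for r
    by (intro measurable_compose[OF _ borel_measurable_norm] borel_measurable_diff
      measurable_compose[OF solutionD(1)[OF U that] G_m] measurable_compose[OF solutionD(1)[OF V that] G_m])
  interpret P: ito_process M \<F> W "\<lambda>r \<omega>. proj n (\<Phi> (U r \<omega>) - \<Phi> (V r \<omega>))" "\<lambda>r \<omega>. S1 r \<omega> - S2 r \<omega>"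
    "\<lambda>r \<omega>. proj n (U r \<omega> - V r \<omega>)" "\<lambda>r \<omega>. drift n (U r \<omega>) - drift n (V r \<omega>)" "\<lambda>r \<omega>. A1 r \<omega> - A2 r \<omega>"
    "\<lambda>r \<omega>. 2 * norm (proj n (U r \<omega> - V r \<omega>)) * norm (G (U r \<omega>) - G (V r \<omega>))" "proj n (x - y)"
  proof
    fix r :: real assume r: "0 \<le> r"
    show "(\<lambda>\<omega>. proj n (U r \<omega> - V r \<omega>)) \<in> borel_measurable (\<F> r)" by (rule UV_F[OF r])
    show "(\<lambda>\<omega>. 2 * norm (proj n (U r \<omega> - V r \<omega>)) * norm (G (U r \<omega>) - G (V r \<omega>))) \<in> borel_measurable (\<F> r)"
      by (intro borel_measurable_times borel_measurable_const measurable_compose[OF UV_F[OF r] borel_measurable_norm] GF r)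
    show "AE \<omega> in M. proj n (U r \<omega> - V r \<omega>) = proj n (U 0 \<omega> - V 0 \<omega>) + (A1 r \<omega> - A2 r \<omega>) + (S1 r \<omega> - S2 r \<omega>)"
      using 1(3)[OF r] 2(3)[OF r] by eventually_elim (simp add: proj_diff)
  next
    fix \<omega> assume \<omega>: "\<omega> \<in> space M"
    note c = paths_cont[OF \<omega>]
    show cp: "continuous_on {0..} (\<lambda>r. proj n (U r \<omega> - V r \<omega>))" by (rule proj_continuous[OF c(1)])
    show "continuous_on {0..} (\<lambda>r. drift n (U r \<omega>) - drift n (V r \<omega>))" by (rule c(4))
    show "continuous_on {0..} (\<lambda>r. 2 * norm (proj n (U r \<omega> - V r \<omega>)) * norm (G (U r \<omega>) - G (V r \<omega>)))"
      by (intro continuous_intros cp c(3))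
  next
    show "AE \<omega> in M. \<forall>u v c. 0 \<le> u \<longrightarrow> u \<le> v \<longrightarrow>
      (\<forall>r\<in>{u..v}. norm (drift n (U r \<omega>) - drift n (V r \<omega>) - (drift n (U u \<omega>) - drift n (V u \<omega>))) \<le> c) \<longrightarrow>
      norm (A1 v \<omega> - A2 v \<omega> - (A1 u \<omega> - A2 u \<omega>) - (v - u) *\<^sub>R (drift n (U u \<omega>) - drift n (V u \<omega>))) \<le> c * (v - u)"
      using 1(2) 2(2)
    proof (eventually_elim, intro allI impI)
      fix \<omega> u v c
      assume d1: "\<forall>r\<ge>0. ((\<lambda>r. A1 r \<omega>) has_vector_derivative drift n (U r \<omega>)) (at r within {0..})"
        and d2: "\<forall>r\<ge>0. ((\<lambda>r. A2 r \<omega>) has_vector_derivative drift n (V r \<omega>)) (at r within {0..})"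
        and uv: "0 \<le> u" "u \<le> v" "\<forall>r\<in>{u..v}. norm (drift n (U r \<omega>) - drift n (V r \<omega>) - (drift n (U u \<omega>) - drift n (V u \<omega>))) \<le> c"
      show "norm (A1 v \<omega> - A2 v \<omega> - (A1 u \<omega> - A2 u \<omega>) - (v - u) *\<^sub>R (drift n (U u \<omega>) - drift n (V u \<omega>))) \<le> c * (v - u)"
        by (rule derivative_increment_bound[of "\<lambda>r. A1 r \<omega> - A2 r \<omega>" "\<lambda>r. drift n (U r \<omega>) - drift n (V r \<omega>)" u v c])
          (use d1 d2 uv in \<open>auto intro: has_vector_derivative_diff\<close>)
    qed
    show "AE \<omega> in M. \<forall>r\<ge>0. \<bar>2 * (proj n (U r \<omega> - V r \<omega>) \<bullet> (drift n (U r \<omega>) - drift n (V r \<omega>)))\<bar>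
        \<le> 2 * norm (proj n (U r \<omega> - V r \<omega>)) * norm (G (U r \<omega>) - G (V r \<omega>))"
      using inner_proj_drift by (intro AE_I2 allI impI) (simp add: abs_mult mult.assoc)
    show "AE \<omega> in M. proj n (U 0 \<omega> - V 0 \<omega>) = proj n (x - y)"
      using solutionD(3)[OF U] solutionD(3)[OF V] by eventually_elim simp
  qed
  from P.supermart_lyap[OF \<epsilon>, of \<kappa>]
  show ?thesis
    unfolding P.lyap_def[OF \<epsilon>, abs_def] P.rate_def[OF \<epsilon>] P.gam_def[OF \<epsilon>] lrate_def Let_def .
qed

lemma Lyap_F_cont:
  assumes \<epsilon>: "\<epsilon> > 0" and \<omega>: "\<omega> \<in> space M"
  shows "continuous_on {0..} (\<lambda>r. lrate \<kappa> \<epsilon> (U r \<omega> - V r \<omega>) (\<Phi> (U r \<omega>) - \<Phi> (V r \<omega>)) (norm (G (U r \<omega>) - G (V r \<omega>))))"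
    and "continuous_on {0..} (\<lambda>t. Lyap \<kappa> \<epsilon> U V t \<omega>)"
proof -
  note c = paths_cont[OF \<omega>]
  show lc: "continuous_on {0..} (\<lambda>r. lrate \<kappa> \<epsilon> (U r \<omega> - V r \<omega>) (\<Phi> (U r \<omega>) - \<Phi> (V r \<omega>)) (norm (G (U r \<omega>) - G (V r \<omega>))))"
    by (rule lrate_continuous[OF \<epsilon> c(1-3)])
  have ic: "continuous_on {0..} (\<lambda>t. integral {0..t} (\<lambda>r. lrate \<kappa> \<epsilon> (U r \<omega> - V r \<omega>) (\<Phi> (U r \<omega>) - \<Phi> (V r \<omega>)) (norm (G (U r \<omega>) - G (V r \<omega>)))))"
    unfolding continuous_on_eq_continuous_within
  proof
    fix t :: real assume t: "t \<in> {0..}"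
    have "continuous_on {0..t+1} (\<lambda>t. integral {0..t} (\<lambda>r. lrate \<kappa> \<epsilon> (U r \<omega> - V r \<omega>) (\<Phi> (U r \<omega>) - \<Phi> (V r \<omega>)) (norm (G (U r \<omega>) - G (V r \<omega>)))))"
      by (intro indefinite_integral_continuous_1 integrable_continuous_interval continuous_on_subset[OF lc]) auto
    then have "continuous (at t within {0..t+1}) (\<lambda>t. integral {0..t} (\<lambda>r. lrate \<kappa> \<epsilon> (U r \<omega> - V r \<omega>) (\<Phi> (U r \<omega>) - \<Phi> (V r \<omega>)) (norm (G (U r \<omega>) - G (V r \<omega>)))))"
      using t by (simp add: continuous_on_eq_continuous_within)
    moreover have "at t within {0..t+1} = at t within {0..}"
      using t by (intro at_within_nhd[of _ "{..<t+1}"]) auto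
    ultimately show "continuous (at t within {0..}) (\<lambda>t. integral {0..t} (\<lambda>r. lrate \<kappa> \<epsilon> (U r \<omega> - V r \<omega>) (\<Phi> (U r \<omega>) - \<Phi> (V r \<omega>)) (norm (G (U r \<omega>) - G (V r \<omega>)))))"
      by (simp add: continuous_within)
  qed
  have "\<epsilon> + (norm z)\<^sup>2 \<noteq> 0" for z :: "'k ell2" using \<epsilon> by (simp add: add_pos_nonneg less_imp_neq[symmetric])
  then show "continuous_on {0..} (\<lambda>t. Lyap \<kappa> \<epsilon> U V t \<omega>)"
    unfolding Lyap_def by (intro continuous_intros c(1) ic) auto
qed

text \<open>The limit of the truncations at fixed \<epsilon>: the rates converge pointwise in time
  and are dominated by a continuous function of the path, so the discount factors converge.\<close>

theorem supermart_Lyap: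
  assumes \<epsilon>: "\<epsilon> > 0"
  shows "supermart ((\<epsilon> + (norm (x - y))\<^sup>2) powr \<kappa>) (Lyap \<kappa> \<epsilon> U V)"
proof -
  have pos: "\<epsilon> + (norm z)\<^sup>2 \<noteq> 0" for z :: "'k ell2" using \<epsilon> by (simp add: add_pos_nonneg less_imp_neq[symmetric])
  define Y where "Y n t \<omega> = (\<epsilon> + (norm (proj n (U t \<omega> - V t \<omega>)))\<^sup>2) powr \<kappa> * exp (- integral {0..t} (\<lambda>r.
      lrate \<kappa> \<epsilon> (proj n (U r \<omega> - V r \<omega>)) (proj n (\<Phi> (U r \<omega>) - \<Phi> (V r \<omega>))) (norm (G (U r \<omega>) - G (V r \<omega>)))))" for n t \<omega>
  have lim: "(\<lambda>n. Y n t \<omega>) \<longlonglongrightarrow> Lyap \<kappa> \<epsilon> U V t \<omega>" if \<omega>: "\<omega> \<in> space M" and t: "0 \<le> t" for t \<omega>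
  proof -
    note c = paths_cont[OF \<omega>]
    let ?X = "\<lambda>r. U r \<omega> - V r \<omega>" and ?b = "\<lambda>r. \<Phi> (U r \<omega>) - \<Phi> (V r \<omega>)" and ?w = "\<lambda>r. norm (G (U r \<omega>) - G (V r \<omega>))"
    have sub: "{0..t} \<subseteq> {0..}" by auto
    define h where "h r = \<bar>\<kappa>\<bar> * (1 / \<epsilon> * (2 * norm (?X r) * ?w r)) + \<bar>\<kappa>\<bar> * (1 / \<epsilon> * (norm (?b r))\<^sup>2)
      + \<bar>2 * \<kappa>\<^sup>2 - 2 * \<kappa>\<bar> * ((1 / \<epsilon>)\<^sup>2 * (norm (?X r) * norm (?b r))\<^sup>2)" for r
    have 1: "(\<lambda>r. lrate \<kappa> \<epsilon> (proj n (?X r)) (proj n (?b r)) (?w r)) integrable_on {0..t}" for n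
      by (rule integrable_continuous_interval[OF lrate_continuous[OF \<epsilon> proj_continuous[OF continuous_on_subset[OF c(1) sub]]
        proj_continuous[OF continuous_on_subset[OF c(2) sub]] continuous_on_subset[OF c(3) sub]]])
    have "continuous_on {0..} (\<lambda>r. \<bar>\<kappa>\<bar> * (1 / \<epsilon> * (2 * norm (X r) * w r)) + \<bar>\<kappa>\<bar> * (1 / \<epsilon> * (norm (b r))\<^sup>2)
        + \<bar>2 * \<kappa>\<^sup>2 - 2 * \<kappa>\<bar> * ((1 / \<epsilon>)\<^sup>2 * (norm (X r) * norm (b r))\<^sup>2))"
      if "continuous_on {0..} X" "continuous_on {0..} b" "continuous_on {0..} w" for X b :: "real \<Rightarrow> 'k ell2" and w
      by (intro continuous_intros that)
    from this[OF c(1-3)] have "continuous_on {0..} h" unfolding h_def .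
    then have 2: "h integrable_on {0..t}" by (rule integrable_continuous_interval[OF continuous_on_subset[OF _ sub]])
    have 3: "norm (lrate \<kappa> \<epsilon> (proj n (?X r)) (proj n (?b r)) (?w r)) \<le> h r" for n r
      unfolding h_def real_norm_def by (intro lrate_bound_crude \<epsilon> norm_proj_le) simp
    have 4: "(\<lambda>n. lrate \<kappa> \<epsilon> (proj n (?X r)) (proj n (?b r)) (?w r)) \<longlonglongrightarrow> lrate \<kappa> \<epsilon> (?X r) (?b r) (?w r)" for r
      by (intro lrate_tendsto \<epsilon> proj_tendsto)
    have "(\<lambda>n. integral {0..t} (\<lambda>r. lrate \<kappa> \<epsilon> (proj n (?X r)) (proj n (?b r)) (?w r))) \<longlonglongrightarrow> integral {0..t} (\<lambda>r. lrate \<kappa> \<epsilon> (?X r) (?b r) (?w r))"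
      by (rule dominated_convergence(2)[OF 1 2 3 4])
    then show ?thesis
      unfolding Y_def Lyap_def using pos by (intro tendsto_intros proj_tendsto) auto
  qed
  have Ys: "supermart ((\<epsilon> + (norm (proj n (x - y)))\<^sup>2) powr \<kappa>) (Y n)" for n
    using supermart_truncated[OF \<epsilon>, of n \<kappa>] unfolding Y_def[abs_def] .
  show ?thesis
  proof (rule supermart_limit[OF Ys])
    show "(\<lambda>n. (\<epsilon> + (norm (proj n (x - y)))\<^sup>2) powr \<kappa>) \<longlonglongrightarrow> (\<epsilon> + (norm (x - y))\<^sup>2) powr \<kappa>"
      using pos by (intro tendsto_intros proj_tendsto) auto
    show "Lyap \<kappa> \<epsilon> U V t \<in> borel_measurable M" if t: "0 \<le> t" for t
      by (rule borel_measurable_LIMSEQ_real[OF lim[OF _ t]]) (use Ys t in \<open>auto simp: supermart_def\<close>)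
    show "0 \<le> Lyap \<kappa> \<epsilon> U V t \<omega>" for t \<omega> unfolding Lyap_def by simp
    show "AE \<omega> in M. \<forall>t\<ge>0. ennreal (Lyap \<kappa> \<epsilon> U V t \<omega>) \<le> liminf (\<lambda>n. ennreal (Y n t \<omega>))"
    proof (intro AE_I2 allI impI)
      fix \<omega> t assume \<omega>: "\<omega> \<in> space M" and t: "(0::real) \<le> t"
      have "liminf (\<lambda>n. ennreal (Y n t \<omega>)) = ennreal (Lyap \<kappa> \<epsilon> U V t \<omega>)"
        by (intro lim_imp_Liminf tendsto_ennrealI lim[OF \<omega> t]) simp
      then show "ennreal (Lyap \<kappa> \<epsilon> U V t \<omega>) \<le> liminf (\<lambda>n. ennreal (Y n t \<omega>))" by simp
    qed
  qed
qed

lemma rate_bound_ball: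
  assumes R: "norm (U r \<omega>) \<le> R" "norm (V r \<omega>) \<le> R" and L: "L \<ge> 0"
    "\<And>U V. norm U \<le> R \<Longrightarrow> norm V \<le> R \<Longrightarrow> norm (\<Phi> U - \<Phi> V) \<le> L * norm (U - V)"
    "\<And>U V. norm U \<le> R \<Longrightarrow> norm V \<le> R \<Longrightarrow> norm (G U - G V) \<le> L * norm (U - V)" and \<epsilon>: "\<epsilon> > 0"
  shows "\<bar>lrate \<kappa> \<epsilon> (U r \<omega> - V r \<omega>) (\<Phi> (U r \<omega>) - \<Phi> (V r \<omega>)) (norm (G (U r \<omega>) - G (V r \<omega>)))\<bar>
    \<le> \<bar>\<kappa>\<bar> * (2 * L) + \<bar>\<kappa>\<bar> * L\<^sup>2 + \<bar>2 * \<kappa>\<^sup>2 - 2 * \<kappa>\<bar> * L\<^sup>2"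
  by (intro lrate_bound \<epsilon> L R norm_ge_zero)

lemma Lyap_lower_ball:
  assumes R: "\<And>r. 0 \<le> r \<Longrightarrow> r \<le> t \<Longrightarrow> norm (U r \<omega>) \<le> R \<and> norm (V r \<omega>) \<le> R" and L: "L \<ge> 0"
    "\<And>U V. norm U \<le> R \<Longrightarrow> norm V \<le> R \<Longrightarrow> norm (\<Phi> U - \<Phi> V) \<le> L * norm (U - V)"
    "\<And>U V. norm U \<le> R \<Longrightarrow> norm V \<le> R \<Longrightarrow> norm (G U - G V) \<le> L * norm (U - V)" and \<epsilon>: "\<epsilon> > 0"
    and \<omega>: "\<omega> \<in> space M" and s: "0 \<le> s" "s \<le> t"
  shows "(\<epsilon> + (norm (U s \<omega> - V s \<omega>))\<^sup>2) powr \<kappa> * exp (- ((\<bar>\<kappa>\<bar> * (2 * L) + \<bar>\<kappa>\<bar> * L\<^sup>2 + \<bar>2 * \<kappa>\<^sup>2 - 2 * \<kappa>\<bar> * L\<^sup>2) * t))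
    \<le> Lyap \<kappa> \<epsilon> U V s \<omega>"
proof -
  let ?C = "\<bar>\<kappa>\<bar> * (2 * L) + \<bar>\<kappa>\<bar> * L\<^sup>2 + \<bar>2 * \<kappa>\<^sup>2 - 2 * \<kappa>\<bar> * L\<^sup>2"
  let ?f = "\<lambda>r. lrate \<kappa> \<epsilon> (U r \<omega> - V r \<omega>) (\<Phi> (U r \<omega>) - \<Phi> (V r \<omega>)) (norm (G (U r \<omega>) - G (V r \<omega>)))"
  have C: "?C \<ge> 0" using L(1) by simp
  have "norm (integral {0..s} ?f) \<le> ?C * (s - 0)"
  proof (rule integral_bound[OF s(1)])
    show "continuous_on {0..s} ?f" by (rule continuous_on_subset[OF Lyap_F_cont(1)[OF \<epsilon> \<omega>]]) auto
    fix r assume "r \<in> {0..s}"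
    then show "norm (?f r) \<le> ?C" unfolding real_norm_def using R[of r] s by (intro rate_bound_ball[OF _ _ L \<epsilon>]) auto
  qed
  also have "\<dots> \<le> ?C * t" using C s by (intro mult_left_mono) auto
  finally show ?thesis unfolding Lyap_def by (intro mult_left_mono) auto
qed

text \<open>Up to time t a continuous path stays in a ball, on which the coefficients are Lipschitz.
  The point is that c depends on the path and on t but not on \<epsilon>.\<close>

lemma Lyap_lower:
  assumes \<omega>: "\<omega> \<in> space M" and t: "0 \<le> t"
  obtains c where "c > 0" "\<And>\<epsilon> s. \<epsilon> > 0 \<Longrightarrow> 0 \<le> s \<Longrightarrow> s \<le> t \<Longrightarrow> (\<epsilon> + (norm (U s \<omega> - V s \<omega>))\<^sup>2) powr \<kappa> * c \<le> Lyap \<kappa> \<epsilon> U V s \<omega>"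
proof -
  obtain R1 where R1: "\<And>r. 0 \<le> r \<Longrightarrow> r \<le> t \<Longrightarrow> norm (U r \<omega>) \<le> R1"
    using continuous_bounded[OF continuous_on_subset[OF solutionD(2)[OF U \<omega>]], of t] by auto
  obtain R2 where R2: "\<And>r. 0 \<le> r \<Longrightarrow> r \<le> t \<Longrightarrow> norm (V r \<omega>) \<le> R2"
    using continuous_bounded[OF continuous_on_subset[OF solutionD(2)[OF V \<omega>]], of t] by auto
  have R: "norm (U r \<omega>) \<le> max R1 R2 \<and> norm (V r \<omega>) \<le> max R1 R2" if "0 \<le> r" "r \<le> t" for r
    using R1[OF that] R2[OF that] by auto
  obtain L where L: "L \<ge> 0"
    "\<And>U V. norm U \<le> max R1 R2 \<Longrightarrow> norm V \<le> max R1 R2 \<Longrightarrow> norm (\<Phi> U - \<Phi> V) \<le> L * norm (U - V)"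
    "\<And>U V. norm U \<le> max R1 R2 \<Longrightarrow> norm V \<le> max R1 R2 \<Longrightarrow> norm (G U - G V) \<le> L * norm (U - V)"
    by (rule lip[of "max R1 R2"]) blast
  show ?thesis
    by (rule that[of "exp (- ((\<bar>\<kappa>\<bar> * (2 * L) + \<bar>\<kappa>\<bar> * L\<^sup>2 + \<bar>2 * \<kappa>\<^sup>2 - 2 * \<kappa>\<bar> * L\<^sup>2) * t))"])
      (auto intro!: Lyap_lower_ball[OF R L _ \<omega>])
qed

text \<open>With \<kappa> = 1/2 the rate on the ball is at most \<open>L + L^2\<close>. Outside A1
  and A2 both paths stay in the ball for all times, so Markov's inequality for \<open>Lyap\<close>
  controls the difference.\<close>

lemma difference_prob:
  assumes t: "0 \<le> t" and L: "L \<ge> 0"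
    "\<And>U V. norm U \<le> R \<Longrightarrow> norm V \<le> R \<Longrightarrow> norm (\<Phi> U - \<Phi> V) \<le> L * norm (U - V)"
    "\<And>U V. norm U \<le> R \<Longrightarrow> norm V \<le> R \<Longrightarrow> norm (G U - G V) \<le> L * norm (U - V)"
    and A: "A1 \<in> sets M" "A2 \<in> sets M"
    and R: "\<And>\<omega> r. \<omega> \<in> space M - A1 \<Longrightarrow> 0 \<le> r \<Longrightarrow> norm (U r \<omega>) \<le> R" "\<And>\<omega> r. \<omega> \<in> space M - A2 \<Longrightarrow> 0 \<le> r \<Longrightarrow> norm (V r \<omega>) \<le> R"
    and \<eta>: "\<eta> > 0" and \<epsilon>: "\<epsilon> > 0"
  shows "prob {\<omega>\<in>space M. norm (U t \<omega> - V t \<omega>) > \<eta>}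
    \<le> sqrt (\<epsilon> + (norm (x - y))\<^sup>2) * exp ((L + L\<^sup>2) * t) / \<eta> + prob A1 + prob A2"
proof -
  let ?Y = "Lyap (1/2) \<epsilon> U V t"
  let ?c = "exp (- ((L + L\<^sup>2) * t))"
  have C: "\<bar>1/2::real\<bar> * (2 * L) + \<bar>1/2\<bar> * L\<^sup>2 + \<bar>2 * (1/2)\<^sup>2 - 2 * (1/2)\<bar> * L\<^sup>2 = L + L\<^sup>2"
    by (simp add: power2_eq_square field_simps)
  have S: "supermart (sqrt (\<epsilon> + (norm (x - y))\<^sup>2)) (Lyap (1/2) \<epsilon> U V)"
    using supermart_Lyap[OF \<epsilon>, of "1/2"] \<epsilon> by (simp add: powr_half_sqrt)
  then have [measurable]: "?Y \<in> borel_measurable M" using t unfolding supermart_def by blast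
  have [measurable]: "U t \<in> borel_measurable M" "V t \<in> borel_measurable M"
    using F_M[OF solutionD(1)[OF U t] t] F_M[OF solutionD(1)[OF V t] t] .
  note [measurable] = A
  have "{\<omega>\<in>space M. norm (U t \<omega> - V t \<omega>) > \<eta>} \<subseteq> {\<omega>\<in>space M. ?Y \<omega> > \<eta> * ?c} \<union> (A1 \<union> A2)"
  proof
    fix \<omega> assume \<omega>: "\<omega> \<in> {\<omega>\<in>space M. norm (U t \<omega> - V t \<omega>) > \<eta>}"
    show "\<omega> \<in> {\<omega>\<in>space M. ?Y \<omega> > \<eta> * ?c} \<union> (A1 \<union> A2)"
    proof (cases "\<omega> \<in> A1 \<union> A2")
      case False
      have "\<eta> < norm (U t \<omega> - V t \<omega>)" using \<omega> by simp
      also have "\<dots> \<le> sqrt (\<epsilon> + (norm (U t \<omega> - V t \<omega>))\<^sup>2)" using \<epsilon> by (intro real_le_rsqrt) simp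
      also have "\<dots> = (\<epsilon> + (norm (U t \<omega> - V t \<omega>))\<^sup>2) powr (1/2)" using \<epsilon> by (simp add: powr_half_sqrt)
      finally have "\<eta> * ?c < (\<epsilon> + (norm (U t \<omega> - V t \<omega>))\<^sup>2) powr (1/2) * ?c" by (intro mult_strict_right_mono) auto
      also have "\<dots> \<le> ?Y \<omega>"
        using Lyap_lower_ball[of t \<omega> R L \<epsilon> t "1/2", OF _ L \<epsilon>] R False \<omega> t unfolding C by blast
      finally show ?thesis using \<omega> by simp
    qed simp
  qed
  then have "prob {\<omega>\<in>space M. norm (U t \<omega> - V t \<omega>) > \<eta>} \<le> prob ({\<omega>\<in>space M. ?Y \<omega> > \<eta> * ?c} \<union> (A1 \<union> A2))"
    by (intro finite_measure_mono) auto
  also have "\<dots> \<le> prob {\<omega>\<in>space M. ?Y \<omega> > \<eta> * ?c} + prob (A1 \<union> A2)" by (rule measure_Un_le) auto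
  also have "prob (A1 \<union> A2) \<le> prob A1 + prob A2" by (rule measure_Un_le) (rule A)+
  also have "prob {\<omega>\<in>space M. ?Y \<omega> > \<eta> * ?c} \<le> sqrt (\<epsilon> + (norm (x - y))\<^sup>2) / (\<eta> * ?c)"
    using S t \<eta> \<epsilon> by (intro nn_integral_markov) (auto simp: supermart_def)
  also have "sqrt (\<epsilon> + (norm (x - y))\<^sup>2) / (\<eta> * ?c) = sqrt (\<epsilon> + (norm (x - y))\<^sup>2) * exp ((L + L\<^sup>2) * t) / \<eta>"
    unfolding exp_minus by (simp add: divide_inverse)
  finally show ?thesis by simp
qed

end

section \<open>The zero solution, nonvanishing and decay\<close>

lemma supermart_liminf_integral:
  assumes Y: "\<And>n. supermart (y n) (Y n)" and y: "y \<longlonglongrightarrow> y'" and t: "0 \<le> t"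
  shows "(\<integral>\<^sup>+\<omega>. liminf (\<lambda>n. ennreal (Y n t \<omega>)) \<partial>M) \<le> ennreal y'"
proof -
  have "(\<integral>\<^sup>+\<omega>. liminf (\<lambda>n. ennreal (Y n t \<omega>)) \<partial>M) \<le> liminf (\<lambda>n. \<integral>\<^sup>+\<omega>. ennreal (Y n t \<omega>) \<partial>M)"
    using Y t by (intro nn_integral_liminf measurable_compose[OF _ measurable_ennreal]) (auto simp: supermart_def)
  also have "\<dots> \<le> liminf (\<lambda>n. ennreal (y n))"
    using Y t by (intro Liminf_mono always_eventually allI) (auto simp: supermart_def)
  also have "\<dots> = ennreal y'" by (intro lim_imp_Liminf tendsto_ennrealI y) simp
  finally show ?thesis .
qed

lemma rational_sequence_from_right:
  obtains s :: "nat \<Rightarrow> real" where "\<And>n. s n \<in> \<rat>" "\<And>n. t < s n" "s \<longlonglongrightarrow> t"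
proof -
  have "\<exists>q\<in>\<rat>. t < q \<and> q < t + 1 / real (Suc n)" for n by (rule Rats_dense_in_real) simp
  then obtain s where s: "\<And>n. s n \<in> \<rat>" "\<And>n. t < s n" "\<And>n. s n < t + 1 / real (Suc n)" by metis
  have "s \<longlonglongrightarrow> t"
  proof (rule tendsto_sandwich[OF _ _ tendsto_const])
    show "(\<lambda>n. t + 1 / real (Suc n)) \<longlonglongrightarrow> t"
      using tendsto_add[OF tendsto_const[of t] LIMSEQ_Suc[OF lim_const_over_n[of 1]]] by simp
  qed (use s in \<open>auto intro!: always_eventually less_imp_le simp del: of_nat_Suc\<close>)
  with s show ?thesis using that by blast
qed

lemma tendsto_along_right_sequence:
  assumes f: "continuous_on {0..} f" and t: "0 \<le> t" and s: "\<And>n. t < s n" "s \<longlonglongrightarrow> (t::real)"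
  shows "(\<lambda>n. f (s n)) \<longlonglongrightarrow> f t"
proof (rule continuous_on_tendsto_compose[OF f s(2)])
  show "t \<in> {0..}" using t by simp
  show "\<forall>\<^sub>F n in sequentially. s n \<in> {0..}"
  proof (intro always_eventually allI)
    show "s n \<in> {0..}" for n using t s(1)[of n] by simp
  qed
qed

lemma AE_all_times:
  fixes U :: "real \<Rightarrow> 'w \<Rightarrow> 'b::real_normed_vector"
  assumes cont: "\<And>\<omega>. \<omega> \<in> space M \<Longrightarrow> continuous_on {0..} (\<lambda>r. U r \<omega>)"
    and z: "\<And>t. 0 \<le> t \<Longrightarrow> AE \<omega> in M. U t \<omega> = 0"
  shows "AE \<omega> in M. \<forall>t\<ge>0. U t \<omega> = 0"
proof -
  have "AE \<omega> in M. \<forall>q\<in>\<rat> \<inter> {0..}. U q \<omega> = 0"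
    using countable_rat z by (subst AE_ball_countable) (auto intro: countable_subset)
  then show ?thesis
    using AE_space
  proof (eventually_elim, intro allI impI)
    fix \<omega> t assume q: "\<forall>q\<in>\<rat> \<inter> {0..}. U q \<omega> = 0" and \<omega>: "\<omega> \<in> space M" and t: "(0::real) \<le> t"
    obtain s where s: "\<And>n. s n \<in> \<rat>" "\<And>n. t < s n" "s \<longlonglongrightarrow> t" by (rule rational_sequence_from_right) blast
    have "(\<lambda>n. U (s n) \<omega>) \<longlonglongrightarrow> U t \<omega>" by (rule tendsto_along_right_sequence[OF cont[OF \<omega>] t s(2,3)])
    moreover have "U (s n) \<omega> = 0" for n using q s(1,2)[of n] t by auto
    ultimately show "U t \<omega> = 0" by (simp add: LIMSEQ_const_iff)
  qed
qed

text \<open>With \<kappa> = 1/2 the initial value is the square root of \<epsilon>, so the lower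
  limit of the discounted processes vanishes almost surely; \<open>Lyap_lower\<close> bounds it
  below by a positive multiple of |U t|.\<close>

theorem solution_zero_unique:
  assumes U: "solution 0 U"
  shows "AE \<omega> in M. \<forall>t\<ge>0. U t \<omega> = 0"
proof (rule AE_all_times[OF solutionD(2)[OF U]])
  fix t :: real assume t: "0 \<le> t"
  let ?V = "\<lambda>r \<omega>. 0 :: 'k ell2"
  let ?e = "\<lambda>n. 1 / real (Suc n)"
  let ?Y = "\<lambda>n. Lyap (1/2) (?e n) U ?V"
  have S: "supermart (sqrt (?e n)) (?Y n)" for n
    using supermart_Lyap[OF U solution_zero, of "?e n" "1/2"] by (simp add: powr_half_sqrt del: of_nat_Suc)
  have "(\<lambda>n. sqrt (?e n)) \<longlonglongrightarrow> sqrt 0" by (intro tendsto_real_sqrt LIMSEQ_Suc[OF lim_const_over_n])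
  then have "(\<integral>\<^sup>+\<omega>. liminf (\<lambda>n. ennreal (?Y n t \<omega>)) \<partial>M) \<le> ennreal (sqrt 0)"
    by (intro supermart_liminf_integral[OF S _ t])
  then have "(\<integral>\<^sup>+\<omega>. liminf (\<lambda>n. ennreal (?Y n t \<omega>)) \<partial>M) = 0" by simp
  moreover have "(\<lambda>\<omega>. liminf (\<lambda>n. ennreal (?Y n t \<omega>))) \<in> borel_measurable M"
    using S t by (intro borel_measurable_liminf measurable_compose[OF _ measurable_ennreal]) (auto simp: supermart_def)
  ultimately have "AE \<omega> in M. liminf (\<lambda>n. ennreal (?Y n t \<omega>)) = 0" by (simp add: nn_integral_0_iff_AE)
  then show "AE \<omega> in M. U t \<omega> = 0"
    using AE_space
  proof eventually_elim
    fix \<omega> assume l: "liminf (\<lambda>n. ennreal (?Y n t \<omega>)) = 0" and \<omega>: "\<omega> \<in> space M"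
    obtain c where c: "c > 0" "\<And>\<epsilon> s. \<epsilon> > 0 \<Longrightarrow> 0 \<le> s \<Longrightarrow> s \<le> t \<Longrightarrow> (\<epsilon> + (norm (U s \<omega> - ?V s \<omega>))\<^sup>2) powr (1/2) * c \<le> Lyap (1/2) \<epsilon> U ?V s \<omega>"
      by (rule Lyap_lower[OF U solution_zero \<omega> t]) blast
    have "ennreal (norm (U t \<omega>) * c) \<le> ennreal (?Y n t \<omega>)" for n
    proof (rule ennreal_leI)
      have "norm (U t \<omega>) \<le> sqrt (?e n + (norm (U t \<omega>))\<^sup>2)" by (intro real_le_rsqrt) simp
      also have "\<dots> = (?e n + (norm (U t \<omega> - 0))\<^sup>2) powr (1/2)" by (simp add: powr_half_sqrt)
      finally have "norm (U t \<omega>) * c \<le> (?e n + (norm (U t \<omega> - 0))\<^sup>2) powr (1/2) * c" using c(1) by (intro mult_right_mono) auto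
      also have "\<dots> \<le> ?Y n t \<omega>" using t by (intro c(2)) auto
      finally show "norm (U t \<omega>) * c \<le> ?Y n t \<omega>" .
    qed
    then have "ennreal (norm (U t \<omega>) * c) \<le> liminf (\<lambda>n. ennreal (?Y n t \<omega>))" by (intro Liminf_bounded always_eventually) auto
    then show "U t \<omega> = 0" using l c(1) by (simp add: ennreal_eq_0_iff mult_le_0_iff)
  qed
qed

text \<open>If a path reached 0, the power with \<kappa> = -1/2 would be of size
  \<open>\<epsilon>^(-1/2)\<close> there, up to a factor independent of \<epsilon>. The maximal
  inequality, with initial value at most 1/|x| for every \<epsilon>, excludes this off an event of
  small probability.\<close>

theorem solution_nonvanishing:
  assumes U: "solution x U" and x: "x \<noteq> 0"
  shows "AE \<omega> in M. \<forall>t\<ge>0. U t \<omega> \<noteq> 0"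
proof -
  let ?V = "\<lambda>r \<omega>. 0 :: 'k ell2"
  let ?e = "\<lambda>n. 1 / real (Suc n)"
  let ?Y = "\<lambda>n. Lyap (-1/2) (?e n) U ?V"
  let ?y = "1 / norm x"
  have "\<exists>B\<in>sets M. prob B \<le> ?y / c \<and> (\<forall>\<omega>\<in>space M - B. \<forall>t\<ge>0. U t \<omega> \<noteq> 0)" if c: "c > 0" for c
  proof -
    have "\<exists>A\<in>sets M. prob A \<le> ?y / c \<and> (\<forall>\<omega>\<in>space M - A. \<forall>t\<ge>0. ?Y n t \<omega> \<le> c)" for n
    proof -
      have S: "supermart ((?e n + (norm (x - 0))\<^sup>2) powr (-1/2)) (?Y n)" by (rule supermart_Lyap[OF U solution_zero]) simp
      obtain A where A: "A \<in> sets M" "prob A \<le> (?e n + (norm (x - 0))\<^sup>2) powr (-1/2) / c"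
        "\<And>\<omega> t. \<omega> \<in> space M - A \<Longrightarrow> 0 \<le> t \<Longrightarrow> ?Y n t \<omega> \<le> c"
        by (rule supermart_bounded_paths[OF S Lyap_F_cont(2)[OF U solution_zero] c]) auto
      have "(?e n + (norm (x - 0))\<^sup>2) powr (-1/2) \<le> ((norm x)\<^sup>2) powr (-1/2)"
        using x by (intro powr_mono2') auto
      also have "\<dots> = ?y" using x by (simp add: powr_minus powr_half_sqrt inverse_eq_divide)
      finally have "prob A \<le> ?y / c" using A(2) c by (meson divide_right_mono less_imp_le order_trans)
      then show ?thesis using A by blast
    qed
    then obtain A where A: "\<And>n. A n \<in> sets M" "\<And>n. prob (A n) \<le> ?y / c"
      "\<And>n \<omega> t. \<omega> \<in> space M - A n \<Longrightarrow> 0 \<le> t \<Longrightarrow> ?Y n t \<omega> \<le> c" by metis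
    \<comment> \<open>The exceptional events depend on \<epsilon>. A path outside the union of the
      \<open>I m\<close> avoids \<open>A n\<close> for infinitely many n, which suffices, and this
      union is an increasing limit of events of probability at most \<open>?y / c\<close>.\<close>
    define I where "I m = (\<Inter>n\<in>{m..}. A n)" for m
    have Im: "I m \<in> sets M" for m unfolding I_def by (rule sets.countable_INT') (use A(1) in auto)
    have "incseq I" unfolding I_def incseq_def by (intro allI impI INF_superset_mono) auto
    then have lim: "(\<lambda>m. prob (I m)) \<longlonglongrightarrow> prob (\<Union>m. I m)" using Im by (intro finite_Lim_measure_incseq) auto
    have "prob (I m) \<le> ?y / c" for m
    proof -
      have "prob (I m) \<le> prob (A m)" using A(1) by (intro finite_measure_mono) (auto simp: I_def)
      then show ?thesis using A(2)[of m] by linarith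
    qed
    then have P: "prob (\<Union>m. I m) \<le> ?y / c" using lim by (intro LIMSEQ_le_const2[OF lim]) auto
    have "U t \<omega> \<noteq> 0" if \<omega>: "\<omega> \<in> space M - (\<Union>m. I m)" and t: "0 \<le> t" for \<omega> t
    proof
      assume z: "U t \<omega> = 0"
      obtain k where k: "k > 0" "\<And>\<epsilon> s. \<epsilon> > 0 \<Longrightarrow> 0 \<le> s \<Longrightarrow> s \<le> t \<Longrightarrow> (\<epsilon> + (norm (U s \<omega> - ?V s \<omega>))\<^sup>2) powr (-1/2) * k \<le> Lyap (-1/2) \<epsilon> U ?V s \<omega>"
        by (rule Lyap_lower[OF U solution_zero _ t, of \<omega>]) (use \<omega> in auto)
      \<comment> \<open>From m on, \<open>sqrt (Suc n) * k\<close> exceeds c, contradicting the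
        bound at an n with \<omega> outside \<open>A n\<close>.\<close>
      obtain m :: nat where m: "(c / k)\<^sup>2 < real m" using reals_Archimedean2 by blast
      obtain n where n: "n \<ge> m" "\<omega> \<notin> A n" using \<omega> unfolding I_def by auto
      have "?e n powr (-1/2) = sqrt (real (Suc n))"
        by (simp add: powr_minus powr_half_sqrt real_sqrt_divide inverse_eq_divide del: of_nat_Suc)
      moreover have "?e n powr (-1/2) * k \<le> ?Y n t \<omega>" using k(2)[of "?e n" t] z t by simp
      moreover have "?Y n t \<omega> \<le> c" using A(3)[of \<omega> n t] \<omega> n t by auto
      ultimately have "sqrt (real (Suc n)) * k \<le> c" by simp
      then have "sqrt (real (Suc n)) \<le> c / k" using k(1) by (simp add: field_simps)
      then have "(sqrt (real (Suc n)))\<^sup>2 \<le> (c / k)\<^sup>2" by (intro power_mono) auto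
      then show False using m n(1) by simp
    qed
    moreover have "(\<Union>m. I m) \<in> sets M" using Im by auto
    ultimately show ?thesis using P by blast
  qed
  then have "\<exists>B\<in>sets M. prob B \<le> ?y / real (Suc n) \<and> (\<forall>\<omega>\<in>space M - B. \<forall>t\<ge>0. U t \<omega> \<noteq> 0)" for n by simp
  then obtain B where B: "\<And>n. B n \<in> sets M" "\<And>n. prob (B n) \<le> ?y / real (Suc n)"
    "\<And>n \<omega> t. \<omega> \<in> space M - B n \<Longrightarrow> 0 \<le> t \<Longrightarrow> U t \<omega> \<noteq> 0" by metis
  have BI: "(\<Inter>n. B n) \<in> sets M" using B(1) by auto
  have "prob (\<Inter>n. B n) \<le> ?y / real (Suc n)" for n
    using finite_measure_mono[of "\<Inter>n. B n" "B n"] B(1,2)[of n] by (meson INT_lower UNIV_I order_trans)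
  then have "prob (\<Inter>n. B n) \<le> 0" by (intro LIMSEQ_le_const[OF LIMSEQ_Suc[OF lim_const_over_n]]) blast
  then have "prob (\<Inter>n. B n) = 0" by (simp add: measure_le_0_iff)
  then have "(\<Inter>n. B n) \<in> null_sets M" using BI by (simp add: null_sets_def emeasure_eq_measure)
  then show ?thesis using B(3) by (intro AE_I'[of "\<Inter>n. B n"]) blast+
qed

text \<open>The limit of \<epsilon> to 0 at \<kappa> = p/2. The rates converge pointwise because the
  path never vanishes, and they have a majorant independent of \<epsilon> because the coefficients
  are Lipschitz on a ball containing the path up to time t.\<close>

theorem supermart_decay:
  assumes p: "p > 0"
    and energy: "\<And>v. norm v * norm (G v) + (norm (\<Phi> v))\<^sup>2 / 2 - (1 - p / 2) * (v \<bullet> \<Phi> v)\<^sup>2 / (norm v)\<^sup>2 \<le> B * (norm v)\<^sup>2"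
    and U: "solution x U"
  shows "supermart (norm x powr p) (\<lambda>t \<omega>. norm (U t \<omega>) powr p * exp (- (p * B) * t))"
\<comment> \<open>For x = 0 nonvanishing fails; the path is then identically 0 by
  uniqueness.\<close>
proof (cases "x = 0")
  case True
  have z: "AE \<omega> in M. \<forall>t\<ge>0. U t \<omega> = 0" using solution_zero_unique U True by simp
  have [measurable]: "0 \<le> t \<Longrightarrow> U t \<in> borel_measurable M" for t using F_M[OF solutionD(1)[OF U]] .
  have "prob {\<omega> \<in> space M. \<exists>j\<le>m. c < norm (U (real j * h) \<omega>) powr p * exp (- (p * B) * (real j * h))} \<le> 0"
    if h: "0 < h" and c: "0 < c" for h c :: real and m :: nat
  proof -
    have "prob {\<omega> \<in> space M. \<exists>j\<le>m. c < norm (U (real j * h) \<omega>) powr p * exp (- (p * B) * (real j * h))} \<le> prob {}"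
    proof (rule finite_measure_mono_AE)
      show "AE \<omega> in M. \<omega> \<in> {\<omega> \<in> space M. \<exists>j\<le>m. c < norm (U (real j * h) \<omega>) powr p * exp (- (p * B) * (real j * h))} \<longrightarrow> \<omega> \<in> {}"
        using z by eventually_elim (use h c p in auto)
    qed simp
    then show ?thesis by simp
  qed
  moreover have "(\<integral>\<^sup>+\<omega>. ennreal (norm (U t \<omega>) powr p * exp (- (p * B) * t)) \<partial>M) = 0" if t: "0 \<le> t" for t
    using z t by (subst nn_integral_0_iff_AE) (auto elim!: eventually_mono)
  ultimately show ?thesis unfolding supermart_def using True p by auto
next
  case False
  let ?V = "\<lambda>r \<omega>. 0 :: 'k ell2"
  let ?e = "\<lambda>n. 1 / real (Suc n)"
  let ?Y = "\<lambda>n. Lyap (p/2) (?e n) U ?V"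
  have e0: "?e \<longlonglongrightarrow> 0" by (rule LIMSEQ_Suc[OF lim_const_over_n])
  have S: "supermart ((?e n + (norm (x - 0))\<^sup>2) powr (p/2)) (?Y n)" for n by (rule supermart_Lyap[OF U solution_zero]) simp
  have sq: "((norm z)\<^sup>2) powr (p/2) = norm z powr p" if "z \<noteq> 0" for z :: "'k ell2"
    using that powr_powr[of "norm z" 2 "p / 2"] by simp
  show ?thesis
  proof (rule supermart_limit[OF S])
    have "(\<lambda>n. (?e n + (norm (x - 0))\<^sup>2) powr (p/2)) \<longlonglongrightarrow> (0 + (norm (x - 0))\<^sup>2) powr (p/2)"
      using False by (intro tendsto_intros e0) auto
    then show "(\<lambda>n. (?e n + (norm (x - 0))\<^sup>2) powr (p/2)) \<longlonglongrightarrow> norm x powr p"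
      using sq[OF False] by simp
    show "(\<lambda>\<omega>. norm (U t \<omega>) powr p * exp (- (p * B) * t)) \<in> borel_measurable M" if "0 \<le> t" for t
    proof -
      have [measurable]: "U t \<in> borel_measurable M" using F_M[OF solutionD(1)[OF U that] that] .
      show ?thesis by measurable
    qed
    show "AE \<omega> in M. \<forall>t\<ge>0. ennreal (norm (U t \<omega>) powr p * exp (- (p * B) * t)) \<le> liminf (\<lambda>n. ennreal (?Y n t \<omega>))"
      using solution_nonvanishing[OF U False] AE_space
    proof (eventually_elim, intro allI impI)
      fix \<omega> t assume nz: "\<forall>t\<ge>0. U t \<omega> \<noteq> 0" and \<omega>: "\<omega> \<in> space M" and t: "(0::real) \<le> t"
      obtain R where R: "\<And>r. 0 \<le> r \<Longrightarrow> r \<le> t \<Longrightarrow> norm (U r \<omega>) \<le> R"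
        using continuous_bounded[OF continuous_on_subset[OF solutionD(2)[OF U \<omega>]], of t] by auto
      obtain L where L: "L \<ge> 0" "\<And>U V. norm U \<le> R \<Longrightarrow> norm V \<le> R \<Longrightarrow> norm (\<Phi> U - \<Phi> V) \<le> L * norm (U - V)"
        "\<And>U V. norm U \<le> R \<Longrightarrow> norm V \<le> R \<Longrightarrow> norm (G U - G V) \<le> L * norm (U - V)"
        by (rule lip[of R]) blast
      let ?l = "\<lambda>\<epsilon> r. lrate (p/2) \<epsilon> (U r \<omega> - 0) (\<Phi> (U r \<omega>) - \<Phi> 0) (norm (G (U r \<omega>) - G 0))"
      let ?C = "\<bar>p/2\<bar> * (2 * L) + \<bar>p/2\<bar> * L\<^sup>2 + \<bar>2 * (p/2)\<^sup>2 - 2 * (p/2)\<bar> * L\<^sup>2"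
      have lim: "?l 0 integrable_on {0..t}" "(\<lambda>n. integral {0..t} (?l (?e n))) \<longlonglongrightarrow> integral {0..t} (?l 0)"
      proof (atomize (full), intro conjI)
        have 0: "(\<lambda>_. ?C) integrable_on {0..t}" by (intro integrable_continuous_interval continuous_on_const)
        have 1: "?l (?e n) integrable_on {0..t}" for n
          by (rule integrable_continuous_interval[OF continuous_on_subset[OF Lyap_F_cont(1)[OF U solution_zero _ \<omega>]]]) auto
        have 2: "norm (?l (?e n) r) \<le> ?C" if r: "r \<in> {0..t}" for n r
          unfolding real_norm_def
          by (rule rate_bound_ball[OF U solution_zero, of r \<omega> R L, OF _ _ L])
            (use R[of r] r order_trans[OF norm_ge_zero R[of r]] in auto)
        have 3: "(\<lambda>n. ?l (?e n) r) \<longlonglongrightarrow> ?l 0 r" if r: "r \<in> {0..t}" for r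
        proof -
          have "0 + (norm (U r \<omega> - 0))\<^sup>2 \<noteq> 0" using nz r by simp
          then show ?thesis unfolding lrate_def Let_def by (intro tendsto_intros e0)
        qed
        show "?l 0 integrable_on {0..t}" "(\<lambda>n. integral {0..t} (?l (?e n))) \<longlonglongrightarrow> integral {0..t} (?l 0)"
          by (rule dominated_convergence[OF 1 0 2 3]; assumption)+
      qed
      have "integral {0..t} (?l 0) \<le> integral {0..t} (\<lambda>r. p * B)"
      proof (rule integral_le[OF lim(1)])
        fix r assume r: "r \<in> {0..t}"
        let ?v = "U r \<omega>"
        have v: "norm ?v > 0" using nz r by simp
        \<comment> \<open>At \<epsilon> = 0 and \<kappa> = p/2 one has
          \<open>2 \<kappa>^2 - 2 \<kappa> = - p (1 - p/2)\<close>, so the rate is p times the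
          energy expression over |v|^2.\<close>
        have "?l 0 r = p * (norm ?v * norm (G ?v) + (norm (\<Phi> ?v))\<^sup>2 / 2 - (1 - p / 2) * (?v \<bullet> \<Phi> ?v)\<^sup>2 / (norm ?v)\<^sup>2) / (norm ?v)\<^sup>2"
          using v p unfolding lrate_def Let_def \<Phi>_0 G_0 by (simp add: field_simps power2_eq_square)
        also have "\<dots> \<le> p * (B * (norm ?v)\<^sup>2) / (norm ?v)\<^sup>2"
          using energy[of ?v] p by (intro divide_right_mono mult_left_mono) auto
        also have "\<dots> = p * B" using v by simp
        finally show "?l 0 r \<le> p * B" .
      qed (intro integrable_continuous_interval continuous_on_const)
      then have il: "integral {0..t} (?l 0) \<le> p * B * t" using t by (simp add: mult.commute mult.left_commute)
      have "(\<lambda>n. ?Y n t \<omega>) \<longlonglongrightarrow> (0 + (norm (U t \<omega> - 0))\<^sup>2) powr (p/2) * exp (- integral {0..t} (?l 0))"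
        unfolding Lyap_def using nz t by (intro tendsto_intros e0 lim(2)) auto
      then have "liminf (\<lambda>n. ennreal (?Y n t \<omega>)) = ennreal ((0 + (norm (U t \<omega> - 0))\<^sup>2) powr (p/2) * exp (- integral {0..t} (?l 0)))"
        by (intro lim_imp_Liminf tendsto_ennrealI) auto
      moreover have "norm (U t \<omega>) powr p * exp (- (p * B) * t) \<le> (0 + (norm (U t \<omega> - 0))\<^sup>2) powr (p/2) * exp (- integral {0..t} (?l 0))"
        using sq[of "U t \<omega>"] nz t il by (auto intro!: mult_left_mono)
      ultimately show "ennreal (norm (U t \<omega>) powr p * exp (- (p * B) * t)) \<le> liminf (\<lambda>n. ennreal (?Y n t \<omega>))"
        by (simp add: ennreal_leI)
    qed
  qed simp
qed

end

section \<open>The nonlinearity on Sobolev spaces\<close>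

lemma sq_coord_le_freq_norm: "(real_of_int (k $ i))\<^sup>2 \<le> (freq_norm k)\<^sup>2"
proof -
  have "(real_of_int (k $ i))\<^sup>2 \<le> (\<Sum>i\<in>UNIV. (real_of_int (k $ i))\<^sup>2)" by (rule member_le_sum) auto
  also have "\<dots> = (freq_norm k)\<^sup>2" unfolding freq_norm_def by (simp add: sum_nonneg)
  finally show ?thesis .
qed

text \<open>Both halves of the integers are compared with the convergent series of the powers of n
  with exponent -q.\<close>

lemma sum_int_powr_bound:
  fixes q :: real
  assumes q: "q > 1"
  obtains S where "\<And>A :: int set. finite A \<Longrightarrow> (\<Sum>a\<in>A. sqrt (1 + (real_of_int a)\<^sup>2) powr (- q)) \<le> S"
proof -
  let ?g = "\<lambda>a :: int. sqrt (1 + (real_of_int a)\<^sup>2) powr (- q)"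
  have sm: "summable (\<lambda>n. ?g (int n))"
  proof (rule summable_comparison_test_ev)
    show "summable (\<lambda>n. real n powr (- q))" using q by (simp add: summable_real_powr_iff)
    show "\<forall>\<^sub>F n in sequentially. norm (?g (int n)) \<le> real n powr (- q)"
      using eventually_gt_at_top[of 0]
    proof eventually_elim
      fix n :: nat assume n: "0 < n"
      have "real n \<le> sqrt (1 + (real n)\<^sup>2)" by (intro real_le_rsqrt) simp
      then show "norm (?g (int n)) \<le> real n powr (- q)" using n q by (simp add: powr_mono2')
    qed
  qed
  show thesis
  proof (rule that)
    fix A :: "int set" assume A: "finite A"
    define m where "m = Max (insert 0 ((\<lambda>a. nat \<bar>a\<bar>) ` A))"
    have m: "nat \<bar>a\<bar> \<le> m" if "a \<in> A" for a unfolding m_def using A that by (intro Max_ge) auto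
    have sub: "A \<subseteq> int ` {..m} \<union> (\<lambda>n. - int n) ` {..m}"
    proof
      fix a assume "a \<in> A"
      then have "nat \<bar>a\<bar> \<in> {..m}" "a = int (nat \<bar>a\<bar>) \<or> a = - int (nat \<bar>a\<bar>)" using m by auto
      then show "a \<in> int ` {..m} \<union> (\<lambda>n. - int n) ` {..m}" by blast
    qed
    have "sum ?g A \<le> sum ?g (int ` {..m} \<union> (\<lambda>n. - int n) ` {..m})" by (rule sum_mono2[OF _ sub]) auto
    also have "\<dots> \<le> sum ?g (int ` {..m}) + sum ?g ((\<lambda>n. - int n) ` {..m})"
      by (subst sum.union_inter[symmetric]) (auto intro: sum_nonneg)
    also have "\<dots> = (\<Sum>n\<le>m. ?g (int n)) + (\<Sum>n\<le>m. ?g (int n))"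
      by (subst (1 2) sum.reindex) (auto simp: inj_on_def)
    also have "(\<Sum>n\<le>m. ?g (int n)) \<le> (\<Sum>n. ?g (int n))" by (rule sum_le_suminf[OF sm]) auto
    finally show "sum ?g A \<le> (\<Sum>n. ?g (int n)) + (\<Sum>n. ?g (int n))" by simp
  qed
qed

text \<open>A power of \<open>\<langle>k\<rangle>\<close> splits into \<open>d\<close> equal factors, each of which is compared with one coordinate.\<close>

lemma jbracket_powr_summable:
  assumes s: "s > real CARD('d) / 2"
  shows "(\<lambda>k :: int ^ 'd::finite. jbracket k powr (- 2 * s)) summable_on UNIV"
proof (rule nonneg_bdd_above_summable_on)
  define q where "q = 2 * s / real CARD('d)"
  have q: "q > 1" using s unfolding q_def by (simp add: field_simps)
  let ?g = "\<lambda>a :: int. sqrt (1 + (real_of_int a)\<^sup>2) powr (- q)"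
  obtain S where S: "\<And>A :: int set. finite A \<Longrightarrow> sum ?g A \<le> S" by (rule sum_int_powr_bound[OF q]) blast
  have le: "jbracket k powr (- 2 * s) \<le> (\<Prod>i\<in>UNIV. ?g (k $ i))" for k :: "int ^ 'd"
  proof -
    have "jbracket k powr (- 2 * s) = (\<Prod>i\<in>(UNIV :: 'd set). jbracket k powr (- q))"
      using jbracket_pos[of k] by (simp add: powr_realpow[symmetric] powr_powr q_def)
    also have "\<dots> \<le> (\<Prod>i\<in>UNIV. ?g (k $ i))"
    proof (rule prod_mono)
      fix i :: 'd
      have "sqrt (1 + (real_of_int (k $ i))\<^sup>2) \<le> jbracket k"
        unfolding jbracket_def using sq_coord_le_freq_norm[of k i] by simp
      moreover have "0 < sqrt (1 + (real_of_int (k $ i))\<^sup>2)" by (simp add: add_pos_nonneg)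
      ultimately show "0 \<le> jbracket k powr (- q) \<and> jbracket k powr (- q) \<le> ?g (k $ i)"
        using q by (simp add: powr_mono2')
    qed
    finally show ?thesis .
  qed
  have "sum (\<lambda>k :: int ^ 'd. jbracket k powr (- 2 * s)) F \<le> S ^ CARD('d)" if F: "finite F" for F
  proof -
    \<comment> \<open>All coordinates that occur in F. Enlarging F to the product set over A makes
      the sum of products factorise into one-dimensional sums.\<close>
    define A where "A = (\<Union>i. (\<lambda>k. k $ i) ` F)"
    have A: "finite A" unfolding A_def using F by auto
    let ?P = "PiE (UNIV :: 'd set) (\<lambda>_. A)"
    have fP: "finite ?P" using A by (intro finite_PiE) auto
    have inj: "inj_on (\<lambda>k. ($) k) F" by (auto simp: inj_on_def vec_eq_iff)
    have "sum (\<lambda>k. jbracket k powr (- 2 * s)) F \<le> (\<Sum>k\<in>F. \<Prod>i\<in>UNIV. ?g (k $ i))" by (intro sum_mono le)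
    also have "\<dots> = (\<Sum>h\<in>(\<lambda>k. ($) k) ` F. \<Prod>i\<in>UNIV. ?g (h i))" by (subst sum.reindex[OF inj]) simp
    also have "\<dots> \<le> (\<Sum>h\<in>?P. \<Prod>i\<in>UNIV. ?g (h i))"
      by (rule sum_mono2[OF fP]) (auto simp: A_def intro!: prod_nonneg)
    also have "\<dots> = (\<Prod>i\<in>(UNIV :: 'd set). \<Sum>a\<in>A. ?g a)" using A by (subst prod_sum_PiE) auto
    also have "\<dots> = (\<Sum>a\<in>A. ?g a) ^ CARD('d)" by simp
    also have "\<dots> \<le> S ^ CARD('d)" by (intro power_mono S A sum_nonneg) auto
    finally show ?thesis .
  qed
  then show "bdd_above (sum (\<lambda>k :: int ^ 'd. jbracket k powr (- 2 * s)) ` {F. F \<subseteq> UNIV \<and> finite F})"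
    by (intro bdd_aboveI2) auto
qed simp

text \<open>Weighted arithmetic-geometric mean: with \<open>J = <k>^s\<close>, |u k| is at most
  \<open>J^-2 + J^2 |u k|^2\<close>, and both series converge.\<close>

lemma sob_abs_summable:
  fixes u :: "('d::finite) fseries"
  assumes s: "s > real CARD('d) / 2" and u: "u \<in> sob s"
  shows "(\<lambda>k. cmod (u k)) summable_on UNIV"
proof (rule summable_on_comparison_test)
  show "(\<lambda>k. jbracket k powr (- 2 * s) + jbracket k powr (2 * s) * (cmod (u k))\<^sup>2) summable_on UNIV"
    using u unfolding sob_def by (intro summable_on_add jbracket_powr_summable s) simp
  fix k :: "int ^ 'd"
  define J where "J = jbracket k powr s"
  have J: "J > 0" using jbracket_pos[of k] unfolding J_def by simp
  have "cmod (u k) \<le> (1 / J)\<^sup>2 + (J * cmod (u k))\<^sup>2"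
    using sum_squares_bound[of "1 / J" "J * cmod (u k)"] J norm_ge_zero[of "u k"] by (simp del: norm_ge_zero)
  also have "(1 / J)\<^sup>2 = jbracket k powr (- 2 * s)"
    unfolding J_def by (simp add: power_divide powr_power[symmetric] powr_minus_divide powr_powr power2_eq_square powr_add[symmetric])
  also have "(J * cmod (u k))\<^sup>2 = jbracket k powr (2 * s) * (cmod (u k))\<^sup>2"
    unfolding J_def by (simp add: power_mult_distrib power2_eq_square powr_add[symmetric])
  finally show "cmod (u k) \<le> jbracket k powr (- 2 * s) + jbracket k powr (2 * s) * (cmod (u k))\<^sup>2" .
qed auto

lemma norm_fbasis: "cmod (fbasis k x) = (2 * pi) powr (- real CARD('d) / 2)" for x :: "real ^ 'd::finite"
  unfolding fbasis_def by (simp add: norm_mult)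

lemma
  fixes u :: "('d::finite) fseries"
  assumes u: "(\<lambda>k. cmod (u k)) summable_on UNIV"
  shows fun_of_abs_summable: "(\<lambda>k. norm (u k * fbasis k x)) summable_on UNIV"
    and fun_of_summable: "(\<lambda>k. u k * fbasis k x) summable_on UNIV"
    and norm_fun_of_le: "cmod (fun_of u x) \<le> (2 * pi) powr (- real CARD('d) / 2) * (\<Sum>\<^sub>\<infinity>k. cmod (u k))"
    and fun_of_measurable: "fun_of u \<in> borel_measurable borel"
proof -
  show 1: "(\<lambda>k. norm (u k * fbasis k x)) summable_on UNIV" for x
    unfolding norm_mult norm_fbasis by (rule summable_on_cmult_left[OF u])
  then show "(\<lambda>k. u k * fbasis k x) summable_on UNIV" by (rule abs_summable_summable)
  have "cmod (fun_of u x) \<le> (\<Sum>\<^sub>\<infinity>k. norm (u k * fbasis k x))" unfolding fun_of_def by (rule norm_infsum_bound[OF 1])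
  also have "\<dots> = (2 * pi) powr (- real CARD('d) / 2) * (\<Sum>\<^sub>\<infinity>k. cmod (u k))"
    unfolding norm_mult norm_fbasis by (subst mult.commute) (rule infsum_cmult_right[OF u])
  finally show "cmod (fun_of u x) \<le> (2 * pi) powr (- real CARD('d) / 2) * (\<Sum>\<^sub>\<infinity>k. cmod (u k))" .
  \<comment> \<open>As an integral over the counting measure the series inherits measurability in x
    from a jointly measurable integrand.\<close>
  have "fun_of u x = (LINT k|count_space UNIV. u k * fbasis k x)" for x
    unfolding fun_of_def infsetsum_def[symmetric]
    by (rule infsetsum_infsum[symmetric]) (use 1 abs_summable_equivalent in blast)
  then have eq: "fun_of u = (\<lambda>x. LINT k|count_space UNIV. u k * fbasis k x)" by blast
  interpret sigma_finite_measure "count_space (UNIV :: (int ^ 'd) set)" by (rule sigma_finite_measure_count_space)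
  have "fbasis k \<in> borel_measurable borel" for k :: "int ^ 'd"
    unfolding fbasis_def freq_dot_def by measurable
  then have "(\<lambda>(x, k). u k * fbasis k x) \<in> borel_measurable (borel \<Otimes>\<^sub>M count_space UNIV)"
    by (subst measurable_pair_swap_iff, intro measurable_pair_measure_countable1) auto
  then show "fun_of u \<in> borel_measurable borel" unfolding eq by (rule borel_measurable_lebesgue_integral)
qed

lemma fun_of_add_cmult:
  assumes "(\<lambda>k. cmod (u k)) summable_on UNIV" "(\<lambda>k. cmod (v k)) summable_on UNIV"
  shows "fun_of (\<lambda>k. u k + c * v k) x = fun_of u x + c * fun_of v x"
proof -
  have "fun_of (\<lambda>k. u k + c * v k) x = (\<Sum>\<^sub>\<infinity>k. u k * fbasis k x + c * (v k * fbasis k x))"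
    unfolding fun_of_def by (simp add: algebra_simps)
  also have "\<dots> = fun_of u x + (\<Sum>\<^sub>\<infinity>k. c * (v k * fbasis k x))"
    unfolding fun_of_def by (intro infsum_add summable_on_cmult_right fun_of_summable assms)
  also have "(\<Sum>\<^sub>\<infinity>k. c * (v k * fbasis k x)) = c * fun_of v x"
    unfolding fun_of_def by (intro infsum_cmult_right fun_of_summable assms)
  finally show ?thesis .
qed

lemma finite_measure_torus: "finite_measure (torus :: (real ^ 'd::finite) measure)"
proof
  let ?C = "{x :: real ^ 'd. \<forall>i. 0 \<le> x $ i \<and> x $ i < 2 * pi}"
  have sub: "?C \<subseteq> cbox 0 (\<chi> i. 2 * pi)" by (auto simp: mem_box_cart less_imp_le)
  have "?C \<in> sets borel" by measurable
  then have "emeasure torus (space (torus :: (real ^ 'd) measure)) = emeasure lborel ?C"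
    unfolding torus_def by (simp add: emeasure_restrict_space space_restrict_space)
  also have "\<dots> \<le> emeasure lborel (cbox 0 (\<chi> i. 2 * pi) :: (real ^ 'd) set)" by (rule emeasure_mono[OF sub]) simp
  also have "\<dots> < \<infinity>" by (rule emeasure_lborel_cbox_finite)
  finally show "emeasure torus (space (torus :: (real ^ 'd) measure)) \<noteq> \<infinity>" by simp
qed

lemma fourier_coeff_sum:
  fixes g :: "'j \<Rightarrow> real ^ 'd::finite \<Rightarrow> complex"
  assumes "\<And>j. j \<in> J \<Longrightarrow> g j \<in> borel_measurable borel" "\<And>j x. j \<in> J \<Longrightarrow> cmod (g j x) \<le> B j"
  shows "fourier_coeff (\<lambda>x. \<Sum>j\<in>J. c j * g j x) k = (\<Sum>j\<in>J. c j * fourier_coeff (g j) k)"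
proof -
  interpret finite_measure "torus :: (real ^ 'd) measure" by (rule finite_measure_torus)
  let ?e = "\<lambda>x. exp (- (\<i> * of_real (freq_dot k x)))"
  have int: "integrable torus (\<lambda>x. g j x * ?e x)" if j: "j \<in> J" for j
  proof (rule integrable_const_bound[where B = "B j"])
    have [measurable]: "g j \<in> borel_measurable borel" using assms j by blast
    have "(\<lambda>x. g j x * ?e x) \<in> borel_measurable borel" unfolding freq_dot_def by measurable
    then show "(\<lambda>x. g j x * ?e x) \<in> borel_measurable torus"
      unfolding torus_def by (intro measurable_restrict_space1) simp
  qed (use assms j in \<open>auto simp: norm_mult\<close>)
  have "(LINT x|torus. (\<Sum>j\<in>J. c j * g j x) * ?e x) = (LINT x|torus. (\<Sum>j\<in>J. c j * (g j x * ?e x)))"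
    by (simp add: sum_distrib_right mult.assoc)
  also have "\<dots> = (\<Sum>j\<in>J. c j * (LINT x|torus. g j x * ?e x))"
    using int by (subst Bochner_Integration.integral_sum) auto
  finally show ?thesis unfolding fourier_coeff_def by (simp add: sum_distrib_left mult.left_commute)
qed

section \<open>Interpolation of the nonlinearity along lines\<close>

definition lagrange :: "nat \<Rightarrow> nat \<Rightarrow> real poly"
  where "lagrange N j = smult (1 / (\<Prod>m\<in>{..N} - {j}. real j - real m)) (\<Prod>m\<in>{..N} - {j}. [:- real m, 1:])"

lemma lagrange_node:
  assumes "i \<le> N" "j \<le> N"
  shows "poly (lagrange N j) (real i) = (if i = j then 1 else 0)"
proof -
  have "(\<Prod>m\<in>{..N} - {j}. real j - real m) \<noteq> 0" by auto
  moreover have "(\<Prod>m\<in>{..N} - {j}. real i - real m) = 0" if "i \<noteq> j" using assms that by (intro prod_zero) auto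
  ultimately show ?thesis unfolding lagrange_def by (auto simp: poly_prod)
qed

text \<open>A polynomial of degree at most N is determined by its values at 0, ..., N. The weights
  are real for real t, which keeps the formula usable in a real vector space.\<close>

lemma lagrange_interpolation:
  fixes p :: "complex poly"
  assumes p: "degree p \<le> N"
  shows "poly p (of_real t) = (\<Sum>j\<le>N. of_real (poly (lagrange N j) t) * poly p (of_nat j))"
proof -
  let ?q = "\<Sum>j\<le>N. smult (poly p (of_nat j)) (map_poly of_real (lagrange N j) :: complex poly)"
  have deg: "degree (lagrange N j) \<le> N" if "j \<le> N" for j
  proof -
    have "degree (lagrange N j) \<le> degree (\<Prod>m\<in>{..N} - {j}. [:- real m, 1:])" unfolding lagrange_def by (rule degree_smult_le)
    also have "\<dots> \<le> (\<Sum>m\<in>{..N} - {j}. 1)" by (rule degree_prod_sum_le[THEN order_trans]) auto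
    also have "\<dots> = N" using that by simp
    finally show ?thesis .
  qed
  have map: "poly (map_poly of_real r) (of_real t) = complex_of_real (poly r t)" for r :: "real poly" and t
    by (induction r) (simp_all add: map_poly_pCons)
  have ev: "poly ?q (of_real t) = (\<Sum>j\<le>N. of_real (poly (lagrange N j) t) * poly p (of_nat j))" for t
    by (simp add: poly_sum mult.commute map)
  have "p = ?q"
  proof (rule poly_eqI_degree[where A = "of_nat ` {..N}"])
    have c: "card ((of_nat :: nat \<Rightarrow> complex) ` {..N}) = Suc N" by (subst card_image) (auto simp: inj_on_def)
    show "degree p < card ((of_nat :: nat \<Rightarrow> complex) ` {..N})" using p c by simp
    have "degree ?q \<le> N"
      using deg by (intro degree_sum_le order_trans[OF degree_smult_le]) (auto simp: degree_map_poly)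
    then show "degree ?q < card ((of_nat :: nat \<Rightarrow> complex) ` {..N})" using c by simp
    fix x :: complex assume "x \<in> of_nat ` {..N}"
    then obtain i where i: "i \<le> N" "x = of_real (real i)" by auto
    have "poly ?q x = (\<Sum>j\<le>N. if j = i then poly p (of_nat i) else 0)"
      unfolding i(2) ev using i(1) by (intro sum.cong) (auto simp: lagrange_node)
    also have "\<dots> = poly p x" using i by simp
    finally show "poly p x = poly ?q x" by simp
  qed
  then show ?thesis using ev by metis
qed

text \<open>For real t the conjugate of z + t w is again linear in t. The expression is therefore
  the product of \<sigma> + 1 factors \<open>z + t w\<close> and \<sigma> factors
  \<open>cnj z + t cnj w\<close>, a polynomial of degree at most \<open>2 * \<sigma> + 1\<close>
  although the nonlinearity is not holomorphic.\<close>

lemma power_nonlinearity_interpolation: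
  fixes z w :: complex
  shows "of_real (cmod (z + of_real t * w) ^ (2 * \<sigma>)) * (z + of_real t * w) =
    (\<Sum>j\<le>2 * \<sigma> + 1. of_real (poly (lagrange (2 * \<sigma> + 1) j) t) * (of_real (cmod (z + of_nat j * w) ^ (2 * \<sigma>)) * (z + of_nat j * w)))"
proof -
  let ?p = "[:z, w:] ^ (\<sigma> + 1) * [:cnj z, cnj w:] ^ \<sigma>"
  have F: "of_real (cmod (z + of_real t * w) ^ (2 * \<sigma>)) * (z + of_real t * w) = poly ?p (of_real t)" for t
  proof -
    have "of_real (cmod (z + of_real t * w) ^ (2 * \<sigma>)) = ((z + of_real t * w) * (cnj z + of_real t * cnj w)) ^ \<sigma>"
      using complex_norm_square[of "z + of_real t * w"] by (simp add: power_mult)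
    then have "of_real (cmod (z + of_real t * w) ^ (2 * \<sigma>)) * (z + of_real t * w)
        = (z + of_real t * w) ^ (\<sigma> + 1) * (cnj z + of_real t * cnj w) ^ \<sigma>"
      by (simp only: power_mult_distrib power_add power_one_right mult_ac)
    moreover have "poly [:z, w:] (of_real t) = z + of_real t * w" "poly [:cnj z, cnj w:] (of_real t) = cnj z + of_real t * cnj w" by simp_all
    ultimately show ?thesis by (simp only: poly_mult poly_power)
  qed
  have lin: "degree ([:a, b:] ^ n) \<le> n" for a b :: complex and n
    using degree_power_le[of "[:a, b:]" n] by (cases "b = 0") simp_all
  have "degree ?p \<le> (\<sigma> + 1) + \<sigma>" by (intro order_trans[OF degree_mult_le] add_mono lin)
  then have "degree ?p \<le> 2 * \<sigma> + 1" by simp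
  from lagrange_interpolation[OF this, of t] show ?thesis
    unfolding F F[of "real _", unfolded of_real_of_nat_eq] .
qed

text \<open>The interpolation holds at each point x, and taking Fourier coefficients is linear on
  bounded measurable functions.\<close>

lemma nonlin_interpolation:
  fixes v w :: "('d::finite) fseries"
  assumes v: "(\<lambda>k. cmod (v k)) summable_on UNIV" and w: "(\<lambda>k. cmod (w k)) summable_on UNIV"
  shows "nonlin \<sigma> (\<lambda>k. v k + of_real t * w k) k =
    (\<Sum>j\<le>2 * \<sigma> + 1. of_real (poly (lagrange (2 * \<sigma> + 1) j) t) * nonlin \<sigma> (\<lambda>k. v k + of_nat j * w k) k)"
proof -
  let ?c = "(2 * pi) powr (- real CARD('d) / 2)"
  let ?u = "\<lambda>j :: nat. \<lambda>k. v k + of_nat j * w k"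
  have s: "(\<lambda>k. cmod (?u j k)) summable_on UNIV" for j
  proof (rule summable_on_comparison_test)
    show "(\<lambda>k. cmod (v k) + real j * cmod (w k)) summable_on UNIV" by (intro summable_on_add summable_on_cmult_right v w)
    show "cmod (?u j k) \<le> cmod (v k) + real j * cmod (w k)" for k
      using norm_triangle_ineq[of "v k" "of_nat j * w k"] by (simp add: norm_mult)
  qed auto
  note m [measurable] = fun_of_measurable[OF s]
  show ?thesis
    unfolding nonlin_def
  proof (subst fourier_coeff_sum[symmetric])
    fix j x
    show "(\<lambda>x. of_real (cmod (fun_of (?u j) x) ^ (2 * \<sigma>)) * fun_of (?u j) x) \<in> borel_measurable borel" by measurable
    show "cmod (of_real (cmod (fun_of (?u j) x) ^ (2 * \<sigma>)) * fun_of (?u j) x) \<le> (?c * (\<Sum>\<^sub>\<infinity>k. cmod (?u j k))) ^ (2 * \<sigma> + 1)"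
      using power_mono[OF norm_fun_of_le[OF s, of j x] norm_ge_zero, of "2 * \<sigma> + 1"] by (simp add: norm_mult norm_power mult.commute)
  next
    show "fourier_coeff (\<lambda>x. of_real (cmod (fun_of (\<lambda>k. v k + of_real t * w k) x) ^ (2 * \<sigma>)) * fun_of (\<lambda>k. v k + of_real t * w k) x) k =
      fourier_coeff (\<lambda>x. \<Sum>j\<le>2 * \<sigma> + 1. of_real (poly (lagrange (2 * \<sigma> + 1) j) t) * (of_real (cmod (fun_of (?u j) x) ^ (2 * \<sigma>)) * fun_of (?u j) x)) k"
      unfolding fun_of_add_cmult[OF v w] power_nonlinearity_interpolation[of _ t] ..
  qed
qed

lemma poly_difference_bound:
  fixes p :: "real poly"
  obtains C where "C \<ge> 0" "\<And>t. 0 \<le> t \<Longrightarrow> t \<le> T \<Longrightarrow> \<bar>poly p t - poly p 0\<bar> \<le> C * t"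
proof (cases p)
  case (pCons a q)
  obtain C where C: "C \<ge> 0" "\<And>t. t \<in> {0..T} \<Longrightarrow> norm (poly q t) \<le> C"
    by (rule continuous_bounded[of T "poly q"]) (auto intro!: continuous_intros)
  have "\<bar>poly p t - poly p 0\<bar> \<le> C * t" if "0 \<le> t" "t \<le> T" for t
    using mult_left_mono[OF C(2)[of t] that(1)] that pCons by (simp add: abs_mult mult.commute)
  then show ?thesis using that C(1) by blast
qed

text \<open>The direction H is normalised, so the nodes \<open>W + j H\<close> stay within distance
  N of the ball, where G is bounded. The step length enters only through the weights, which are
  polynomials and change by at most a multiple of it.\<close>

lemma polynomial_imp_lipschitz_on_balls:
  fixes G :: "'b::real_normed_vector \<Rightarrow> 'c::real_normed_vector"
  assumes poly: "\<And>V H t. G (V + t *\<^sub>R H) = (\<Sum>j\<le>N. poly (lagrange N j) t *\<^sub>R G (V + real j *\<^sub>R H))"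
    and bnd: "\<And>R. \<exists>C. \<forall>V. norm V \<le> R \<longrightarrow> norm (G V) \<le> C"
  shows "\<exists>L. \<forall>V W. norm V \<le> R \<longrightarrow> norm W \<le> R \<longrightarrow> norm (G V - G W) \<le> L * norm (V - W)"
proof -
  obtain B where B: "\<And>V. norm V \<le> R + real N \<Longrightarrow> norm (G V) \<le> B" using bnd[of "R + real N"] by blast
  have "\<exists>C. C \<ge> 0 \<and> (\<forall>t. 0 \<le> t \<longrightarrow> t \<le> 2 * R \<longrightarrow> \<bar>poly (lagrange N j) t - poly (lagrange N j) 0\<bar> \<le> C * t)" for j
    using poly_difference_bound[of "2 * R" "lagrange N j"] by metis
  then obtain C where C: "\<And>j. C j \<ge> 0"
    "\<And>j t. 0 \<le> t \<Longrightarrow> t \<le> 2 * R \<Longrightarrow> \<bar>poly (lagrange N j) t - poly (lagrange N j) 0\<bar> \<le> C j * t" by metis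
  have "norm (G V - G W) \<le> (\<Sum>j\<le>N. C j * B) * norm (V - W)" if V: "norm V \<le> R" and W: "norm W \<le> R" for V W
  proof (cases "V = W")
    case False
    define \<delta> where "\<delta> = norm (V - W)"
    have \<delta>: "\<delta> > 0" "\<delta> \<le> 2 * R" using False V W norm_triangle_ineq4[of V W] unfolding \<delta>_def by auto
    define H where "H = (1 / \<delta>) *\<^sub>R (V - W)"
    have H: "norm H = 1" "V = W + \<delta> *\<^sub>R H" using \<delta>(1) unfolding H_def by (auto simp: \<delta>_def)
    have "G V - G W = G (W + \<delta> *\<^sub>R H) - G (W + 0 *\<^sub>R H)" using H(2) by simp
    also have "\<dots> = (\<Sum>j\<le>N. (poly (lagrange N j) \<delta> - poly (lagrange N j) 0) *\<^sub>R G (W + real j *\<^sub>R H))"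
      unfolding poly[of W \<delta> H] poly[of W 0 H] by (simp add: sum_subtractf scaleR_diff_left)
    also have "norm \<dots> \<le> (\<Sum>j\<le>N. C j * \<delta> * B)"
    proof (rule sum_norm_le)
      fix j assume j: "j \<in> {..N}"
      have "norm (W + real j *\<^sub>R H) \<le> R + real N"
        using norm_triangle_ineq[of W "real j *\<^sub>R H"] W H(1) j by simp
      then show "norm ((poly (lagrange N j) \<delta> - poly (lagrange N j) 0) *\<^sub>R G (W + real j *\<^sub>R H)) \<le> C j * \<delta> * B"
        using C(2)[of \<delta> j] \<delta> C(1)[of j] by (auto intro!: mult_mono B)
    qed
    also have "\<dots> = (\<Sum>j\<le>N. C j * B) * norm (V - W)" unfolding \<delta>_def by (simp add: sum_distrib_left sum_distrib_right mult_ac)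
    finally show ?thesis .
  qed simp
  then show ?thesis by blast
qed

section \<open>From Sobolev spaces to square-summable families\<close>

definition unbessel :: "real \<Rightarrow> (int ^ 'd) ell2 \<Rightarrow> ('d::finite) fseries"
  where "unbessel r V = (\<lambda>k. jbracket k powr (- r) *\<^sub>R ell2_coeff V k)"

lemma jbracket_ge_1: "jbracket k \<ge> 1"
  unfolding jbracket_def by simp

lemma jbracket_powr_cancel: "jbracket k powr r *\<^sub>R (jbracket k powr (- r) *\<^sub>R z) = (z :: complex)"
  using jbracket_pos[of k] by (simp add: powr_minus del: scaleR_complex_def)

lemma unbessel_sob: "unbessel r V \<in> sob r"
  unfolding sob_def bessel_sq[symmetric] unbessel_def by (simp only: jbracket_powr_cancel ell2_summable mem_Collect_eq)

lemma bessel_unbessel: "bessel r (unbessel r V) = V"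
proof (rule ell2_eqI)
  show "ell2_coeff (bessel r (unbessel r V)) k = ell2_coeff V k" for k
    unfolding bessel_coeff[OF unbessel_sob] unfolding unbessel_def by (rule jbracket_powr_cancel)
qed

lemma unbessel_bessel: "u \<in> sob r \<Longrightarrow> unbessel r (bessel r u) = u"
  using bessel_inj[of r] unbessel_sob bessel_unbessel by (metis inj_onD)

lemma sob_norm_unbessel: "sob_norm r (unbessel r V) = norm V"
  by (metis norm_bessel unbessel_sob bessel_unbessel)

lemma bessel_zero: "bessel r (\<lambda>_. 0) = 0" and zero_sob: "(\<lambda>_. 0) \<in> sob r"
proof -
  have 1: "unbessel r 0 = (\<lambda>_. 0)" by (simp add: unbessel_def zero_ell2.rep_eq)
  show "bessel r (\<lambda>_. 0) = 0" using bessel_unbessel[of r 0] unfolding 1 .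
  show "(\<lambda>_. 0) \<in> sob r" using unbessel_sob[of r 0] unfolding 1 .
qed

text \<open>The metric topology read through the isometry, the form in which measurability and
  continuity are transported to \<open>ell2\<close>.\<close>

lemma openin_sob_top_iff:
  "openin (sob_top r) U \<longleftrightarrow> U \<subseteq> sob r \<and> (\<forall>u\<in>U. \<exists>e>0. \<forall>v\<in>sob r. dist (bessel r u) (bessel r v) < e \<longrightarrow> v \<in> U)"
proof -
  have "openin (sob_top r) U \<longleftrightarrow> U \<subseteq> sob r \<and> (\<forall>u. u \<in> U \<longrightarrow> (\<exists>e>0. Metric_space.mball (sob r) (sob_dist r) u e \<subseteq> U))"
    unfolding sob_top_def by (rule Metric_space.openin_mtopology[OF Metric_space_sob])
  also have "\<dots> \<longleftrightarrow> U \<subseteq> sob r \<and> (\<forall>u\<in>U. \<exists>e>0. \<forall>v\<in>sob r. dist (bessel r u) (bessel r v) < e \<longrightarrow> v \<in> U)"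
  proof (rule conj_cong[OF refl])
    assume U: "U \<subseteq> sob r"
    have "Metric_space.mball (sob r) (sob_dist r) u e \<subseteq> U \<longleftrightarrow> (\<forall>v\<in>sob r. dist (bessel r u) (bessel r v) < e \<longrightarrow> v \<in> U)"
      if "u \<in> U" for u e
      unfolding Metric_space.mball_def[OF Metric_space_sob] using subsetD[OF U that] by (auto simp: sob_dist_bessel)
    then show "(\<forall>u. u \<in> U \<longrightarrow> (\<exists>e>0. Metric_space.mball (sob r) (sob_dist r) u e \<subseteq> U)) \<longleftrightarrow>
        (\<forall>u\<in>U. \<exists>e>0. \<forall>v\<in>sob r. dist (bessel r u) (bessel r v) < e \<longrightarrow> v \<in> U)" by (simp add: Ball_def)
  qed
  finally show ?thesis .
qed

lemma openin_sob_top_unbessel: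
  assumes "openin (sob_top r) U"
  shows "open (unbessel r -` U)"
  unfolding open_dist
proof
  fix V assume V: "V \<in> unbessel r -` U"
  then obtain e where e: "e > 0" "\<And>v. v \<in> sob r \<Longrightarrow> dist (bessel r (unbessel r V)) (bessel r v) < e \<Longrightarrow> v \<in> U"
    using assms unfolding openin_sob_top_iff by blast
  have "Y \<in> unbessel r -` U" if "dist Y V < e" for Y
    using e(2)[OF unbessel_sob, of Y] that by (simp add: bessel_unbessel dist_commute)
  then show "\<exists>e>0. \<forall>Y. dist Y V < e \<longrightarrow> Y \<in> unbessel r -` U" using e(1) by blast
qed

lemma openin_sob_top_bessel:
  assumes "open Q"
  shows "openin (sob_top r) (bessel r -` Q \<inter> sob r)"
  unfolding openin_sob_top_iff
proof (intro conjI ballI)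
  fix u assume "u \<in> bessel r -` Q \<inter> sob r"
  then obtain e where "e > 0" "\<And>y. dist y (bessel r u) < e \<Longrightarrow> y \<in> Q" using assms unfolding open_dist by blast
  then show "\<exists>e>0. \<forall>v\<in>sob r. dist (bessel r u) (bessel r v) < e \<longrightarrow> v \<in> bessel r -` Q \<inter> sob r"
    by (intro exI[of _ e]) (auto simp: dist_commute)
qed auto

lemma space_sob_borel: "space (sob_borel r) = sob r"
  and sets_sob_borel: "sets (sob_borel r) = sigma_sets (sob r) {U. openin (sob_top r) U}"
proof -
  have U: "{U. openin (sob_top r) U} \<subseteq> Pow (sob r)" by (auto simp: openin_sob_top_iff)
  show "space (sob_borel r) = sob r" unfolding sob_borel_def by (rule space_measure_of[OF U])
  show "sets (sob_borel r) = sigma_sets (sob r) {U. openin (sob_top r) U}"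
    unfolding sob_borel_def by (rule sets_measure_of[OF U])
qed

lemma bessel_measurable: "bessel r \<in> borel_measurable (sob_borel r)"
proof (rule borel_measurableI)
  fix Q :: "(int ^ 'a) ell2 set" assume "open Q"
  then show "bessel r -` Q \<inter> space (sob_borel r) \<in> sets (sob_borel r)"
    unfolding space_sob_borel sets_sob_borel by (intro sigma_sets.Basic) (simp add: openin_sob_top_bessel)
qed

lemma unbessel_measurable: "unbessel r \<in> measurable borel (sob_borel r)"
proof (rule measurable_sigma_sets[OF sets_sob_borel])
  show "unbessel r -` U \<inter> space borel \<in> sets borel" if "U \<in> {U. openin (sob_top r) U}" for U
    using openin_sob_top_unbessel[of r U] that by simp
qed (auto simp: openin_sob_top_iff unbessel_sob)

lemma continuous_path_bessel:
  assumes "continuous_map (top_of_set S) (sob_top r) g"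
  shows "continuous_on S (\<lambda>t. bessel r (g t))" "t \<in> S \<Longrightarrow> g t \<in> sob r"
proof -
  show g: "g t \<in> sob r" if "t \<in> S" for t
    using continuous_map_funspace[OF assms] that by (auto simp: topspace_sob_top)
  show "continuous_on S (\<lambda>t. bessel r (g t))"
    unfolding continuous_on_open_invariant
  proof (intro allI impI)
    fix Q :: "(int ^ 'b) ell2 set" assume "open Q"
    then have "openin (top_of_set S) {t \<in> topspace (top_of_set S). g t \<in> bessel r -` Q \<inter> sob r}"
      by (intro openin_continuous_map_preimage[OF assms] openin_sob_top_bessel)
    then obtain A where "open A" "{t \<in> S. g t \<in> bessel r -` Q \<inter> sob r} = S \<inter> A" unfolding openin_open by auto
    then show "\<exists>A. open A \<and> A \<inter> S = (\<lambda>t. bessel r (g t)) -` Q \<inter> S"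
      using g by (intro exI[of _ A]) auto
  qed
qed

lemma bounded_linear_coeff: "bounded_linear (\<lambda>V. ell2_coeff V k)"
proof (rule bounded_linear_intro[where K = 1])
  fix V :: "'a ell2"
  have "(\<Sum>j\<in>{k}. (cmod (ell2_coeff V j))\<^sup>2) \<le> (norm V)\<^sup>2"
    unfolding norm_ell2_sq by (rule finite_sum_le_infsum[OF ell2_summable]) auto
  then show "norm (ell2_coeff V k) \<le> norm V * 1" by (simp add: power2_le_iff_abs_le)
qed (simp_all add: plus_ell2.rep_eq scaleR_ell2.rep_eq)

text \<open>The real inner product sees only the real part of c; this is where Re f in the energy
  condition comes from.\<close>

lemma
  fixes V b :: "'k ell2"
  assumes "\<And>k. ell2_coeff b k = c * ell2_coeff V k"
  shows norm_scalar_multiple: "norm b = cmod c * norm V"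
    and inner_scalar_multiple: "V \<bullet> b = Re c * (norm V)\<^sup>2"
proof -
  have "(norm b)\<^sup>2 = (cmod c * norm V)\<^sup>2"
    unfolding power_mult_distrib norm_ell2_sq assms norm_mult by (rule infsum_cmult_right) (rule ell2_summable)
  then show "norm b = cmod c * norm V" by (rule power2_eq_imp_eq) auto
  have "z \<bullet> (c * z) = Re c * (cmod z)\<^sup>2" for z
    unfolding cmod_power2 by (simp add: inner_complex_def power2_eq_square algebra_simps)
  then show "V \<bullet> b = Re c * (norm V)\<^sup>2"
    unfolding inner_ell2 assms norm_ell2_sq by (simp add: infsum_cmult_right[OF ell2_summable])
qed

section \<open>The Schroedinger coefficients on square-summable families\<close>

locale schroedinger = brownian M \<F> W for M :: "'w measure" and \<F> W +
  fixes \<sigma> :: nat and \<alpha> :: complex and s K p B :: real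
    and \<phi> :: "('d::finite) fseries \<Rightarrow> 'd fseries" and f :: "'d fseries \<Rightarrow> complex" and \<psi> :: "real \<times> real \<Rightarrow> real"
  assumes s: "s > real CARD('d) / 2"
    and K: "nonlin_const TYPE('d) s \<sigma> K"
    and \<phi>_sob: "\<phi> ` sob s \<subseteq> sob s"
    and \<psi>: "S \<subseteq> {0..} \<times> {0..} \<Longrightarrow> bounded S \<Longrightarrow> bounded (\<psi> ` S)"
    and \<phi>_lip: "v \<in> sob s \<Longrightarrow> w \<in> sob s \<Longrightarrow> sob_dist s (\<phi> v) (\<phi> w) \<le> \<psi> (sob_norm s v, sob_norm s w) * sob_dist s v w"
    and \<phi>_f: "v \<in> sob s \<Longrightarrow> \<phi> v = (\<lambda>k. f v * v k)"
    and p: "0 < p" "p < 1" and B: "B < 0"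
    and energy: "v \<in> sob s \<Longrightarrow> cmod \<alpha> * K * Linf_norm v ^ (2 * \<sigma>) + 1 / 2 * (cmod (f v))\<^sup>2 - (2 - p) / 2 * (Re (f v))\<^sup>2 \<le> B"
begin

definition \<Phi> :: "(int ^ 'd) ell2 \<Rightarrow> (int ^ 'd) ell2"
  where "\<Phi> V = bessel s (\<phi> (unbessel s V))"

definition G :: "(int ^ 'd) ell2 \<Rightarrow> (int ^ 'd) ell2"
  where "G V = bessel s (\<lambda>k. \<alpha> * nonlin \<sigma> (unbessel s V) k)"

lemma s_pos: "s > 0"
  using s by (meson le_less_trans of_nat_0_le_iff zero_le_divide_iff zero_le_numeral)

lemma nonlin_sob: "(v :: 'd fseries) \<in> sob s \<Longrightarrow> nonlin \<sigma> v \<in> sob s"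
  "(v :: 'd fseries) \<in> sob s \<Longrightarrow> sob_norm s (nonlin \<sigma> v) \<le> K * Linf_norm v ^ (2 * \<sigma>) * sob_norm s v"
  using K unfolding nonlin_const_def by auto

lemma cmult_sob:
  assumes "v \<in> sob s"
  shows "(\<lambda>k. c * v k) \<in> sob s"
  using assms summable_on_cmult_right[of "\<lambda>k. jbracket k powr (2 * s) * (cmod (v k))\<^sup>2" UNIV "(cmod c)\<^sup>2"]
  unfolding sob_def by (simp add: norm_mult power_mult_distrib mult.left_commute)

lemma \<Phi>_coeff: "ell2_coeff (\<Phi> V) k = f (unbessel s V) * ell2_coeff V k"
proof -
  have "\<phi> (unbessel s V) \<in> sob s" using \<phi>_sob unbessel_sob[of s V] by blast
  then have "ell2_coeff (\<Phi> V) k = f (unbessel s V) * (jbracket k powr s *\<^sub>R unbessel s V k)"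
    unfolding \<Phi>_def by (simp add: bessel_coeff \<phi>_f unbessel_sob)
  then show ?thesis by (simp only: bessel_coeff[OF unbessel_sob, symmetric] bessel_unbessel)
qed

lemma G_coeff: "ell2_coeff (G V) k = jbracket k powr s *\<^sub>R (\<alpha> * nonlin \<sigma> (unbessel s V) k)"
  unfolding G_def by (rule bessel_coeff[OF cmult_sob[OF nonlin_sob(1)[OF unbessel_sob]]])

lemma norm_\<Phi>: "norm (\<Phi> V) = cmod (f (unbessel s V)) * norm V"
  and inner_\<Phi>: "V \<bullet> \<Phi> V = Re (f (unbessel s V)) * (norm V)\<^sup>2"
  by (rule norm_scalar_multiple inner_scalar_multiple, rule \<Phi>_coeff)+

lemma norm_G: "norm (G V) \<le> cmod \<alpha> * K * Linf_norm (unbessel s V) ^ (2 * \<sigma>) * norm V"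
proof -
  have "ell2_coeff (G V) k = \<alpha> * ell2_coeff (bessel s (nonlin \<sigma> (unbessel s V))) k" for k
    unfolding G_coeff bessel_coeff[OF nonlin_sob(1)[OF unbessel_sob]] by simp
  then have "norm (G V) = cmod \<alpha> * sob_norm s (nonlin \<sigma> (unbessel s V))"
    by (simp add: norm_scalar_multiple norm_bessel[OF nonlin_sob(1)[OF unbessel_sob]])
  also have "\<dots> \<le> cmod \<alpha> * (K * Linf_norm (unbessel s V) ^ (2 * \<sigma>) * norm V)"
    using nonlin_sob(2)[OF unbessel_sob, of V] by (intro mult_left_mono) (auto simp: sob_norm_unbessel)
  finally show ?thesis by (simp add: mult.assoc)
qed

lemma \<Phi>_0: "\<Phi> 0 = 0" and G_0: "G 0 = 0"
  using norm_\<Phi>[of 0] norm_G[of 0] by simp_all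

lemma \<Phi>_lipschitz: "\<exists>L. \<forall>U V. norm U \<le> R \<longrightarrow> norm V \<le> R \<longrightarrow> norm (\<Phi> U - \<Phi> V) \<le> L * norm (U - V)"
proof -
  have "bounded (\<psi> ` ({0..R} \<times> {0..R}))" by (intro \<psi> bounded_Times bounded_closed_interval) auto
  then obtain L where L: "\<And>y. y \<in> {0..R} \<times> {0..R} \<Longrightarrow> norm (\<psi> y) \<le> L" unfolding bounded_iff by blast
  have "norm (\<Phi> U - \<Phi> V) \<le> L * norm (U - V)" if "norm U \<le> R" "norm V \<le> R" for U V
  proof -
    have "\<phi> (unbessel s U) \<in> sob s" "\<phi> (unbessel s V) \<in> sob s" using \<phi>_sob unbessel_sob by blast+
    then have "norm (\<Phi> U - \<Phi> V) \<le> \<psi> (norm U, norm V) * norm (U - V)"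
      using \<phi>_lip[OF unbessel_sob unbessel_sob, of U V]
      by (simp add: sob_dist_bessel unbessel_sob bessel_unbessel sob_norm_unbessel \<Phi>_def dist_norm)
    also have "\<dots> \<le> L * norm (U - V)" using L[of "(norm U, norm V)"] that by (intro mult_right_mono) auto
    finally show ?thesis .
  qed
  then show ?thesis by blast
qed

text \<open>The energy condition multiplied by the squared norm of V: \<Phi> multiplies by the
  scalar f, so its norm and its inner product with V produce |f| and Re f.\<close>

lemma energy_ell2:
  "norm V * norm (G V) + (norm (\<Phi> V))\<^sup>2 / 2 - (1 - p / 2) * (V \<bullet> \<Phi> V)\<^sup>2 / (norm V)\<^sup>2 \<le> B * (norm V)\<^sup>2"
proof (cases "V = 0")
  case False
  let ?v = "unbessel s V"
  let ?a = "cmod \<alpha> * K * Linf_norm ?v ^ (2 * \<sigma>)" and ?b = "1 / 2 * (cmod (f ?v))\<^sup>2" and ?c = "(2 - p) / 2 * (Re (f ?v))\<^sup>2"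
  have "norm V * norm (G V) \<le> norm V * (?a * norm V)" by (intro mult_left_mono norm_G norm_ge_zero)
  then have "norm V * norm (G V) \<le> ?a * (norm V)\<^sup>2" by (simp add: power2_eq_square mult_ac)
  moreover have "(1 - p / 2) * (V \<bullet> \<Phi> V)\<^sup>2 / (norm V)\<^sup>2 = ?c * (norm V)\<^sup>2"
    unfolding inner_\<Phi> using False by (simp add: field_simps power2_eq_square)
  moreover have "(norm (\<Phi> V))\<^sup>2 / 2 = ?b * (norm V)\<^sup>2" unfolding norm_\<Phi> by (simp add: power_mult_distrib)
  moreover have "(?a + ?b - ?c) * (norm V)\<^sup>2 \<le> B * (norm V)\<^sup>2"
    by (intro mult_right_mono energy unbessel_sob) simp
  ultimately show ?thesis by (simp only: distrib_right left_diff_distrib)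
qed (simp add: \<Phi>_0)

text \<open>Since \<open>B < 0\<close>, the energy condition bounds the nonlinearity by the noise coefficient \<open>f\<close>, and \<open>f\<close>
  is bounded on balls as \<open>\<phi>\<close> is locally Lipschitz with \<open>\<phi>(0) = 0\<close>.\<close>

lemma G_bounded: "\<exists>C. \<forall>V. norm V \<le> R \<longrightarrow> norm (G V) \<le> C"
proof -
  obtain L where L: "\<And>U V. norm U \<le> R \<Longrightarrow> norm V \<le> R \<Longrightarrow> norm (\<Phi> U - \<Phi> V) \<le> L * norm (U - V)" using \<Phi>_lipschitz by blast
  have "norm (G V) \<le> 1 / 2 * L\<^sup>2 * R" if V: "norm V \<le> R" for V
  proof (cases "V = 0")
    case False
    let ?v = "unbessel s V"
    have R: "R \<ge> 0" using V norm_ge_zero order_trans by blast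
    have "cmod (f ?v) * norm V \<le> L * norm V" using L[of V 0] V R by (simp add: \<Phi>_0 norm_\<Phi>)
    then have "cmod (f ?v) \<le> L" using False by simp
    then have fL: "(cmod (f ?v))\<^sup>2 \<le> L\<^sup>2" by (intro power_mono) auto
    have "(2 - p) / 2 * (Re (f ?v))\<^sup>2 \<le> 1 * (cmod (f ?v))\<^sup>2"
      using p by (intro mult_mono) (auto simp: cmod_power2)
    then have "cmod \<alpha> * K * Linf_norm ?v ^ (2 * \<sigma>) \<le> 1 / 2 * L\<^sup>2"
      using energy[OF unbessel_sob, of V] B fL by linarith
    then have "cmod \<alpha> * K * Linf_norm ?v ^ (2 * \<sigma>) * norm V \<le> 1 / 2 * L\<^sup>2 * R"
      by (rule mult_mono[OF _ V]) auto
    then show ?thesis using norm_G[of V] by linarith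
  qed (use that in \<open>simp add: G_0\<close>)
  then show ?thesis by blast
qed

text \<open>The interpolation identity holds for every Fourier coefficient, hence for G in
  \<open>ell2\<close>; together with boundedness on balls it yields the Lipschitz bound.\<close>

lemma G_lipschitz: "\<exists>L. \<forall>U V. norm U \<le> R \<longrightarrow> norm V \<le> R \<longrightarrow> norm (G U - G V) \<le> L * norm (U - V)"
proof (rule polynomial_imp_lipschitz_on_balls[OF _ G_bounded])
  fix V H :: "(int ^ 'd) ell2" and t :: real
  have un: "unbessel s (V + t *\<^sub>R H) = (\<lambda>k. unbessel s V k + of_real t * unbessel s H k)" for t
    by (rule ext) (simp add: unbessel_def plus_ell2.rep_eq scaleR_ell2.rep_eq scaleR_conv_of_real algebra_simps)
  have ns: "nonlin \<sigma> (unbessel s (V + t *\<^sub>R H)) k =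
      (\<Sum>j\<le>2 * \<sigma> + 1. of_real (poly (lagrange (2 * \<sigma> + 1) j) t) * nonlin \<sigma> (unbessel s (V + real j *\<^sub>R H)) k)" for k
    unfolding un of_real_of_nat_eq by (intro nonlin_interpolation sob_abs_summable[OF s] unbessel_sob)
  show "G (V + t *\<^sub>R H) = (\<Sum>j\<le>2 * \<sigma> + 1. poly (lagrange (2 * \<sigma> + 1) j) t *\<^sub>R G (V + real j *\<^sub>R H))"
  proof (rule ell2_eqI)
    fix k :: "int ^ 'd"
    interpret c: bounded_linear "\<lambda>V. ell2_coeff V k" by (rule bounded_linear_coeff)
    show "ell2_coeff (G (V + t *\<^sub>R H)) k = ell2_coeff (\<Sum>j\<le>2 * \<sigma> + 1. poly (lagrange (2 * \<sigma> + 1) j) t *\<^sub>R G (V + real j *\<^sub>R H)) k"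
      unfolding c.sum c.scaleR G_coeff ns by (simp only: scaleR_conv_of_real sum_distrib_left mult_ac)
  qed
qed

sublocale spectral_spde M \<F> W \<Phi> G freq_norm
  by unfold_locales (rule \<Phi>_lipschitz G_lipschitz \<Phi>_0 G_0 | simp add: freq_norm_def sum_nonneg)+

end

section \<open>Strong solutions as solutions of the truncated equations\<close>

lemma integral_has_vector_derivative_half_line:
  fixes h :: "real \<Rightarrow> 'b::banach"
  assumes h: "continuous_on {0..} h" and r: "0 \<le> r"
  shows "((\<lambda>t. integral {0..t} h) has_vector_derivative h r) (at r within {0..})"
proof -
  have "continuous_on {0..r + 1} h" by (rule continuous_on_subset[OF h]) auto
  then have "((\<lambda>t. integral {0..t} h) has_vector_derivative h r) (at r within {0..r + 1})"
    by (rule integral_has_vector_derivative) (use r in auto)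
  moreover have "at r within {0..r + 1} = at r within {0..}"
    using r by (intro at_within_nhd[of _ "{..<r + 1}"]) auto
  ultimately show ?thesis by (simp add: has_vector_derivative_def)
qed

text \<open>Compared coefficient by coefficient, where the Lebesgue and the gauge integral of a
  complex function agree.\<close>

lemma has_bochner_integral_ell2_eq_integral:
  fixes h :: "real \<Rightarrow> ('k::countable) ell2"
  assumes z: "has_bochner_integral (restrict_space lborel {0..t}) h z" and h: "continuous_on {0..t} h"
  shows "z = integral {0..t} h"
proof (rule ell2_eqI)
  fix k :: 'k
  let ?c = "\<lambda>V. ell2_coeff V k"
  have "has_bochner_integral (restrict_space lborel {0..t}) (\<lambda>r. ?c (h r)) (?c z)"
    by (rule has_bochner_integral_bounded_linear[OF bounded_linear_coeff z])
  then have i: "integrable (restrict_space lborel {0..t}) (\<lambda>r. ?c (h r))"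
    and e: "?c z = (LINT r|restrict_space lborel {0..t}. ?c (h r))"
    by (auto simp: has_bochner_integral_iff)
  have si: "set_integrable lborel {0..t} (\<lambda>r. ?c (h r))"
    using i by (subst (asm) integrable_restrict_space) (auto simp: set_integrable_def)
  have "?c z = (LINT r:{0..t}|lborel. ?c (h r))"
    unfolding e set_lebesgue_integral_def by (subst integral_restrict_space) auto
  also have "\<dots> = integral {0..t} (\<lambda>r. ?c (h r))" by (rule set_borel_integral_eq_integral(2)[OF si])
  also have "\<dots> = ?c (integral {0..t} h)"
    using integral_linear[OF integrable_continuous_interval[OF h] bounded_linear_coeff] by (simp add: o_def)
  finally show "?c z = ?c (integral {0..t} h)" .
qed

context brownian
begin

lemma riemann_ito_linear:
  assumes "bounded_linear T"
  shows "riemann_ito (\<lambda>r \<omega>. T (b r \<omega>)) t m \<omega> = T (riemann_ito b t m \<omega>)"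
proof -
  interpret T: bounded_linear T by fact
  show ?thesis unfolding riemann_ito_def elementary_ito_def by (simp add: T.sum T.scaleR)
qed

end

context schroedinger
begin

text \<open>The equation holds in \<open>H\<^sup>-\<^sup>s\<^sup>-\<^sup>1\<close>. On finitely many modes the orders \<open>-s-1\<close> and \<open>s\<close> differ by the
  bounded multiplier \<open>raise\<close>, a left inverse of the embedding \<open>lower\<close> of \<open>H\<^sup>s\<close> into \<open>H\<^sup>-\<^sup>s\<^sup>-\<^sup>1\<close>.\<close>

definition raise :: "nat \<Rightarrow> complex \<Rightarrow> (int ^ 'd) ell2 \<Rightarrow> (int ^ 'd) ell2"
  where "raise n c = diag (\<lambda>k. c * of_real (jbracket k powr (2 * s + 1)) * cutoff n k)"

definition lower :: "(int ^ 'd) ell2 \<Rightarrow> (int ^ 'd) ell2"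
  where "lower = diag (\<lambda>k. of_real (jbracket k powr (- 2 * s - 1)))"

lemma raise_le: "cmod (c * of_real (jbracket k powr (2 * s + 1)) * cutoff n k) \<le> cmod c * sqrt (1 + (real n)\<^sup>2) powr (2 * s + 1)"
proof (cases "freq_norm k \<le> real n")
  case True
  then have "jbracket k \<le> sqrt (1 + (real n)\<^sup>2)"
    unfolding jbracket_def using freq_nonneg[of k] by (intro real_sqrt_le_mono add_left_mono power_mono)
  then have "jbracket k powr (2 * s + 1) \<le> sqrt (1 + (real n)\<^sup>2) powr (2 * s + 1)"
    using jbracket_pos[of k] s_pos by (intro powr_mono2) auto
  then show ?thesis using True by (simp add: norm_mult cutoff_def mult_left_mono)
qed (simp add: cutoff_def)

lemma lower_le: "cmod (of_real (jbracket k powr (- 2 * s - 1))) \<le> 1"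
  using powr_mono[of "- 2 * s - 1" 0 "jbracket k"] jbracket_ge_1[of k] s_pos by simp

lemma raise_linear: "bounded_linear (raise n c)" and lower_linear: "bounded_linear lower"
  unfolding raise_def lower_def by (rule bounded_linear_diag, rule raise_le lower_le)+

lemma norm_raise_le: "norm (raise n c V) \<le> cmod c * sqrt (1 + (real n)\<^sup>2) powr (2 * s + 1) * norm V"
  unfolding raise_def by (rule norm_diag_le[OF raise_le])

lemma raise_bessel_coeff:
  assumes "v \<in> sob (- s - 1)"
  shows "ell2_coeff (raise n c (bessel (- s - 1) v)) k = c * cutoff n k * (jbracket k powr s *\<^sub>R v k)"
proof -
  have "jbracket k powr (2 * s + 1) * jbracket k powr (- s - 1) = jbracket k powr s"
    by (simp add: powr_add[symmetric])
  then have "of_real (jbracket k powr (2 * s + 1)) * (jbracket k powr (- s - 1) *\<^sub>R v k) = jbracket k powr s *\<^sub>R v k"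
    by (simp only: scaleR_conv_of_real of_real_mult[symmetric] mult.assoc[symmetric])
  then show ?thesis
    unfolding raise_def diag_coeff[OF raise_le] bessel_coeff[OF assms] by (simp only: mult_ac)
qed

lemma lower_bessel:
  assumes "v \<in> sob s" "v \<in> sob (- s - 1)"
  shows "lower (bessel s v) = bessel (- s - 1) v"
proof (rule ell2_eqI)
  fix k :: "int ^ 'd"
  have "jbracket k powr (- 2 * s - 1) * jbracket k powr s = jbracket k powr (- s - 1)"
    by (simp add: powr_add[symmetric])
  then show "ell2_coeff (lower (bessel s v)) k = ell2_coeff (bessel (- s - 1) v) k"
    unfolding lower_def diag_coeff[OF lower_le] bessel_coeff[OF assms(1)] bessel_coeff[OF assms(2)]
    by (simp only: scaleR_conv_of_real of_real_mult[symmetric] mult.assoc[symmetric])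
qed

lemma raise_lower: "raise n 1 (lower V) = proj n V"
proof (rule ell2_eqI)
  fix k :: "int ^ 'd"
  have "jbracket k powr (2 * s + 1) * jbracket k powr (- 2 * s - 1) = 1"
    using jbracket_pos[of k] by (simp add: powr_add[symmetric])
  then have "of_real (jbracket k powr (2 * s + 1)) * (of_real (jbracket k powr (- 2 * s - 1)) * z) = z" for z :: complex
    by (simp only: of_real_mult[symmetric] mult.assoc[symmetric] of_real_1 mult_1_left)
  then show "ell2_coeff (raise n 1 (lower V)) k = ell2_coeff (proj n V) k"
    unfolding raise_def lower_def diag_coeff[OF raise_le] diag_coeff[OF lower_le] proj_coeff
    by (simp only: mult_1_left mult.left_commute mult.assoc)
qed

text \<open>The multiplier replaces the weight of \<open>H^(-s-1)\<close> by that of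
  \<open>H^s\<close> on the modes up to n; \<i> is the factor in front of the time integral.\<close>

lemma raise_drift:
  assumes v: "v \<in> sob s" and g: "(\<lambda>k. neg_laplace v k - \<alpha> * nonlin \<sigma> v k) \<in> sob (- s - 1)"
  shows "raise n \<i> (bessel (- s - 1) (\<lambda>k. neg_laplace v k - \<alpha> * nonlin \<sigma> v k)) = drift n (bessel s v)"
proof (rule ell2_eqI)
  fix k :: "int ^ 'd"
  show "ell2_coeff (raise n \<i> (bessel (- s - 1) (\<lambda>k. neg_laplace v k - \<alpha> * nonlin \<sigma> v k))) k = ell2_coeff (drift n (bessel s v)) k"
    unfolding raise_bessel_coeff[OF g] unfolding drift_def minus_ell2.rep_eq diag_coeff[OF cutoff_le(2)] diag_coeff[OF cutoff_le(3)]
      bessel_coeff[OF v] G_coeff unbessel_bessel[OF v] neg_laplace_def scaleR_conv_of_real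
    by (simp add: algebra_simps)
qed

lemma raise_solution:
  assumes "x \<in> sob s" "y \<in> sob s" "D \<in> sob (- s - 1)" "S \<in> sob (- s - 1)" "y = (\<lambda>k. x k + \<i> * D k + S k)"
  shows "proj n (bessel s y) = proj n (bessel s x) + raise n \<i> (bessel (- s - 1) D) + raise n 1 (bessel (- s - 1) S)"
proof (rule ell2_eqI)
  fix k :: "int ^ 'd"
  have "y k = x k + \<i> * D k + S k" using assms(5) by simp
  then show "ell2_coeff (proj n (bessel s y)) k =
      ell2_coeff (proj n (bessel s x) + raise n \<i> (bessel (- s - 1) D) + raise n 1 (bessel (- s - 1) S)) k"
    unfolding plus_ell2.rep_eq proj_coeff raise_bessel_coeff[OF assms(3)] raise_bessel_coeff[OF assms(4)]
      bessel_coeff[OF assms(1)] bessel_coeff[OF assms(2)] scaleR_conv_of_real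
    by (simp add: algebra_simps)
qed

text \<open>Paths are altered on a null set to be continuous everywhere. Both integrals of the
  equation are then carried from order -s-1 to the truncations by \<open>raise\<close>, which
  commutes with them as a bounded linear operator.\<close>

theorem strong_solution_ell2:
  assumes x: "x \<in> sob s" and u: "strong_solution s \<sigma> \<alpha> \<phi> M \<F> W x u"
  obtains U where "solution (bessel s x) U" "AE \<omega> in M. \<forall>t\<ge>0. u t \<omega> \<in> sob s \<and> bessel s (u t \<omega>) = U t \<omega>"
proof -
  have uF: "\<And>t. 0 \<le> t \<Longrightarrow> u t \<in> measurable (\<F> t) (sob_borel s)"
    and paths: "AE \<omega> in M. continuous_map (top_of_set {0..}) (sob_top s) (\<lambda>t. u t \<omega>)"
    and init: "AE \<omega> in M. u 0 \<omega> = x"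
    using u unfolding strong_solution_def by blast+
  have us: "u t \<omega> \<in> sob s" if "\<omega> \<in> space M" "0 \<le> t" for t \<omega>
    using measurable_space[OF F_M[OF uF[OF that(2)] that(2)] that(1)] unfolding space_sob_borel .
  have "AE \<omega> in M. continuous_map (top_of_set {0..}) (sob_top s) (\<lambda>t. u t \<omega>) \<and> u 0 \<omega> = x" using paths init by eventually_elim blast
  then obtain N where N: "N \<in> null_sets M" and
    Np: "\<And>\<omega>. \<omega> \<in> space M - N \<Longrightarrow> continuous_map (top_of_set {0..}) (sob_top s) (\<lambda>t. u t \<omega>) \<and> u 0 \<omega> = x"
    by (rule AE_E3) blast
  \<comment> \<open>On the exceptional null set the path becomes the constant initial value;
    adaptedness survives because null sets belong to every \<open>\<F> t\<close>.\<close>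
  define U where "U t \<omega> = (if \<omega> \<in> N then bessel s x else bessel s (u t \<omega>))" for t \<omega>
  have Un: "AE \<omega> in M. \<omega> \<notin> N" using N by (rule AE_not_in)
  have UF: "U t \<in> borel_measurable (\<F> t)" if t: "0 \<le> t" for t
    unfolding U_def
  proof (rule measurable_If_set)
    show "(\<lambda>\<omega>. bessel s (u t \<omega>)) \<in> borel_measurable (\<F> t)" by (rule measurable_compose[OF uF[OF t] bessel_measurable])
    show "N \<inter> space (\<F> t) \<in> sets (\<F> t)" using null_in_F[OF N t] by blast
  qed simp
  have Uc: "continuous_on {0..} (\<lambda>t. U t \<omega>)" if "\<omega> \<in> space M" for \<omega>
    using continuous_path_bessel(1)[of "{0..}" s "\<lambda>t. u t \<omega>"] Np[of \<omega>] that by (cases "\<omega> \<in> N") (simp_all add: U_def)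
  have U0: "U 0 \<omega> = bessel s x" if "\<omega> \<in> space M" for \<omega> using Np[of \<omega>] that by (auto simp: U_def)
  define A where "A n t \<omega> = integral {0..t} (\<lambda>r. drift n (U r \<omega>))" for n t \<omega>
  have dc: "continuous_on {0..} (\<lambda>r. drift n (U r \<omega>))" if "\<omega> \<in> space M" for n \<omega>
    by (rule continuous_on_compose2[OF drift_cont Uc[OF that]]) simp
  \<comment> \<open>One predicate for the pair, so that D and S can be chosen as functions of
    t.\<close>
  define P where "P t D S \<longleftrightarrow> (AE \<omega> in M. has_sob_integral (- s - 1) (restrict_space lborel {0..t})
        (\<lambda>\<rho> k. neg_laplace (u \<rho> \<omega>) k - \<alpha> * nonlin \<sigma> (u \<rho> \<omega>) k) (D \<omega>)) \<and>
      has_sob_ito_integral (- s - 1) M \<F> W t (\<lambda>\<rho> \<omega>. \<phi> (u \<rho> \<omega>)) S \<and>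
      (AE \<omega> in M. u t \<omega> = (\<lambda>k. x k + \<i> * D \<omega> k + S \<omega> k))" for t D S
  have "\<exists>D S. P t D S" if "0 \<le> t" for t using u that unfolding strong_solution_def P_def by blast
  then obtain D S where "\<And>t. 0 \<le> t \<Longrightarrow> P t (D t) (S t)" by metis
  then have D: "\<And>t. 0 \<le> t \<Longrightarrow> AE \<omega> in M. has_sob_integral (- s - 1) (restrict_space lborel {0..t})
        (\<lambda>\<rho> k. neg_laplace (u \<rho> \<omega>) k - \<alpha> * nonlin \<sigma> (u \<rho> \<omega>) k) (D t \<omega>)"
    and S: "\<And>t. 0 \<le> t \<Longrightarrow> has_sob_ito_integral (- s - 1) M \<F> W t (\<lambda>\<rho> \<omega>. \<phi> (u \<rho> \<omega>)) (S t)"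
    and E: "\<And>t. 0 \<le> t \<Longrightarrow> AE \<omega> in M. u t \<omega> = (\<lambda>k. x k + \<i> * D t \<omega> k + S t \<omega> k)"
    unfolding P_def by blast+
  have Ss: "S t \<omega> \<in> sob (- s - 1)" "0 \<le> r \<Longrightarrow> r \<le> t \<Longrightarrow> \<phi> (u r \<omega>) \<in> sob (- s - 1)" if "0 \<le> t" "\<omega> \<in> space M" for t \<omega> r
    using S[OF that(1)] that(2) unfolding has_sob_ito_integral_def by auto
  have SI: "has_ito_integral M \<F> W t (\<lambda>r \<omega>. bessel (- s - 1) (\<phi> (u r \<omega>))) (\<lambda>\<omega>. bessel (- s - 1) (S t \<omega>))" if "0 \<le> t" for t
    using S[OF that] unfolding has_sob_ito_integral_def by blast
  have A: "AE \<omega> in M. A n t \<omega> = raise n \<i> (bessel (- s - 1) (D t \<omega>)) \<and> D t \<omega> \<in> sob (- s - 1)" if t: "0 \<le> t" for n t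
    using D[OF t] Un AE_space
  proof eventually_elim
    fix \<omega> assume i: "has_sob_integral (- s - 1) (restrict_space lborel {0..t})
        (\<lambda>\<rho> k. neg_laplace (u \<rho> \<omega>) k - \<alpha> * nonlin \<sigma> (u \<rho> \<omega>) k) (D t \<omega>)" and n: "\<omega> \<notin> N" and \<omega>: "\<omega> \<in> space M"
    let ?g = "\<lambda>\<rho> k. neg_laplace (u \<rho> \<omega>) k - \<alpha> * nonlin \<sigma> (u \<rho> \<omega>) k"
    have gs: "?g r \<in> sob (- s - 1)" if "r \<in> {0..t}" for r
      using i that unfolding has_sob_integral_def by (simp add: space_restrict_space)
    have Ds: "D t \<omega> \<in> sob (- s - 1)" and I: "has_bochner_integral (restrict_space lborel {0..t}) (\<lambda>r. bessel (- s - 1) (?g r)) (bessel (- s - 1) (D t \<omega>))"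
      using i unfolding has_sob_integral_def by blast+
    have "has_bochner_integral (restrict_space lborel {0..t}) (\<lambda>r. raise n \<i> (bessel (- s - 1) (?g r))) (raise n \<i> (bessel (- s - 1) (D t \<omega>)))"
      by (rule has_bochner_integral_bounded_linear[OF raise_linear I])
    moreover have "raise n \<i> (bessel (- s - 1) (?g r)) = drift n (U r \<omega>)" if r: "r \<in> {0..t}" for r
      using raise_drift[OF us[OF \<omega>] gs[OF r]] r n by (simp add: U_def)
    ultimately have "has_bochner_integral (restrict_space lborel {0..t}) (\<lambda>r. drift n (U r \<omega>)) (raise n \<i> (bessel (- s - 1) (D t \<omega>)))"
      by (subst (asm) has_bochner_integral_cong[OF refl _ refl]) (auto simp: space_restrict_space)
    then have "raise n \<i> (bessel (- s - 1) (D t \<omega>)) = A n t \<omega>"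
      unfolding A_def by (rule has_bochner_integral_ell2_eq_integral) (rule continuous_on_subset[OF dc[OF \<omega>]], auto)
    then show "A n t \<omega> = raise n \<i> (bessel (- s - 1) (D t \<omega>)) \<and> D t \<omega> \<in> sob (- s - 1)" using Ds by simp
  qed
  have "solution (bessel s x) U"
    unfolding solution_def
  proof (intro conjI allI impI ballI)
    show "AE \<omega> in M. U 0 \<omega> = bessel s x" using U0 by (intro AE_I2)
    fix n
    let ?S = "\<lambda>t \<omega>. raise n 1 (bessel (- s - 1) (S t \<omega>))"
    show "\<exists>S A. ito_integral M \<F> W (\<lambda>r \<omega>. proj n (\<Phi> (U r \<omega>))) S \<and>
      (AE \<omega> in M. \<forall>r\<ge>0. ((\<lambda>r. A r \<omega>) has_vector_derivative drift n (U r \<omega>)) (at r within {0..})) \<and>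
      (\<forall>r\<ge>0. AE \<omega> in M. proj n (U r \<omega>) = proj n (U 0 \<omega>) + A r \<omega> + S r \<omega>)"
    proof (rule exI[of _ ?S], rule exI[of _ "A n"], intro conjI allI impI)
      show "AE \<omega> in M. \<forall>r\<ge>0. ((\<lambda>r. A n r \<omega>) has_vector_derivative drift n (U r \<omega>)) (at r within {0..})"
        unfolding A_def by (intro AE_I2 allI impI integral_has_vector_derivative_half_line dc)
      show "AE \<omega> in M. proj n (U r \<omega>) = proj n (U 0 \<omega>) + A n r \<omega> + ?S r \<omega>" if r: "0 \<le> r" for r
        using A[OF r, of n] E[OF r] Un AE_space
      proof eventually_elim
        fix \<omega> assume a: "A n r \<omega> = raise n \<i> (bessel (- s - 1) (D r \<omega>)) \<and> D r \<omega> \<in> sob (- s - 1)"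
          and e: "u r \<omega> = (\<lambda>k. x k + \<i> * D r \<omega> k + S r \<omega> k)" and n: "\<omega> \<notin> N" and \<omega>: "\<omega> \<in> space M"
        have "U r \<omega> = bessel s (u r \<omega>)" using n by (simp add: U_def)
        then show "proj n (U r \<omega>) = proj n (U 0 \<omega>) + A n r \<omega> + ?S r \<omega>"
          using raise_solution[OF x us[OF \<omega> r] _ Ss(1)[OF r \<omega>] e] a U0[OF \<omega>] by metis
      qed
      show "ito_integral M \<F> W (\<lambda>r \<omega>. proj n (\<Phi> (U r \<omega>))) ?S"
      proof (unfold_locales)
        \<comment> \<open>The integrand as it stands in the equation, as an element of order -s-1;
          \<open>raise n 1\<close> maps its left-point sums to those of the truncated
          integrand.\<close>
        let ?b = "\<lambda>r \<omega>. lower (\<Phi> (U r \<omega>))"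
        have pc: "continuous_on UNIV (\<lambda>V. proj n (\<Phi> V))" by (rule proj_continuous[OF \<Phi>_cont])
        have lc: "continuous_on UNIV (\<lambda>V. lower (\<Phi> V))" by (rule bounded_linear.continuous_on[OF lower_linear \<Phi>_cont])
        show "(\<lambda>\<omega>. proj n (\<Phi> (U r \<omega>))) \<in> borel_measurable (\<F> r)" if "0 \<le> r" for r
          by (rule measurable_compose[OF UF[OF that] borel_measurable_continuous_onI[OF pc]])
        show "continuous_on {0..} (\<lambda>r. proj n (\<Phi> (U r \<omega>)))" if "\<omega> \<in> space M" for \<omega>
          by (rule continuous_on_compose2[OF pc Uc[OF that]]) simp
        fix r :: real assume r: "0 \<le> r"
        have [measurable]: "(\<lambda>\<omega>. bessel (- s - 1) (S r \<omega>)) \<in> borel_measurable M"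
          using SI[OF r] unfolding has_ito_integral_def by blast
        have rm: "raise n 1 \<in> borel_measurable borel"
          by (intro borel_measurable_continuous_onI bounded_linear.continuous_on[OF raise_linear continuous_on_id])
        show Sm: "?S r \<in> borel_measurable M" by (rule measurable_compose[OF _ rm]) measurable
        have bF: "?b t \<in> borel_measurable (\<F> t)" if "0 \<le> t" for t
          by (rule measurable_compose[OF UF[OF that] borel_measurable_continuous_onI[OF lc]])
        have Z: "null_in_prob (\<lambda>m \<omega>. norm (riemann_ito ?b r m \<omega> - bessel (- s - 1) (S r \<omega>)))"
        proof (rule riemann_ito_null[OF r SI[OF r] bF])
          show "continuous_on {0..} (\<lambda>r. ?b r \<omega>)" if "\<omega> \<in> space M" for \<omega>
            by (rule continuous_on_compose2[OF lc Uc[OF that]]) simp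
          show "AE \<omega> in M. \<forall>q\<in>{0..r}. bessel (- s - 1) (\<phi> (u q \<omega>)) = ?b q \<omega>"
            using Un AE_space
          proof (eventually_elim, intro ballI)
            fix \<omega> q assume n: "\<omega> \<notin> N" and \<omega>: "\<omega> \<in> space M" and q: "q \<in> {0..r}"
            have "\<Phi> (U q \<omega>) = bessel s (\<phi> (u q \<omega>))" using n q us[OF \<omega>, of q] by (simp add: U_def \<Phi>_def unbessel_bessel)
            moreover have "\<phi> (u q \<omega>) \<in> sob s" using \<phi>_sob us[OF \<omega>, of q] q by auto
            ultimately show "bessel (- s - 1) (\<phi> (u q \<omega>)) = ?b q \<omega>" using lower_bessel Ss(2)[OF r \<omega>, of q] q by simp
          qed
        qed
        have eqR: "riemann_ito (\<lambda>r \<omega>. proj n (\<Phi> (U r \<omega>))) r m \<omega> - ?S r \<omega> = raise n 1 (riemann_ito ?b r m \<omega> - bessel (- s - 1) (S r \<omega>))" for m \<omega>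
          unfolding raise_lower[symmetric] riemann_ito_linear[OF raise_linear]
          by (rule linear_diff[OF bounded_linear.linear[OF raise_linear], symmetric])
        show "null_in_prob (\<lambda>m \<omega>. norm (riemann_ito (\<lambda>r \<omega>. proj n (\<Phi> (U r \<omega>))) r m \<omega> - ?S r \<omega>))"
        proof (rule null_in_prob_cmult[OF Z])
          show "AE \<omega> in M. \<bar>norm (riemann_ito (\<lambda>r \<omega>. proj n (\<Phi> (U r \<omega>))) r m \<omega> - ?S r \<omega>)\<bar>
              \<le> cmod 1 * sqrt (1 + (real n)\<^sup>2) powr (2 * s + 1) * \<bar>norm (riemann_ito ?b r m \<omega> - bessel (- s - 1) (S r \<omega>))\<bar>" for m
            unfolding eqR abs_norm_cancel by (intro AE_I2 norm_raise_le)
          have "riemann_ito ?b r m \<in> borel_measurable M" for m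
            unfolding riemann_ito_def elementary_ito_def
            using r by (intro borel_measurable_sum borel_measurable_scaleR borel_measurable_diff W_M F_M[OF bF]) auto
          then have "(\<lambda>\<omega>. riemann_ito ?b r m \<omega> - bessel (- s - 1) (S r \<omega>)) \<in> borel_measurable M" for m by measurable
          then show "(\<lambda>\<omega>. norm (riemann_ito (\<lambda>r \<omega>. proj n (\<Phi> (U r \<omega>))) r m \<omega> - ?S r \<omega>)) \<in> borel_measurable M" for m
            unfolding eqR by (rule measurable_compose[OF measurable_compose[OF _ rm] borel_measurable_norm])
        qed
      qed
    qed
  qed (use UF Uc in blast)+
  moreover have "AE \<omega> in M. \<forall>t\<ge>0. u t \<omega> \<in> sob s \<and> bessel s (u t \<omega>) = U t \<omega>"
    using Un AE_space by eventually_elim (simp add: U_def us)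
  ultimately show thesis by (rule that)
qed

end

section \<open>Stability and the invariant measure\<close>

text \<open>Continuity in probability makes the expectation of F (V x) continuous in x for bounded
  Lipschitz F, and indicators of open sets are limits of such F. Open sets form a generator stable
  under intersection, which extends measurability to the whole kernel and so to all Borel h.\<close>

lemma (in prob_space) integral_kernel_measurable:
  fixes V :: "'c::metric_space \<Rightarrow> 'a \<Rightarrow> 'b::{metric_space, second_countable_topology}" and h :: "'b \<Rightarrow> real"
  assumes V[measurable]: "\<And>x. V x \<in> borel_measurable M"
    and cont: "\<And>x \<eta> \<delta>. \<eta> > 0 \<Longrightarrow> \<delta> > 0 \<Longrightarrow> \<exists>\<rho>>0. \<forall>y. dist y x < \<rho> \<longrightarrow> prob {\<omega>\<in>space M. dist (V y \<omega>) (V x \<omega>) > \<eta>} \<le> \<delta>"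
    and h: "h \<in> borel_measurable borel"
  shows "(\<lambda>x. LINT \<omega>|M. h (V x \<omega>)) \<in> borel_measurable borel"
proof -
  have opn: "(\<lambda>x. prob {\<omega>\<in>space M. V x \<omega> \<in> A}) \<in> borel_measurable borel" if A: "open A" for A
  \<comment> \<open>The full space is separated because \<open>infdist\<close> to its empty
    complement is 0, so F would not approximate the indicator.\<close>
  proof (cases "A = UNIV")
    case False
    define F where "F m y = min 1 (real m * infdist y (- A))" for m :: nat and y
    have Fc: "continuous_on UNIV (F m)" for m unfolding F_def by (intro continuous_intros)
    have Fm[measurable]: "F m \<in> borel_measurable borel" for m by (rule borel_measurable_continuous_onI[OF Fc])
    have F01: "0 \<le> F m y" "F m y \<le> 1" for m y unfolding F_def by (auto simp: infdist_nonneg)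
    have FL: "\<bar>F m y - F m z\<bar> \<le> real m * dist y z" for m y z
    proof -
      have "\<bar>F m y - F m z\<bar> \<le> \<bar>real m * infdist y (- A) - real m * infdist z (- A)\<bar>" unfolding F_def by linarith
      also have "\<dots> = real m * \<bar>infdist y (- A) - infdist z (- A)\<bar>" by (simp add: right_diff_distrib[symmetric] abs_mult)
      also have "\<dots> \<le> real m * dist y z" by (intro mult_left_mono infdist_triangle_abs) simp
      finally show ?thesis .
    qed
    have int: "integrable M (\<lambda>\<omega>. F m (V x \<omega>))" for m x
      using F01 by (intro integrable_const_bound[where B = 1]) auto
    have "continuous_on UNIV (\<lambda>x. LINT \<omega>|M. F m (V x \<omega>))" for m
      unfolding continuous_on_iff
    proof (intro ballI allI impI)
      fix x and e :: real assume e: "0 < e"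
      \<comment> \<open>F m has Lipschitz constant m, so a distance \<eta> changes it by at most
        e/4; the +1 covers m = 0.\<close>
      define \<eta> where "\<eta> = e / (4 * (real m + 1))"
      have \<eta>: "\<eta> > 0" "real m * \<eta> \<le> e / 4" using e unfolding \<eta>_def by (auto simp: field_simps)
      obtain \<rho> where \<rho>: "\<rho> > 0" "\<And>y. dist y x < \<rho> \<Longrightarrow> prob {\<omega>\<in>space M. dist (V y \<omega>) (V x \<omega>) > \<eta>} \<le> e / 4"
        using cont[OF \<eta>(1), of "e / 4" x] e by auto
      have "dist (LINT \<omega>|M. F m (V y \<omega>)) (LINT \<omega>|M. F m (V x \<omega>)) < e" if y: "dist y x < \<rho>" for y
      proof -
        let ?E = "{\<omega>\<in>space M. dist (V y \<omega>) (V x \<omega>) > \<eta>}"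
        have "dist (LINT \<omega>|M. F m (V y \<omega>)) (LINT \<omega>|M. F m (V x \<omega>)) = \<bar>LINT \<omega>|M. F m (V y \<omega>) - F m (V x \<omega>)\<bar>"
          unfolding dist_real_def by (simp add: int)
        also have "\<dots> \<le> (LINT \<omega>|M. \<bar>F m (V y \<omega>) - F m (V x \<omega>)\<bar>)" by (rule integral_abs_bound)
        also have "\<dots> \<le> (LINT \<omega>|M. e / 4 + indicator ?E \<omega>)"
        proof (rule integral_mono)
          show "integrable M (\<lambda>\<omega>. \<bar>F m (V y \<omega>) - F m (V x \<omega>)\<bar>)" by (intro integrable_abs Bochner_Integration.integrable_diff int)
          show "integrable M (\<lambda>\<omega>. e / 4 + indicator ?E \<omega>)"
            by (intro Bochner_Integration.integrable_add integrable_const integrable_real_indicator) (auto simp: emeasure_eq_measure)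
          fix \<omega> assume \<omega>: "\<omega> \<in> space M"
          show "\<bar>F m (V y \<omega>) - F m (V x \<omega>)\<bar> \<le> e / 4 + indicator ?E \<omega>"
          proof (cases "\<omega> \<in> ?E")
            case True
            then show ?thesis using F01[of m "V y \<omega>"] F01[of m "V x \<omega>"] e by simp
          next
            case False
            then have "real m * dist (V y \<omega>) (V x \<omega>) \<le> real m * \<eta>" using \<omega> by (intro mult_left_mono) auto
            then show ?thesis using FL[of m "V y \<omega>" "V x \<omega>"] \<eta>(2) False by simp
          qed
        qed
        also have "\<dots> = e / 4 + prob ?E"
          by (subst Bochner_Integration.integral_add) (auto simp: emeasure_eq_measure prob_space intro!: integrable_real_indicator)
        also have "\<dots> \<le> e / 4 + e / 4" using \<rho>(2)[OF y] by simp
        also have "\<dots> < e" using e by simp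
        finally show ?thesis .
      qed
      then show "\<exists>d>0. \<forall>y\<in>UNIV. dist y x < d \<longrightarrow> dist (LINT \<omega>|M. F m (V y \<omega>)) (LINT \<omega>|M. F m (V x \<omega>)) < e"
        using \<rho>(1) by blast
    qed
    then have Em: "(\<lambda>x. LINT \<omega>|M. F m (V x \<omega>)) \<in> borel_measurable borel" for m
      by (rule borel_measurable_continuous_onI)
    have lim: "(\<lambda>m. F m y) \<longlonglongrightarrow> indicator A y" for y
    proof (cases "y \<in> A")
      case True
      have "infdist y (- A) \<noteq> 0" using in_closed_iff_infdist_zero[of "- A" y] A False True by auto
      then have d: "infdist y (- A) > 0" using infdist_nonneg[of y "- A"] by linarith
      obtain m0 :: nat where m0: "1 / infdist y (- A) \<le> real m0" using real_arch_simple by blast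
      have "F m y = 1" if m: "m \<ge> m0" for m
      proof -
        have "1 / infdist y (- A) \<le> real m" using m0 m by linarith
        then show ?thesis unfolding F_def using d by (simp add: divide_le_eq)
      qed
      then show ?thesis using True by (intro tendsto_eventually eventually_sequentiallyI[of m0]) simp
    qed (simp add: F_def infdist_zero)
    have "(\<lambda>m. LINT \<omega>|M. F m (V x \<omega>)) \<longlonglongrightarrow> prob {\<omega>\<in>space M. V x \<omega> \<in> A}" for x
    proof -
      have [measurable]: "A \<in> sets borel" using A by simp
      have "(\<lambda>m. LINT \<omega>|M. F m (V x \<omega>)) \<longlonglongrightarrow> (LINT \<omega>|M. indicator A (V x \<omega>))"
        by (rule integral_dominated_convergence[where w = "\<lambda>_. 1"]) (use F01 lim in auto)
      also have "(LINT \<omega>|M. indicator A (V x \<omega>) :: real) = (LINT \<omega>|M. indicator {\<omega>\<in>space M. V x \<omega> \<in> A} \<omega>)"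
        by (intro Bochner_Integration.integral_cong) (auto simp: indicator_def)
      also have "\<dots> = prob {\<omega>\<in>space M. V x \<omega> \<in> A}" by (simp add: Int_def conj_commute)
      finally show ?thesis .
    qed
    then show ?thesis using Em by (rule borel_measurable_LIMSEQ_real)
  qed (simp add: prob_space)
  have "(\<lambda>x. distr M borel (V x)) \<in> measurable borel (prob_algebra borel)"
  proof (rule measurable_prob_algebra_generated[where \<Omega> = UNIV and G = "{A. open A}"])
    show "sets (borel :: 'b measure) = sigma_sets UNIV {A. open A}" by (simp add: borel_def)
    show "Int_stable {A :: 'b set. open A}" by (auto simp: Int_stable_def)
    fix A :: "'b set" assume A: "A \<in> {A. open A}"
    have "emeasure (distr M borel (V x)) A = ennreal (prob {\<omega>\<in>space M. V x \<omega> \<in> A})" for x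
      using A by (simp add: emeasure_distr emeasure_eq_measure vimage_def Int_def conj_commute)
    then show "(\<lambda>x. emeasure (distr M borel (V x)) A) \<in> borel_measurable borel"
      using opn[of A] A by simp
  qed (auto intro: prob_space_distr)
  from measurable_compose[OF measurable_prob_algebraD[OF this] integral_measurable_subprob_algebra[OF h]]
  show ?thesis using h by (simp add: integral_distr)
qed

lemma sob_norm_nonneg: "0 \<le> sob_norm r v"
  unfolding sob_norm_def by (simp add: infsum_nonneg)

text \<open>Since p < 1, the p-th power dominates this bounded test function on all of the half
  line, so that decay in p-mean controls it.\<close>

lemma ge_powr_less_one:
  fixes z p :: real
  assumes "0 \<le> z" "0 < p" "p < 1"
  shows "min 1 z \<le> z powr p"
proof (cases "z \<le> 1")
  case True
  then show ?thesis using powr_mono'[of p 1 z] assms by simp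
next
  case False
  then show ?thesis using ge_one_powr_ge_zero[of z p] assms by simp
qed

section \<open>Decay of the flow, dependence on the initial value and invariant measures\<close>

locale schroedinger_flow = schroedinger M \<F> W \<sigma> \<alpha> s K p B \<phi> f \<psi>
  for M :: "'w measure" and \<F> W \<sigma> \<alpha> s K p B and \<phi> :: "('d::finite) fseries \<Rightarrow> 'd fseries" and f \<psi> +
  fixes u
  assumes u: "x \<in> sob s \<Longrightarrow> strong_solution s \<sigma> \<alpha> \<phi> M \<F> W x (u x)"
begin

text \<open>The decay exponent \<lambda> of the English statement, valid with constant 1.\<close>

definition \<kappa> :: real where "\<kappa> = - (p * B)"

lemma \<kappa>_pos: "\<kappa> > 0"
  unfolding \<kappa>_def using p B by (simp add: mult_pos_neg)

lemma flow:
  assumes x: "x \<in> sob s"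
  obtains U where "solution (bessel s x) U" "AE \<omega> in M. \<forall>t\<ge>0. u x t \<omega> \<in> sob s \<and> bessel s (u x t \<omega>) = U t \<omega>"
    "supermart (sob_norm s x powr p) (\<lambda>t \<omega>. norm (U t \<omega>) powr p * exp (\<kappa> * t))"
    "\<And>\<omega>. \<omega> \<in> space M \<Longrightarrow> continuous_on {0..} (\<lambda>t. norm (U t \<omega>) powr p * exp (\<kappa> * t))"
proof -
  obtain U where U: "solution (bessel s x) U" "AE \<omega> in M. \<forall>t\<ge>0. u x t \<omega> \<in> sob s \<and> bessel s (u x t \<omega>) = U t \<omega>"
    using strong_solution_ell2[OF x u[OF x]] by blast
  have "supermart (sob_norm s x powr p) (\<lambda>t \<omega>. norm (U t \<omega>) powr p * exp (\<kappa> * t))"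
    using supermart_decay[OF p(1) energy_ell2 U(1)] unfolding norm_bessel[OF x] \<kappa>_def .
  moreover have "continuous_on {0..} (\<lambda>t. norm (U t \<omega>) powr p * exp (\<kappa> * t))" if "\<omega> \<in> space M" for \<omega>
    using p by (intro continuous_intros solutionD(2)[OF U(1) that] continuous_on_powr') auto
  ultimately show thesis using that U by blast
qed

lemma mean_decay:
  assumes x: "x \<in> sob s" and t: "0 \<le> t"
  shows "(\<integral>\<^sup>+\<omega>. ennreal (sob_norm s (u x t \<omega>) powr p) \<partial>M) \<le> ennreal (exp (- \<kappa> * t) * sob_norm s x powr p)"
proof -
  obtain U where U: "solution (bessel s x) U" "AE \<omega> in M. \<forall>t\<ge>0. u x t \<omega> \<in> sob s \<and> bessel s (u x t \<omega>) = U t \<omega>"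
    "supermart (sob_norm s x powr p) (\<lambda>t \<omega>. norm (U t \<omega>) powr p * exp (\<kappa> * t))" by (rule flow[OF x])
  have [measurable]: "U t \<in> borel_measurable M" using F_M[OF solutionD(1)[OF U(1) t] t] .
  have "AE \<omega> in M. ennreal (sob_norm s (u x t \<omega>) powr p) = ennreal (exp (- \<kappa> * t)) * ennreal (norm (U t \<omega>) powr p * exp (\<kappa> * t))"
    using U(2)
  proof eventually_elim
    fix \<omega> assume "\<forall>t\<ge>0. u x t \<omega> \<in> sob s \<and> bessel s (u x t \<omega>) = U t \<omega>"
    then have "sob_norm s (u x t \<omega>) = norm (U t \<omega>)" using t norm_bessel by metis
    then show "ennreal (sob_norm s (u x t \<omega>) powr p) = ennreal (exp (- \<kappa> * t)) * ennreal (norm (U t \<omega>) powr p * exp (\<kappa> * t))"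
      by (simp add: ennreal_mult[symmetric] exp_minus)
  qed
  then have "(\<integral>\<^sup>+\<omega>. ennreal (sob_norm s (u x t \<omega>) powr p) \<partial>M)
      = (\<integral>\<^sup>+\<omega>. ennreal (exp (- \<kappa> * t)) * ennreal (norm (U t \<omega>) powr p * exp (\<kappa> * t)) \<partial>M)"
    by (rule nn_integral_cong_AE)
  also have "\<dots> = ennreal (exp (- \<kappa> * t)) * (\<integral>\<^sup>+\<omega>. ennreal (norm (U t \<omega>) powr p * exp (\<kappa> * t)) \<partial>M)"
    by (rule nn_integral_cmult) measurable
  also have "\<dots> \<le> ennreal (exp (- \<kappa> * t)) * ennreal (sob_norm s x powr p)"
    using U(3) t unfolding supermart_def by (intro mult_left_mono) auto
  finally show ?thesis by (simp add: ennreal_mult)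
qed

text \<open>The supermartingale \<open>Y(t) = \<parallel>u(t)\<parallel>\<^sup>p e\<^sup>\<kappa>\<^sup>t\<close> is almost surely bounded, and \<open>\<tau>\<^sub>0\<close> is a time from which on
  \<open>\<parallel>u\<^sup>0\<parallel>\<^sup>p e\<^bsup>(\<kappa>-\<kappa>')t\<^esup> \<ge> \<parallel>u\<^sup>0\<parallel>\<^sup>p (\<kappa> - \<kappa>') t\<close> exceeds the supremum of \<open>Y\<close>.\<close>

lemma pathwise_decay:
  assumes x: "x \<in> sob s" and \<kappa>': "\<kappa>' < \<kappa>"
  shows "\<exists>\<tau>0 :: _ \<Rightarrow> ennreal. \<tau>0 \<in> borel_measurable M \<and> (AE \<omega> in M. \<tau>0 \<omega> < \<infinity>) \<and>
    (AE \<omega> in M. \<forall>t\<ge>0. \<tau>0 \<omega> \<le> ennreal t \<longrightarrow> sob_norm s (u x t \<omega>) powr p \<le> exp (- \<kappa>' * t) * sob_norm s x powr p)"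
proof -
  obtain U where U: "solution (bessel s x) U" "AE \<omega> in M. \<forall>t\<ge>0. u x t \<omega> \<in> sob s \<and> bessel s (u x t \<omega>) = U t \<omega>"
    "supermart (sob_norm s x powr p) (\<lambda>t \<omega>. norm (U t \<omega>) powr p * exp (\<kappa> * t))"
    "\<And>\<omega>. \<omega> \<in> space M \<Longrightarrow> continuous_on {0..} (\<lambda>t. norm (U t \<omega>) powr p * exp (\<kappa> * t))" by (rule flow[OF x]) blast
  define y where "y = sob_norm s x powr p"
  define Y where "Y t \<omega> = norm (U t \<omega>) powr p * exp (\<kappa> * t)" for t \<omega>
  have y0: "y \<ge> 0" by (simp add: y_def)
  have S: "supermart y Y" using U(3) unfolding y_def Y_def[abs_def] .
  have Yc: "continuous_on {0..} (\<lambda>t. Y t \<omega>)" if "\<omega> \<in> space M" for \<omega> using U(4)[OF that] unfolding Y_def .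
  have Ym[measurable]: "Y t \<in> borel_measurable M" if "0 \<le> t" for t using S that unfolding supermart_def by blast
  have Y0: "0 \<le> Y t \<omega>" for t \<omega> by (simp add: Y_def)
  have norm_Y: "AE \<omega> in M. \<forall>t\<ge>0. sob_norm s (u x t \<omega>) powr p = exp (- \<kappa> * t) * Y t \<omega>"
    using U(2)
  proof (eventually_elim, intro allI impI)
    fix \<omega> t assume "\<forall>t\<ge>0. u x t \<omega> \<in> sob s \<and> bessel s (u x t \<omega>) = U t \<omega>" and "(0::real) \<le> t"
    then have "sob_norm s (u x t \<omega>) = norm (U t \<omega>)" using norm_bessel by metis
    then show "sob_norm s (u x t \<omega>) powr p = exp (- \<kappa> * t) * Y t \<omega>" by (simp add: Y_def exp_minus)
  qed
  show ?thesis
  \<comment> \<open>For y = 0 the scale c below would vanish; the path is then identically 0 and the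
    random time 0 serves.\<close>
  proof (cases "y = 0")
    case True
    then have "bessel s x = 0" using norm_bessel[OF x] by (simp add: y_def)
    then have "solution 0 U" using U(1) by simp
    then have "AE \<omega> in M. \<forall>t\<ge>0. U t \<omega> = 0" by (rule solution_zero_unique)
    with norm_Y have "AE \<omega> in M. \<forall>t\<ge>0. sob_norm s (u x t \<omega>) powr p \<le> exp (- \<kappa>' * t) * y"
      by eventually_elim (use True in \<open>simp add: Y_def\<close>)
    then show ?thesis by (intro exI[of _ "\<lambda>_. 0"]) (simp add: y_def)
  next
    case False
    define c where "c = y * (\<kappa> - \<kappa>')"
    have c: "c > 0" using False y0 \<kappa>' unfolding c_def by (intro mult_pos_pos) auto
    \<comment> \<open>The supremum runs over rational times to be measurable; continuity of Y
      recovers all times.\<close>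
    define \<tau>0 where "\<tau>0 \<omega> = (SUP q\<in>\<rat> \<inter> {0..}. ennreal (Y q \<omega> / c))" for \<omega>
    have m[measurable]: "\<tau>0 \<in> borel_measurable M"
      unfolding \<tau>0_def[abs_def] by (rule borel_measurable_SUP) (auto intro: countable_subset[OF _ countable_rat])
    let ?I = "{\<omega> \<in> space M. \<tau>0 \<omega> = \<infinity>}"
    \<comment> \<open>An infinite \<tau>0 means an unbounded path of Y, and such paths lie in the
      exceptional event of the maximal inequality at every level \<open>Suc n\<close>.\<close>
    have I: "prob ?I \<le> y / real (Suc n)" for n
    proof -
      obtain A where A: "A \<in> sets M" "prob A \<le> y / real (Suc n)" "\<And>\<omega> t. \<omega> \<in> space M - A \<Longrightarrow> 0 \<le> t \<Longrightarrow> Y t \<omega> \<le> real (Suc n)"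
        by (rule supermart_bounded_paths[OF S Yc, of "real (Suc n)"]) auto
      have "?I \<subseteq> A"
      proof
        fix \<omega> assume \<omega>: "\<omega> \<in> ?I"
        show "\<omega> \<in> A"
        proof (rule ccontr)
          assume "\<omega> \<notin> A"
          then have "\<tau>0 \<omega> \<le> ennreal (real (Suc n) / c)"
            unfolding \<tau>0_def using A(3)[of \<omega>] \<omega> c by (intro SUP_least ennreal_leI divide_right_mono) auto
          then show False using \<omega> by (simp add: top_unique)
        qed
      qed
      then have "prob ?I \<le> prob A" using A(1) by (rule finite_measure_mono)
      then show ?thesis using A(2) by linarith
    qed
    have "prob ?I \<le> 0" by (rule LIMSEQ_le_const[OF LIMSEQ_Suc[OF lim_const_over_n[of y]]]) (use I in blast)
    then have "AE \<omega> in M. \<tau>0 \<omega> \<noteq> \<infinity>"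
      by (subst AE_iff_measurable[of ?I]) (auto simp: emeasure_eq_measure measure_le_0_iff)
    then have fin: "AE \<omega> in M. \<tau>0 \<omega> < \<infinity>" by eventually_elim (simp add: less_top)
    have "AE \<omega> in M. \<forall>t\<ge>0. \<tau>0 \<omega> \<le> ennreal t \<longrightarrow> sob_norm s (u x t \<omega>) powr p \<le> exp (- \<kappa>' * t) * y"
      using norm_Y AE_space
    proof (eventually_elim, intro allI impI)
      fix \<omega> t assume n: "\<forall>t\<ge>0. sob_norm s (u x t \<omega>) powr p = exp (- \<kappa> * t) * Y t \<omega>" and \<omega>: "\<omega> \<in> space M"
        and t: "0 \<le> t" and \<tau>: "\<tau>0 \<omega> \<le> ennreal t"
      obtain r where r: "\<And>n. r n \<in> \<rat>" "\<And>n. t < r n" "r \<longlonglongrightarrow> t" by (rule rational_sequence_from_right) blast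
      have "Y (r n) \<omega> \<le> c * t" for n
      proof -
        have "ennreal (Y (r n) \<omega> / c) \<le> \<tau>0 \<omega>" unfolding \<tau>0_def using r(1,2)[of n] t by (intro SUP_upper) auto
        also have "\<dots> \<le> ennreal t" by (rule \<tau>)
        finally show ?thesis using t c by (simp add: divide_le_eq mult.commute)
      qed
      moreover have "(\<lambda>n. Y (r n) \<omega>) \<longlonglongrightarrow> Y t \<omega>" by (rule tendsto_along_right_sequence[OF Yc[OF \<omega>] t r(2,3)])
      ultimately have "Y t \<omega> \<le> c * t" by (intro LIMSEQ_le_const2) auto
      also have "\<dots> = y * ((\<kappa> - \<kappa>') * t)" by (simp add: c_def)
      also have "\<dots> \<le> y * exp ((\<kappa> - \<kappa>') * t)"
        using exp_ge_add_one_self[of "(\<kappa> - \<kappa>') * t"] y0 by (intro mult_left_mono) linarith+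
      finally have "exp (- \<kappa> * t) * Y t \<omega> \<le> exp (- \<kappa> * t) * (y * exp ((\<kappa> - \<kappa>') * t))" by (intro mult_left_mono) auto
      also have "\<dots> = exp (- \<kappa>' * t) * y" by (simp add: exp_add[symmetric] algebra_simps)
      finally show "sob_norm s (u x t \<omega>) powr p \<le> exp (- \<kappa>' * t) * y" using n t by simp
    qed
    then show ?thesis using m fin unfolding y_def by blast
  qed
qed

lemma flow_measurable:
  assumes "x \<in> sob s" "0 \<le> t"
  shows "u x t \<in> measurable M (sob_borel s)"
  using u[OF assms(1)] assms(2) unfolding strong_solution_def by (blast intro: F_M)

text \<open>By the maximal inequality, solutions from a bounded set of initial values stay in one
  ball for all times with high probability. On that ball the coefficients have a common Lipschitz
  constant, and \<open>difference_prob\<close> applies.\<close>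

lemma flow_continuous_in_probability:
  assumes t: "0 \<le> t" and \<eta>: "\<eta> > 0" and \<delta>: "\<delta> > 0"
  shows "\<exists>\<rho>>0. \<forall>Y. dist Y X < \<rho> \<longrightarrow>
    prob {\<omega>\<in>space M. dist (bessel s (u (unbessel s Y) t \<omega>)) (bessel s (u (unbessel s X) t \<omega>)) > \<eta>} \<le> \<delta>"
proof -
  define y where "y = (norm X + 1) powr p"
  \<comment> \<open>This level gives each of the two exceptional events probability at most
    \<delta>/4, leaving \<delta>/2 for the difference itself.\<close>
  define c where "c = 4 * y / \<delta>"
  have y: "y > 0" unfolding y_def using add_nonneg_pos[OF norm_ge_zero[of X] zero_less_one] by simp
  have c: "c > 0" using y \<delta> by (simp add: c_def)
  define R where "R = c powr (1 / p)"
  have bd: "\<exists>U A. solution Z U \<and> (AE \<omega> in M. bessel s (u (unbessel s Z) t \<omega>) = U t \<omega>) \<and> A \<in> sets M \<and> prob A \<le> \<delta> / 4 \<and>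
      (\<forall>\<omega> r. \<omega> \<in> space M - A \<longrightarrow> 0 \<le> r \<longrightarrow> norm (U r \<omega>) \<le> R)" if Z: "norm Z \<le> norm X + 1" for Z
  proof -
    obtain U where U: "solution (bessel s (unbessel s Z)) U"
      "AE \<omega> in M. \<forall>t\<ge>0. u (unbessel s Z) t \<omega> \<in> sob s \<and> bessel s (u (unbessel s Z) t \<omega>) = U t \<omega>"
      "supermart (sob_norm s (unbessel s Z) powr p) (\<lambda>t \<omega>. norm (U t \<omega>) powr p * exp (\<kappa> * t))"
      "\<And>\<omega>. \<omega> \<in> space M \<Longrightarrow> continuous_on {0..} (\<lambda>t. norm (U t \<omega>) powr p * exp (\<kappa> * t))"
      by (rule flow[OF unbessel_sob]) blast
    obtain A where A: "A \<in> sets M" "prob A \<le> sob_norm s (unbessel s Z) powr p / c"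
      "\<And>\<omega> t. \<omega> \<in> space M - A \<Longrightarrow> 0 \<le> t \<Longrightarrow> norm (U t \<omega>) powr p * exp (\<kappa> * t) \<le> c"
      by (rule supermart_bounded_paths[OF U(3,4) c]) auto
    have "sob_norm s (unbessel s Z) powr p \<le> y" unfolding sob_norm_unbessel y_def using Z p by (intro powr_mono2) auto
    then have "sob_norm s (unbessel s Z) powr p / c \<le> y / c" using c by (intro divide_right_mono) auto
    also have "y / c = \<delta> / 4" using y \<delta> by (simp add: c_def)
    finally have "prob A \<le> \<delta> / 4" using A(2) by linarith
    moreover have "norm (U r \<omega>) \<le> R" if \<omega>: "\<omega> \<in> space M - A" and r: "0 \<le> r" for \<omega> r
    proof -
      have "norm (U r \<omega>) powr p * 1 \<le> norm (U r \<omega>) powr p * exp (\<kappa> * r)"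
        using r \<kappa>_pos by (intro mult_left_mono) auto
      also have "\<dots> \<le> c" by (rule A(3)[OF \<omega> r])
      finally have "(norm (U r \<omega>) powr p) powr (1 / p) \<le> c powr (1 / p)" using p by (intro powr_mono2) auto
      then show ?thesis using p unfolding R_def by (simp add: powr_powr)
    qed
    moreover have "AE \<omega> in M. bessel s (u (unbessel s Z) t \<omega>) = U t \<omega>" using U(2) by eventually_elim (use t in blast)
    ultimately show ?thesis using U(1) A(1) unfolding bessel_unbessel by blast
  qed
  obtain L where L: "L \<ge> 0" "\<And>U V. norm U \<le> R \<Longrightarrow> norm V \<le> R \<Longrightarrow> norm (\<Phi> U - \<Phi> V) \<le> L * norm (U - V)"
    "\<And>U V. norm U \<le> R \<Longrightarrow> norm V \<le> R \<Longrightarrow> norm (G U - G V) \<le> L * norm (U - V)" by (rule lip[of R]) blast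
  define C where "C = exp ((L + L\<^sup>2) * t) / \<eta>"
  have C: "C > 0" using \<eta> by (simp add: C_def)
  \<comment> \<open>\<rho> serves as the radius and, squared, as the \<epsilon> of
    \<open>difference_prob\<close>; the square root there is then at most
    \<open>2 * \<rho>\<close>.\<close>
  define \<rho> where "\<rho> = min 1 (\<delta> / (4 * C))"
  have \<rho>: "\<rho> > 0" "\<rho> \<le> 1" "2 * \<rho> * C \<le> \<delta> / 2" using C \<delta> by (auto simp: \<rho>_def min_def field_simps)
  have "prob {\<omega>\<in>space M. dist (bessel s (u (unbessel s Y) t \<omega>)) (bessel s (u (unbessel s X) t \<omega>)) > \<eta>} \<le> \<delta>"
    if Y: "dist Y X < \<rho>" for Y
  proof -
    have nY: "norm Y \<le> norm X + 1" using Y \<rho>(2) norm_triangle_ineq2[of Y X] by (simp add: dist_norm)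
    obtain U1 A1 where 1: "solution Y U1" "AE \<omega> in M. bessel s (u (unbessel s Y) t \<omega>) = U1 t \<omega>" "A1 \<in> sets M" "prob A1 \<le> \<delta> / 4"
      "\<And>\<omega> r. \<omega> \<in> space M - A1 \<Longrightarrow> 0 \<le> r \<Longrightarrow> norm (U1 r \<omega>) \<le> R" using bd[OF nY] by blast
    obtain U2 A2 where 2: "solution X U2" "AE \<omega> in M. bessel s (u (unbessel s X) t \<omega>) = U2 t \<omega>" "A2 \<in> sets M" "prob A2 \<le> \<delta> / 4"
      "\<And>\<omega> r. \<omega> \<in> space M - A2 \<Longrightarrow> 0 \<le> r \<Longrightarrow> norm (U2 r \<omega>) \<le> R" using bd[of X] by auto
    have [measurable]: "U1 t \<in> borel_measurable M" "U2 t \<in> borel_measurable M"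
      using F_M[OF solutionD(1)[OF 1(1) t] t] F_M[OF solutionD(1)[OF 2(1) t] t] .
    have "prob {\<omega>\<in>space M. dist (bessel s (u (unbessel s Y) t \<omega>)) (bessel s (u (unbessel s X) t \<omega>)) > \<eta>}
        \<le> prob {\<omega>\<in>space M. norm (U1 t \<omega> - U2 t \<omega>) > \<eta>}"
    proof (rule finite_measure_mono_AE)
      show "AE \<omega> in M. \<omega> \<in> {\<omega>\<in>space M. dist (bessel s (u (unbessel s Y) t \<omega>)) (bessel s (u (unbessel s X) t \<omega>)) > \<eta>} \<longrightarrow>
          \<omega> \<in> {\<omega>\<in>space M. norm (U1 t \<omega> - U2 t \<omega>) > \<eta>}"
        using 1(2) 2(2) by eventually_elim (simp add: dist_norm)
    qed measurable
    also have "\<dots> \<le> sqrt (\<rho>\<^sup>2 + (norm (Y - X))\<^sup>2) * exp ((L + L\<^sup>2) * t) / \<eta> + prob A1 + prob A2"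
      using \<rho>(1) by (intro difference_prob[OF 1(1) 2(1) t L 1(3) 2(3) 1(5) 2(5) \<eta>]) auto
    also have "sqrt (\<rho>\<^sup>2 + (norm (Y - X))\<^sup>2) \<le> sqrt ((2 * \<rho>)\<^sup>2)"
    proof (rule real_sqrt_le_mono)
      have "(norm (Y - X))\<^sup>2 \<le> \<rho>\<^sup>2" using Y by (intro power_mono) (auto simp: dist_norm)
      moreover have "(2 * \<rho>)\<^sup>2 = 4 * \<rho>\<^sup>2" by (simp add: power_mult_distrib)
      ultimately show "\<rho>\<^sup>2 + (norm (Y - X))\<^sup>2 \<le> (2 * \<rho>)\<^sup>2" using zero_le_power2[of \<rho>] by linarith
    qed
    also have "sqrt ((2 * \<rho>)\<^sup>2) = 2 * \<rho>" using \<rho>(1) by (intro real_sqrt_unique) auto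
    also have "2 * \<rho> * exp ((L + L\<^sup>2) * t) / \<eta> = 2 * \<rho> * C" by (simp add: C_def)
    finally show ?thesis using 1(4) 2(4) \<rho>(3) \<eta> by (auto simp: mult_right_mono divide_right_mono)
  qed
  then show ?thesis using \<rho>(1) by blast
qed

text \<open>Conjugation by the isometry reduces the claim to a kernel on
  \<open>ell2\<close>.\<close>

lemma transition_op_measurable:
  assumes t: "0 \<le> t" and g: "g \<in> borel_measurable (sob_borel s)"
  shows "transition_op M u t g \<in> borel_measurable (sob_borel s)"
proof -
  have V: "(\<lambda>\<omega>. bessel s (u (unbessel s X) t \<omega>)) \<in> borel_measurable M" for X
    by (rule measurable_compose[OF flow_measurable[OF unbessel_sob t] bessel_measurable])
  have h: "(\<lambda>V. g (unbessel s V)) \<in> borel_measurable borel" by (rule measurable_compose[OF unbessel_measurable g])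
  have "(\<lambda>X. LINT \<omega>|M. g (unbessel s (bessel s (u (unbessel s X) t \<omega>)))) \<in> borel_measurable borel"
    by (rule integral_kernel_measurable[OF V flow_continuous_in_probability[OF t] h])
  from measurable_compose[OF bessel_measurable this]
  have "(\<lambda>x. LINT \<omega>|M. g (unbessel s (bessel s (u (unbessel s (bessel s x)) t \<omega>)))) \<in> borel_measurable (sob_borel s)" .
  moreover have "transition_op M u t g x = (LINT \<omega>|M. g (unbessel s (bessel s (u (unbessel s (bessel s x)) t \<omega>))))"
    if x: "x \<in> space (sob_borel s)" for x
  proof -
    have xs: "x \<in> sob s" using x by (simp add: space_sob_borel)
    have "u x t \<omega> \<in> sob s" if "\<omega> \<in> space M" for \<omega>
      using measurable_space[OF flow_measurable[OF xs t] that] by (simp add: space_sob_borel)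
    then show ?thesis unfolding transition_op_def unbessel_bessel[OF xs]
      by (intro Bochner_Integration.integral_cong) (simp_all add: unbessel_bessel)
  qed
  ultimately show ?thesis by (subst measurable_cong) auto
qed

lemma sob_norm_measurable: "sob_norm s \<in> borel_measurable (sob_borel s)"
proof -
  have "(\<lambda>x. norm (bessel s x)) \<in> borel_measurable (sob_borel s)" by (rule measurable_compose[OF bessel_measurable borel_measurable_norm])
  then show ?thesis by (subst measurable_cong[of _ _ "\<lambda>x. norm (bessel s x)"]) (auto simp: norm_bessel space_sob_borel)
qed

lemma sob_norm_zero_iff: "x \<in> sob s \<Longrightarrow> sob_norm s x = 0 \<longleftrightarrow> x = (\<lambda>_. 0)"
  by (metis norm_bessel norm_eq_zero unbessel_bessel bessel_zero zero_sob)

text \<open>Uniqueness of the zero solution makes the transition operator preserve the value of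
  every test function at 0.\<close>

lemma dirac_invariant: "invariant_measure s M u (return (sob_borel s) (\<lambda>_. 0))"
proof -
  have z: "(\<lambda>_. 0) \<in> space (sob_borel s)" by (simp add: space_sob_borel zero_sob)
  have "(LINT x|return (sob_borel s) (\<lambda>_. 0). g x) = (LINT x|return (sob_borel s) (\<lambda>_. 0). transition_op M u t g x)"
    if t: "0 \<le> t" and g: "g \<in> borel_measurable (sob_borel s)" for t g
  proof -
    obtain U where U: "solution (bessel s (\<lambda>_. 0)) U"
      "AE \<omega> in M. \<forall>t\<ge>0. u (\<lambda>_. 0) t \<omega> \<in> sob s \<and> bessel s (u (\<lambda>_. 0) t \<omega>) = U t \<omega>" by (rule flow[OF zero_sob])
    have "AE \<omega> in M. \<forall>t\<ge>0. U t \<omega> = 0" by (rule solution_zero_unique[OF U(1)[unfolded bessel_zero]])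
    with U(2) have "AE \<omega> in M. g (u (\<lambda>_. 0) t \<omega>) = g (\<lambda>_. 0)"
    proof eventually_elim
      fix \<omega> assume "\<forall>t\<ge>0. u (\<lambda>_. 0) t \<omega> \<in> sob s \<and> bessel s (u (\<lambda>_. 0) t \<omega>) = U t \<omega>" "\<forall>t\<ge>0. U t \<omega> = 0"
      then have "u (\<lambda>_. 0) t \<omega> \<in> sob s" "bessel s (u (\<lambda>_. 0) t \<omega>) = bessel s (\<lambda>_. 0)" using t by (simp_all add: bessel_zero)
      then have "u (\<lambda>_. 0) t \<omega> = (\<lambda>_. 0)" using bessel_inj zero_sob by (metis inj_onD)
      then show "g (u (\<lambda>_. 0) t \<omega>) = g (\<lambda>_. 0)" by simp
    qed
    then have "transition_op M u t g (\<lambda>_. 0) = (LINT \<omega>|M. g (\<lambda>_. 0))"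
      unfolding transition_op_def
      by (intro integral_cong_AE measurable_compose[OF flow_measurable[OF zero_sob t] g]) simp_all
    also have "\<dots> = g (\<lambda>_. 0)" by (simp add: prob_space)
    finally show ?thesis
      unfolding integral_return[OF z g] integral_return[OF z transition_op_measurable[OF t g]] ..
  qed
  then show ?thesis unfolding invariant_measure_def using prob_space_return[OF z] by simp
qed

lemma transition_op_norm_le:
  assumes x: "x \<in> sob s" and t: "0 \<le> t"
  shows "transition_op M u t (\<lambda>v. min 1 (sob_norm s v)) x \<le> exp (- \<kappa> * t) * sob_norm s x powr p"
    and "0 \<le> transition_op M u t (\<lambda>v. min 1 (sob_norm s v)) x" "transition_op M u t (\<lambda>v. min 1 (sob_norm s v)) x \<le> 1"
proof -
  have [measurable]: "(\<lambda>\<omega>. sob_norm s (u x t \<omega>)) \<in> borel_measurable M"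
    by (rule measurable_compose[OF flow_measurable[OF x t] sob_norm_measurable])
  have int: "integrable M (\<lambda>\<omega>. min 1 (sob_norm s (u x t \<omega>)))" by (rule integrable_const_bound[where B = 1]) (auto simp: sob_norm_nonneg)
  show T0: "0 \<le> transition_op M u t (\<lambda>v. min 1 (sob_norm s v)) x"
    unfolding transition_op_def by (intro Bochner_Integration.integral_nonneg) (simp add: sob_norm_nonneg)
  show "transition_op M u t (\<lambda>v. min 1 (sob_norm s v)) x \<le> 1"
    unfolding transition_op_def by (rule integral_le_const[OF int]) simp
  have "ennreal (transition_op M u t (\<lambda>v. min 1 (sob_norm s v)) x) = (\<integral>\<^sup>+\<omega>. ennreal (min 1 (sob_norm s (u x t \<omega>))) \<partial>M)"
    unfolding transition_op_def by (rule nn_integral_eq_integral[OF int, symmetric]) (simp add: sob_norm_nonneg)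
  also have "\<dots> \<le> (\<integral>\<^sup>+\<omega>. ennreal (sob_norm s (u x t \<omega>) powr p) \<partial>M)"
    using p by (intro nn_integral_mono ennreal_leI ge_powr_less_one sob_norm_nonneg)
  also have "\<dots> \<le> ennreal (exp (- \<kappa> * t) * sob_norm s x powr p)" by (rule mean_decay[OF x t])
  finally show "transition_op M u t (\<lambda>v. min 1 (sob_norm s v)) x \<le> exp (- \<kappa> * t) * sob_norm s x powr p" by simp
qed

text \<open>\<mu> may have no moments, so the bounded test function is essential: its integral is
  constant in time, while its evolution tends to 0 pointwise, and dominated convergence applies.
  Hence the norm vanishes \<mu>-almost surely.\<close>

lemma invariant_measure_unique:
  assumes \<mu>: "invariant_measure s M u \<mu>"
  shows "\<mu> = return (sob_borel s) (\<lambda>_. 0)"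
proof -
  interpret \<mu>: prob_space \<mu> using \<mu> unfolding invariant_measure_def by blast
  have sets: "sets \<mu> = sets (sob_borel s)" using \<mu> unfolding invariant_measure_def by blast
  have space: "space \<mu> = sob s" using sets_eq_imp_space_eq[OF sets] by (simp add: space_sob_borel)
  have meas: "measurable \<mu> N = measurable (sob_borel s) N" for N :: "'n measure" by (rule measurable_cong_sets[OF sets refl])
  let ?g = "\<lambda>v :: 'd fseries. min 1 (sob_norm s v)"
  have gm: "?g \<in> borel_measurable (sob_borel s)" using sob_norm_measurable by measurable
  have gm\<mu>[measurable]: "?g \<in> borel_measurable \<mu>" unfolding meas by (rule gm)
  have "bounded (?g ` sob s)" by (rule boundedI[of _ 1]) (auto simp: sob_norm_nonneg)
  then have inv: "(LINT x|\<mu>. ?g x) = (LINT x|\<mu>. transition_op M u t ?g x)" if "0 \<le> t" for t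
    using \<mu> gm that unfolding invariant_measure_def by blast
  have "(\<lambda>n. LINT x|\<mu>. transition_op M u (real n) ?g x) \<longlonglongrightarrow> (LINT x|\<mu>. 0)"
  proof (rule integral_dominated_convergence[where w = "\<lambda>_. 1"])
    show "transition_op M u (real n) ?g \<in> borel_measurable \<mu>" for n
      unfolding meas by (rule transition_op_measurable[OF _ gm]) simp
    show "AE x in \<mu>. (\<lambda>n. transition_op M u (real n) ?g x) \<longlonglongrightarrow> 0"
    proof (rule AE_I2)
      fix x assume "x \<in> space \<mu>"
      then have x: "x \<in> sob s" by (simp add: space)
      have "(\<lambda>n. exp (- \<kappa>) ^ n * sob_norm s x powr p) \<longlonglongrightarrow> 0 * sob_norm s x powr p"
        using \<kappa>_pos by (intro tendsto_mult LIMSEQ_power_zero tendsto_const) simp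
      then have l: "(\<lambda>n. exp (- \<kappa> * real n) * sob_norm s x powr p) \<longlonglongrightarrow> 0"
        by (simp add: exp_of_nat_mult[symmetric] mult.commute)
      show "(\<lambda>n. transition_op M u (real n) ?g x) \<longlonglongrightarrow> 0"
        by (rule tendsto_sandwich[OF _ _ tendsto_const l])
          (intro always_eventually allI transition_op_norm_le(1,2) x of_nat_0_le_iff)+
    qed
    show "AE x in \<mu>. norm (transition_op M u (real n) ?g x) \<le> 1" for n
      using transition_op_norm_le(2,3)[of _ "real n"] by (intro AE_I2) (simp add: space)
  qed auto
  moreover have "(LINT x|\<mu>. transition_op M u (real n) ?g x) = (LINT x|\<mu>. ?g x)" for n by (rule inv[symmetric]) simp
  ultimately have "(\<lambda>n :: nat. LINT x|\<mu>. ?g x) \<longlonglongrightarrow> 0" by simp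
  then have "(LINT x|\<mu>. ?g x) = 0" by (simp add: LIMSEQ_const_iff)
  moreover have "integrable \<mu> ?g" by (rule \<mu>.integrable_const_bound[where B = 1]) (auto simp: sob_norm_nonneg)
  ultimately have "AE x in \<mu>. ?g x = 0" by (subst (asm) integral_nonneg_eq_0_iff_AE) (auto simp: sob_norm_nonneg)
  then have z: "AE x in \<mu>. x = (\<lambda>_. 0)"
    using AE_space
  proof eventually_elim
    fix x assume g0: "?g x = 0" and x: "x \<in> space \<mu>"
    have "sob_norm s x = 0" using g0 by (simp add: min_def split: if_splits)
    then show "x = (\<lambda>_. 0)" using x sob_norm_zero_iff[of x] unfolding space by blast
  qed
  show ?thesis
  proof (rule measure_eqI)
    show "sets \<mu> = sets (return (sob_borel s) (\<lambda>_. 0))" using sets by simp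
    fix A assume A: "A \<in> sets \<mu>"
    have "emeasure \<mu> A = (\<integral>\<^sup>+x. indicator A x \<partial>\<mu>)" using A by simp
    also have "\<dots> = (\<integral>\<^sup>+x. indicator A (\<lambda>_. 0) \<partial>\<mu>)" by (rule nn_integral_cong_AE) (use z in eventually_elim, simp)
    also have "\<dots> = indicator A (\<lambda>_. 0)" by (simp add: \<mu>.emeasure_space_1)
    also have "\<dots> = emeasure (return (sob_borel s) (\<lambda>_. 0)) A" using A sets by simp
    finally show "emeasure \<mu> A = emeasure (return (sob_borel s) (\<lambda>_. 0)) A" .
  qed
qed

end

theorem theorem4p7:
  fixes \<sigma> :: nat and \<alpha> :: complex and s s' K p B :: real
    and M :: "'w measure" and \<F> :: "real \<Rightarrow> 'w measure" and W :: "real \<Rightarrow> 'w \<Rightarrow> real"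
    and \<phi> :: "('d::finite) fseries \<Rightarrow> 'd fseries"
    and f :: "'d fseries \<Rightarrow> complex"
    and u :: "'d fseries \<Rightarrow> real \<Rightarrow> 'w \<Rightarrow> 'd fseries"
  assumes sigma: "\<sigma> \<ge> 1"
    and s': "s' > real CARD('d) / 2" and s: "s > s'"
    and K: "nonlin_const TYPE('d) s \<sigma> K"
    and prob: "prob_space M" and filt: "standard_filtration M \<F>" and W: "brownian_motion M \<F> W"
    and a: "\<phi> ` sob s \<subseteq> sob s" "bounded_on_balls s s \<phi>"
    and b: "continuous_map (sob_top s') (sob_top (- s - 1)) \<phi>" "bounded_on_balls s' (- s - 1) \<phi>"
    and c: "\<And>n. n \<ge> 1 \<Longrightarrow> galerkin_loc_lipschitz n \<phi>"
    and d: "\<exists>\<psi> :: real \<times> real \<Rightarrow> real.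
      \<psi> \<in> borel_measurable (restrict_space borel ({0..} \<times> {0..})) \<and>
      (\<forall>y \<in> {0..} \<times> {0..}. \<psi> y \<ge> 0) \<and>
      (\<forall>S \<subseteq> {0..} \<times> {0..}. bounded S \<longrightarrow> bounded (\<psi> ` S)) \<and>
      (\<forall>v\<in>sob s. \<forall>w\<in>sob s.
        sob_dist s (\<phi> v) (\<phi> w) \<le> \<psi> (sob_norm s v, sob_norm s w) * sob_dist s v w)"
    and e: "\<And>v. v \<in> sob s \<Longrightarrow> \<phi> v = (\<lambda>k. f v * v k)" "0 < p" "p < 1" "B < 0"
      "\<And>v. v \<in> sob s \<Longrightarrow>
        cmod \<alpha> * K * Linf_norm v ^ (2 * \<sigma>) + 1 / 2 * (cmod (f v))\<^sup>2 - (2 - p) / 2 * (Re (f v))\<^sup>2 \<le> B"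
    and u: "\<And>x. x \<in> sob s \<Longrightarrow> strong_solution s \<sigma> \<alpha> \<phi> M \<F> W x (u x)"
  shows "(\<exists>C \<kappa> :: real. \<kappa> > 0 \<and>
      (\<forall>u0\<in>sob s. \<forall>t\<ge>0.
        (\<integral>\<^sup>+\<omega>. ennreal (sob_norm s (u u0 t \<omega>) powr p) \<partial>M)
          \<le> ennreal (C * exp (- \<kappa> * t) * sob_norm s u0 powr p)) \<and>
      (\<forall>u0\<in>sob s. \<forall>\<kappa>'. 0 < \<kappa>' \<and> \<kappa>' < \<kappa> \<longrightarrow>
        (\<exists>\<tau>0 :: 'w \<Rightarrow> ennreal. \<tau>0 \<in> borel_measurable M \<and> (AE \<omega> in M. \<tau>0 \<omega> < \<infinity>) \<and>
          (AE \<omega> in M. \<forall>t\<ge>0. \<tau>0 \<omega> \<le> ennreal t \<longrightarrow>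
            sob_norm s (u u0 t \<omega>) powr p \<le> C * exp (- \<kappa>' * t) * sob_norm s u0 powr p)))) \<and>
    invariant_measure s M u (return (sob_borel s) (\<lambda>_. 0)) \<and>
    (\<forall>\<mu>. invariant_measure s M u \<mu> \<longrightarrow> \<mu> = return (sob_borel s) (\<lambda>_. 0))"
proof -
  obtain \<psi> :: "real \<times> real \<Rightarrow> real" where
    \<psi>: "\<forall>S \<subseteq> {0..} \<times> {0..}. bounded S \<longrightarrow> bounded (\<psi> ` S)"
      "\<forall>v\<in>sob s. \<forall>w\<in>sob s. sob_dist s (\<phi> v) (\<phi> w) \<le> \<psi> (sob_norm s v, sob_norm s w) * sob_dist s v w"
    using d by blast
  interpret prob_space M by (rule prob)
  interpret brownian M \<F> W by unfold_locales (rule filt W)+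
  interpret schroedinger M \<F> W \<sigma> \<alpha> s K p B \<phi> f \<psi>
  proof
    show "real CARD('d) / 2 < s" using s s' by linarith
    show "bounded (\<psi> ` S)" if "S \<subseteq> {0..} \<times> {0..}" "bounded S" for S using \<psi>(1) that by blast
    show "sob_dist s (\<phi> v) (\<phi> w) \<le> \<psi> (sob_norm s v, sob_norm s w) * sob_dist s v w" if "v \<in> sob s" "w \<in> sob s" for v w
      using \<psi>(2) that by blast
  qed (rule K a(1) e; assumption)+
  interpret schroedinger_flow M \<F> W \<sigma> \<alpha> s K p B \<phi> f \<psi> u
    by unfold_locales (rule u)
  show ?thesis
  proof (intro conjI allI impI dirac_invariant invariant_measure_unique)
    show "\<exists>C \<kappa> :: real. \<kappa> > 0 \<and>
      (\<forall>u0\<in>sob s. \<forall>t\<ge>0.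
        (\<integral>\<^sup>+\<omega>. ennreal (sob_norm s (u u0 t \<omega>) powr p) \<partial>M)
          \<le> ennreal (C * exp (- \<kappa> * t) * sob_norm s u0 powr p)) \<and>
      (\<forall>u0\<in>sob s. \<forall>\<kappa>'. 0 < \<kappa>' \<and> \<kappa>' < \<kappa> \<longrightarrow>
        (\<exists>\<tau>0 :: 'w \<Rightarrow> ennreal. \<tau>0 \<in> borel_measurable M \<and> (AE \<omega> in M. \<tau>0 \<omega> < \<infinity>) \<and>
          (AE \<omega> in M. \<forall>t\<ge>0. \<tau>0 \<omega> \<le> ennreal t \<longrightarrow>
            sob_norm s (u u0 t \<omega>) powr p \<le> C * exp (- \<kappa>' * t) * sob_norm s u0 powr p)))"
      \<comment> \<open>C = 1, because the supermartingale has the initial value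
        \<open>sob_norm s u0 powr p\<close>.\<close>
      unfolding mult_1_left
      by (rule exI[of _ 1], rule exI[of _ \<kappa>], unfold mult_1_left)
        (intro conjI ballI allI impI \<kappa>_pos mean_decay pathwise_decay; blast)
  qed
qed

end
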